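(* Let $\mathbb{K}$ be a field, $n>6$ an integer, and let $\Gamma=(\mathcal{P},\mathcal{L})$ be a parapolar space which is locally $A_{n-1,3}(\mathbb{K})$. Let $\mathcal{S}$ be the family of symplecta of $\Gamma$. Then there is a collection $\mathbb{D}$ of $2$-convex subspaces of $\Gamma$, each isomorphic (as a point-line geometry) to $D_{5,5}(\mathbb{K})$, such that every symplecton $S\in\mathcal{S}$ is contained in a unique member $\mathsf{D}(S)\in\mathbb{D}$.
   Context: In a point-line geometry $(\mathcal{P},\mathcal{L})$ (partial linear space), two points are collinear if they lie on a common line; $x^\perp$ is the set consisting of $x$ and all points collinear with $x$; $d(x,y)$ is the distance in the collinearity graph. A subspace is a set of points containing every line that meets it in at least two points; it is singular if any two of its points are collinear. A subspace $X$ is $2$-convex if for all $x,y\in X$ at distance two, $x^\perp\cap y^\perp\subseteq X$. A subspace is regarded as a point-line geometry with the lines it contains. A parapolar space is a connected partial linear space such that: (i) it is a gamma space (for a point $x$ and a line $L$ with $x\notin L$, $x^\perp\cap L$ is empty, one point, or $L$); (ii) for every line $L$, the set $\bigcap_{x\in L}x^\perp$ is not a singular subspace; (iii) for any two points $x,y$ at distance two, $x^\perp\cap y^\perp$ is either a single point or a nondegenerate polar space of rank at least $2$. In the latter case $\{x,y\}$ is called a polar pair, and it lies in a unique symplecton, i.e. a $2$-convex subspace that is a nondegenerate polar space (the smallest $2$-convex subspace containing $x,y$). The Grassmann space $A_{n-1,j}(\mathbb{K})$ has as points the $j$-dimensional subspaces of an $n$-dimensional vector space $V$ over $\mathbb{K}$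 and as lines the flags $(U,W)$ with $\dim U=j-1$, $\dim W=j+1$ (the line being the set of $j$-subspaces between $U$ and $W$). $\Gamma$ is locally $A_{n-1,j}(\mathbb{K})$ if for every point $p$ the geometry whose points are the lines of $\Gamma$ on $p$ and whose lines are the planes (singular subspaces that are projective planes) on $p$ is isomorphic to $A_{n-1,j}(\mathbb{K})$. The half-spin geometry $D_{m,m}(\mathbb{K})$ has as points the maximal singular subspaces in one of the two classes of the polar space $D_m(\mathbb{K})$ (the hyperbolic quadric in a $2m$-dimensional vector space over $\mathbb{K}$), and as lines the totally singular subspaces of vector space dimension $m-2$ (each identified with the set of points containing it). *)

theory Defs
  imports "HOL-Analysis.Analysis"
begin

section \<open>Point-line geometries\<close>

record 'p geometry =
  points :: "'p set"
  lines :: "'p set set"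

definition partial_linear_space :: "'p geometry \<Rightarrow> bool" where
  "partial_linear_space G \<longleftrightarrow>
     (\<forall>l\<in>lines G. l \<subseteq> points G \<and> (\<exists>x\<in>l. \<exists>y\<in>l. x \<noteq> y)) \<and>
     (\<forall>l\<in>lines G. \<forall>m\<in>lines G. \<forall>x\<in>l \<inter> m. \<forall>y\<in>l \<inter> m. x \<noteq> y \<longrightarrow> l = m)"

definition adjacent :: "'p geometry \<Rightarrow> 'p \<Rightarrow> 'p \<Rightarrow> bool" where
  "adjacent G x y \<longleftrightarrow> (\<exists>l\<in>lines G. x \<in> l \<and> y \<in> l)"

definition perp :: "'p geometry \<Rightarrow> 'p \<Rightarrow> 'p set" where
  "perp G x = insert x {y \<in> points G. adjacent G x y}"

text \<open>Distance in the collinearity graph; it is \<open>\<infinity>\<close> for points in different components.\<close>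

definition distance :: "'p geometry \<Rightarrow> 'p \<Rightarrow> 'p \<Rightarrow> enat" where
  "distance G x y = Inf {enat k |k. (x, y) \<in> {(u, v). adjacent G u v} ^^ k}"

definition connected_geometry :: "'p geometry \<Rightarrow> bool" where
  "connected_geometry G \<longleftrightarrow> (\<forall>x\<in>points G. \<forall>y\<in>points G. distance G x y < \<infinity>)"

definition isomorphic_geometry :: "'p geometry \<Rightarrow> 'q geometry \<Rightarrow> bool" where
  "isomorphic_geometry G H \<longleftrightarrow>
     (\<exists>f. bij_betw f (points G) (points H) \<and> (\<lambda>l. f ` l) ` lines G = lines H)"

definition is_subspace :: "'p geometry \<Rightarrow> 'p set \<Rightarrow> bool" where
  "is_subspace G X \<longleftrightarrow> X \<subseteq> points G \<and>
     (\<forall>l\<in>lines G. (\<exists>x\<in>l \<inter> X. \<exists>y\<in>l \<inter> X. x \<noteq> y) \<longrightarrow> l \<subseteq> X)"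

definition singular_subspace :: "'p geometry \<Rightarrow> 'p set \<Rightarrow> bool" where
  "singular_subspace G X \<longleftrightarrow> is_subspace G X \<and> (\<forall>x\<in>X. \<forall>y\<in>X. x \<noteq> y \<longrightarrow> adjacent G x y)"

definition two_convex_subspace :: "'p geometry \<Rightarrow> 'p set \<Rightarrow> bool" where
  "two_convex_subspace G X \<longleftrightarrow> is_subspace G X \<and>
     (\<forall>x\<in>X. \<forall>y\<in>X. distance G x y = 2 \<longrightarrow> perp G x \<inter> perp G y \<subseteq> X)"

definition subgeometry :: "'p geometry \<Rightarrow> 'p set \<Rightarrow> 'p geometry" where
  "subgeometry G X = \<lparr>points = X, lines = {l \<in> lines G. l \<subseteq> X}\<rparr>"

section \<open>Polar spaces and parapolar spaces\<close>

text \<open>The Buekenhout--Shult one-or-all axiom; nondegeneracy says that no point is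
  collinear with all points.\<close>

definition nondegenerate_polar_space :: "'p geometry \<Rightarrow> bool" where
  "nondegenerate_polar_space G \<longleftrightarrow> partial_linear_space G \<and>
     (\<forall>x\<in>points G. \<forall>l\<in>lines G. x \<notin> l \<longrightarrow>
        (\<exists>y. perp G x \<inter> l = {y}) \<or> l \<subseteq> perp G x) \<and>
     (\<forall>x\<in>points G. perp G x \<noteq> points G)"

text \<open>The rank is the supremum of the lengths of strictly increasing chains of nonempty
  singular subspaces, that is, the vector space dimension of the maximal ones in the
  classical case.\<close>

definition polar_rank :: "'p geometry \<Rightarrow> enat" where
  "polar_rank G = Sup {enat r |r. \<exists>X :: nat \<Rightarrow> 'p set.
     (\<forall>i<r. singular_subspace G (X i) \<and> X i \<noteq> {}) \<and> (\<forall>j<r. \<forall>i<j. X i \<subset> X j)}"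

definition polar_pair :: "'p geometry \<Rightarrow> 'p \<Rightarrow> 'p \<Rightarrow> bool" where
  "polar_pair G x y \<longleftrightarrow> x \<in> points G \<and> y \<in> points G \<and> distance G x y = 2 \<and>
     nondegenerate_polar_space (subgeometry G (perp G x \<inter> perp G y)) \<and>
     2 \<le> polar_rank (subgeometry G (perp G x \<inter> perp G y))"

definition gamma_space :: "'p geometry \<Rightarrow> bool" where
  "gamma_space G \<longleftrightarrow> (\<forall>x\<in>points G. \<forall>l\<in>lines G. x \<notin> l \<longrightarrow>
     perp G x \<inter> l = {} \<or> (\<exists>y. perp G x \<inter> l = {y}) \<or> perp G x \<inter> l = l)"

definition parapolar_space :: "'p geometry \<Rightarrow> bool" where
  "parapolar_space G \<longleftrightarrow> partial_linear_space G \<and> connected_geometry G \<and>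
     gamma_space G \<and>
     (\<forall>l\<in>lines G. \<not> singular_subspace G (\<Inter>x\<in>l. perp G x)) \<and>
     (\<forall>x\<in>points G. \<forall>y\<in>points G. distance G x y = 2 \<longrightarrow>
        (\<exists>z. perp G x \<inter> perp G y = {z}) \<or> polar_pair G x y)"

text \<open>The polar pair in the definition excludes the empty set and sets of pairwise
  noncollinear points; it also forces \<open>S\<close> to be the smallest 2-convex subspace containing
  the pair.\<close>

definition symplecta :: "'p geometry \<Rightarrow> 'p set set" where
  "symplecta G = {S. two_convex_subspace G S \<and>
     nondegenerate_polar_space (subgeometry G S) \<and> (\<exists>x\<in>S. \<exists>y\<in>S. polar_pair G x y)}"

section \<open>The geometry of lines and planes on a point\<close>

definition projective_plane :: "'p geometry \<Rightarrow> bool" where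
  "projective_plane G \<longleftrightarrow> (\<forall>l\<in>lines G. l \<subseteq> points G) \<and>
     (\<forall>x\<in>points G. \<forall>y\<in>points G. x \<noteq> y \<longrightarrow> (\<exists>!l. l \<in> lines G \<and> x \<in> l \<and> y \<in> l)) \<and>
     (\<forall>l\<in>lines G. \<forall>m\<in>lines G. l \<noteq> m \<longrightarrow> (\<exists>!x. x \<in> l \<and> x \<in> m)) \<and>
     (\<exists>Q\<subseteq>points G. card Q = 4 \<and> (\<forall>l\<in>lines G. card (l \<inter> Q) \<le> 2))"

definition planes :: "'p geometry \<Rightarrow> 'p set set" where
  "planes G = {X. singular_subspace G X \<and> projective_plane (subgeometry G X)}"

text \<open>A plane on \<open>p\<close> is represented by the set of its lines on \<open>p\<close>, which determines it.\<close>

definition local_geometry :: "'p geometry \<Rightarrow> 'p \<Rightarrow> 'p set geometry" where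
  "local_geometry G p =
     \<lparr>points = {l \<in> lines G. p \<in> l},
      lines = (\<lambda>X. {l \<in> lines G. p \<in> l \<and> l \<subseteq> X}) ` {X \<in> planes G. p \<in> X}\<rparr>"

section \<open>Grassmann spaces and half-spin geometries\<close>

text \<open>The space \<open>A\<^bsub>n-1,j\<^esub>\<close> of a vector space of dimension \<open>n\<close> with scalar
  multiplication \<open>smul\<close>.\<close>

definition grassmann_space ::
    "('k::field \<Rightarrow> 'v::ab_group_add \<Rightarrow> 'v) \<Rightarrow> nat \<Rightarrow> 'v set geometry" where
  "grassmann_space smul j =
     \<lparr>points = {X. module.subspace smul X \<and> vector_space.dim smul X = j},
      lines = {{X. module.subspace smul X \<and> vector_space.dim smul X = j \<and> U \<subseteq> X \<and> X \<subseteq> W} |U W.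
        module.subspace smul U \<and> module.subspace smul W \<and> U \<subseteq> W \<and>
        vector_space.dim smul U + 1 = j \<and> vector_space.dim smul W = j + 1}\<rparr>"

definition locally_grassmann ::
    "'p geometry \<Rightarrow> ('k::field \<Rightarrow> 'v::ab_group_add \<Rightarrow> 'v) \<Rightarrow> nat \<Rightarrow> bool" where
  "locally_grassmann G smul j \<longleftrightarrow>
     (\<forall>p\<in>points G. isomorphic_geometry (local_geometry G p) (grassmann_space smul j))"

text \<open>The hyperbolic quadric \<open>D\<^sub>m\<close>, \<open>m\<close> being the cardinality of the index type \<open>'m\<close>.\<close>

definition hyperbolic_form :: "'k::field ^ ('m::finite + 'm) \<Rightarrow> 'k" where
  "hyperbolic_form v = (\<Sum>i\<in>UNIV. v $ Inl i * v $ Inr i)"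

definition totally_singular :: "('k::field ^ ('m::finite + 'm)) set \<Rightarrow> bool" where
  "totally_singular U \<longleftrightarrow> vec.subspace U \<and> (\<forall>v\<in>U. hyperbolic_form v = 0)"

definition maximal_totally_singular :: "('k::field ^ ('m::finite + 'm)) set \<Rightarrow> bool" where
  "maximal_totally_singular M \<longleftrightarrow> totally_singular M \<and>
     (\<forall>N. totally_singular N \<and> M \<subseteq> N \<longrightarrow> N = M)"

text \<open>Two maximal totally singular subspaces belong to the same class if their
  intersection has even codimension in each of them.\<close>

definition same_class ::
    "('k::field ^ ('m::finite + 'm)) set \<Rightarrow> ('k ^ ('m + 'm)) set \<Rightarrow> bool" where
  "same_class M N \<longleftrightarrow> even (vec.dim M - vec.dim (M \<inter> N))"

text \<open>The points are taken from the class of the coordinate subspace below.  The other class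
  gives an isomorphic geometry: interchanging the coordinates \<open>Inl i\<close> and \<open>Inr i\<close> for a single
  \<open>i\<close> is an isometry interchanging the classes.\<close>

definition half_spin_points :: "('k::field ^ ('m::finite + 'm)) set set" where
  "half_spin_points =
     {M. maximal_totally_singular M \<and> same_class M {v. \<forall>i. v $ Inr i = 0}}"

definition half_spin_geometry :: "('k::field ^ ('m::finite + 'm)) set geometry" where
  "half_spin_geometry =
     \<lparr>points = half_spin_points,
      lines = {{M \<in> half_spin_points. U \<subseteq> M} |U.
        totally_singular U \<and> vec.dim U + 2 = CARD('m)}\<rparr>"

end

theory Submission imports Defs begin

text \<open>Identify the lines on a point \<open>p\<close> with the 3-spaces of \<open>V\<close>.  Points on two such lines turn out to be collinear
 only if the lines are coplanar, and for a polar pair \<open>x, y\<close> the lines on \<open>x\<close> with a point collinear to \<open>y\<close> are the 3-spaces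
 between a 1-space \<open>U\<close> and a 5-space \<open>W\<close>.  Let \<open>D(p,W)\<close> consist of \<open>p\<close>, the points on the lines inside \<open>W\<close>, and the points \<open>y\<close> whose
 pair with \<open>p\<close> has this \<open>W\<close>.  The lines joining a vertex of a solid to the others span a 4-space or a 5-space; as \<open>n > 6\<close>, which of the two
 occurs is independent of the vertex, so \<open>W\<close> can be carried along lines and \<open>D(p,W)\<close> does not depend on the base point.

 In the dual \<open>K\<^sup>5\<close> of \<open>W\<close>, lines on a point become 2-spaces, and the lines joining \<open>p\<close> to the neighbours of a point far from \<open>p\<close> become
 the 2-spaces of a 4-space.  A Desargues argument scales the points on all lines through \<open>p\<close> simultaneously, by bivectors.  A point \<open>x\<close> is then
 given by a subspace \<open>Y\<close> of dimension 0, 2 or 4 with an alternating form \<open>g\<close> on it, and the vectors \<open>(w, f)\<close> with \<open>f\<close> in \<open>Y\<close> and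
 \<open>e . w = g f e\<close> for \<open>e\<close> in \<open>Y\<close> form a point of the half-spin geometry.\<close>

section \<open>Subspaces\<close>

text \<open>The local hypothesis speaks of planes on a single point, and the isomorphisms are chosen
  point by point; this causes two difficulties. Points on noncoplanar lines through p might still be
  collinear. One such exceptional pair would spread, through the polar spaces of common neighbours,
  until all points near p were collinear, against axiom (ii). Secondly, nothing relates the 5-spaces
  at different points. The kind of a solid has to be recognized by incidences that treat its
  vertices alike; they use two dimensions outside a 5-space, which is where the number 6 comes from.
  The 5 of D_{5,5} is the dimension of the sum of two 3-spaces meeting in a 1-space. At the end p
  corresponds to Y = 0, and the alternating forms on even-dimensional subspaces of K^5 describe
  exactly one class of maximal totally singular subspaces. In both geometries a line is recovered
  from collinearity as a double perp, so a bijection that respects collinearity suffices.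
  Alternating forms vanish on the diagonal by definition, and generic vectors only ever avoid two
  proper subspaces, so characteristic two and the field of two elements need no separate
  treatment.\<close>

notation iff (infixr "<->" 25)

text \<open>Set up for an arbitrary space because it is interpreted for V as well as for K^5 and the
  coordinate spaces of the quadric.\<close>

locale subspace_calculus = finite_dimensional_vector_space scale Basis
 for scale :: "'a::field => 'b::ab_group_add => 'b" and Basis
begin

definition ssum :: "'b set => 'b set => 'b set" (infixl "#+" 65)
 where "A #+ B = span (A Un B)"

lemma subspace_ssum [simp]: "subspace (A #+ B)"
 by (simp add: ssum_def)

lemma ssum_ub1: "A <= A #+ B"
 by (auto simp: ssum_def span_base)

lemma ssum_ub2: "B <= A #+ B"
 by (auto simp: ssum_def span_base)

lemma ssum_least: "A <= C ==> B <= C ==> subspace C ==> A #+ B <= C"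
 unfolding ssum_def by (rule span_minimal) auto

lemma ssum_commute: "A #+ B = B #+ A"
 by (simp add: ssum_def Un_commute)

lemma ssum_span: "span X #+ span Y = span (X Un Y)"
proof -
 have "span X <= span (X Un Y)" "span Y <= span (X Un Y)" by (auto intro!: span_mono)
 then have "span (span X Un span Y) <= span (X Un Y)" by (intro span_minimal) auto
 moreover have "span (X Un Y) <= span (span X Un span Y)"
  using span_superset[of X] span_superset[of Y] by (intro span_mono) auto
 ultimately show ?thesis unfolding ssum_def by simp
qed

lemma ssum_mono: "A <= A' ==> B <= B' ==> A #+ B <= A' #+ B'"
 unfolding ssum_def by (rule span_mono) auto

lemma ssum_eqD: "x:A #+ B ==> subspace A ==> subspace B ==> EX a:A. EX b:B. x = a + b"
 unfolding ssum_def span_Un by (auto simp: span_eq_iff[THEN iffD2])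

lemma dim_ssum: "subspace A ==> subspace B ==> dim (A #+ B) + dim (A Int B) = dim A + dim B"
 using dim_sums_Int[of A B] by (simp add: ssum_def span_Un span_eq_iff[THEN iffD2])

lemma subspace_eqI: "subspace A ==> subspace B ==> A <= B ==> dim B <= dim A ==> A = B"
 by (rule subspace_dim_equal)

lemma dim_ins: "x ~: span S ==> dim (insert x S) = Suc (dim S)"
 by (simp add: dim_insert)

lemma dim_le_card': "finite S ==> dim S <= card S"
 by (rule dim_le_card[OF span_superset])

lemma dim_card_independent: "finite S ==> dim S = card S ==> independent S" using basis_exists card_subset_eq by metis

lemma dim_card_subset:
 assumes "finite S" "dim S = card S" "T <= S" shows "dim T = card T"
 using dim_card_independent[OF assms(1,2)] assms(3) independent_mono dim_eq_card_independent by blast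

lemma span_inter_card:
 assumes "finite S" "dim S = card S" "X <= S" "Y <= S"
 shows "span X Int span Y = span (X Int Y)"
proof (rule sym, rule subspace_eqI)
 have f: "finite X" "finite Y" using assms finite_subset by auto
 show "dim (span X Int span Y) <= dim (span (X Int Y))"
  using dim_card_subset[OF assms(1,2), of "X Int Y"] assms card_Un_Int[OF f] dim_ssum[of "span X" "span Y"] dim_card_subset[OF assms(1,2)]
  by (fastforce simp: ssum_span)
 show "span (X Int Y) <= span X Int span Y" by (simp add: span_mono)
 show "subspace (span X Int span Y)" by (simp add: subspace_inter)
qed simp

lemma obtain_extension:
 assumes "dim S < dim A"
 obtains x where "x:A" "x ~: span S" "dim (insert x S) = Suc (dim S)"
proof -
 obtain x where "x:A" "x ~: span S" using assms dim_mono[of A S] by auto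
 then show thesis using that[of x] dim_ins[of x S] by simp
qed

lemma span_eq_if_dim:
 assumes "S <= A" "subspace A" "dim A <= dim S"
 shows "A = span S"
 using subspace_eqI[of "span S" A] assms span_minimal by auto

lemma obtain_extension_in:
 assumes "S <= A" "subspace A" "dim S < dim A"
 obtains x where "x:A" "x ~: span S" "dim (insert x S) = Suc (dim S)" "insert x S <= A" using obtain_extension[OF assms(3)] assms(1) by auto

lemma dim_le_1_span: "x:A ==> x ~= 0 ==> subspace A ==> dim A <= 1 ==> A = span {x}"
 by (rule span_eq_if_dim) simp_all

lemma dim_pos: "0 < dim A ==> EX x:A. x ~= 0"
 using dim_eq_0[of A] by fastforce

lemma span_replace:
 assumes "y:span (insert x S)" "x:span (insert y S)"
 shows "span (insert y S) = span (insert x S)" using assms(1) span_superset[of "insert x S"] assms(2) span_superset[of "insert y S"] by (simp add: span_eq)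

lemma basis1: "subspace A ==> dim A = 1 ==> EX x. x ~= 0 & A = span {x}"
proof -
 assume A: "subspace A" "dim A = 1"
 then obtain x where x: "x:A" "x ~= 0" using dim_pos[of A] by auto
 then have "A = span {x}" using A by (intro span_eq_if_dim) simp_all
 then show ?thesis using x by blast
qed

lemma dim_pos_iff: "subspace A ==> 0 < dim A <-> A ~= {0}" using subspace_0[of A] by auto

lemma span_lin2: "x:span {a, b} <-> (EX s t. x = scale s a + scale t b)" by (simp add: span_insert diff_eq_eq add.commute)

lemma span_lin3: "x:span {a, b, c} <-> (EX s t r. x = scale s a + scale t b + scale r c)" using span_lin2
 by (simp add: diff_eq_eq ac_simps span_insert[of a "{b,c}"])

end

context subspace_calculus
begin

definition gr :: "nat => 'b set => bool" where "gr k A <-> subspace A & dim A = k"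

lemma gr_span: "dim S = k ==> gr k (span S)"
 by (simp add: gr_def)

lemma grD: "gr k A ==> subspace A" "gr k A ==> dim A = k"
 by (auto simp: gr_def)

lemma dim_inter_span: "dim (span X Int span Y) + dim (X Un Y) = dim X + dim Y" using dim_ssum[of "span X" "span Y"] by (simp add: ssum_span)

lemma span_insert_diff:
 assumes "y:span S" shows "span (insert (x - y) S) = span (insert x S)"
 by (rule eq_span_insert_eq) (use assms span_neg[of "y" S] in simp)

lemma dim_insert_diff:
 "y:span S ==> dim (insert (x - y) S) = dim (insert x S)"
 by (metis dim_span span_insert_diff)

lemma dim_le2: "dim {a,b} <= 2" and dim_le3: "dim {a,b,c} <= 3"
 and dim_le4: "dim {a,b,c,d} <= 4" and dim_le5: "dim {a,b,c,d,e} <= 5"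
 by (rule order_trans[OF dim_le_card'], simp, simp add: card_insert_if)+

lemma dim_notin: "dim (insert x S) = Suc (dim S) ==> x ~: span S"
 using span_redundant[of x S] by (metis dim_span n_not_Suc_n)

lemma dim_insert_le: "dim (insert x S) <= Suc (dim S)"
 by (simp add: dim_insert)

lemma dim_sub1: "dim (insert x S) = Suc k ==> dim S <= k ==> dim S = k"
 using dim_insert_le[of x S] by simp

lemma dim_dist: "dim (set xs) = length xs ==> distinct xs"
 using dim_le_card'[of "set xs"] card_length[of xs] card_distinct[of xs] by simp

lemma dim_sub:
 "dim (set xs) = length xs ==> set ys <= set xs ==> distinct ys ==> dim (set ys) = length ys"
 using dim_card_subset[of "set xs" "set ys"] dim_dist[of xs] by (simp add: distinct_card)

lemma obtain_vectors2:
 assumes "gr 2 A" obtains a b where "A = span {a,b}" "dim {a,b} = 2"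
proof -
 have A: "subspace A" "dim A = 2" using assms by (auto simp: gr_def)
 obtain a where a: "dim {a} = Suc (dim {})" "{a} <= A"
  by (rule obtain_extension_in[of "{}" A]) (simp_all add: A)
 then have a1: "dim {a} < dim A" by (simp only: A dim_empty)
 obtain b where b: "dim {b,a} = Suc (dim {a})" "{b,a} <= A"
  by (rule obtain_extension_in[OF a(2) A(1) a1])
 have "dim {b,a} = 2" using a(1) b(1) by simp
 moreover have "A = span {b,a}"
  by (rule span_eq_if_dim[OF b(2) A(1)]) (use calculation A in simp)
 ultimately show thesis using that by blast
qed

lemma obtain_vectors3:
 assumes "gr 3 A" "u:A" "u ~= 0"
 obtains a b where "A = span {u,a,b}" "dim {u,a,b} = 3"
proof -
 have A: "subspace A" "dim A = 3" using assms by (auto simp: gr_def)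
 have u: "{u} <= A" "dim {u} = 1" "dim {u} < dim A" using assms A by auto
 obtain a where a: "dim {a,u} = Suc (dim {u})" "{a,u} <= A"
  by (rule obtain_extension_in[OF u(1) A(1) u(3)])
 have a1: "dim {a,u} < dim A" using a(1) u(2) A(2) by linarith
 obtain b where b: "dim {b,a,u} = Suc (dim {a,u})" "{b,a,u} <= A"
  by (rule obtain_extension_in[OF a(2) A(1) a1])
 have e: "{b,a,u} = {u,a,b}" by auto
 have d: "dim {u,a,b} = 3" using a(1) b(1) u(2) unfolding e by linarith
 have "A = span {u,a,b}"
  by (rule span_eq_if_dim) (use b e d A in simp_all)
 then show thesis using that d by blast
qed

lemma obtain_vectors5:
 assumes "gr 3 A" "gr 3 B" "dim (A Int B) = 1" "u:A" "u:B" "u ~= 0"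
 obtains a1 a2 b1 b2 where "A = span {u,a1,a2}" "B = span {u,b1,b2}"
  "dim {u,a1,a2,b1,b2} = 5" "A #+ B = span {u,a1,a2,b1,b2}"
proof -
 obtain a1 a2 where a: "A = span {u,a1,a2}" "dim {u,a1,a2} = 3"
  using obtain_vectors3[OF assms(1,4,6)] by blast
 obtain b1 b2 where b: "B = span {u,b1,b2}" "dim {u,b1,b2} = 3"
  using obtain_vectors3[OF assms(2,5,6)] by blast
 have "{u,a1,a2} Un {u,b1,b2} = {u,a1,a2,b1,b2}" by auto
 then show thesis using that[of a1 a2 b1 b2] a b assms(3) dim_inter_span[of "{u,a1,a2}" "{u,b1,b2}"]
  by (simp add: ssum_span)
qed

end

section \<open>Collinearity of points on two lines through a point\<close>

text \<open>Properties of the relation between the lines on a fixed point whose points are pairwise collinear.\<close>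

locale weak_adjacency = subspace_calculus scale Basis
 for scale :: "'k::field => 'v::ab_group_add => 'v" and Basis +
 fixes w :: "'v set => 'v set => bool"
 assumes dimV: "7 <= dimension"
  and wsym: "gr 3 A ==> gr 3 B ==> w A B ==> w B A"
  and wadj: "gr 3 A ==> gr 3 B ==> 2 <= dim (A Int B) ==> w A B"
  and wline: "gr 3 A ==> gr 3 B ==> gr 3 C ==> gr 3 D ==> w A B ==> w A C ==> dim (B Int C) = 2 ==>
    B Int C <= D ==> D <= B #+ C ==> w A D"
  and wpolar: "gr 3 A ==> gr 3 B ==> gr 3 X ==> ~ w A B ==> w X A ==> w X B ==>
    gr 2 U ==> gr 4 W ==> U <= W ==> (!!C. gr 3 C ==> U <= C ==> C <= W ==> w C A & w C B) ==>
    EX C. gr 3 C & U <= C & C <= W & w X C"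
  and wclique: "gr 3 A ==> gr 3 B ==> gr 3 X ==> gr 3 Y ==> w A B ==> dim (A Int B) < 2 ==>
    w X A ==> w X B ==> w Y A ==> w Y B ==> w X Y"
  and wex: "EX X Y. gr 3 X & gr 3 Y & ~ w X Y"
begin

lemma wadj_span:
 assumes "dim X = 3" "dim Y = 3" "dim (X Un Y) <= 4" shows "w (span X) (span Y)"
 using wadj[OF gr_span gr_span, of X Y] assms dim_inter_span[of X Y] by auto

lemma wline_span:
 assumes "gr 3 A" "dim {u,v,b,c} = 4" "w A (span {u,v,b})" "w A (span {u,v,c})"
 shows "w A (span {u,v,b-c})"
proof -
 have s: "card {u,v,b,c} = 4"
  using assms(2) dim_le_card'[of "{u,v,b,c}"] by (simp add: card_insert_if split: if_splits)
 then have d: "dim {u,v,b} = 3" "dim {u,v,c} = 3" "dim {u,v} = 2"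
  using dim_card_subset[of "{u,v,b,c}"] assms(2) by (simp_all add: card_insert_if split: if_splits)
 have i: "span {u,v,b} Int span {u,v,c} = span {u,v}"
  using span_inter_card[of "{u,v,b,c}" "{u,v,b}" "{u,v,c}"] assms(2) s
  by (auto simp: card_insert_if insert_commute split: if_splits)
 have sum: "span {u,v,b} #+ span {u,v,c} = span {u,v,b,c}"
  by (simp add: ssum_span insert_commute)
 have e: "dim {u,v,b-c} = 3"
 proof -
  have "b - c ~: span {u,v}"
  proof
   assume "b - c:span {u,v}"
   then have "(b - c) + c:span {u,v,c}"
    by (meson insertI1 insertI2 span_add span_base span_mono subsetD subset_insertI insert_mono)
   then have "b:span {u,v,c}" by simp
   then have "dim {b,u,v,c} = dim {u,v,c}" by (metis dim_span span_redundant)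
   then show False using assms(2) d by (simp add: insert_commute)
  qed
  then show ?thesis using dim_ins[of "b-c" "{u,v}"] d by (simp add: insert_commute)
 qed
 have "span {u,v} <= span {u,v,b-c}" by (rule span_mono) auto
 moreover have "span {u,v,b-c} <= span {u,v,b,c}"
  by (rule span_minimal) (auto intro: span_base span_diff)
 ultimately show ?thesis
  using wline[OF assms(1) gr_span gr_span gr_span, OF d(1,2) e] assms(3,4) d i sum by simp
qed

text \<open>\<open>span {u,v,a}\<close> shares the vectors \<open>u\<close> and \<open>a\<close>
  with \<open>span {u,a1,a2}\<close>, so the two are adjacent by \<open>wadj\<close>. In the pencil
  over \<open>span {u,v}\<close> the gamma property then passes from \<open>b\<close> to
  \<open>b - a\<close>.\<close>

lemma skew_step:
 assumes d: "dim {u,a1,a2,v,b} = 5" and w: "w (span {u,a1,a2}) (span {u,v,b})"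
  and a: "a:span {a1,a2}"
 shows "w (span {u,a1,a2}) (span {u,v,b-a})" and "dim {u,a1,a2,v,b-a} = 5"
proof -
 let ?A = "span {u,a1,a2}"
 have dist: "distinct [u,a1,a2,v,b]" using d by (intro dim_dist) simp
 have sub: "dim {u,a1,a2} = 3" "dim {u,v,b} = 3"
  using dim_sub[of "[u,a1,a2,v,b]" "[u,a1,a2]"] dim_sub[of "[u,a1,a2,v,b]" "[u,v,b]"] d dist
  by auto
 have "dim (insert (b-a) {u,a1,a2,v}) = dim (insert b {u,a1,a2,v})"
  by (rule dim_insert_diff) (use a span_mono[of "{a1,a2}" "{u,a1,a2,v}"] in auto)
 moreover have "insert b {u,a1,a2,v} = {u,a1,a2,v,b}" "insert (b-a) {u,a1,a2,v} = {u,a1,a2,v,b-a}" by auto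
 ultimately show "dim {u,a1,a2,v,b-a} = 5" using d by simp
 show "w ?A (span {u,v,b-a})"
 proof (cases "a = 0")
  case True then show ?thesis using w by simp
 next
  case False
  have "span {u,v,b} Int span {a1,a2} = span ({u,v,b} Int {a1,a2})"
     by (rule span_inter_card[of "{u,a1,a2,v,b}"]) (use d dist in auto)
  then have "dim (insert a {u,v,b}) = 4" using a False dist dim_ins sub(2) by force
  moreover have "insert a {u,v,b} = {u,v,b,a}" by auto
  ultimately have d4: "dim {u,v,b,a} = 4" by simp
  then have d3: "dim {u,v,a} = 3"
   using dim_sub[of "[u,v,b,a]" "[u,v,a]"] dim_dist[of "[u,v,b,a]"] by auto
  have "{u,a1,a2} Un {u,v,a} = insert a {u,a1,a2,v}" by auto
  moreover have "span (insert a {u,a1,a2,v}) = span {u,a1,a2,v}"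
   by (rule span_redundant) (use a span_mono[of "{a1,a2}" "{u,a1,a2,v}"] in auto)
  ultimately have "dim ({u,a1,a2} Un {u,v,a}) <= 4" using dim_le4[of u a1 a2 v] by (metis dim_span)
  then show ?thesis using wadj_span sub d3 wline_span[OF gr_span[OF sub(1)] d4 w] by simp
 qed
qed

text \<open>Only the case where \<open>C\<close> meets \<open>A = span {u,a1,a2}\<close> in a
  1-space matters. Then \<open>C\<close> arises from \<open>span {u,b1,b2}\<close> by subtracting
  vectors of \<open>span {a1,a2}\<close> from \<open>b1\<close> and \<open>b2\<close>, which takes
  two applications of \<open>skew_step\<close>.\<close>

lemma bad_star:
 assumes d: "dim {u,a1,a2,b1,b2} = 5" and w: "w (span {u,a1,a2}) (span {u,b1,b2})"
  and C: "gr 3 C" "u:C" "C <= span {u,a1,a2,b1,b2}"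
 shows "w (span {u,a1,a2}) C"
proof -
 let ?A = "span {u,a1,a2}" and ?B = "span {u,b1,b2}"
 have dist: "distinct [u,a1,a2,b1,b2]" using d by (intro dim_dist) simp
 have dA: "dim {u,a1,a2} = 3" and du: "dim {u} = 1"
  using dim_sub[of "[u,a1,a2,b1,b2]" "[u,a1,a2]"] dim_sub[of "[u,a1,a2,b1,b2]" "[u]"] d dist
  by auto
 have gA: "gr 3 ?A" using dA by (rule gr_span)
 have u0: "u ~= 0" using du by auto
 show ?thesis
 proof (cases "2 <= dim (?A Int C)")
  case True then show ?thesis using wadj gA C(1) by blast
 next
  case False
  have "u:?A Int C" using C(2) by (simp add: span_base)
  then have AC1: "dim (?A Int C) = 1" using u0 dim_eq_0[of "?A Int C"] False by fastforce
  have "?A #+ C <= span {u,a1,a2,b1,b2}"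
     by (rule ssum_least[OF _ C(3)]) (auto intro!: span_mono)
  then have AC: "?A #+ C = span {u,a1,a2,b1,b2}" using subspace_eqI[of "?A #+ C" "span {u,a1,a2,b1,b2}"] d dim_ssum[of ?A C] AC1 dA grD[OF C(1)] by simp
  have dec: "EX a:span {a1,a2}. b - a:C" if "b:{b1,b2}" for b
  proof -
   have "b:?A #+ C" using AC that by (auto intro: span_base)
   then obtain x c where x: "x:?A" "c:C" "b = x + c"
    using ssum_eqD[OF _ subspace_span grD(1)[OF C(1)]] by blast
   obtain s where s: "x - scale s u:span {a1,a2}" using x(1) span_breakdown_eq by blast
   have "b - (x - scale s u) = c + scale s u" unfolding x(3) by simp
   also have "... : C" by (rule subspace_add[OF grD(1)[OF C(1)] x(2) subspace_scale[OF grD(1)[OF C(1)] C(2)]])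
   finally show ?thesis using s by blast
  qed
  obtain a where a: "a:span {a1,a2}" "b1 - a:C" using dec by blast
  obtain a' where a': "a':span {a1,a2}" "b2 - a':C" using dec by blast
  define c1 where "c1 = b1 - a"
  define c2 where "c2 = b2 - a'"
  have s1: "w ?A (span {u,b1,c2})" "dim {u,a1,a2,b1,c2} = 5"
   unfolding c2_def by (rule skew_step[OF d w a'(1)])+
  have e: "{u,b1,c2} = {u,c2,b1}" "{u,a1,a2,b1,c2} = {u,a1,a2,c2,b1}" by auto
  have s2: "w ?A (span {u,c2,c1})" "dim {u,a1,a2,c2,c1} = 5"
   unfolding c1_def by (rule skew_step[OF s1(2,1)[unfolded e] a(1)])+
  have "dim {u,c2,c1} = 3"
   using dim_sub[of "[u,a1,a2,c2,c1]" "[u,c2,c1]"] dim_dist[of "[u,a1,a2,c2,c1]"] s2 by auto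
  then have "C = span {u,c2,c1}"
   by (intro span_eq_if_dim) (use a(2) a'(2) C in \<open>auto simp: gr_def c1_def c2_def\<close>)
  then show ?thesis using s2 by simp
 qed
qed

end

context subspace_calculus
begin

lemma dim_inter_card:
 assumes "finite S" "dim S = card S" "X <= S" "Y <= S"
 shows "dim (span X Int span Y) = card (X Int Y)"
 using span_inter_card[OF assms] dim_card_subset[OF assms(1,2), of "X Int Y"] assms(3) by auto

lemma span_inter_set:
 "finite S ==> dim S = card S ==> X <= S ==> Y <= S ==> X Int Y = Z ==> span X Int span Y = span Z"
 using span_inter_card by blast

lemma dim_inter_set:
 "finite S ==> dim S = card S ==> X <= S ==> Y <= S ==> X Int Y = Z ==> dim (span X Int span Y) = card Z"
 using dim_inter_card by blast

lemma avoid_two: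
 assumes "subspace W" "subspace A" "subspace B" "~ W <= A" "~ W <= B"
 obtains x where "x:W" "x ~: A" "x ~: B"
proof -
 obtain a b where ab: "a:W" "a ~: A" "b:W" "b ~: B" using assms(4,5) by blast
 show thesis
 proof (cases "a:B & b:A")
  case True
  show thesis using ab subspace_add[OF assms(1)] that subspace_diff[OF assms(2), of "a+b" b] subspace_diff[OF assms(3), of "a+b" a] by auto
 qed (use ab that in blast)
qed

lemma gr_ext:
 assumes "subspace A" "dim A = k" "x ~: A" shows "gr (Suc k) (span (insert x A))"
 using dim_ins[of x A] assms by (simp add: gr_def span_eq_iff[THEN iffD2])

lemma span_ins_le: "x:W ==> A <= W ==> subspace W ==> span (insert x A) <= W"
 by (rule span_minimal) auto

lemma dim_ex: "dim A < dim W ==> ~ W <= A"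
 using dim_subset[of W A] by auto

lemma subspace_between:
 assumes "subspace A" "subspace W" "A <= W" "dim A <= k" "k <= dim W"
 obtains H where "gr k H" "A <= H" "H <= W"
 using assms(4,1,3,5)
proof (induction k rule: dec_induct)
 case base then show ?case unfolding gr_def by blast
next
 case (step m)
 show ?case
 proof (rule step.IH)
  fix H assume H: "gr m H" "A <= H" "H <= W"
  obtain x where x: "x:W" "x ~: H" using dim_ex[of H W] H(1) step by (auto simp: gr_def)
  have "A <= span (insert x H)" using H(2) by (auto intro: span_base)
  then show thesis using step.prems(1) gr_ext[of H m x] H x gr_def span_ins_le assms(2) by blast
 qed (use step in auto)
qed

lemma ssum_subset_dim:
 "subspace W ==> A <= W ==> B <= W ==> dim W <= dim (A #+ B) ==> A #+ B = W"
 by (rule subspace_eqI) (simp_all add: ssum_least)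

lemma dim_ssum_gr: "gr k A ==> gr l B ==> dim (A #+ B) + dim (A Int B) = k + l"
 using dim_ssum by (simp add: gr_def)

text \<open>\<open>D\<close> grows from \<open>u\<close> by two vectors. Each has to avoid just two
  proper subspaces of \<open>W\<close>, which is possible over every field.\<close>

lemma common_complement:
 assumes W: "gr 5 W" and A: "gr 3 A" "gr 3 A'" "A <= W" "A' <= W" and u: "u:A" "u:A'" "u ~= 0"
 obtains D where "gr 3 D" "u:D" "D <= W" "dim (A Int D) = 1" "dim (A' Int D) = 1"
proof -
 note gr_def[simp]
 obtain x where x: "x:W" "x ~: A" "x ~: A'"
  by (rule avoid_two[of W A A']) (use W A dim_ex[of _ W] in auto)
 let ?B = "span (insert x A)" and ?B' = "span (insert x A')"
 have B: "gr 4 ?B" "gr 4 ?B'" using gr_ext[of A 3 x] gr_ext[of A' 3 x] A x by auto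
 obtain y where y: "y:W" "y ~: ?B" "y ~: ?B'"
  by (rule avoid_two[of W ?B ?B']) (use W B dim_ex[of _ W] in auto)
 have dy: "dim (insert y (insert x A)) = 5" "dim (insert y (insert x A')) = 5" using dim_ins[OF y(2)] dim_ins[OF y(3)] B by auto
 have d: "dim {y,x,u} = 3" using x(2) u(1) A(1) span_minimal[of "{u}" A] dim_ins[of x "{u}"] u(3) dim_ins[of y "{x,u}"] y(2) span_mono[of "{x,u}" "insert x A"] by force
 let ?D = "span {y,x,u}"
 have D: "gr 3 ?D" using d by simp
 have *: "dim (A'' Int ?D) = 1" if "A'':{A,A'}" for A''
 proof -
  have "insert y (insert x A'') <= A'' #+ ?D"
   using ssum_ub1[of A'' ?D] ssum_ub2[of ?D A''] span_superset[of "{y,x,u}"] by auto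
  then have "dim (insert y (insert x A'')) <= dim (A'' #+ ?D)" by (rule dim_subset)
  then have "5 <= dim (A'' #+ ?D)" using dy that by auto
  moreover have "A'' #+ ?D <= W" using that A W x y u by (intro ssum_least span_minimal) auto
  ultimately have "dim (A'' #+ ?D) = 5" using dim_subset[of "A'' #+ ?D" W] W by simp
  then show ?thesis using dim_ssum_gr[of 3 A'' 3 ?D] D A that by auto
 qed
 have "?D <= W" using A W x y u by (intro span_minimal) auto
 moreover have "u:?D" by (auto intro: span_base)
 ultimately show thesis using that D * by blast
qed

end

section \<open>Spreading of an exceptional adjacent pair\<close>

context weak_adjacency
begin

text \<open>A violation, at \<open>u\<close> inside \<open>W\<close>, of the rule that adjacent
  3-spaces share a 2-space. The following lemmas carry one violation to all of \<open>W\<close>,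
  then to all 5-spaces, until it contradicts \<open>wex\<close>.\<close>

definition bad :: "'v => 'v set => bool" where
 "bad u W <-> u ~= 0 & gr 5 W & (EX A B. gr 3 A & gr 3 B & u:A & u:B & A <= W & B <= W &
   dim (A Int B) = 1 & w A B)"

lemma bad_star':
 assumes "gr 5 W" "gr 3 A" "gr 3 B" "u:A" "u:B" "u ~= 0" "A <= W" "B <= W" "dim (A Int B) = 1" "w A B"
  "gr 3 C" "u:C" "C <= W"
 shows "w A C"
proof -
 obtain a1 a2 b1 b2 where v: "A = span {u,a1,a2}" "B = span {u,b1,b2}"
  "dim {u,a1,a2,b1,b2} = 5" "A #+ B = span {u,a1,a2,b1,b2}"
  using obtain_vectors5[OF assms(2,3,9,4,5,6)] by blast
 show ?thesis using ssum_subset_dim[of W A B] assms v bad_star[of u a1 a2 b1 b2 C] by (simp add: gr_def)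
qed

text \<open>A common complement \<open>D\<close> of \<open>P\<close> and \<open>A\<close> connects
  the given bad pair with \<open>A\<close>: \<open>bad_star'\<close> leads from \<open>P\<close> to
  \<open>D\<close>, from \<open>D\<close> to \<open>A\<close>, and from \<open>A\<close> to every
  \<open>B\<close> in the star.\<close>

lemma badD:
 assumes "bad u W" "gr 3 A" "gr 3 B" "u:A" "u:B" "A <= W" "B <= W"
 shows "w A B"
proof -
 obtain P Q where P: "gr 5 W" "u ~= 0" "gr 3 P" "gr 3 Q" "u:P" "u:Q" "P <= W" "Q <= W" "dim (P Int Q) = 1" "w P Q"
  using assms(1) unfolding bad_def by blast
 obtain D where D: "gr 3 D" "u:D" "D <= W" "dim (P Int D) = 1" "dim (A Int D) = 1"
  using common_complement[OF P(1,3) assms(2) P(7) assms(6) P(5) assms(4) P(2)] by blast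
 have DP: "w D P" using wsym P(3) D(1) bad_star'[OF P(1,3,4,5,6,2,7-10) D(1-3)] by simp
 have i: "dim (D Int P) = 1" using D(4) by (simp add: Int_commute)
 have AD: "w A D" using wsym assms(2) D(1) bad_star'[OF P(1) D(1) P(3) D(2) P(5) P(2) D(3) P(7) i DP assms(2,4,6)] by simp
 show ?thesis
  by (rule bad_star'[OF P(1) assms(2) D(1) assms(4) D(2) P(2) assms(6) D(3) D(5) AD assms(3,5,7)])
qed

lemma bad_span:
 assumes "dim S = 5" "finite S" "card S = 5" "X <= S" "Y <= S" "dim X = 3" "dim Y = 3" "X Int Y = {u}" "w (span X) (span Y)"
 shows "bad u (span S)"
proof -
 have 1: "dim {u} = 1" using dim_card_subset[OF assms(2), of "{u}"] assms by auto
 have 2: "u ~= 0" using 1 by auto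
 have 3: "dim (span X Int span Y) = 1"
  using dim_inter_card[OF assms(2) _ assms(4,5)] assms(1,3,8) by simp
 have "span X <= span S" "span Y <= span S" "u:span X" "u:span Y"
  using assms(4,5,8) by (auto intro!: span_mono intro: span_base)
 then show ?thesis unfolding bad_def using 2 3 gr_span[OF assms(1)] gr_span[OF assms(6)] gr_span[OF assms(7)] assms(9)
  by blast
qed

lemma wadj_common:
 assumes "dim X = 3" "dim Y = 3" "dim Z = 2" "Z <= span X" "Z <= span Y"
 shows "w (span X) (span Y)"
 using wadj[OF gr_span[OF assms(1)] gr_span[OF assms(2)]] dim_subset[of Z "span X Int span Y"] assms by auto

text \<open>Put \<open>A = span {u,u',x}\<close>. Both \<open>span {u,v,t}\<close> and
  \<open>span {u',v,t}\<close> are adjacent to \<open>A\<close>, hence so is the member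
  \<open>span {v,t,u-u'}\<close> of their pencil, and it meets \<open>A\<close> only in the
  multiples of \<open>u - u'\<close>.\<close>

lemma bad_diff:
 assumes d: "dim {u,u',v,t,x} = 5" and b: "bad u (span {u,u',v,t,x})" "bad u' (span {u,u',v,t,x})"
 shows "bad (u - u') (span {u,u',v,t,x})"
proof -
 let ?W = "span {u,u',v,t,x}"
 have dist: "distinct [u,u',v,t,x]" using d by (intro dim_dist) simp
 have sub: "dim {u,u',x} = 3" "dim {u,v,t} = 3" "dim {u',v,t} = 3" "dim {v,t,u,u'} = 4"
  using dim_sub[of "[u,u',v,t,x]" "[u,u',x]"] dim_sub[of "[u,u',v,t,x]" "[u,v,t]"]
   dim_sub[of "[u,u',v,t,x]" "[u',v,t]"] dim_sub[of "[u,u',v,t,x]" "[v,t,u,u']"] d dist by auto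
 let ?A = "span {u,u',x}"
 have s: "?A <= ?W" "span {u,v,t} <= ?W" "span {u',v,t} <= ?W" by (auto intro!: span_mono)
 have "w ?A (span {u,v,t})"
  by (rule badD[OF b(1)]) (use sub s in \<open>auto simp: gr_def intro: span_base\<close>)
 moreover have "w ?A (span {u',v,t})"
  by (rule badD[OF b(2)]) (use sub s in \<open>auto simp: gr_def intro: span_base\<close>)
 moreover have "{v,t,u} = {u,v,t}" "{v,t,u'} = {u',v,t}" by auto
 ultimately have w: "w ?A (span {v,t,u-u'})" using wline_span[OF gr_span[OF sub(1)] sub(4)] by simp
 define r where "r = u - u'"
 have "dim (insert r {u',v,t,x}) = dim (insert u {u',v,t,x})" unfolding r_def
  by (rule dim_insert_diff) (auto intro: span_base)
 then have d5: "dim {r,u',v,t,x} = 5" using d by simp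
 have WS: "span {r,u',v,t,x} = ?W" unfolding r_def
  by (rule span_insert_diff) (auto intro: span_base)
 have A: "span {r,u',x} = ?A" unfolding r_def
  by (rule span_insert_diff) (auto intro: span_base)
 have dist': "distinct [r,u',v,t,x]" using d5 by (intro dim_dist) simp
 have sub': "dim {r,u',x} = 3" "dim {v,t,r} = 3"
  using dim_sub[of "[r,u',v,t,x]" "[r,u',x]"] dim_sub[of "[r,u',v,t,x]" "[v,t,r]"] d5 dist' by auto
 have i: "{r,u',x} Int {v,t,r} = {r}" using dist' by auto
 have "card {r,u',v,t,x} = 5" using distinct_card[OF dist'] by simp
 moreover have "w (span {r,u',x}) (span {v,t,r})" using w unfolding A r_def[symmetric] .
 ultimately have "bad r (span {r,u',v,t,x})"
  by (intro bad_span[OF d5 _ _ _ _ sub' i]) auto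
 then show ?thesis unfolding WS r_def[symmetric] .
qed

end

context subspace_calculus
begin

lemma extend1:
 assumes "gr n W" "S <= W" "dim S < n"
 shows "EX x:W. dim (insert x S) = Suc (dim S)"
proof -
 have 1: "subspace W" "dim S < dim W" using assms by (auto simp: gr_def)
 show ?thesis by (rule obtain_extension_in[OF assms(2) 1]) blast
qed

lemma extend3:
 assumes W: "gr n W" and S: "S <= W" "dim S + 3 = n"
 obtains a b c where "W = span (insert a (insert b (insert c S)))" "dim (insert a (insert b (insert c S))) = n"
proof -
 obtain c where c: "c:W" "dim (insert c S) = Suc (dim S)" using extend1[OF W S(1)] S(2) by auto
 obtain b where b: "b:W" "dim (insert b (insert c S)) = Suc (Suc (dim S))"
  using extend1[OF W, of "insert c S"] S c by auto
 obtain a where a: "a:W" "dim (insert a (insert b (insert c S))) = Suc (Suc (Suc (dim S)))"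
  using extend1[OF W, of "insert b (insert c S)"] S b c by auto
 have "W = span (insert a (insert b (insert c S)))"
  by (rule span_eq_if_dim) (use W S a b c in \<open>auto simp: gr_def\<close>)
 then show thesis using that a S(2) by simp
qed

lemma extend2:
 assumes W: "gr n W" and S: "S <= W" "dim S + 2 = n"
 obtains a b where "W = span (insert a (insert b S))" "dim (insert a (insert b S)) = n"
proof -
 obtain b where b: "b:W" "dim (insert b S) = Suc (dim S)" using extend1[OF W S(1)] S(2) by auto
 obtain a where a: "a:W" "dim (insert a (insert b S)) = Suc (Suc (dim S))"
  using extend1[OF W, of "insert b S"] S b by auto
 have "W = span (insert a (insert b S))"
  by (rule span_eq_if_dim) (use W S a b in \<open>auto simp: gr_def\<close>)
 then show thesis using that a S(2) by simp
qed

lemma obtain_dim1: "gr 1 A ==> EX u. u ~= 0 & A = span {u}"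
 using basis1 by (simp add: gr_def)

lemma dim_ge_1: "x:A ==> x ~= 0 ==> 1 <= dim A"
 using dim_eq_0[of A] by (metis One_nat_def Suc_leI neq0_conv singletonD subsetD)

lemma gr_inter_ge: "gr k A ==> gr l B ==> A <= W ==> B <= W ==> gr m W ==> k + l <= m + dim (A Int B)"
 using dim_ssum_gr[of k A l B] dim_subset[of "A #+ B" W] ssum_least[of A W B] by (simp add: gr_def)

end

context weak_adjacency
begin

text \<open>As \<open>u\<close> is not bad, \<open>A = span {u,u',a}\<close> and
  \<open>B = span {u,p,q}\<close> are not adjacent, while \<open>X = span {u',p,q}\<close> is
  adjacent to both. The pencil between \<open>span {u,a}\<close> and \<open>span {u,a,p,q}\<close>
  consists of common neighbours of \<open>A\<close> and \<open>B\<close>, so \<open>wpolar\<close>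
  yields a member \<open>C\<close> adjacent to \<open>X\<close>. The intersection of
  \<open>X\<close> and \<open>C\<close> is a 1-space inside \<open>span {p,q}\<close>, and its
  vectors are bad.\<close>

lemma bad_step:
 assumes d: "dim {u,u',a,p,q} = 5" and b: "bad u' (span {u,u',a,p,q})" and nb: "~ bad u (span {u,u',a,p,q})"
 shows "EX x:span {p,q}. bad x (span {u,u',a,p,q})"
proof -
 let ?S = "{u,u',a,p,q}" let ?W = "span ?S"
 let ?A = "span {u,u',a}" and ?B = "span {u,p,q}" and ?X = "span {u',p,q}"
 have dist: "distinct [u,u',a,p,q]" using d by (intro dim_dist) simp
 have card: "card ?S = 5" using distinct_card[OF dist] by simp
 have sub: "dim {u,u',a} = 3" "dim {u,p,q} = 3" "dim {u',p,q} = 3" "dim {u,a} = 2" "dim {u,a,p,q} = 4" "dim {p,q} = 2"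
  using dim_sub[of "[u,u',a,p,q]" "[u,u',a]"] dim_sub[of "[u,u',a,p,q]" "[u,p,q]"]
   dim_sub[of "[u,u',a,p,q]" "[u',p,q]"] dim_sub[of "[u,u',a,p,q]" "[u,a]"]
   dim_sub[of "[u,u',a,p,q]" "[u,a,p,q]"] dim_sub[of "[u,u',a,p,q]" "[p,q]"] d dist by auto
 have gA: "gr 3 ?A" and gB: "gr 3 ?B" and gX: "gr 3 ?X" using sub by (auto simp: gr_def)
 have nw: "~ w ?A ?B" using dist bad_span[OF d _ card _ _ sub(1,2)] nb by auto
 have XA: "w ?X ?A"
  by (rule badD[OF b gX gA]) (auto intro: span_base intro!: span_mono)
 have XB: "w ?X ?B"
  by (rule wadj_common[of _ _ "{p,q}"]) (use sub in \<open>auto intro: span_base\<close>)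
 have C: "w C ?A & w C ?B" if C: "gr 3 C" "span {u,a} <= C" "C <= span {u,a,p,q}" for C
 proof
  show "w C ?A" using C(2) span_mono[of "{u,a}" "{u,u',a}"] dim_subset[of "span {u,a}"] sub(4) wadj[OF C(1) gA] by simp
  have "?B <= span {u,a,p,q}" by (rule span_mono) auto
  then show "w C ?B" using gr_inter_ge[OF C(1) gB C(3) _ gr_span[OF sub(5)]] wadj[OF C(1) gB] by simp
 qed
 obtain C where C': "gr 3 C" "span {u,a} <= C" "C <= span {u,a,p,q}" "w ?X C"
  using wpolar[OF gA gB gX nw XA XB gr_span[OF sub(4)] gr_span[OF sub(5)] _ C] span_mono[of "{u,a}" "{u,a,p,q}"] by auto
 have CW: "C <= ?W" using C'(3) span_mono[of "{u,a,p,q}" ?S] by auto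
 have XW: "?X <= ?W" by (rule span_mono) auto
 have XC: "?X Int C <= span {p,q}"
  proof -
   have "span {u',p,q} Int span {u,a,p,q} = span ({u',p,q} Int {u,a,p,q})"
      by (rule span_inter_card[of ?S]) (use d card in auto)
   then show ?thesis using C'(3) dist by auto
  qed
 moreover have "dim (?X Int C) <= 1"
  proof (rule ccontr)
   assume "~ dim (?X Int C) <= 1"
   then have "{p,q} <= C" using subspace_eqI[of "?X Int C" "span {p,q}"] XC sub(6) subspace_inter C'(1) span_superset[of "{p,q}"] by (simp add: gr_def)
   moreover have "{u,a} <= C" using C'(2) span_superset[of "{u,a}"] by auto
   ultimately have "dim {u,a,p,q} <= dim C" by (intro dim_subset) auto
   then show False using sub(5) C'(1) by (simp add: gr_def)
  qed
 ultimately have d1: "dim (?X Int C) = 1" using gr_inter_ge[OF gX C'(1) XW CW gr_span[OF d]] by simp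
 then obtain x where x: "x:?X Int C" "x ~= 0" using dim_pos[of "?X Int C"] by auto
 show ?thesis using x gr_span[OF d] gX C'(1,4) XW CW d1 XC by (auto simp: bad_def)
qed

lemma bad_scale: "bad u W ==> c ~= 0 ==> bad (scale c u) W"
 unfolding bad_def gr_def by (metis scale_eq_0_iff subspace_scale)

text \<open>If \<open>u\<close> were not bad, \<open>bad_step\<close> would supply bad vectors
  \<open>x\<close> and \<open>y\<close> that complete \<open>u\<close>, \<open>u'\<close>,
  \<open>a\<close> to a basis of \<open>W\<close>. Then \<open>A = span {u',x,y}\<close> and
  \<open>B = span {u,x,a}\<close> are adjacent because of \<open>x\<close>, and both
  \<open>X = span {u,x,u'}\<close> and \<open>Y = span {u,a,y}\<close> are adjacent to each of them.
  By \<open>wclique\<close> the 3-spaces \<open>X\<close> and \<open>Y\<close> are adjacent, but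
  they meet only in the multiples of \<open>u\<close>.\<close>

lemma bad_const:
 assumes b: "bad u' W" and u: "u:W" "u ~= 0"
 shows "bad u W"
proof (cases "u:span {u'}")
 case True
 then obtain c where c: "u = scale c u'" by (auto simp: span_singleton)
 show ?thesis using u bad_scale[OF b] c by fastforce
next
 case False
 have W: "gr 5 W" and u': "u' ~= 0" "u':W" using b by (auto simp: bad_def)
 show ?thesis
 proof (rule ccontr)
  assume nb: "~ bad u W"
  have d2: "dim {u,u'} = 2" using dim_ins[OF False] u' by simp
  obtain a p q where v: "W = span {a,p,q,u,u'}" "dim {a,p,q,u,u'} = 5"
   by (rule extend3[OF W, of "{u,u'}"]) (use u u' d2 in auto)
  have e: "{a,p,q,u,u'} = {u,u',a,p,q}" by auto
  note v = v[unfolded e]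
  obtain x where x: "x:span {p,q}" "bad x W" using bad_step[of u u' a p q] v b nb by blast
  have x0: "x ~= 0" using x by (auto simp: bad_def)
  have "gr 2 (span {p,q})"
   using dim_sub[of "[u,u',a,p,q]" "[p,q]"] v(2) dim_dist[of "[u,u',a,p,q]"] by (auto simp: gr_def)
  then obtain z where z: "z:span {p,q}" "dim {z,x} = 2" using extend1[of 2 "span {p,q}" "{x}"] x x0 by auto
  have zx: "span {p,q} = span {z,x}"
   by (rule span_eq_if_dim) (use x z dim_le2[of p q] in auto)
  have W1: "span {u,u',a,z,x} = W"
  proof -
   have "span {u,u',a} #+ span {z,x} = span {u,u',a} #+ span {p,q}" using zx by simp
   then show ?thesis unfolding ssum_span v(1) by (simp add: insert_commute)
  qed
  have d5: "dim {u,u',a,z,x} = 5" using W1 W by (metis dim_span gr_def)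
  \<comment> \<open>With \<open>r\<close> in place of \<open>x\<close> in the basis, the second use
    of \<open>bad_step\<close> gives a bad vector of \<open>span {r,z}\<close>. It is independent of
    the earlier vectors unless it is a multiple of \<open>r\<close>; in that case \<open>r\<close>
    is bad, and so is \<open>u = x - r\<close> by \<open>bad_diff\<close>.\<close>
  define r where "r = x - u"
  have "span (insert r {u,u',a,z}) = span (insert x {u,u',a,z})" unfolding r_def
   by (rule span_insert_diff) (auto intro: span_base)
  moreover have "insert x {u,u',a,z} = {u,u',a,z,x}" by auto
  moreover have "insert r {u,u',a,z} = {u,u',a,r,z}" by auto
  ultimately have W2: "span {u,u',a,r,z} = W" using W1 by simp
  have d5': "dim {u,u',a,r,z} = 5" using W2 W by (metis dim_span gr_def)
  obtain y where y: "y:span {r,z}" "bad y W" using bad_step[OF d5', unfolded W2, OF b nb] by blast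
  obtain s t where st: "y = scale s r + scale t z" using y(1) by (auto simp: span_lin2)
  have t0: "t ~= 0"
  proof
   assume "t = 0"
   then have "y = scale s r" using st by simp
   moreover have "s ~= 0" using y calculation by (auto simp: bad_def)
   ultimately have "r = scale (inverse s) y" by simp
   then have br: "bad r W" using bad_scale[OF y(2), of "inverse s"] \<open>s ~= 0\<close> by simp
   have "span (insert r {x,u',a,z}) = span (insert u {x,u',a,z})"
   proof (rule span_replace)
    have "x - r:span (insert r {x,u',a,z})" by (intro span_diff) (auto intro: span_base)
    then show "u:span (insert r {x,u',a,z})" by (simp add: r_def)
    show "r:span (insert u {x,u',a,z})" unfolding r_def by (intro span_diff) (auto intro: span_base)
   qed
   moreover have "insert u {x,u',a,z} = {u,u',a,z,x}" "insert r {x,u',a,z} = {x,r,u',a,z}" by auto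
   ultimately have W3: "span {x,r,u',a,z} = W" using W1 by simp
   have "dim {x,r,u',a,z} = 5" using W3 W by (metis dim_span gr_def)
   from bad_diff[OF this, unfolded W3, OF x(2) br] have "bad u W" by (simp add: r_def)
   then show False using nb by simp
  qed
  have W4: "span {u,u',a,x,y} = W"
  proof -
   have "y - scale t z = scale s r" using st by simp
   have "span (insert y {u,u',a,x}) = span (insert z {u,u',a,x})"
   proof (rule span_replace)
    have r: "scale s r:span T" if "x:T" "u:T" for T
     unfolding r_def using that by (intro span_scale span_diff) (auto intro: span_base)
    show "y:span (insert z {u,u',a,x})" unfolding st
     by (intro span_add r span_scale) (auto intro: span_base)
    have "scale (inverse t) (y - scale s r):span (insert y {u,u',a,x})"
         by (intro span_scale span_diff r) (auto intro: span_base)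
    then show "z:span (insert y {u,u',a,x})" using st t0 by simp
   qed
   moreover have "insert y {u,u',a,x} = {u,u',a,x,y}" "insert z {u,u',a,x} = {u,u',a,z,x}" by auto
   ultimately show ?thesis using W1 by simp
  qed
  have d: "dim {u,u',a,x,y} = 5" using W4 W by (metis dim_span gr_def)
  have dist: "distinct [u,u',a,x,y]" using d by (intro dim_dist) simp
  have sub: "dim {u',x,y} = 3" "dim {u,x,a} = 3" "dim {u,x,u'} = 3" "dim {u,a,y} = 3" "dim {x,u'} = 2" "dim {u,x} = 2" "dim {u,a} = 2"
   using dim_sub[of "[u,u',a,x,y]" "[u',x,y]"] dim_sub[of "[u,u',a,x,y]" "[u,x,a]"]
    dim_sub[of "[u,u',a,x,y]" "[u,x,u']"] dim_sub[of "[u,u',a,x,y]" "[u,a,y]"]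
    dim_sub[of "[u,u',a,x,y]" "[x,u']"] dim_sub[of "[u,u',a,x,y]" "[u,x]"]
    dim_sub[of "[u,u',a,x,y]" "[u,a]"] d dist by auto
  have card: "card {u,u',a,x,y} = 5" using distinct_card[OF dist] by simp
  let ?A = "span {u',x,y}" and ?B = "span {u,x,a}" and ?X = "span {u,x,u'}" and ?Y = "span {u,a,y}"
  have inW: "?A <= W" "?B <= W" "?Y <= W" unfolding W4[symmetric] by (auto intro!: span_mono)
  have AB: "w ?A ?B"
   by (rule badD[OF x(2)]) (use sub inW in \<open>auto simp: gr_def intro: span_base\<close>)
  have "dim (?A Int ?B) = card ({u',x,y} Int {u,x,a})"
     by (rule dim_inter_card[of "{u,u',a,x,y}"]) (use d card in auto)
  then have AB1: "dim (?A Int ?B) < 2" using dist by fastforce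
  have XA: "w ?X ?A" by (rule wadj_common[of _ _ "{x,u'}"]) (use sub in \<open>auto intro: span_base\<close>)
  have XB: "w ?X ?B" by (rule wadj_common[of _ _ "{u,x}"]) (use sub in \<open>auto intro: span_base\<close>)
  have YA: "w ?Y ?A"
   by (rule badD[OF y(2)]) (use sub inW in \<open>auto simp: gr_def intro: span_base\<close>)
  have YB: "w ?Y ?B" by (rule wadj_common[of _ _ "{u,a}"]) (use sub in \<open>auto intro: span_base\<close>)
  have "w ?X ?Y"
     by (rule wclique[OF _ _ _ _ AB AB1 XA XB YA YB]) (use sub in \<open>auto simp: gr_def\<close>)
  then show False using bad_span[OF d _ card _ _ sub(3,4)] dist nb W4 by force
 qed
qed

text \<open>Two 3-spaces of a 5-space always have a nonzero vector in common, and by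
  \<open>bad_const\<close> that vector is bad.\<close>

lemma w_in_bad:
 assumes "bad u W" "gr 3 A" "gr 3 B" "A <= W" "B <= W"
 shows "w A B"
proof -
 have "0 < dim (A Int B)" using assms(1) gr_inter_ge[OF assms(2-5), of 5] by (simp add: bad_def)
 then obtain x where "x:A Int B" "x ~= 0" using dim_pos by blast
 then show ?thesis using badD[OF bad_const[OF assms(1)] assms(2,3) _ _ assms(4,5)] assms(4) by blast
qed

text \<open>Choose a 3-space \<open>X0\<close> of \<open>W\<close> that contains
  \<open>B Int W\<close> and meets \<open>Y\<close> in at most a 1-space. \<open>B\<close> is
  adjacent to \<open>X0\<close> because they share a 2-space, and to \<open>Y\<close> by assumption.
  Every \<open>X\<close> in the bad space \<open>W\<close> is adjacent to \<open>X0\<close> and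
  \<open>Y\<close> too, and \<open>X0\<close> and \<open>Y\<close> are adjacent, so
  \<open>wclique\<close> applies.\<close>

lemma bad_spread:
 assumes b: "bad u W" and B: "gr 3 B" "dim (B Int W) = 2" and Y: "gr 3 Y" "Y <= W" "w B Y" "~ B Int W <= Y"
  and X: "gr 3 X" "X <= W"
 shows "w B X"
proof -
 have W: "gr 5 W" using b by (simp add: bad_def)
 let ?P = "B Int W"
 have P: "gr 2 ?P" using B W subspace_inter by (simp add: gr_def)
 have "dim (?P Int Y) < 2"
 proof (rule ccontr)
  assume "~ ?thesis"
  then have "?P Int Y = ?P"
   by (intro subspace_eqI) (use P Y(1) subspace_inter in \<open>auto simp: gr_def\<close>)
  then show False using Y(4) by blast
 qed
 then have PY: "4 <= dim (?P #+ Y)" using dim_ssum_gr[OF P Y(1)] by simp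
 obtain x where x: "x:W" "x ~: ?P" "?P #+ Y = W | x ~: ?P #+ Y"
 proof (cases "?P #+ Y = W")
  case True
  show ?thesis using dim_ex[of ?P W] P W that True by (auto simp: gr_def)
 next
  case False
  have "?P #+ Y <= W" using Y(2) W by (intro ssum_least) (auto simp: gr_def)
  then obtain x where "x:W" "x ~: ?P #+ Y" using False by blast
  then show ?thesis using that ssum_ub1[of ?P Y] by blast
 qed
 let ?X0 = "span (insert x ?P)"
 have X0: "gr 3 ?X0" using gr_ext[of ?P 2 x] P x(2) by (simp add: gr_def)
 have X0W: "?X0 <= W" using span_ins_le[of x W ?P] x(1) W by (simp add: gr_def)
 have PX0: "?P <= ?X0" by (auto intro: span_base)
 have "W <= ?X0 #+ Y"
 proof -
  have le: "?P #+ Y <= ?X0 #+ Y" by (rule ssum_mono[OF PX0]) simp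
  show ?thesis
  proof (cases "?P #+ Y = W")
   case False
   then have "dim (span (insert x (?P #+ Y))) >= 5" using x(3) dim_ins[of x "?P #+ Y"] PY by (simp add: span_eq_iff[THEN iffD2])
   moreover have "span (insert x (?P #+ Y)) <= ?X0 #+ Y"
   proof (rule span_ins_le)
    have "x:?X0" by (auto intro: span_base)
    then show "x:?X0 #+ Y" using ssum_ub1[of ?X0 Y] by blast
   qed (use le in auto)
   ultimately have "5 <= dim (?X0 #+ Y)" using dim_subset order_trans by blast
   moreover have "?X0 #+ Y <= W" using X0W Y(2) W by (intro ssum_least) (auto simp: gr_def)
   ultimately show ?thesis using subspace_eqI[of "?X0 #+ Y" W] W by (simp add: gr_def)
  qed (use le in simp)
 qed
 then have "5 <= dim (?X0 #+ Y)" using dim_subset[of W] W by (metis grD(2))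
 then have d1: "dim (?X0 Int Y) < 2" using dim_ssum_gr[OF X0 Y(1)] by simp
 have BX0: "w B ?X0" using PX0 dim_subset[of ?P] B(2) wadj[OF B(1) X0] by simp
 show ?thesis
  by (rule wsym[OF X(1) B(1)], rule wclique[OF X0 Y(1) X(1) B(1) w_in_bad[OF b X0 Y(1) X0W Y(2)] d1
     w_in_bad[OF b X(1) X0 X(2) X0W] w_in_bad[OF b X(1) Y(1) X(2) Y(2)] BX0 Y(3)])
qed

text \<open>If \<open>W\<close> had no bad vector, some \<open>A\<close> and \<open>B\<close> in
  \<open>W\<close> would be nonadjacent, although an \<open>X\<close> in \<open>W'\<close> is
  adjacent to both. The polar axiom gives a \<open>C\<close> in \<open>W\<close>, adjacent to
  \<open>X\<close> and with only a 2-space in \<open>W'\<close>. By \<open>bad_spread\<close> this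
  \<open>C\<close> is adjacent to all 3-spaces of \<open>W'\<close>, among them one in the
  intersection of \<open>W\<close> and \<open>W'\<close> that meets \<open>C\<close> in a 1-space;
  this pair is bad in \<open>W\<close>.\<close>

lemma bad_neighbour:
 assumes b: "bad u0 W'" and W: "gr 5 W" and Z: "dim (W Int W') = 4"
 shows "EX u. bad u W"
proof (rule ccontr)
 assume good: "~ (EX u. bad u W)"
 have W': "gr 5 W'" using b by (simp add: bad_def)
 let ?Z = "W Int W'"
 have gZ: "gr 4 ?Z" using W W' Z subspace_inter by (simp add: gr_def)
 obtain u where u: "u:?Z" "u ~= 0" using dim_pos[of ?Z] Z by auto
 obtain a1 a2 b where v: "?Z = span {a1,a2,b,u}" "dim {a1,a2,b,u} = 4"
  by (rule extend3[OF gZ, of "{u}"]) (use u in auto)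
 obtain b' c where bc: "b':W" "b' ~: ?Z" "c:W'" "c ~: ?Z" using dim_ex[of ?Z W] dim_ex[of ?Z W'] Z W W' by (auto simp: gr_def)
 have dS: "dim {b',a1,a2,b,u} = 5" "dim {c,a1,a2,b,u} = 5" using dim_ins[of b' "{a1,a2,b,u}"] dim_ins[of c "{a1,a2,b,u}"] v bc by auto
 have inZ: "{a1,a2,b,u} <= ?Z" unfolding v(1) by (rule span_superset)
 have WS: "W = span {b',a1,a2,b,u}" 
  by (rule span_eq_if_dim) (use inZ bc W dS in \<open>auto simp: gr_def\<close>)
 have WS': "W' = span {c,a1,a2,b,u}" 
  by (rule span_eq_if_dim) (use inZ bc W' dS in \<open>auto simp: gr_def\<close>)
 have dist1: "distinct [b',a1,a2,b,u]" using dS(1) by (intro dim_dist) simp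
 have dist2: "distinct [c,a1,a2,b,u]" using dS(2) by (intro dim_dist) simp
 note dist = dist1 dist2
 have card: "card {b',a1,a2,b,u} = 5" "card {c,a1,a2,b,u} = 5" using distinct_card[OF dist(1)] distinct_card[OF dist(2)] by auto
 have sub: "dim {u,a1,a2} = 3" "dim {u,b,b'} = 3" "dim {u,b,c} = 3" "dim {u,b'} = 2" "dim {u,b',a1,a2} = 4" "dim {u,b} = 2" 
  using dim_sub[of "[b',a1,a2,b,u]" "[u,a1,a2]"] dim_sub[of "[b',a1,a2,b,u]" "[u,b,b']"]
   dim_sub[of "[b',a1,a2,b,u]" "[u,b']"] dim_sub[of "[b',a1,a2,b,u]" "[u,b',a1,a2]"]
   dim_sub[of "[b',a1,a2,b,u]" "[u,b]"] dim_sub[of "[c,a1,a2,b,u]" "[u,b,c]"] dS dist by auto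
 let ?A = "span {u,a1,a2}" and ?B = "span {u,b,b'}" and ?X = "span {u,b,c}"
 have g: "gr 3 ?A" "gr 3 ?B" "gr 3 ?X" "gr 2 (span {u,b'})" "gr 4 (span {u,b',a1,a2})"
  using sub by (auto simp: gr_def)
 have AZ: "?A <= ?Z" unfolding v(1) by (rule span_mono) auto
 have XW': "?X <= W'" unfolding WS' by (rule span_mono) auto
 have nw: "~ w ?A ?B" using dist bad_span[OF dS(1) _ card(1) _ _ sub(1,2)] good WS by auto
 have XA: "w ?X ?A" by (rule w_in_bad[OF b g(3,1) XW']) (use AZ in auto)
 have XB: "w ?X ?B" by (rule wadj_common[of _ _ "{u,b}"]) (use sub in \<open>auto intro: span_base\<close>)
 have C: "w C ?A & w C ?B" if C: "gr 3 C" "span {u,b'} <= C" "C <= span {u,b',a1,a2}" for C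
 proof
  show "w C ?B" using C(2) span_mono[of "{u,b'}" "{u,b,b'}"] dim_subset[of "span {u,b'}"] sub(4) wadj[OF C(1) g(2)] by simp
  have "?A <= span {u,b',a1,a2}" by (rule span_mono) auto
  then show "w C ?A" using gr_inter_ge[OF C(1) g(1) C(3) _ g(5)] wadj[OF C(1) g(1)] by simp
 qed
 obtain C where C': "gr 3 C" "span {u,b'} <= C" "C <= span {u,b',a1,a2}" "w ?X C"
  using wpolar[OF g(1,2,3) nw XA XB g(4,5) _ C] span_mono[of "{u,b'}" "{u,b',a1,a2}"] by auto
 have CW: "C <= W" using C'(3) span_mono[of "{u,b',a1,a2}" "{b',a1,a2,b,u}"] WS by auto
 have CZ: "C Int W' = C Int ?Z" using CW by blast
 have "b':C" using C'(2) span_base[of b' "{u,b'}"] by blast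
 have CW2: "dim (C Int W') = 2" using gr_inter_ge[OF C'(1) gZ CW _ W] CZ subspace_eqI[of "C Int W'" C] C'(1) W' subspace_inter \<open>b' : C\<close> bc
  by (force simp: gr_def)
 have CA: "C Int W' <= ?A"
 proof -
  have e: "span {u,b',a1,a2} Int span {a1,a2,b,u} = ?A"
   by (rule span_inter_set[of "{b',a1,a2,b,u}"]) (use dS card dist in auto)
  show ?thesis using e C'(3) by (auto simp: CZ v(1)[symmetric])
 qed
 have nCX: "~ C Int W' <= ?X"
 proof
  assume "C Int W' <= ?X"
  then have "2 <= dim (?A Int ?X)" using dim_subset[of "C Int W'" "?A Int ?X"] CA CW2 by simp
  moreover have "dim (?A Int ?X) = card {u}"
   by (rule dim_inter_set[of "{c,a1,a2,b,u}"]) (use dS card dist in auto)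
  ultimately show False by simp
 qed
 obtain p where p: "p:C Int ?Z" "p ~= 0" using dim_pos[of "C Int ?Z"] CZ CW2 by auto
 have gP: "gr 2 (C Int ?Z)" using CZ CW2 subspace_inter[of C ?Z] C'(1) gZ by (simp add: gr_def)
 obtain q where q: "q:C Int ?Z" "dim {q,p} = 2" using extend1[OF gP, of "{p}"] p by auto
 obtain r s where rs: "?Z = span {r,s,q,p}" "dim {r,s,q,p} = 4"
  by (rule extend2[OF gZ, of "{q,p}"]) (use p q in auto)
 have drs: "distinct [r,s,q,p]" using rs(2) by (intro dim_dist) simp
 \<comment> \<open>\<open>q\<close> is left out, so this 3-space meets \<open>C\<close> only in the
   multiples of \<open>p\<close>.\<close>
 let ?D = "span {r,s,p}"
 have D: "gr 3 ?D" using dim_sub[of "[r,s,q,p]" "[r,s,p]"] drs rs(2) by (auto simp: gr_def)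
 have DZ: "?D <= ?Z" unfolding rs(1) by (rule span_mono) auto
 have Pq: "C Int ?Z = span {q,p}"
  by (rule span_eq_if_dim) (use p q gP in \<open>auto simp: gr_def\<close>)
 have "C Int ?D = span {q,p} Int ?D" using DZ Pq by blast
 also have "... = span ({q,p} Int {r,s,p})"
  by (rule span_inter_card[of "{r,s,q,p}"]) (use rs(2) drs distinct_card[OF drs] in auto)
 also have "{q,p} Int {r,s,p} = {p}" using drs by auto
 finally have CD: "dim (C Int ?D) = 1" using p(2) by simp
 have wCX: "w C ?X" using wsym[OF g(3) C'(1) C'(4)] .
 have CwD: "w C ?D"
  by (rule bad_spread[OF b C'(1) CW2 g(3) XW' wCX nCX D]) (use DZ in auto)
 have pD: "p:?D" and DW: "?D <= W" using DZ by (auto intro: span_base)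
 show False using p(2) W C'(1) D IntD1[OF p(1)] pD CW DW CD CwD good by (auto simp: bad_def)
qed

text \<open>The bad space is moved towards \<open>W\<close> through 5-spaces sharing a 4-space: a
  4-space \<open>H\<close> of \<open>W'\<close> containing \<open>W Int W'\<close> is kept, and one
  vector of \<open>W\<close> outside \<open>W'\<close> is added.\<close>

lemma bad_everywhere:
 assumes W: "gr 5 W" and b: "bad u0 W'"
 shows "EX u. bad u W"
 using b
proof (induction "5 - dim (W Int W')" arbitrary: W' u0 rule: less_induct)
 case less
 note b = less.prems
 have W': "gr 5 W'" using b by (simp add: bad_def)
 consider "dim (W Int W') = 5" | "dim (W Int W') = 4" | "dim (W Int W') <= 3" using dim_subset[of "W Int W'" W] W by (force simp: gr_def)
 then show ?case
 proof cases
  case 1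
  have "W Int W' = W" by (rule subspace_eqI) (use 1 W W' subspace_inter in \<open>auto simp: gr_def\<close>)
  moreover have "W Int W' = W'" by (rule subspace_eqI) (use 1 W W' subspace_inter in \<open>auto simp: gr_def\<close>)
  ultimately show ?thesis using b by auto
 next
  case 2 then show ?thesis using bad_neighbour[OF b W] by blast
 next
  case 3
  have gI: "subspace (W Int W')" using W W' subspace_inter by (simp add: gr_def)
  obtain H where H: "gr 4 H" "W Int W' <= H" "H <= W'"
   by (rule subspace_between[OF gI, of W' 4]) (use 3 W' in \<open>auto simp: gr_def\<close>)
  obtain x where x: "x:W" "x ~: W'" using dim_ex[of "W Int W'" W] 3 W by (auto simp: gr_def)
  let ?V = "span (insert x H)"
  have V: "gr 5 ?V" using gr_ext[of H 4 x] H x by (auto simp: gr_def)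
  have HV: "H <= ?V" by (auto intro: span_base)
  have xV: "x:?V" by (auto intro: span_base)
  have "dim (?V Int W') = 4"
  proof (rule antisym)
   show "4 <= dim (?V Int W')" using dim_subset[of H "?V Int W'"] H HV by (simp add: gr_def)
   show "dim (?V Int W') <= 4"
   proof (rule ccontr)
    assume "~ ?thesis"
    then show False using subspace_eqI[of "?V Int W'" ?V] V W' subspace_inter x xV by (auto simp: gr_def)
   qed
  qed
  then obtain u1 where b1: "bad u1 ?V" using bad_neighbour[OF b V] by blast
  have "dim (insert x (W Int W')) <= dim (W Int ?V)" using H(2) HV xV x(1) dim_subset by simp
  moreover have "span (W Int W') = W Int W'" using gI by simp
  then have "x ~: span (W Int W')" using x(2) by blast
  ultimately have "dim (W Int W') < dim (W Int ?V)" using dim_ins[of x "W Int W'"] by simp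
  then show ?thesis using 3 less.hyps b1 by force
 qed
qed

lemma w_if_bad:
 assumes b: "bad u0 W'" and A: "gr 3 A" "gr 3 B" "0 < dim (A Int B)"
 shows "w A B"
proof (cases "2 <= dim (A Int B)")
 case True then show ?thesis using wadj A by blast
next
 case False
 then obtain u where "bad u (A #+ B)" using dim_ssum_gr[OF A(1,2)] A(3) bad_everywhere[OF _ b] by (force simp: gr_def)
 then show ?thesis using w_in_bad A ssum_ub1 ssum_ub2 by blast
qed

lemma bad_if_w:
 assumes "gr 3 A" "gr 3 B" "dim (A Int B) = 1" "w A B"
 shows "EX u. bad u (A #+ B)" using dim_ssum_gr[OF assms(1,2)] dim_pos[of "A Int B"] assms ssum_ub1[of A B] ssum_ub2[of B A] by (auto simp: gr_def bad_def)

lemma disjoint_vectors: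
 assumes "gr 3 A" "gr 3 B" "dim (A Int B) = 0"
 obtains a1 a2 a3 b1 b2 b3 where "A = span {a1,a2,a3}" "B = span {b1,b2,b3}" "dim {a1,a2,a3,b1,b2,b3} = 6"
proof -
 obtain a1 a2 a3 where a: "A = span {a1,a2,a3}" "dim {a1,a2,a3} = 3"
  by (rule extend3[OF assms(1), of "{}"]) auto
 obtain b1 b2 b3 where b: "B = span {b1,b2,b3}" "dim {b1,b2,b3} = 3"
  by (rule extend3[OF assms(2), of "{}"]) auto
 have "{a1,a2,a3} Un {b1,b2,b3} = {a1,a2,a3,b1,b2,b3}" by auto
 then show thesis using that a b dim_inter_span[of "{a1,a2,a3}" "{b1,b2,b3}"] assms(3) by force
qed

text \<open>A bad pair makes all 3-spaces with a nonzero intersection adjacent. Two disjoint ones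
  then have the common neighbours \<open>span {a1,a2,b1}\<close> and \<open>span {a1,b2,b3}\<close>,
  which are adjacent without sharing a 2-space, so \<open>wclique\<close> makes the disjoint pair
  adjacent as well. This leaves no nonadjacent pair.\<close>

lemma not_bad: "~ bad u0 W'"
proof
 assume b: "bad u0 W'"
 obtain X Y where XY: "gr 3 X" "gr 3 Y" "~ w X Y" using wex by blast
 then obtain a1 a2 a3 b1 b2 b3 where v: "X = span {a1,a2,a3}" "Y = span {b1,b2,b3}"
  "dim {a1,a2,a3,b1,b2,b3} = 6" using w_if_bad[OF b] disjoint_vectors[OF XY(1,2)] by blast
 have dist: "distinct [a1,a2,a3,b1,b2,b3]" using v(3) by (intro dim_dist) simp
 have sub: "dim {a1,a2,b1} = 3" "dim {a1,b2,b3} = 3" 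
  using dim_sub[of "[a1,a2,a3,b1,b2,b3]" "[a1,a2,b1]"] dim_sub[of "[a1,a2,a3,b1,b2,b3]" "[a1,b2,b3]"] v(3) dist by auto
 have g: "gr 3 (span {a1,a2,b1})" "gr 3 (span {a1,b2,b3})" using sub by (auto simp: gr_def)
 have n: "x ~= 0" if "x:{a1,b1,b2}" for x
  using dim_card_independent[of "{a1,a2,a3,b1,b2,b3}"] dependent_zero v(3) distinct_card[OF dist] that by auto
 have pos: "0 < dim (span P Int span Q)" if "x:P" "x:Q" "x ~= 0" for x P Q
  using dim_ge_1[of x "span P Int span Q"] that(3) span_base[OF that(1)] span_base[OF that(2)] by simp
 have "dim (span {a1,a2,b1} Int span {a1,b2,b3}) = card {a1}"
  by (rule dim_inter_set[of "{a1,a2,a3,b1,b2,b3}"]) (use v(3) distinct_card[OF dist] dist in auto)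
 then have AB: "dim (span {a1,a2,b1} Int span {a1,b2,b3}) < 2" by simp
 have "w X Y"
 proof (rule wclique[OF g XY(1,2) _ AB])
  show "w (span {a1,a2,b1}) (span {a1,b2,b3})" by (rule w_if_bad[OF b g pos[of a1]]) (use n in auto)
  show "w X (span {a1,a2,b1})" using w_if_bad[OF b XY(1) g(1)] pos[of a1 "{a1,a2,a3}" "{a1,a2,b1}"] n v(1) by auto
  show "w X (span {a1,b2,b3})" using w_if_bad[OF b XY(1) g(2)] pos[of a1 "{a1,a2,a3}" "{a1,b2,b3}"] n v(1) by auto
  show "w Y (span {a1,a2,b1})" using w_if_bad[OF b XY(2) g(1)] pos[of b1 "{b1,b2,b3}" "{a1,a2,b1}"] n v(2) by auto
  show "w Y (span {a1,b2,b3})" using w_if_bad[OF b XY(2) g(2)] pos[of b2 "{b1,b2,b3}" "{a1,b2,b3}"] n v(2) by auto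
 qed
 then show False using XY by blast
qed

text \<open>An adjacent pair with a 1-dimensional intersection would be bad. For a disjoint adjacent
  pair let \<open>X\<close> share a 2-space with \<open>B\<close> and a 1-space with
  \<open>A\<close>. Then \<open>X\<close> and \<open>A\<close> are not adjacent, \<open>B\<close> is
  adjacent to both, and \<open>wpolar\<close> produces a \<open>C\<close> that is adjacent to
  \<open>B\<close> and meets it in a 1-space, which was just excluded.\<close>

theorem w_iff:
 assumes A: "gr 3 A" "gr 3 B"
 shows "w A B <-> 2 <= dim (A Int B)"
proof
 assume w: "w A B"
 have n1: "dim (P Int Q) ~= 1" if "gr 3 P" "gr 3 Q" "w P Q" for P Q
  using bad_if_w[OF that(1,2) _ that(3)] not_bad by blast
 show "2 <= dim (A Int B)"
 proof (rule ccontr)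
  assume "~ ?thesis"
  then have "dim (A Int B) = 0" using n1[OF A w] by linarith
  then obtain a1 a2 a3 b1 b2 b3 where v: "A = span {a1,a2,a3}" "B = span {b1,b2,b3}"
   "dim {a1,a2,a3,b1,b2,b3} = 6" using disjoint_vectors[OF A] by blast
  have dist: "distinct [a1,a2,a3,b1,b2,b3]" using v(3) by (intro dim_dist) simp
  have sub: "dim {a1,b1,b2} = 3" "dim {a1,a2} = 2" "dim {a1,a2,b1,b2} = 4" "dim {b1,b2} = 2"
   using dim_sub[of "[a1,a2,a3,b1,b2,b3]" "[a1,b1,b2]"] dim_sub[of "[a1,a2,a3,b1,b2,b3]" "[a1,a2]"]
    dim_sub[of "[a1,a2,a3,b1,b2,b3]" "[a1,a2,b1,b2]"] dim_sub[of "[a1,a2,a3,b1,b2,b3]" "[b1,b2]"] v(3) dist by auto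
  have card: "card {a1,a2,a3,b1,b2,b3} = 6" using distinct_card[OF dist] by simp
  let ?X = "span {a1,b1,b2}"
  have g: "gr 3 ?X" "gr 2 (span {a1,a2})" "gr 4 (span {a1,a2,b1,b2})" "gr 2 (span {b1,b2})" using sub by (auto simp: gr_def)
  have i: "dim (span P Int span Q) = card (P Int Q)" if "P <= {a1,a2,a3,b1,b2,b3}" "Q <= {a1,a2,a3,b1,b2,b3}" for P Q
   by (rule dim_inter_card[of "{a1,a2,a3,b1,b2,b3}"]) (use v(3) card that in auto)
  have AX: "dim (A Int ?X) = 1" and BX: "dim (B Int ?X) = 2" using dist i[of "{a1,a2,a3}" "{a1,b1,b2}"] i[of "{b1,b2,b3}" "{a1,b1,b2}"] v(1,2) by auto
  have nw: "~ w A ?X" using n1[OF A(1) g(1)] AX by blast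
  have BA: "w B A" using wsym[OF A w] .
  have wBX: "w B ?X" using wadj[OF A(2) g(1)] BX by simp
  have C: "w C A & w C ?X" if C: "gr 3 C" "span {a1,a2} <= C" "C <= span {a1,a2,b1,b2}" for C
  proof
   show "w C A" using C(2) span_mono[of "{a1,a2}" "{a1,a2,a3}"] dim_subset[of "span {a1,a2}"] sub(2) wadj[OF C(1) A(1)] by (simp add: v(1))
   have "?X <= span {a1,a2,b1,b2}" by (rule span_mono) auto
   then show "w C ?X" using gr_inter_ge[OF C(1) g(1) C(3) _ g(3)] wadj[OF C(1) g(1)] by simp
  qed
  obtain C where C': "gr 3 C" "span {a1,a2} <= C" "C <= span {a1,a2,b1,b2}" "w B C"
   using wpolar[OF A(1) g(1) A(2) nw BA wBX g(2,3) _ C] span_mono[of "{a1,a2}" "{a1,a2,b1,b2}"] by blast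
  have "span {b1,b2,b3} Int span {a1,a2,b1,b2} = span {b1,b2}"
   by (rule span_inter_set[of "{a1,a2,a3,b1,b2,b3}"]) (use v(3) card dist in auto)
  then have BC: "B Int C <= span {b1,b2}" unfolding v(2) using C'(3) by blast
  have bB: "span {b1,b2} <= B" unfolding v(2) by (rule span_mono) auto
  have bW: "span {b1,b2} <= span {a1,a2,b1,b2}" by (rule span_mono) auto
  have "1 <= dim (C Int span {b1,b2})" using gr_inter_ge[OF C'(1) g(4) C'(3) bW g(3)] by simp
  moreover have "C Int span {b1,b2} <= B Int C" using bB by blast
  then have "dim (C Int span {b1,b2}) <= dim (B Int C)" by (rule dim_subset)
  ultimately have "1 <= dim (B Int C)" by linarith
  moreover have "dim (B Int C) <= 1"
  proof (rule ccontr)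
   assume "~ dim (B Int C) <= 1"
   then have "{b1,b2} <= C" using subspace_eqI[OF _ subspace_span BC] sub(4) subspace_inter[OF grD(1)[OF A(2)] grD(1)[OF C'(1)]] span_superset[of "{b1,b2}"] by auto
   moreover have "{a1,a2} <= C" using C'(2) span_superset[of "{a1,a2}"] by blast
   ultimately have "dim {a1,a2,b1,b2} <= dim C" by (intro dim_subset) auto
   then show False using sub(3) C'(1) by (simp add: gr_def)
  qed
  ultimately show False using n1[OF A(2) C'(1) C'(4)] by linarith
 qed
qed (use wadj A in blast)

end

section \<open>Polar spaces\<close>

text \<open>Collinearity is spelled out in the axioms because \<open>col\<close> becomes available
  only inside the locale. The locale is interpreted for common neighbours in a parapolar space, and
  once more inside \<open>residue_eq\<close>.\<close>

locale polar_system =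
 fixes Q :: "'p set" and LL :: "'p set set"
 assumes line_sub: "l:LL ==> l <= Q"
  and line_eq: "l:LL ==> m:LL ==> x:l ==> x:m ==> y:l ==> y:m ==> x ~= y ==> l = m"
  and one: "x:Q ==> l:LL ==> EX y:l. x = y | (EX m:LL. x:m & y:m)"
  and all: "x:Q ==> l:LL ==> y:l ==> z:l ==> y ~= z ==>
   x = y | (EX m:LL. x:m & y:m) ==> x = z | (EX m:LL. x:m & z:m) ==>
   w:l ==> x = w | (EX m:LL. x:m & w:m)"
  and nondeg: "x:Q ==> EX y:Q. ~ (x = y | (EX m:LL. x:m & y:m))"
begin

definition col :: "'p => 'p => bool" where
 "col x y <-> x = y | (EX m:LL. x:m & y:m)"

lemma col_refl [simp]: "col x x" by (simp add: col_def)
lemma col_sym: "col x y ==> col y x" by (auto simp: col_def)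
lemma col_line: "l:LL ==> x:l ==> y:l ==> col x y" by (auto simp: col_def)
lemma ex_line: "col x y ==> x ~= y ==> EX l:LL. x:l & y:l" by (auto simp: col_def)
lemma col_one: "x:Q ==> l:LL ==> EX y:l. col x y" using one by (simp add: col_def)
lemma col_all: "x:Q ==> l:LL ==> y:l ==> z:l ==> y ~= z ==> col x y ==> col x z ==> w:l ==> col x w"
 unfolding col_def using all[of x l y z w] by blast
lemma col_nondeg: "x:Q ==> EX y:Q. ~ col x y" using nondeg by (simp add: col_def)
lemma col_in: "col x y ==> x:Q ==> y:Q" using line_sub by (auto simp: col_def)

text \<open>Suppose \<open>l\<close> and \<open>m\<close> differ, and let \<open>z\<close> be
  noncollinear with \<open>m\<close>, hence with \<open>l\<close>. Let \<open>u\<close> be the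
  neighbour of \<open>z\<close> on the line \<open>lm\<close>, and \<open>y\<close> a point
  noncollinear with \<open>u\<close>. On the line through \<open>y\<close> and its neighbour
  \<open>x\<close> on \<open>uz\<close> there is a point \<open>r\<close> collinear with
  \<open>l\<close>, hence with \<open>m\<close> and with \<open>u\<close>. Being collinear with
  \<open>r\<close> and \<open>x\<close>, the point \<open>u\<close> would be collinear with
  \<open>y\<close>.\<close>

lemma perp_eq:
 assumes l: "l:Q" and sub: "!!z. z:Q ==> col l z ==> col m z"
 shows "l = m"
proof (rule ccontr)
 assume n: "l ~= m"
 have ml: "col l m" using sub[OF l] col_sym by simp
 then have m: "m:Q" using l col_in by blast
 obtain L where L: "L:LL" "l:L" "m:L" using ex_line[OF ml n] by blast
 obtain z where z: "z:Q" "~ col m z" using col_nondeg[OF m] by blast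
 then have zl: "~ col l z" using sub by blast
 obtain u where u: "u:L" "col z u" using col_one[OF z(1) L(1)] by blast
 have uQ: "u:Q" using u L line_sub by blast
 have uz: "u ~= z" using u(1) L zl col_line by blast
 obtain y where y: "y:Q" "~ col u y" using col_nondeg[OF uQ] by blast

 obtain M where M: "M:LL" "u:M" "z:M" using ex_line[of u z] u(2) uz col_sym by metis
 obtain x where x: "x:M" "col y x" using col_one[OF y(1) M(1)] by blast

 have xu: "x ~= u" using x y col_sym by metis
 have xl: "~ col l x" using L u(1) col_line col_all[OF l M(1) x(1) M(2) xu _ _ M(3)] zl by auto
 obtain N where N: "N:LL" "x:N" "y:N" using col_line[OF M(1) M(2) x(1)] y(2) ex_line[of y x] x(2) by auto
 obtain r where r: "r:N" "col l r" using col_one[OF l N(1)] by blast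
 have rQ: "r:Q" using r N line_sub by blast
 have rx: "r ~= x" using r xl by blast
 have "col r l" "col r m" using sub[OF rQ r(2)] r(2) col_sym by metis+
 then show False using col_all[OF rQ L n] u(1) col_sym col_all[OF uQ N(1) r(1) N(2) rx _ _ N(3)] M x(1) col_line y(2) by blast
qed

text \<open>This is \<open>perp_eq\<close> in the residue of \<open>t\<close>, realized as the polar
  space of points collinear with both \<open>t\<close> and a point \<open>t'\<close> opposite to it:
  each line on \<open>t\<close> carries exactly one of these points.\<close>

lemma residue_eq:
 assumes L: "L:LL" "t:L" "a:L" "a ~= t" and M: "M:LL" "t:M" "b:M" "b ~= t"
  and sub: "!!z. z:Q ==> col z t ==> col z a ==> col z b"
 shows "L = M"
proof -
 have t: "t:Q" using L line_sub by blast
 obtain t' where t': "t':Q" "~ col t t'" using col_nondeg[OF t] by blast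
 define Q' where "Q' = {z:Q. col z t & col z t'}"
 define LL' where "LL' = {l:LL. l <= Q'}"
 have Q'Q: "x:Q' ==> x:Q" for x by (simp add: Q'_def)
 have closed: "l:LL'" if h: "l:LL" "x:l" "y:l" "x ~= y" "x:Q'" "y:Q'" for l x y
 proof -
  have "w:Q'" if w: "w:l" for w
  proof -
   have xy: "col x t" "col y t" "col x t'" "col y t'" using h(5,6) by (simp_all add: Q'_def)
   show ?thesis using w h(1) line_sub col_all[OF t'(1) h(1-4) col_sym[OF xy(3)] col_sym[OF xy(4)] w] col_all[OF t h(1-4) col_sym[OF xy(1)] col_sym[OF xy(2)] w] by (auto simp: col_sym Q'_def)
  qed
  then show ?thesis unfolding LL'_def using h(1) by blast
 qed
 have col': "(x = y | (EX m:LL'. x:m & y:m)) <-> col x y" if "x:Q'" "y:Q'" for x y using ex_line[of x y] closed[of _ x y] that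
  by (force simp: LL'_def col_def)
 have LQ': "l:LL' ==> x:l ==> x:Q'" and LL'L: "l:LL' ==> l:LL" for l x by (auto simp: LL'_def)
 interpret R: polar_system Q' LL'
 proof
  show "l:LL' ==> l <= Q'" for l by (simp add: LL'_def)
  show "l = m" if "l:LL'" "m:LL'" "x:l" "x:m" "y:l" "y:m" "x ~= y" for l m x y
   using line_eq LL'L that by blast
  show "EX y:l. x = y | (EX m:LL'. x:m & y:m)" if "x:Q'" "l:LL'" for x l
   using col_one[OF Q'Q[OF that(1)] LL'L[OF that(2)]] col'[OF that(1)] LQ'[OF that(2)] by blast
  show "x = w | (EX m:LL'. x:m & w:m)"
   if "x:Q'" "l:LL'" "y:l" "z:l" "y ~= z" "x = y | (EX m:LL'. x:m & y:m)"
    "x = z | (EX m:LL'. x:m & z:m)" "w:l" for x l y z w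
   using col_all[OF Q'Q LL'L, of x l y z w] that LQ'[OF that(2)] col'[OF that(1)] by blast
  \<comment> \<open>A point \<open>x\<close> collinear with all of \<open>Q'\<close> would be
    collinear with all neighbours of \<open>t\<close>, because each line on \<open>t\<close>
    contains a point of \<open>Q'\<close>. Then \<open>perp_eq\<close> gives \<open>t = x\<close>,
    although \<open>x\<close> is collinear with \<open>t'\<close>.\<close>
  show "EX y:Q'. ~ (x = y | (EX m:LL'. x:m & y:m))" if x: "x:Q'" for x
  proof (rule ccontr)
   assume "~ ?thesis"
   then have c: "!!y. y:Q' ==> col x y" using col'[OF x] by blast
   have "col x z" if z: "z:Q" "col t z" for z
   proof (cases "z = t")
    case True then show ?thesis using x by (simp add: Q'_def)
   next
    case False
    obtain l where l: "l:LL" "t:l" "z:l" using ex_line[OF z(2)] False by blast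
    obtain s where s: "s:l" "col t' s" using col_one[OF t'(1) l(1)] by blast
    have st: "s ~= t" using s t'(2) col_sym by metis
    show ?thesis using subsetD[OF line_sub[OF l(1)] s(1)] col_line[OF l(1) s(1) l(2)] col_sym[OF s(2)] c col_all[OF Q'Q[OF x] l(1) s(1) l(2) st _ _ l(3)] x
     by (simp add: Q'_def)
   qed
   then show False using perp_eq[OF t] x t'(2) by (auto simp: Q'_def)
  qed
 qed
 have Rcol: "R.col x y <-> col x y" if "x:Q'" "y:Q'" for x y
  unfolding R.col_def using col'[OF that] .
 obtain a' where a': "a':L" "col t' a'" using col_one[OF t'(1) L(1)] by blast
 obtain b' where b': "b':M" "col t' b'" using col_one[OF t'(1) M(1)] by blast
 have ne: "a' ~= t" "b' ~= t" using a' b' t' col_sym by metis+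
 have aQ: "a':Q'" unfolding Q'_def
  using subsetD[OF line_sub[OF L(1)] a'(1)] col_line[OF L(1) a'(1) L(2)] col_sym[OF a'(2)] by simp
 have bQ: "b':Q'" unfolding Q'_def
  using subsetD[OF line_sub[OF M(1)] b'(1)] col_line[OF M(1) b'(1) M(2)] col_sym[OF b'(2)] by simp
 have "R.col b' z" if z: "z:Q'" "R.col a' z" for z
 proof -
  have zQ: "z:Q" using Q'Q z by blast
  have zt: "col z t" using z by (simp add: Q'_def)
  then show ?thesis using col_all[OF zQ L(1) a'(1) L(2) ne(1) _ _ L(3)] Rcol[OF aQ z(1)] z(2) col_sym sub[OF zQ zt] col_all[OF zQ M(1) M(3) M(2) M(4) _ zt b'(1)] Rcol[OF bQ z(1)] by simp
 qed
 then show ?thesis using R.perp_eq[OF aQ] line_eq[OF L(1) M(1) a'(1) _ L(2) M(2) ne(1)] b' by auto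
qed

text \<open>Otherwise \<open>residue_eq\<close> at \<open>a\<close> would identify the lines
  \<open>ab\<close> and \<open>ac\<close>.\<close>

lemma separate:
 assumes L: "L:LL" "a:L" "b:L" "a ~= b" and c: "col a c" "col b c" "c ~: L"
 obtains v where "v:Q" "col v a" "col v b" "~ col v c" using c L ex_line[OF c(1)] residue_eq by blast

text \<open>\<open>m\<close> belongs to the double perp of \<open>p\<close>, \<open>a\<close>,
  \<open>b\<close>, which is to be a plane; the point \<open>q\<close>, collinear with
  \<open>a\<close> and \<open>b\<close> but not with \<open>p\<close>, cuts the line
  \<open>L\<close> out of it. If \<open>m\<close> were off \<open>L\<close>, a point
  \<open>v\<close> separating it from \<open>a\<close> and \<open>b\<close> is joined to a point of
  the line \<open>qm\<close>. The point of the joining line collinear with \<open>p\<close> is then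
  collinear with \<open>m\<close>, and so is \<open>v\<close>.\<close>

lemma on_line:
 assumes L: "L:LL" "a:L" "b:L" "a ~= b" and q: "q:Q" "col q a" "col q b" "~ col q p"
  and p: "p:Q"
  and m: "col q m" "col a m" "col b m" "col p m"
  and sub: "!!v. v:Q ==> col v p ==> col v a ==> col v b ==> col v m"
 shows "m:L"
proof (rule ccontr)
 assume "m ~: L"
 then obtain v where v: "v:Q" "col v a" "col v b" "~ col v m" using separate[OF L m(2,3)] by blast

 have qm: "q ~= m" using q(4) m(4) col_sym by metis
 obtain J where J: "J:LL" "q:J" "m:J" using ex_line[OF m(1) qm] by blast
 obtain s where s: "s:J" "col v s" using col_one[OF v(1) J(1)] by blast

 have sm: "s ~= m" using s v by blast
 have sp: "~ col p s" using col_all[OF p J(1) s(1) J(3) sm _ m(4) J(2)] q(4) col_sym by auto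
 have aQ: "a:Q" "b:Q" using L line_sub by blast+
 have sa: "col a s" using col_all[OF aQ(1) J(1,2,3) qm _ m(2) s(1)] q(2) col_sym by metis
 have sb: "col b s" using col_all[OF aQ(2) J(1,2,3) qm _ m(3) s(1)] q(3) col_sym by metis
 have sv: "s ~= v" using v(4) s(1) J col_line by blast
 obtain N where N: "N:LL" "v:N" "s:N" using ex_line[OF s(2)] sv by blast
 obtain r where r: "r:N" "col p r" using col_one[OF p N(1)] by blast
 have rQ: "r:Q" using r N line_sub by blast
 have rs: "r ~= s" using r sp by blast
 have "col a r" "col b r"
  using col_all[OF aQ(1) N sv[symmetric] _ sa r(1)] col_all[OF aQ(2) N sv[symmetric] _ sb r(1)] v(2,3) col_sym by metis+
 then have mr: "col m r" using sub[OF rQ] r(2) col_sym by simp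
 have ms: "col m s" using J s(1) col_line by blast
 have mQ: "m:Q" using J line_sub by blast
 have "col m v" using col_all[OF mQ N(1) r(1) N(3) rs mr ms N(2)] .
 then show False using v(4) col_sym by metis
qed

text \<open>Choose \<open>q\<close> collinear with \<open>a\<close> and \<open>b\<close> but not
  with \<open>p\<close>. Its neighbour on \<open>N\<close>, and likewise its neighbour on a line
  \<open>K\<close> through \<open>p\<close> meeting \<open>N\<close>, lies on \<open>L\<close> by
  \<open>on_line\<close>.\<close>

lemma pasch:
 assumes L: "L:LL" "a:L" "b:L" "a ~= b" and p: "p ~: L"
  and A: "A:LL" "p:A" "a:A" "a':A" "a' ~= p" and B: "B:LL" "p:B" "b:B" "b':B" "b' ~= p"
  and N: "N:LL" "a':N" "b':N"
 shows pasch_meet: "N Int L ~= {}"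
  and pasch_pencil: "K:LL ==> p:K ==> K Int N ~= {} ==> K Int L ~= {}"
proof -
 have pQ: "p:Q" and aQ: "a:Q" "b:Q" using A L line_sub by blast+
 have pa: "p ~= a" "p ~= b" using p L by blast+
 have AB: "A ~= B" using line_eq[OF L(1) A(1) L(2) A(3) L(3) _ L(4)] B(3) A(2) p by blast
 have ab': "a' ~= b'" using line_eq[OF A(1) B(1) A(2) B(2) A(4) _ A(5)[symmetric]] B(4) AB by blast
 have pN: "p ~: N"
  using line_eq[OF A(1) N(1) A(2) _ A(4) N(2) A(5)[symmetric]]
   line_eq[OF B(1) N(1) B(2) _ B(4) N(3) B(5)[symmetric]] AB by blast
 obtain q where q: "q:Q" "col q a" "col q b" "~ col q p"
  using separate[OF L, of p] p col_line A B by blast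
 have sub: "col v m" if "v:Q" "col v p" "col v a" "col v b" "m:N" for v m
  using col_all[OF that(1) A(1,2,3) pa(1) that(2,3) A(4)] col_all[OF that(1) B(1,2,3) pa(2) that(2,4) B(4)] col_all[OF that(1) N ab' _ _ that(5)] by simp
 have cm: "col a m" "col b m" "col p m" if "m:N" for m
  using sub[OF aQ(1) _ _ _ that] sub[OF aQ(2) _ _ _ that] sub[OF pQ _ _ _ that] A B L col_line by blast+
 obtain m where m: "m:N" "col q m" using col_one[OF q(1) N(1)] by blast
 have "m:L" by (rule on_line[OF L q pQ m(2) cm[OF m(1)]]) (use sub m in blast)
 then show "N Int L ~= {}" using m by blast
 show "K Int L ~= {}" if K: "K:LL" "p:K" "K Int N ~= {}"
 proof -
  obtain n where n: "n:K" "n:N" using K by blast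
  have np: "p ~= n" using n pN by blast
  obtain k where k: "k:K" "col q k" using col_one[OF q(1) K(1)] by blast
  have ak: "col a k" using col_all[OF aQ(1) K(1,2) n(1) np _ cm(1)[OF n(2)] k(1)] A col_line by blast
  have bk: "col b k" using col_all[OF aQ(2) K(1,2) n(1) np _ cm(2)[OF n(2)] k(1)] B col_line by blast
  have pk: "col p k" using K k col_line by blast
  have "k:L"
  proof (rule on_line[OF L q pQ k(2) ak bk pk])
   show "col v k" if "v:Q" "col v p" "col v a" "col v b" for v
    using col_all[OF that(1) K(1,2) n(1) np that(2) sub[OF that n(2)] k(1)] .
  qed
  then show ?thesis using k by blast
 qed
qed

text \<open>The plane is the union of the lines through \<open>p\<close> meeting \<open>L\<close>.
  Closure under lines and the meeting of any two lines both reduce to the two conclusions of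
  \<open>pasch\<close>, with \<open>p\<close> as centre.\<close>

lemma plane_exists:
 assumes L: "L:LL" "a:L" "b:L" "a ~= b" and p: "p ~: L" and pc: "col p a" "col p b"
 shows "EX X. X <= Q & p:X & L <= X & (ALL x:X. ALL y:X. col x y) &
  (ALL l:LL. ALL x:X. ALL y:X. x:l --> y:l --> x ~= y --> l <= X) &
  (ALL l:LL. ALL m:LL. l <= X --> m <= X --> l Int m ~= {})"
proof -
 define X where "X = \<Union>{K:LL. p:K & K Int L ~= {}}"
 have pa: "p ~= a" "p ~= b" using p L by blast+
 have pQ: "p:Q" using ex_line[OF pc(1) pa(1)] line_sub by blast
 have pt: "EX K:LL. p:K & t:K" if t: "t:L" for t using col_all[OF pQ L(1,2,3,4) pc t] ex_line[of p t] p t by auto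
 have XI: "x:X" if "K:LL" "p:K" "t:K" "t:L" "x:K" for x K t
  using that unfolding X_def by blast
 have XD: "EX K t. K:LL & p:K & t:K & t:L & x:K" if "x:X" for x
  using that unfolding X_def by blast
 have 1: "X <= Q" unfolding X_def using line_sub by blast
 have 2: "p:X" using pt[OF L(2)] XI L(2) by blast
 have 3: "L <= X" using pt XI by blast
 have 4: "col x y" if xy: "x:X" "y:X" for x y
 proof -
  obtain K t where K: "K:LL" "p:K" "t:K" "t:L" "x:K" using XD[OF xy(1)] by blast
  obtain K' t' where K': "K':LL" "p:K'" "t':K'" "t':L" "y:K'" using XD[OF xy(2)] by blast
  have ne: "p ~= t" "p ~= t'" using K K' p by blast+
  have tQ: "t:Q" "y:Q" using K K' line_sub by blast+
  have "col t p" "col t t'" using K K' L col_line by blast+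
  then show ?thesis using col_all[OF tQ(1) K'(1-3) ne(2) _ _ K'(5)] col_all[OF tQ(2) K(1-3) ne(1) _ _ K(5)] col_sym K' col_line by simp
 qed
 have two: "EX x y Kx Ky. x:N & y:N & x ~= p & y ~= p & Kx ~= Ky & Kx:LL & Ky:LL & p:Kx & p:Ky & x:Kx & y:Ky
    & Kx Int L ~= {} & Ky Int L ~= {}"
  if N: "N:LL" "p ~: N" "u:N" "v:N" "u:X" "v:X" "u ~= v" for N u v
 proof -
  obtain K where K: "K:LL" "p:K" "K Int L ~= {}" "u:K" using XD[OF N(5)] by blast
  obtain K' where K': "K':LL" "p:K'" "K' Int L ~= {}" "v:K'" using XD[OF N(6)] by blast
  show ?thesis using line_eq[OF K(1) N(1) K(4) N(3) _ N(4) N(7)] K' K N by blast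
 qed
 have meetK: "N Int K ~= {}" if N: "N:LL" "p ~: N" "u:N" "v:N" "u:X" "v:X" "u ~= v"
  and K: "K:LL" "p:K" "K Int L ~= {}" for N K u v
 proof -
  obtain x y Kx Ky where x: "x:N" "y:N" "x ~= p" "y ~= p" "Kx ~= Ky" "Kx:LL" "Ky:LL" "p:Kx" "p:Ky" "x:Kx" "y:Ky"
    "Kx Int L ~= {}" "Ky Int L ~= {}" using two[OF N] by blast
  obtain s t where st: "s:Kx" "s:L" "t:Ky" "t:L" using x by blast
  have xy: "x ~= y" using line_eq[OF x(6,7,8,9,10) _ x(3)[symmetric]] x(5,11) by blast
  have sp: "s ~= p" "t ~= p" using st p by blast+
  show ?thesis
   using pasch_pencil[OF N(1) x(1,2) xy N(2) x(6,8,10) st(1) sp(1) x(7,9,11) st(3) sp(2) L(1) st(2,4) K(1,2)] K(3)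
   by blast
 qed
 have 5: "l <= X" if l: "l:LL" "x:X" "y:X" "x:l" "y:l" "x ~= y" for l x y
 proof (cases "p:l")
  case True
  obtain z where z: "z:X" "z:l" "z ~= p" using l by metis
  obtain K t where K: "K:LL" "p:K" "t:K" "t:L" "z:K" using XD[OF z(1)] by blast
  show ?thesis using line_eq[OF K(1) l(1) K(2) True K(5) z(2)] z(3) XI K by auto
 next
  case False
  obtain x' y' Kx Ky where x: "x':l" "y':l" "x' ~= p" "y' ~= p" "Kx ~= Ky" "Kx:LL" "Ky:LL" "p:Kx" "p:Ky" "x':Kx" "y':Ky"
    "Kx Int L ~= {}" "Ky Int L ~= {}" using two[OF l(1) False l(4,5,2,3,6)] by blast
  obtain s t where st: "s:Kx" "s:L" "t:Ky" "t:L" using x by blast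
  have sne: "s ~= t" using line_eq[OF x(6,7,8,9) st(1) _ ] st p x(5) by blast
  show ?thesis
  proof
   fix m assume m: "m:l"
   obtain K where K: "K:LL" "p:K" "m:K" using col_all[OF pQ l(1,4,5,6) 4[OF 2 l(2)] 4[OF 2 l(3)]] ex_line[of p m] False m by auto
   show "m:X" using pasch_pencil[OF L(1) st(2,4) sne p x(6,8) st(1) x(10,3) x(7,9) st(3) x(11,4) l(1) x(1,2) K(1,2)] m XI K by auto
  qed
 qed
 have thick: "EX u:l. EX v:l. u ~= v" if l: "l:LL" for l
 proof -
  obtain u where u: "u:l" using col_one[OF pQ l] by blast
  then have "u:Q" using line_sub l by blast
  obtain w where w: "w:Q" "~ col u w" using col_nondeg[OF \<open>u : Q\<close>] by blast
  obtain v where "v:l" "col w v" using col_one[OF w(1) l] by blast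
  then show ?thesis using u w col_sym by metis
 qed
 have 6: "l Int m ~= {}" if lm: "l:LL" "m:LL" "l <= X" "m <= X" for l m
 proof -
  have K: "k Int L ~= {}" if k: "k:LL" "p:k" "k <= X" for k
  proof -
   obtain w where w: "w:Q" "~ col p w" using col_nondeg[OF pQ] by blast
   obtain z where z: "z:k" "col w z" using col_one[OF w(1) k(1)] by blast
   have zp: "z ~= p" using z w col_sym by metis
   obtain K t where K: "K:LL" "p:K" "t:K" "t:L" "z:K" using XD z(1) k by blast
   show ?thesis using line_eq[OF K(1) k(1) K(2) k(2) K(5) z(1)] zp K by auto
  qed
  show ?thesis
  proof (cases "p:l")
   case True
   show ?thesis
   proof (cases "p:m")
    case False
    obtain u v where u: "u:m" "v:m" "u ~= v" using thick[OF lm(2)] by blast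
    have "m Int l ~= {}"
     by (rule meetK[OF lm(2) False u(1,2) _ _ u(3) lm(1) True K[OF lm(1) True lm(3)]]) (use lm u in blast)+
    then show ?thesis by blast
   qed (use True in blast)
  next
   case pl: False
   obtain u v where uv: "u:l" "v:l" "u ~= v" using thick[OF lm(1)] by blast
   show ?thesis
   proof (cases "p:m")
    case True
    show ?thesis
     by (rule meetK[OF lm(1) pl uv(1,2) _ _ uv(3) lm(2) True K[OF lm(2) True lm(4)]]) (use lm uv in blast)+
   next
    case pm: False
    obtain u' v' where uv': "u':m" "v':m" "u' ~= v'" using thick[OF lm(2)] by blast
    obtain x y Kx Ky where x: "x:l" "y:l" "x ~= p" "y ~= p" "Kx ~= Ky" "Kx:LL" "Ky:LL" "p:Kx" "p:Ky" "x:Kx" "y:Ky"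
      "Kx Int L ~= {}" "Ky Int L ~= {}" using two[OF lm(1) pl uv(1,2) subsetD[OF lm(3) uv(1)] subsetD[OF lm(3) uv(2)] uv(3)] by blast
    note mK = meetK[OF lm(2) pm uv'(1,2) subsetD[OF lm(4) uv'(1)] subsetD[OF lm(4) uv'(2)] uv'(3)]
    have "m Int Kx ~= {}" "m Int Ky ~= {}" by (rule mK[OF x(6,8,12)], rule mK[OF x(7,9,13)])
    then obtain s t where st: "s:Kx" "s:m" "t:Ky" "t:m" by blast
    have xy: "x ~= y" using line_eq[OF x(6,7,8,9,10) _ x(3)[symmetric]] x(5,11) by blast
    have sp: "s ~= p" "t ~= p" using st pm by blast+
    have "m Int l ~= {}"
     using pasch_meet[OF lm(1) x(1,2) xy pl x(6,8,10) st(1) sp(1) x(7,9,11) st(3) sp(2) lm(2) st(2,4)] .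
    then show ?thesis by blast
   qed
  qed
 qed
 show ?thesis
 proof (intro exI[of _ X] conjI ballI impI)
  show "l <= X" if "l:LL" "x:X" "y:X" "x:l" "y:l" "x ~= y" for l x y by (rule 5[OF that])
  show "l Int m ~= {}" if "l:LL" "m:LL" "l <= X" "m <= X" for l m by (rule 6[OF that])
 qed (use 1 2 3 4 in blast)+
qed

end

section \<open>Gamma spaces\<close>

locale gamma_geometry =
 fixes G :: "'p geometry"
 assumes pls: "partial_linear_space G" and gam: "gamma_space G"
begin

text \<open>Made reflexive, so that \<open>perp G x\<close> is \<open>{y. col x y}\<close> for every
  \<open>x\<close>.\<close>

definition col :: "'p => 'p => bool" where "col x y <-> x = y | adjacent G x y"

lemma perp_col: "perp G x = {y. col x y}" using pls by (auto simp: adjacent_def partial_linear_space_def perp_def col_def)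

lemma line_points: "l:lines G ==> x:l ==> x:points G"
 using pls unfolding partial_linear_space_def by blast

lemma line_eq:
 "l:lines G ==> m:lines G ==> x:l ==> x:m ==> y:l ==> y:m ==> x ~= y ==> l = m"
 using pls unfolding partial_linear_space_def by blast

lemma line_other: "l:lines G ==> EX y:l. y ~= x"
 using pls unfolding partial_linear_space_def by metis

lemma col_refl [simp]: "col x x" by (simp add: col_def)
lemma col_sym: "col x y ==> col y x" by (auto simp: col_def adjacent_def)
lemma col_commute: "col x y <-> col y x" using col_sym by metis
lemma col_line: "l:lines G ==> x:l ==> y:l ==> col x y" by (auto simp: col_def adjacent_def)
lemma ex_line: "col x y ==> x ~= y ==> EX l:lines G. x:l & y:l" by (auto simp: col_def adjacent_def)
lemma col_point: "col x y ==> x:points G ==> y:points G" using line_points by (auto simp: col_def adjacent_def)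

lemma col_all:
 assumes l: "l:lines G" "y:l" "z:l" "y ~= z" and c: "col x y" "col x z" and w: "w:l"
 shows "col x w"
proof (cases "x:l")
 case True then show ?thesis using l(1) w col_line by blast
next
 case False
 have x: "x:points G" using l line_points col_point[OF col_sym[OF c(1)]] by simp
 have yz: "y:perp G x Int l" "z:perp G x Int l" using c l by (simp_all add: perp_col)
 have "perp G x Int l = {} | (EX y. perp G x Int l = {y}) | perp G x Int l = l"
  using gam x l(1) False unfolding gamma_space_def by blast
 then have "perp G x Int l = l" using yz l(4) by (metis empty_iff singletonD)
 then show ?thesis using w by (auto simp: perp_col)
qed

text \<open>Two applications of the gamma property. Hence collinearity of points on two lines
  through \<open>p\<close> is a relation between the lines.\<close>

lemma lines_weak:
 assumes l: "l:lines G" "m:lines G" "p:l" "p:m" "x:l" "x ~= p" "y:m" "y ~= p" and c: "col x y"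
  and x': "x':l" "y':m"
 shows "col x' y'" using l col_line col_all[OF l(1,5,3,6) col_sym[OF c] _ x'(1)] col_sym x' col_all[OF l(2,7,4,8) _ _ x'(2)] by auto

lemma relpow_adj: "(x, y):{(u, v). adjacent G u v} ^^ 2 <-> (EX z. adjacent G x z & adjacent G z y)"
 by (auto simp: numeral_2_eq_2)

lemma distance_2:
 "distance G x y = 2 <-> ~ col x y & (EX z. col x z & col z y)"
proof -
 define A where "A = {enat k |k. (x, y):{(u, v). adjacent G u v} ^^ k}"
 have d: "distance G x y = Inf A" by (simp add: distance_def A_def)
 have 0: "enat 0:A <-> x = y" by (auto simp: A_def)
 have 1: "enat 1:A <-> adjacent G x y" by (auto simp: A_def)
 have 2: "enat 2:A <-> (EX z. adjacent G x z & adjacent G z y)" using relpow_adj by (auto simp: A_def)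
 have mem: "enat k:A ==> Inf A <= enat k" for k by (rule Inf_lower)
 show ?thesis
 proof
  assume h: "distance G x y = 2"
  have "A ~= {}" using h d by (auto simp: Inf_enat_def)
  then have "Inf A:A" unfolding Inf_enat_def by (metis LeastI ex_in_conv)
  then show "~ col x y & (EX z. col x z & col z y)" using h d 0 1 2 mem[of 0] mem[of 1] by (auto simp: numeral_eq_enat col_def)
 next
  assume h: "~ col x y & (EX z. col x z & col z y)"
  then have "enat 2:A" "enat 0 ~: A" "enat 1 ~: A" using 0 1 2 by (auto simp: col_def)
  moreover have "enat 2 <= k" if k: "k:A" for k
  proof -
   obtain j where j: "k = enat j" using k unfolding A_def by blast
   have "j ~= 0" using k j \<open>enat 0 ~: A\<close> by metis
   moreover have "j ~= 1" using k j \<open>enat 1 ~: A\<close> by metis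
   ultimately have "2 <= j" by linarith
   then show ?thesis using j by simp
  qed
  ultimately have "Inf A = enat 2" by (intro antisym Inf_lower Inf_greatest)
  then show "distance G x y = 2" using d by (simp add: numeral_eq_enat)
 qed
qed

lemma subspace_line:
 "is_subspace G X ==> l:lines G ==> x:l ==> y:l ==> x:X ==> y:X ==> x ~= y ==> l <= X"
 unfolding is_subspace_def by blast

lemma perp_subspace: "x:points G ==> is_subspace G (perp G x)"
 unfolding is_subspace_def perp_col using col_point col_all by blast

lemma is_subspace_Int: "is_subspace G X ==> is_subspace G Y ==> is_subspace G (X Int Y)"
proof -
 assume X: "is_subspace G X" and Y: "is_subspace G Y"
 have "l <= X Int Y" if l: "l:lines G" "x:l Int (X Int Y)" "y:l Int (X Int Y)" "x ~= y" for l x y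
  using subspace_line[OF X l(1), of x y] subspace_line[OF Y l(1), of x y] l by simp
 moreover have "X Int Y <= points G" using X unfolding is_subspace_def by blast
 ultimately show ?thesis unfolding is_subspace_def by meson
qed

lemma adjacent_sub:
 assumes "is_subspace G X" "x:X" "y:X"
 shows "(x = y | (EX m:{l:lines G. l <= X}. x:m & y:m)) <-> col x y"
proof
 show "x = y | (EX m:{l:lines G. l <= X}. x:m & y:m) ==> col x y" using col_line by auto
 assume "col x y"
 then show "x = y | (EX m:{l:lines G. l <= X}. x:m & y:m)"
  using ex_line[of x y] subspace_line[OF assms(1) _ _ _ assms(2,3)] by blast
qed

lemma perp_sub:
 assumes "is_subspace G X" "x:X"
 shows "perp (subgeometry G X) x = {y:X. col x y}" using assms(2) adjacent_sub[OF assms] by (auto simp: adjacent_def subgeometry_def perp_def)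

lemma polar_one_or_all:
 assumes X: "is_subspace G X" and pol: "nondegenerate_polar_space (subgeometry G X)"
  and x: "x:X" "l:lines G" "l <= X"
 shows "EX y:l. col x y"
proof (cases "x:l")
 case True then show ?thesis by force
next
 case False
 have "(EX y. perp (subgeometry G X) x Int l = {y}) | l <= perp (subgeometry G X) x"
  using pol x False unfolding nondegenerate_polar_space_def by (auto simp: subgeometry_def)
 then show ?thesis unfolding perp_sub[OF X x(1)] using line_other x by blast
qed

lemma polar_nondeg:
 assumes X: "is_subspace G X" and pol: "nondegenerate_polar_space (subgeometry G X)" and x: "x:X"
 shows "EX y:X. ~ col x y"
proof -
 have "perp (subgeometry G X) x ~= X"
  using pol x unfolding nondegenerate_polar_space_def by (auto simp: subgeometry_def)
 then show ?thesis unfolding perp_sub[OF X x] by blast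
qed

lemma polar_systemI:
 assumes X: "is_subspace G X" and pol: "nondegenerate_polar_space (subgeometry G X)"
 shows "polar_system X {l:lines G. l <= X}"
proof
 let ?L = "{l:lines G. l <= X}"
 show "l <= X" if "l:?L" for l using that by blast
 show "l = m" if "l:?L" "m:?L" "x:l" "x:m" "y:l" "y:m" "x ~= y" for l m x y
  using line_eq[of l m x y] that by blast
 show "EX y:l. x = y | (EX m:?L. x:m & y:m)" if x: "x:X" "l:?L" for x l
 proof -
  obtain y where y: "y:l" "col x y" using polar_one_or_all[OF X pol x(1)] x(2) by blast
  have "y:X" using x(2) y by blast
  then show ?thesis using adjacent_sub[OF X x(1)] y by blast
 qed
 show "x = w | (EX m:?L. x:m & w:m)"
  if h: "x:X" "l:?L" "y:l" "z:l" "y ~= z" "x = y | (EX m:?L. x:m & y:m)"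
    "x = z | (EX m:?L. x:m & z:m)" "w:l" for x l y z w
 proof -
  have i: "y:X" "z:X" "w:X" using h by blast+
  show ?thesis using adjacent_sub[OF X h(1) i(1)] adjacent_sub[OF X h(1) i(2)] col_all[of l y z x w] h adjacent_sub[OF X h(1) i(3)] by simp
 qed
 show "EX y:X. ~ (x = y | (EX m:?L. x:m & y:m))" if x: "x:X" for x
  using polar_nondeg[OF X pol x] adjacent_sub[OF X x] by blast
qed

lemma plane_line:
 assumes X: "X:planes G" and x: "x:X" "y:X" "x ~= y"
 shows "EX l:lines G. l <= X & x:l & y:l"
proof -
 have s: "is_subspace G X" "col x y" using X x by (auto simp: planes_def singular_subspace_def col_def)
 then show ?thesis using adjacent_sub[OF s(1) x(1,2)] x(3) by blast
qed

lemma plane_subspace: "X:planes G ==> is_subspace G X"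
 by (simp add: planes_def singular_subspace_def)

lemma plane_col: "X:planes G ==> x:X ==> y:X ==> col x y"
 by (auto simp: planes_def singular_subspace_def col_def)

lemma plane_meet:
 assumes X: "X:planes G" and l: "l:lines G" "l <= X" "m:lines G" "m <= X"
 shows "l Int m ~= {}"
proof (cases "l = m")
 case True then show ?thesis using line_other[OF l(1)] by blast
next
 case False
 have pp: "projective_plane (subgeometry G X)" using X by (simp add: planes_def)
 have "ALL l:lines (subgeometry G X). ALL m:lines (subgeometry G X). l ~= m --> (EX! x. x:l & x:m)"
   using pp unfolding projective_plane_def by (elim conjE)
 then have "EX! x. x:l & x:m" using False l by (simp add: subgeometry_def)
 then show ?thesis by blast
qed

text \<open>Some point \<open>u\<close> of the quadrangle lies off \<open>l\<close>. The lines
  joining it to the other three points of the quadrangle meet \<open>l\<close> in three different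
  points.\<close>

lemma plane_thick:
 assumes X: "X:planes G" and l: "l:lines G" "l <= X"
 shows "EX z:l. z ~= x & z ~= y"
proof -
 obtain Q where Q: "Q <= X" "card Q = 4" "!!l. l:lines G ==> l <= X ==> card (l Int Q) <= 2" using X
  by (auto simp: planes_def subgeometry_def projective_plane_def)
 have fQ: "finite Q" using Q(2) by (metis card.infinite zero_neq_numeral)
 have "~ Q <= l" using Q(2) Q(3)[OF l] by (auto simp: Int_absorb1)
 then obtain u where u: "u:Q" "u ~: l" by blast
 have uX: "u:X" using u Q by blast
 have c3: "card (Q - {u}) = 3" using u Q by simp
 have "EX k. k:lines G & k <= X & u:k & q:k" if "q:Q - {u}" for q
  using plane_line[OF X uX, of q] that Q by blast
 then obtain k where k: "!!q. q:Q - {u} ==> k q:lines G & k q <= X & u:k q & q:k q"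
  by metis
 then have "EX s. s:l & s:k q" if "q:Q - {u}" for q
  using plane_meet[OF X l, of "k q"] that by blast
 then obtain s where s: "!!q. q:Q - {u} ==> s q:l & s q:k q" by metis
 have "inj_on s (Q - {u})"
 proof (rule inj_onI)
  fix q r assume q: "q:Q - {u}" and r: "r:Q - {u}" and e: "s q = s r"
  have sub: "{u, q, r} <= k q Int Q" using s[OF q] u line_eq[of "k q" "k r" u "s q"] k[OF q] k[OF r] s[OF r] e q r by auto
  show "q = r"
  proof (rule ccontr)
   assume "q ~= r"
   then have "card {u,q,r} = 3" using q r by auto
   moreover have "card {u,q,r} <= card (k q Int Q)" by (rule card_mono[OF _ sub]) (use fQ in auto)
   ultimately show False using Q(3)[of "k q"] k[OF q] by simp
  qed
 qed
 then have "card (s ` (Q - {u})) = 3" using c3 by (simp add: card_image)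
 moreover have "card {x,y} <= 2" by (simp add: card_insert_if)
 ultimately have "~ s ` (Q - {u}) <= {x,y}"
  using card_mono[of "{x,y}" "s ` (Q - {u})"] by fastforce
 then show ?thesis using s by blast
qed

text \<open>The quadrangle consists of two points on each of two lines through \<open>p\<close>, all
  different from \<open>p\<close>.\<close>

lemma planeI:
 assumes X: "X <= points G" and c: "!!x y. x:X ==> y:X ==> col x y"
  and sub: "!!l x y. l:lines G ==> x:X ==> y:X ==> x:l ==> y:l ==> x ~= y ==> l <= X"
  and meet: "!!l m. l:lines G ==> m:lines G ==> l <= X ==> m <= X ==> l Int m ~= {}"
  and A: "A:lines G" "B:lines G" "A <= X" "B <= X" "A ~= B" "p:A" "p:B"
   "a:A" "a':A" "b:B" "b':B" "p ~= a" "p ~= a'" "a ~= a'" "p ~= b" "p ~= b'" "b ~= b'"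
 shows "X:planes G"
proof -
 have s: "singular_subspace G X" unfolding singular_subspace_def is_subspace_def
  using X c sub by (metis IntE col_def)
 let ?S = "subgeometry G X"
 have ptl: "points ?S = X" "lines ?S = {l:lines G. l <= X}" by (auto simp: subgeometry_def)
 have ab: "x ~= y" if "x:A" "y:B" "x ~= p" for x y
  using line_eq[OF A(1,2) that(1) _ A(6,7) that(3)] that A(5) by blast
 have cQ: "card {a,a',b,b'} = 4" using ab[of a b] ab[of a b'] ab[of a' b] ab[of a' b'] A by auto
 have "card (l Int {a,a',b,b'}) <= 2" if l: "l:lines G" for l
 proof -
  have 1: "a:l ==> a':l ==> l = A" "b:l ==> b':l ==> l = B"
   using line_eq[OF l A(1)] line_eq[OF l A(2)] A by blast+
  have 2: "b ~: A" "b' ~: A" "a ~: B" "a' ~: B" using ab A by blast+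
  have "EX x y. l Int {a,a',b,b'} <= {x,y}"
  proof (cases "a:l & a':l")
   case True
   show ?thesis using 1 2 by auto
  next
   case F1: False
   show ?thesis using 1 2 by auto
  qed
  then obtain x y where "l Int {a,a',b,b'} <= {x,y}" by blast
  then have "card (l Int {a,a',b,b'}) <= card {x,y}" by (rule card_mono[rotated]) simp
  also have "... <= 2" by (simp add: card_insert_if)
  finally show ?thesis .
 qed
 then have "EX Q<=points ?S. card Q = 4 & (ALL l:lines ?S. card (l Int Q) <= 2)"
  unfolding ptl using cQ A by (intro exI[of _ "{a,a',b,b'}"]) auto
 moreover have "EX! l. l:lines ?S & x:l & y:l" if xy: "x:points ?S" "y:points ?S" "x ~= y" for x y
 proof -
  have X': "x:X" "y:X" using xy unfolding ptl by auto
  obtain l where l: "l:lines G" "x:l" "y:l" using ex_line[OF c[OF X'] xy(3)] by blast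
  have "l <= X" by (rule sub[OF l(1) X' l(2,3) xy(3)])
  show ?thesis
  proof (rule ex1I[of _ l])
   show "l:lines ?S & x:l & y:l" using l \<open>l <= X\<close> unfolding ptl by blast
   show "m = l" if "m:lines ?S & x:m & y:m" for m
    by (rule line_eq[of m l x y]) (use that l xy(3) ptl in blast)+
  qed
 qed
 moreover have "EX! x. x:l & x:m" if lm: "l:lines ?S" "m:lines ?S" "l ~= m" for l m
 proof -
  have L: "l:lines G" "m:lines G" "l <= X" "m <= X" using lm unfolding ptl by auto
  obtain z where z: "z:l" "z:m" using meet[OF L] by blast
  show ?thesis
  proof (rule ex1I[of _ z])
   show "z:l & z:m" using z by blast
   show "y = z" if "y:l & y:m" for y
    using line_eq[OF L(1,2), of y z] that z lm(3) by blast
  qed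
 qed
 ultimately have "projective_plane ?S" unfolding projective_plane_def by (auto simp: ptl)
 then show ?thesis using s by (simp add: planes_def)
qed

end

section \<open>Locally Grassmannian parapolar spaces\<close>

context subspace_calculus
begin

lemma gr_eqI: "gr k A ==> gr k B ==> A <= B ==> A = B"
 by (rule subspace_eqI) (auto simp: gr_def)

lemma gr_inter: "gr k A ==> gr l B ==> dim (A Int B) = m ==> gr m (A Int B)"
 by (simp add: gr_def subspace_inter)

lemma gr3_adj:
 assumes "gr 3 A" "gr 3 B" "A ~= B" "2 <= dim (A Int B)"
 shows "gr 2 (A Int B)" "gr 4 (A #+ B)"
proof -
 have "dim (A Int B) ~= 3"
  proof
   assume "dim (A Int B) = 3"
   then have i: "gr 3 (A Int B)" using gr_inter assms by blast
   have "A Int B = A" "A Int B = B" by (rule gr_eqI[OF i assms(1)], simp, rule gr_eqI[OF i assms(2)], simp)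
   then show False using assms(3) by simp
  qed
 then have d: "dim (A Int B) = 2" using assms(4) dim_subset[of "A Int B" A] assms(1) by (simp add: gr_def)
 show "gr 2 (A Int B)" by (rule gr_inter[OF assms(1,2) d])
 show "gr 4 (A #+ B)" using dim_ssum_gr[OF assms(1,2)] d by (simp add: gr_def)
qed

lemma pencil_eq:
 assumes "gr 3 A" "gr 3 B" "A ~= B" "gr 2 U" "gr 4 W" "U <= A" "U <= B" "A <= W" "B <= W"
 shows "U = A Int B" "W = A #+ B"
proof -
 have "2 <= dim (A Int B)" using dim_subset[of U "A Int B"] assms by (simp add: gr_def)
 note g = gr3_adj[OF assms(1-3) this]
 show "U = A Int B" by (rule gr_eqI[OF assms(4) g(1)]) (use assms in blast)
 have "A #+ B <= W" by (rule ssum_least) (use assms in \<open>auto simp: gr_def\<close>)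
 then show "W = A #+ B" using gr_eqI[OF g(2) assms(5)] by simp
qed

end

locale locally_grassmannian = gamma_geometry G + subspace_calculus smul Basis
 for G :: "'p geometry" and smul :: "'k::field => 'v::ab_group_add => 'v" and Basis +
 assumes para: "parapolar_space G" and loc: "locally_grassmann G smul 3" and dim7: "7 <= dimension"
begin

notation ssum (infixl "#+" 65)

text \<open>The choices at different points are unrelated. The relation that is eventually needed is
  supplied by \<open>link\<close>.\<close>

definition ph :: "'p => 'p set => 'v set" where
 "ph p = (SOME f. bij_betw f (points (local_geometry G p)) (points (grassmann_space smul 3)) &
   (%l. f ` l) ` lines (local_geometry G p) = lines (grassmann_space smul 3))"

lemma grass_points: "points (grassmann_space smul 3) = {A. gr 3 A}"
 by (simp add: grassmann_space_def gr_def)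

lemma grass_lines:
 "lines (grassmann_space smul 3) = {{A. gr 3 A & U <= A & A <= W} |U W. gr 2 U & gr 4 W & U <= W}" by (simp add: grassmann_space_def conj_ac gr_def)

lemma phi:
 assumes "p:points G"
 shows "bij_betw (ph p) {l:lines G. p:l} {A. gr 3 A}"
  and "(%X. ph p ` {l:lines G. p:l & l <= X}) ` {X:planes G. p:X} =
   {{A. gr 3 A & U <= A & A <= W} |U W. gr 2 U & gr 4 W & U <= W}"
proof -
 have "EX f. bij_betw f (points (local_geometry G p)) (points (grassmann_space smul 3)) &
   (%l. f ` l) ` lines (local_geometry G p) = lines (grassmann_space smul 3)"
  using loc assms unfolding locally_grassmann_def isomorphic_geometry_def by blast
 then have "bij_betw (ph p) (points (local_geometry G p)) (points (grassmann_space smul 3)) &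
   (%l. ph p ` l) ` lines (local_geometry G p) = lines (grassmann_space smul 3)"
  unfolding ph_def by (rule someI_ex)
 then show "bij_betw (ph p) {l:lines G. p:l} {A. gr 3 A}"
  "(%X. ph p ` {l:lines G. p:l & l <= X}) ` {X:planes G. p:X} =
   {{A. gr 3 A & U <= A & A <= W} |U W. gr 2 U & gr 4 W & U <= W}"
  unfolding grass_points grass_lines by (simp_all add: local_geometry_def image_image)
qed

definition ln :: "'p => 'v set => 'p set" where
 "ln p A = inv_into {l:lines G. p:l} (ph p) A"

lemma phi_gr: "l:lines G ==> p:l ==> gr 3 (ph p l)"
 using phi(1)[of p] line_points[of l p] unfolding bij_betw_def by blast

lemma phi_inj:
 assumes "l:lines G" "m:lines G" "p:l" "p:m" "ph p l = ph p m" shows "l = m" using phi(1)[OF line_points[OF assms(1,3)]] assms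
  by (simp add: bij_betw_def inj_on_def)

lemma ln:
 assumes "p:points G" "gr 3 A"
 shows "ln p A:lines G" "p:ln p A" "ph p (ln p A) = A"
proof -
 have "A:ph p ` {l:lines G. p:l}" using phi(1)[OF assms(1)] assms(2) by (simp add: bij_betw_def)
 then have "ln p A:{l:lines G. p:l}" "ph p (ln p A) = A"
  unfolding ln_def by (rule inv_into_into, rule f_inv_into_f)
 then show "ln p A:lines G" "p:ln p A" "ph p (ln p A) = A" by auto
qed

lemma ln_phi: "l:lines G ==> p:l ==> ln p (ph p l) = l"
 using phi_inj[of "ln p (ph p l)" l p] ln[OF line_points phi_gr, of l p l p] by simp

lemma pencil_set:
 assumes "p:points G" "ph p ` {l:lines G. p:l & l <= X} = {A. gr 3 A & U <= A & A <= W}"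
  and l: "l:lines G" "p:l"
 shows "l <= X <-> U <= ph p l & ph p l <= W"
proof
 assume "l <= X"
 then have "ph p l:{A. gr 3 A & U <= A & A <= W}" unfolding assms(2)[symmetric] using l by blast
 then show "U <= ph p l & ph p l <= W" by blast
next
 assume "U <= ph p l & ph p l <= W"
 then have "ph p l:ph p ` {l:lines G. p:l & l <= X}" unfolding assms(2) using phi_gr[OF l] by blast
 then obtain m where m: "m:lines G" "p:m" "m <= X" "ph p l = ph p m" by blast
 show "l <= X" using phi_inj[OF l(1) m(1) l(2) m(2)] m by simp
qed

lemma plane_pencil:
 assumes "p:X" "X:planes G" "p:points G"
 shows "EX U W. gr 2 U & gr 4 W & U <= W & (ALL l:lines G. p:l --> (l <= X <-> U <= ph p l & ph p l <= W))"
proof -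
 have "ph p ` {l:lines G. p:l & l <= X}:(%X. ph p ` {l:lines G. p:l & l <= X}) ` {X:planes G. p:X}"
  using assms by blast
 then have "EX U W. ph p ` {l:lines G. p:l & l <= X} = {A. gr 3 A & U <= A & A <= W} & gr 2 U & gr 4 W & U <= W"
  unfolding phi(2)[OF assms(3)] by (rule CollectD)
 then obtain U W where U: "ph p ` {l:lines G. p:l & l <= X} = {A. gr 3 A & U <= A & A <= W}"
   "gr 2 U" "gr 4 W" "U <= W" by (elim exE conjE)
 show ?thesis using U(2-4) pencil_set[OF assms(3) U(1)] by (intro exI[of _ U] exI[of _ W]) simp
qed

lemma pencil_plane:
 assumes "p:points G" "gr 2 U" "gr 4 W" "U <= W"
 shows "EX X:planes G. p:X & (ALL l:lines G. p:l --> (l <= X <-> U <= ph p l & ph p l <= W))"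
proof -
 have "{A. gr 3 A & U <= A & A <= W}:(%X. ph p ` {l:lines G. p:l & l <= X}) ` {X:planes G. p:X}"
  unfolding phi(2)[OF assms(1)] using assms by blast
 then obtain X where X: "{A. gr 3 A & U <= A & A <= W} = ph p ` {l:lines G. p:l & l <= X}" "X:planes G" "p:X"
  by (elim imageE CollectE conjE)
 show ?thesis using X(2,3) pencil_set[OF assms(1) X(1)[symmetric]] by (intro bexI[of _ X]) simp_all
qed

lemma span_plane:
 assumes l: "l:lines G" "m:lines G" "p:l" "p:m" "l ~= m" and a: "2 <= dim (ph p l Int ph p m)"
 shows "EX X:planes G. l <= X & m <= X &
  (ALL n:lines G. p:n --> (n <= X <-> ph p l Int ph p m <= ph p n & ph p n <= ph p l #+ ph p m))"
proof -
 have p: "p:points G" using l line_points by blast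
 have ne: "ph p l ~= ph p m" using phi_inj[OF l(1-4)] l(5) by blast
 note g = gr3_adj[OF phi_gr[OF l(1,3)] phi_gr[OF l(2,4)] ne a]
 have s: "ph p l Int ph p m <= ph p l #+ ph p m" using ssum_ub1 by blast
 obtain X where X: "X:planes G" "p:X"
  "ALL n:lines G. p:n --> (n <= X <-> ph p l Int ph p m <= ph p n & ph p n <= ph p l #+ ph p m)"
  using pencil_plane[OF p g s] by (elim bexE conjE)
 show ?thesis using l ssum_ub2 X bexI[of _ X] ssum_ub1 by simp
qed

lemma plane_adj:
 assumes X: "X:planes G" and l: "l:lines G" "m:lines G" "p:l" "p:m" "l <= X" "m <= X"
 shows "2 <= dim (ph p l Int ph p m)"
proof -
 have p: "p:X" "p:points G" using l line_points by blast+
 obtain U W where U: "gr 2 U" "ALL l:lines G. p:l --> (l <= X <-> U <= ph p l & ph p l <= W)"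
  using plane_pencil[OF p(1) X p(2)] by (elim exE conjE)
 show ?thesis using U(2) l dim_subset[of U "ph p l Int ph p m"] grD(2)[OF U(1)] by simp
qed

lemma in_plane:
 assumes l: "l:lines G" "p:l"
 shows "EX X:planes G. l <= X"
proof -
 have p: "p:points G" using l line_points by blast
 have A: "subspace (ph p l)" "dim (ph p l) = 3" using phi_gr[OF l] by (auto simp: gr_def)
 obtain U where U: "gr 2 U" "U <= ph p l"
  by (rule subspace_between[of "{0}" "ph p l" 2]) (use A subspace_0 in auto)
 have "4 <= dim UNIV" using dim7 by (simp only: dim_UNIV) (simp add: dimension_def)
 then obtain W where W: "gr 4 W" "ph p l <= W"
  by (rule subspace_between[OF A(1) subspace_UNIV _ _, of 4, rotated 2]) (use A in auto)
 have s: "U <= W" using U W by blast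
 obtain X where "X:planes G" "ALL l:lines G. p:l --> (l <= X <-> U <= ph p l & ph p l <= W)"
  using pencil_plane[OF p U(1) W(1) s] by (elim bexE conjE)
 then show ?thesis using l U(2) W(2) by (intro bexI[of _ X]) simp_all
qed

lemma line_third: "l:lines G ==> EX z:l. z ~= x & z ~= y" using line_other in_plane plane_thick by blast

lemma common_subspace: "x:points G ==> y:points G ==> is_subspace G {z. col x z & col y z}"
 using is_subspace_Int[OF perp_subspace[of x] perp_subspace[of y]] by (simp add: perp_col Collect_conj_eq)

text \<open>Two common neighbours exclude the one-point alternative of the parapolar axiom.\<close>

lemma polar_pairI:
 assumes x: "x:points G" "y:points G" "~ col x y" and z: "col x z" "col y z" "col x z'" "col y z'" "z ~= z'"
 shows "polar_pair G x y"
proof -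
 have "distance G x y = 2" unfolding distance_2 using x z col_sym by blast
 then have "(EX z. perp G x Int perp G y = {z}) | polar_pair G x y"
  using para x unfolding parapolar_space_def by blast
 moreover have "z:perp G x Int perp G y" "z':perp G x Int perp G y" using z by (simp_all add: perp_col)
 ultimately show ?thesis using z(5) by (metis singletonD)
qed

lemma polar_common:
 assumes "polar_pair G x y"
 shows "nondegenerate_polar_space (subgeometry G {z. col x z & col y z})"
 using assms unfolding polar_pair_def by (simp add: perp_col Collect_conj_eq)

lemma polar_pencil:
 assumes xy: "x:points G" "y:points G" "~ col x y" and z: "col x z" "col y z" "col x z'" "col y z'" "z ~= z'"
  and w: "col x w" "col y w" "l:lines G" "!!v. v:l ==> col x v & col y v"
 shows "EX v:l. col w v"
 using polar_one_or_all[OF common_subspace[OF xy(1,2)] polar_common[OF polar_pairI[OF xy z]], of w l] w by auto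

lemma polar_opposite:
 assumes xy: "x:points G" "y:points G" "~ col x y" and z: "col x z" "col y z" "col x z'" "col y z'" "z ~= z'"
  and w: "col x w" "col y w"
 shows "EX v. col x v & col y v & ~ col w v"
 using polar_nondeg[OF common_subspace[OF xy(1,2)] polar_common[OF polar_pairI[OF xy z]], of w] w by auto

text \<open>Both lines lie in the polar space of common neighbours of \<open>x\<close> and
  \<open>y\<close>, and a polar space contains the plane spanned by two such lines. This is how
  collinearity without a visible plane is turned into a plane of the geometry.\<close>

lemma polar_plane:
 assumes xy: "x:points G" "y:points G" "~ col x y"
  and A: "A:lines G" "B:lines G" "A ~= B" "p:A" "p:B"
   "!!z. z:A Un B ==> col x z & col y z" and ab: "a:A" "b:B" "a ~= p" "b ~= p" "col a b"
 shows "EX X:planes G. A <= X & B <= X"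
proof -
 let ?Q = "{z. col x z & col y z}"
 have s: "is_subspace G ?Q" by (rule common_subspace[OF xy(1,2)])
 have pp: "polar_pair G x y"
  by (rule polar_pairI[OF xy, of p a]) (use A ab in auto)
 interpret R: polar_system ?Q "{l:lines G. l <= ?Q}"
  by (rule polar_systemI[OF s polar_common[OF pp]])
 have Rc: "R.col u v <-> col u v" if "u:?Q" "v:?Q" for u v
  unfolding R.col_def by (rule adjacent_sub[OF s that])
 have ne: "a ~= b"
  using line_eq[OF A(1,2) ab(1) _ A(4,5)] ab A(3) by metis
 obtain L where L: "L:lines G" "a:L" "b:L" using ex_line[OF ab(5) ne] by blast
 have Q: "a:?Q" "b:?Q" "p:?Q" "A <= ?Q" "B <= ?Q" using A ab by auto
 have pL: "p ~: L" using line_eq[OF A(1) L(1) A(4) _ ab(1) L(2)] line_eq[OF A(2) L(1) A(5) _ ab(2) L(3)] ab A(3) by auto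
 have pc: "R.col p a" "R.col p b"
  using Rc[OF Q(3,1)] Rc[OF Q(3,2)] col_line[OF A(1,4) ab(1)] col_line[OF A(2,5) ab(2)] by simp_all
 have "L:{l:lines G. l <= ?Q}" using L subspace_line[OF s L Q(1,2) ne] by blast
 from R.plane_exists[OF this L(2,3) ne pL pc]
 obtain X where X: "X <= ?Q" "p:X" "L <= X" and
  X4: "ALL x:X. ALL y:X. R.col x y" and
  X5: "ALL l:{l:lines G. l <= ?Q}. ALL x:X. ALL y:X. x:l --> y:l --> x ~= y --> l <= X" and
  X6: "ALL l:{l:lines G. l <= ?Q}. ALL m:{l:lines G. l <= ?Q}. l <= X --> m <= X --> l Int m ~= {}"
  by (elim exE conjE)
 have XP: "X <= points G" 
 proof (rule subset_trans[OF X(1)])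
  show "?Q <= points G" using s unfolding is_subspace_def by (rule conjunct1)
 qed
 have Xl: "l <= X" if "l:lines G" "x:X" "y:X" "x:l" "y:l" "x ~= y" for l x y
 proof -
  have "l <= ?Q" by (rule subspace_line[OF s that(1,4,5) _ _ that(6)]) (use X(1) that in auto)
  then show ?thesis using X5 that by simp
 qed
 have AX: "A <= X" "B <= X"
  using Xl[OF A(1) X(2) _ A(4) ab(1)] Xl[OF A(2) X(2) _ A(5) ab(2)] X(3) L ab by blast+
 obtain a' where a': "a':A" "a' ~= p" "a' ~= a" using line_third[OF A(1)] by blast
 obtain b' where b': "b':B" "b' ~= p" "b' ~= b" using line_third[OF A(2)] by blast
 have "X:planes G"
 proof (rule planeI[OF XP _ Xl _ A(1,2) AX A(3,4,5) ab(1) a'(1) ab(2) b'(1)])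
  show "col u v" if "u:X" "v:X" for u v using Rc[of u v] X4 X(1) that by blast
  show "l Int m ~= {}" if "l:lines G" "m:lines G" "l <= X" "m <= X" for l m
   using X6 that X(1) by (metis (mono_tags, lifting) mem_Collect_eq subset_trans)
 qed (use ab a' b' in auto)
 then show ?thesis using AX by blast
qed

end

context subspace_calculus
begin

lemma subspace_avoid:
 assumes "subspace A" "subspace W" "A <= W" "x:W" "x ~: A" "dim A <= k" "k < dim W"
 shows "EX H. gr k H & A <= H & H <= W & x ~: H"
 using assms(6,7)
proof (induction k rule: dec_induct)
 case base show ?case using assms by (intro exI[of _ A]) (simp add: gr_def)
next
 case (step m)
 obtain H where H: "gr m H" "A <= H" "H <= W" "x ~: H" using step by auto
 have sH: "span H = H" using H(1) by (simp add: gr_def)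
 obtain y where y: "y:W" "y ~: span (insert x H)" using dim_ins[of x H] H(1,4) sH dim_ex[of "span (insert x H)" W] step by (auto simp: gr_def)
 have yH: "y ~: H" using y(2) by (auto intro: span_base)
 have "A <= span (insert y H)" using H(2) by (auto intro: span_base)
 then show ?case using gr_ext[of H m y] H(1) yH gr_def in_span_insert[of x y H] y(2) H(4) sH span_ins_le[OF y(1) H(3) assms(2)] by auto
qed

end

section \<open>Adjacency of lines on a point\<close>

context locally_grassmannian
begin

definition wk :: "'p => 'v set => 'v set => bool" where
 "wk p A B <-> (ALL x:ln p A. ALL y:ln p B. col x y)"

lemma wkD: "wk p A B ==> x:ln p A ==> y:ln p B ==> col x y"
 by (simp add: wk_def)

lemma wkI:
 assumes "p:points G" "gr 3 A" "gr 3 B" "x:ln p A" "y:ln p B" "x ~= p" "y ~= p" "col x y"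
 shows "wk p A B"
 unfolding wk_def
 using lines_weak[OF ln(1)[OF assms(1,2)] ln(1)[OF assms(1,3)] ln(2)[OF assms(1,2)] ln(2)[OF assms(1,3)] assms(4,6,5,7,8)]
 by blast

lemma ln_other: "p:points G ==> gr 3 A ==> EX x:ln p A. x ~= p"
 using line_other[OF ln(1)] by blast

lemma ln_inj: "p:points G ==> gr 3 A ==> gr 3 B ==> x:ln p A ==> x:ln p B ==> x ~= p ==> A = B"
 using line_eq[OF ln(1) ln(1), of p A p B p x] ln(2,3) by metis

text \<open>Coplanarity gives \<open>wadj\<close> and the gamma property gives \<open>wline\<close>.
  The axioms \<open>wpolar\<close> and \<open>wclique\<close> are statements about the polar space
  of common neighbours of two noncollinear points near \<open>p\<close>, and axiom (ii) yields
  \<open>wex\<close>.\<close>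

lemma weak: assumes p: "p:points G" shows "weak_adjacency smul Basis (wk p)"
proof
 show "7 <= dimension" by (rule dim7)
 show "wk p B A" if "gr 3 A" "gr 3 B" "wk p A B" for A B
  using that(3) col_sym unfolding wk_def by blast
 show adj: "wk p A B" if A: "gr 3 A" "gr 3 B" "2 <= dim (A Int B)" for A B
 proof (cases "A = B")
  case True then show ?thesis using col_line[OF ln(1)[OF p A(1)]] unfolding wk_def by blast
 next
  case False
  obtain X where "X:planes G" "ln p A <= X" "ln p B <= X"
   using False ln(3)[OF p A(1)] ln(3)[OF p A(2)] span_plane[OF ln(1)[OF p A(1)] ln(1)[OF p A(2)] ln(2)[OF p A(1)] ln(2)[OF p A(2)]] A(3) by metis
  then show ?thesis unfolding wk_def using plane_col by blast
 qed
 show "wk p A D" if g: "gr 3 A" "gr 3 B" "gr 3 C" "gr 3 D" and w: "wk p A B" "wk p A C" and d: "dim (B Int C) = 2"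
  and D: "B Int C <= D" "D <= B #+ C" for A B C D
 proof -
  have ne: "B ~= C" using d g(2) by (auto simp: gr_def)
  have lne: "ln p B ~= ln p C" using ne ln(3)[OF p g(2)] ln(3)[OF p g(3)] by metis
  obtain X where X: "X:planes G" "ln p B <= X" "ln p C <= X" "ALL n:lines G. p:n --> (n <= X <-> B Int C <= ph p n & ph p n <= B #+ C)"
   using span_plane[OF ln(1)[OF p g(2)] ln(1)[OF p g(3)] ln(2)[OF p g(2)] ln(2)[OF p g(3)] lne]
    ln(3)[OF p g(2)] ln(3)[OF p g(3)] d by auto
  have DX: "ln p D <= X" using X(4) ln[OF p g(4)] D by simp
  obtain a where a: "a:ln p A" "a ~= p" using ln_other[OF p g(1)] by blast
  obtain b where b: "b:ln p B" "b ~= p" using ln_other[OF p g(2)] by blast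
  obtain c where c: "c:ln p C" "c ~= p" using ln_other[OF p g(3)] by blast
  have bc: "b ~= c" using ln_inj[OF p g(2,3) b(1) _ b(2)] c ne by blast
  obtain k where k: "k:lines G" "k <= X" "b:k" "c:k" using plane_line[OF X(1) _ _ bc] b c X by blast
  obtain e where e: "e:k" "e:ln p D" using plane_meet[OF X(1) k(1,2) ln(1)[OF p g(4)] DX] by blast
  show ?thesis using wkI[OF p g(1,4) a(1) e(2) a(2)] e line_eq[OF k(1) ln(1)[OF p g(2)] _ ln(2)[OF p g(2)] k(3) b(1)] line_eq[OF k(1) ln(1)[OF p g(3)] _ ln(2)[OF p g(3)] k(4) c(1)] b c lne col_all[OF k(1,3,4) bc wkD[OF w(1) a(1) b(1)] wkD[OF w(2) a(1) c(1)] e(1)] by auto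
 qed
 show "EX C. gr 3 C & U <= C & C <= W & wk p X C"
  if g: "gr 3 A" "gr 3 B" "gr 3 X" and nw: "~ wk p A B" and w: "wk p X A" "wk p X B"
   and U: "gr 2 U" "gr 4 W" "U <= W" and C: "!!C. gr 3 C ==> U <= C ==> C <= W ==> wk p C A & wk p C B"
  for A B X U W
 proof -
  obtain a where a: "a:ln p A" "a ~= p" using ln_other[OF p g(1)] by blast
  obtain b where b: "b:ln p B" "b ~= p" using ln_other[OF p g(2)] by blast
  obtain x where x: "x:ln p X" "x ~= p" using ln_other[OF p g(3)] by blast
  have ab: "~ col a b" using wkI[OF p g(1,2) a(1) b(1) a(2) b(2)] nw by blast
  have pa: "col a p" "col b p" using col_line[OF ln(1) a(1) ln(2)] col_line[OF ln(1) b(1) ln(2)] p g by blast+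
  have xa: "col a x" "col b x" using wkD[OF w(1) x(1) a(1)] wkD[OF w(2) x(1) b(1)] col_sym by blast+
  obtain Y where Y: "Y:planes G" "p:Y" "ALL l:lines G. p:l --> (l <= Y <-> U <= ph p l & ph p l <= W)"
   using pencil_plane[OF p U] by (elim bexE conjE)
  have ab_all: "col a y & col b y" if y: "y:Y" "y ~= p" for y
  proof -
   obtain n where n: "n:lines G" "n <= Y" "p:n" "y:n" using plane_line[OF Y(1,2) y(1)] y(2) by blast
   have "wk p (ph p n) A & wk p (ph p n) B" by (rule C[OF phi_gr[OF n(1,3)]]) (use Y(3) n in auto)
   then show ?thesis using wkD[of p "ph p n" A y a] wkD[of p "ph p n" B y b] n(4) ln_phi[OF n(1,3)] a b col_sym by metis
  qed
  \<comment> \<open>The point \<open>x\<close> is already collinear with \<open>p\<close>, so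
    one-or-all must be applied to a line of the plane that misses \<open>p\<close>.\<close>
  obtain m where m: "m:lines G" "m <= Y" "p ~: m"
  proof -
   have sUW: "subspace U" "subspace W" "dim U = 2" "dim W = 4" using U by (auto simp: gr_def)
   obtain C1 where C1: "gr 3 C1" "U <= C1" "C1 <= W"
    by (rule subspace_between[OF sUW(1,2) U(3), of 3]) (use sUW in auto)
   obtain w where w: "w:W" "w ~: C1" using dim_ex[of C1 W] C1 sUW by (auto simp: gr_def)
   have C2: "gr 3 (span (insert w U))" using gr_ext[OF sUW(1,3), of w] w C1 by auto
   have C2': "U <= span (insert w U)" "span (insert w U) <= W"
    using span_ins_le[OF w(1) U(3) sUW(2)] by (auto intro: span_base)
   have ne: "C1 ~= span (insert w U)" using w by (auto intro: span_base)
   obtain c1 where c1: "c1:ln p C1" "c1 ~= p" using ln_other[OF p C1(1)] by blast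
   obtain c2 where c2: "c2:ln p (span (insert w U))" "c2 ~= p" using ln_other[OF p C2] by blast
   have LY: "ln p C1 <= Y" "ln p (span (insert w U)) <= Y"
    using Y(3) ln[OF p C1(1)] ln[OF p C2] C1 C2' by simp_all
   have c12: "c1 ~= c2" using ln_inj[OF p C1(1) C2 c1(1) _ c1(2)] c2 ne by blast
   obtain m where m: "m:lines G" "m <= Y" "c1:m" "c2:m" using plane_line[OF Y(1) _ _ c12] LY c1 c2 by blast
   show thesis using line_eq[OF m(1) ln(1)[OF p C1(1)] _ ln(2)[OF p C1(1)] m(3) c1(1)] line_eq[OF m(1) ln(1)[OF p C2] _ ln(2)[OF p C2] m(4) c2(1)] c1 c2 ne ln(3)[OF p C1(1)] ln(3)[OF p C2] that m by metis
  qed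
  have "EX v:m. col x v"
  proof (rule polar_pencil[OF _ _ ab pa(1,2) xa x(2)[symmetric] xa m(1)])
   show "a:points G" "b:points G" using a b ln(1)[OF p] g line_points by blast+
   show "col a v & col b v" if "v:m" for v by (rule ab_all) (use that m in blast)+
  qed
  then obtain v where v: "v:m" "col x v" by blast
  have vY: "v:Y" "v ~= p" using v m by blast+
  obtain n where n: "n:lines G" "n <= Y" "p:n" "v:n" using plane_line[OF Y(1,2) vY(1)] vY(2) by blast
  have "wk p X (ph p n)"
   by (rule wkI[OF p g(3) phi_gr[OF n(1,3)] x(1) _ x(2) vY(2) v(2)]) (use ln_phi n in simp)
  then show ?thesis using phi_gr[OF n(1,3)] Y(3) n by blast
 qed
 show "wk p X Y" if g: "gr 3 A" "gr 3 B" "gr 3 X" "gr 3 Y" and w: "wk p A B" and d: "dim (A Int B) < 2"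
  and XY: "wk p X A" "wk p X B" "wk p Y A" "wk p Y B" for A B X Y
 proof (rule ccontr)
  assume nw: "~ wk p X Y"
  obtain a where a: "a:ln p A" "a ~= p" using ln_other[OF p g(1)] by blast
  obtain b where b: "b:ln p B" "b ~= p" using ln_other[OF p g(2)] by blast
  obtain x where x: "x:ln p X" "x ~= p" using ln_other[OF p g(3)] by blast
  obtain y where y: "y:ln p Y" "y ~= p" using ln_other[OF p g(4)] by blast
  have xy: "~ col x y" using wkI[OF p g(3,4) x(1) y(1) x(2) y(2)] nw by blast
  have "A ~= B" using d g(1) by (auto simp: gr_def)
  then have ne: "ln p A ~= ln p B" using ln(3)[OF p g(1)] ln(3)[OF p g(2)] by metis
  \<comment> \<open>The lines of \<open>A\<close> and \<open>B\<close> lie in the polar space of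
    common neighbours of the noncollinear points \<open>x\<close> and \<open>y\<close>, and there
    they span a plane, which forces a common 2-space.\<close>
  have "EX Z:planes G. ln p A <= Z & ln p B <= Z"
  proof (rule polar_plane[OF _ _ xy ln(1)[OF p g(1)] ln(1)[OF p g(2)] ne ln(2)[OF p g(1)] ln(2)[OF p g(2)] _ a(1) b(1) a(2) b(2)])
   show "x:points G" "y:points G" using x y ln(1)[OF p] g line_points by blast+
   show "col a b" by (rule wkD[OF w a(1) b(1)])
   show "col x z & col y z" if "z:ln p A Un ln p B" for z
    using that wkD[OF XY(1) x(1)] wkD[OF XY(2) x(1)] wkD[OF XY(3) y(1)] wkD[OF XY(4) y(1)] by blast
  qed
  then obtain Z where Z: "Z:planes G" "ln p A <= Z" "ln p B <= Z" by blast
  show False using d ln(3)[OF p g(1)] ln(3)[OF p g(2)] plane_adj[OF Z(1) ln(1)[OF p g(1)] ln(1)[OF p g(2)] ln(2)[OF p g(1)] ln(2)[OF p g(2)] Z(2,3)]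
   by simp
 qed
 show "EX X Y. gr 3 X & gr 3 Y & ~ wk p X Y"
 proof -
  have "3 <= dim UNIV" using dim7 by (simp only: dim_UNIV) (simp add: dimension_def)
  then obtain A where A: "gr 3 A"
   by (rule subspace_between[OF subspace_single_0 subspace_UNIV _ _, of 3, rotated 2]) auto
  let ?l = "ln p A"
  have l: "?l:lines G" "p:?l" using ln[OF p A] by auto
  let ?P = "\<Inter>x\<in>?l. perp G x"
  \<comment> \<open>By axiom (ii) two points collinear with the whole line are not collinear with
    each other; the lines joining them to \<open>p\<close> are the required pair.\<close>
  have "~ singular_subspace G ?P" using para l unfolding parapolar_space_def by blast
  moreover have "is_subspace G ?P"
  proof -
   have "?P <= points G" using l(2) p col_point by (auto simp: perp_col)
   moreover have "m <= ?P" if m: "m:lines G" "u:m" "v:m" "u:?P" "v:?P" "u ~= v" for m u v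
    using col_all[OF m(1,2,3,6)] m(4,5) unfolding perp_col by blast
   ultimately show ?thesis unfolding is_subspace_def by (metis IntE)
  qed
  ultimately obtain x y where xy: "x:?P" "y:?P" "~ col x y"
   unfolding singular_subspace_def col_def by blast
  have px: "col p x" "col p y" using xy l(2) by (auto simp: perp_col)
  have ne: "x ~= p" "y ~= p" using px xy(3) col_sym by blast+
  obtain m where m: "m:lines G" "p:m" "x:m" using ex_line[OF px(1)] ne by blast
  obtain n where n: "n:lines G" "p:n" "y:n" using ex_line[OF px(2)] ne by blast
  show ?thesis using wkD[of p "ph p m" "ph p n" x y] ln_phi[OF m(1,2)] ln_phi[OF n(1,2)] m n xy(3) phi_gr by blast
 qed
qed

text \<open>An instance of \<open>w_iff\<close>. From here on, collinearity among the neighbours of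
  a point is a question of linear algebra.\<close>

theorem col_iff:
 assumes "l:lines G" "m:lines G" "p:l" "p:m" "x:l" "x ~= p" "y:m" "y ~= p"
 shows "col x y <-> 2 <= dim (ph p l Int ph p m)"
proof -
 have p: "p:points G" using assms line_points by blast
 note g = phi_gr[OF assms(1,3)] phi_gr[OF assms(2,4)]
 show ?thesis using wkI[OF p g, of x y] wkD[of p "ph p l" "ph p m" x y] ln_phi[OF assms(1,3)] ln_phi[OF assms(2,4)] assms(5-8) weak_adjacency.w_iff[OF weak[OF p] g] by auto
qed

lemma pencil_iff:
 assumes l: "l:lines G" "m:lines G" "p:l" "p:m" "l ~= m" "x:l" "x ~= p" "y:m" "y ~= p" and c: "col x y"
  and k: "k:lines G" "x:k" "y:k" and n: "n:lines G" "p:n"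
 shows "n Int k ~= {} <-> ph p l Int ph p m <= ph p n & ph p n <= ph p l #+ ph p m"
proof -
 have adj: "2 <= dim (ph p l Int ph p m)" using col_iff[OF l(1-4,6-9)] c by simp
 obtain X where X: "X:planes G" "l <= X" "m <= X"
   "ALL n:lines G. p:n --> (n <= X <-> ph p l Int ph p m <= ph p n & ph p n <= ph p l #+ ph p m)"
  using span_plane[OF l(1-5) adj] by (elim bexE conjE)
 have xy: "x ~= y" using line_eq[OF l(1,2,6) _ l(3,4,7)] l(5,8) by blast
 have pk: "p ~: k" using line_eq[OF k(1) l(1) _ l(3) k(2) l(6)] line_eq[OF k(1) l(2) _ l(4) k(3) l(8)] l by auto
 have inX: "x:X" "y:X" "p:X" using l(3,6,8) X(2,3) by (auto dest: subsetD)
 have kX: "k <= X" by (rule subspace_line[OF plane_subspace[OF X(1)] k inX(1,2) xy])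
 have "n Int k ~= {} <-> n <= X"
 proof
  assume "n Int k ~= {}"
  then obtain z where z: "z:n" "z:k" by blast
  have "z:X" "p ~= z" using z(2) kX pk by (auto dest: subsetD)
  then show "n <= X" by (rule subspace_line[OF plane_subspace[OF X(1)] n(1) n(2) z(1) inX(3)])
 next
  assume "n <= X"
  then show "n Int k ~= {}" using plane_meet[OF X(1) n(1) _ k(1) kX] by blast
 qed
 then show ?thesis using X(4) n by simp
qed

lemma pasch:
 assumes l: "l:lines G" "m:lines G" "p:l" "p:m" "l ~= m" "x:l" "x ~= p" "y:m" "y ~= p" and c: "col x y"
  and k: "k:lines G" "x:k" "y:k" and k': "k':lines G" "x':k'" "y':k'" "x':l" "y':m" "x' ~= p" "y' ~= p"
 shows "k Int k' ~= {}"
proof -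
 have adj: "2 <= dim (ph p l Int ph p m)" using col_iff[OF l(1-4,6-9)] c by simp
 obtain X where X: "X:planes G" "l <= X" "m <= X" using span_plane[OF l(1-5) adj] by (elim bexE conjE) (rule that)
 show ?thesis using line_eq[OF l(1,2,6) _ l(3,4,7)] l(5,8) subspace_line[OF plane_subspace[OF X(1)] k, OF subsetD[OF X(2) l(6)] subsetD[OF X(3) l(8)]] subspace_line[OF plane_subspace[OF X(1)] k'(1-3), OF subsetD[OF X(2) k'(4)] subsetD[OF X(3) k'(5)]] line_eq[OF l(1,2) k'(4) _ l(3,4) k'(6)] k'(5) plane_meet[OF X(1) k(1) _ k'(1)] by auto
qed

lemma col_ln:
 assumes "p:points G" "gr 3 A" "gr 3 B" "x:ln p A" "y:ln p B" "x ~= p" "y ~= p"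
 shows "col x y <-> 2 <= dim (A Int B)"
 using col_iff[OF ln(1)[OF assms(1,2)] ln(1)[OF assms(1,3)] ln(2)[OF assms(1,2)] ln(2)[OF assms(1,3)] assms(4,6,5,7)]
  ln(3)[OF assms(1,2)] ln(3)[OF assms(1,3)] by simp

lemma col_ln_all:
 assumes "p:points G" "gr 3 A" "gr 3 B" "x:ln p A" "y:ln p B" "2 <= dim (A Int B)"
 shows "col x y"
proof (cases "x = p | y = p")
 case True
 then show ?thesis using col_line[OF ln(1)[OF assms(1,2)]] col_line[OF ln(1)[OF assms(1,3)]] ln(2) assms by metis
qed (use col_ln[OF assms(1-5)] assms(6) in blast)

lemma pencil_ln:
 assumes p: "p:points G" and g: "gr 3 A" "gr 3 B" "gr 3 C" "A ~= B" "2 <= dim (A Int B)" "A Int B <= C" "C <= A #+ B"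
  and x: "x:ln p A" "x ~= p" "y:ln p B" "y ~= p" and k: "k:lines G" "x:k" "y:k"
 shows "EX z:k. z:ln p C & z ~= p"
proof -
 note l = ln[OF p g(1)] ln[OF p g(2)] ln[OF p g(3)]
 have ne: "ln p A ~= ln p B" using l(3,6) g(4) by metis
 have c: "col x y" using col_ln[OF p g(1,2) x(1,3,2,4)] g(5) by blast
 obtain z where z: "z:k" "z:ln p C" using pencil_iff[OF l(1,4,2,5) ne x c k l(7,8)] l(3,6,9) g(6,7) by auto
 show ?thesis using line_eq[OF k(1) l(1) _ l(2) k(2) x(1)] line_eq[OF k(1) l(4) _ l(5) k(3) x(3)] x z ne by auto
qed

text \<open>Rank at least 2 provides two nested nonempty singular subspaces; the larger one has two
  points and so contains a line.\<close>

lemma polar_rank_line: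
 assumes "polar_pair G x y"
 shows "EX l:lines G. ALL v:l. col x v & col y v"
proof -
 let ?S = "subgeometry G (perp G x Int perp G y)"
 define A where "A = {enat r |r. EX X :: nat => 'p set.
   (ALL i<r. singular_subspace ?S (X i) & X i ~= {}) & (ALL j<r. ALL i<j. X i < X j)}"
 have "2 <= Sup A" using assms unfolding polar_pair_def polar_rank_def A_def by blast
 have "EX a:A. 1 < a"
 proof (rule ccontr)
  assume "~ ?thesis"
  then have "Sup A <= 1" by (intro Sup_least) (simp add: linorder_not_less)
  then show False using \<open>2 <= Sup A\<close> order_trans[rotated] by (force simp: one_enat_def)
 qed
 then obtain a where a: "a:A" "1 < a" by blast
 then obtain r X where r: "a = enat r" "ALL i<r. singular_subspace ?S (X i) & X i ~= {}" "ALL j<r. ALL i<j. X i < X j"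
  unfolding A_def by blast
 have "X 0 ~= {}" "X 0 < X 1" "singular_subspace ?S (X 1)" using a(2) r by (auto simp: one_enat_def)
 then obtain u v where "u:X 1" "v:X 1" "u ~= v" by blast
 then have "adjacent ?S u v" using \<open>singular_subspace ?S (X 1)\<close> unfolding singular_subspace_def by blast
 then obtain l where "l:lines G" "l <= perp G x Int perp G y" by (auto simp: adjacent_def subgeometry_def)
 then show ?thesis unfolding perp_col by blast
qed

text \<open>Take noncollinear common neighbours \<open>z\<close>, \<open>z2\<close> and a third one
  \<open>u\<close> collinear with both. The 3-spaces of \<open>xz\<close> and \<open>xz2\<close>
  each share a 2-space with that of \<open>xu\<close>, so they meet; by \<open>col_iff\<close> the
  intersection is no larger than a 1-space.\<close>

lemma polar_noncollinear:
 assumes xy: "x:points G" "y:points G" "~ col x y" and z: "col x z" "col y z" "col x z'" "col y z'" "z ~= z'"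
 shows "EX A B. gr 3 A & gr 3 B & dim (A Int B) = 1 & (EX a:ln x A. col y a) & (EX b:ln x B. col y b)"
proof -
 obtain z2 where z2: "col x z2" "col y z2" "~ col z z2" using polar_opposite[OF xy z z(1,2)] by blast
 have nx: "v ~= x" if "col y v" for v using that xy(3) col_sym by blast
 obtain l where l: "l:lines G" "ALL v:l. col x v & col y v" using polar_rank_line[OF polar_pairI[OF xy z]] by blast
 obtain v where v: "v:l" "col z v" using polar_pencil[OF xy z z(1,2) l(1)] l(2) by blast
 obtain m where m: "m:lines G" "z:m" "ALL v:m. col x v & col y v"
 proof (cases "v = z")
  case True then show ?thesis using that l v by blast
 next
  case False
  obtain m where m: "m:lines G" "z:m" "v:m" using ex_line[OF v(2)] False by blast
  have "col x w & col y w" if "w:m" for w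
   using col_all[OF m(1,2,3) _ _ _ that, of x] col_all[OF m(1,2,3) _ _ _ that, of y] False z(1,2) l(2) v(1) by blast
  then show ?thesis using that m by blast
 qed
 obtain u where u: "u:m" "col z2 u" using polar_pencil[OF xy z z2(1,2) m(1)] m(3) by blast

 have cu: "col x u" "col y u" "col z u" using m u(1) col_line by blast+
 obtain a where a: "a:lines G" "x:a" "z:a" using ex_line[OF z(1)] nx[OF z(2)] by blast
 obtain b where b: "b:lines G" "x:b" "z2:b" using ex_line[OF z2(1)] nx[OF z2(2)] by blast
 obtain d where d: "d:lines G" "x:d" "u:d" using ex_line[OF cu(1)] nx[OF cu(2)] by blast
 note nz = nx[OF z(2)] nx[OF z2(2)] nx[OF cu(2)]
 let ?A = "ph x a" and ?B = "ph x b" and ?D = "ph x d"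
 note g = phi_gr[OF a(1,2)] phi_gr[OF b(1,2)] phi_gr[OF d(1,2)]
 have "2 <= dim (?A Int ?D)" using col_iff[OF a(1) d(1) a(2) d(2) a(3) nz(1) d(3) nz(3)] cu(3) by blast
 moreover have "2 <= dim (?B Int ?D)" using col_iff[OF b(1) d(1) b(2) d(2) b(3) nz(2) d(3) nz(3)] u(2) by blast
 moreover have "1 <= dim (?A Int ?B)"
  proof -
   have gAD: "gr (dim (?A Int ?D)) (?A Int ?D)" "gr (dim (?B Int ?D)) (?B Int ?D)"
    by (rule gr_inter[OF g(1,3) refl], rule gr_inter[OF g(2,3) refl])
   have "dim (?A Int ?D) + dim (?B Int ?D) <= 3 + dim ((?A Int ?D) Int (?B Int ?D))"
    by (rule gr_inter_ge[OF gAD _ _ g(3)]) auto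
   then have "1 <= dim ((?A Int ?D) Int (?B Int ?D))" using calculation by linarith
   also have "... <= dim (?A Int ?B)" by (rule dim_subset) blast
   finally show ?thesis .
  qed
 ultimately have "dim (?A Int ?B) = 1" using col_iff[OF a(1) b(1) a(2) b(2) a(3) nz(1) b(3) nz(2)] z2(3) by simp
 then show ?thesis using g(1,2) ln_phi[OF a(1,2)] ln_phi[OF b(1,2)] a(3) b(3) z(2) z2(2) by blast
qed

section \<open>Common neighbours of two noncollinear points\<close>

definition near :: "'p => 'p => 'v set => bool" where
 "near x y A <-> gr 3 A & (EX z:ln x A. col y z)"

context
 fixes x y assumes xy: "x:points G" "y:points G" "~ col x y"
begin

lemma near_ne: "z:ln x A ==> col y z ==> z ~= x"
 using xy(3) col_sym by blast

lemma near_pencil: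
 assumes A: "near x y A" "near x y B" "A ~= B" "2 <= dim (A Int B)" and C: "gr 3 C" "A Int B <= C" "C <= A #+ B"
 shows "near x y C"
proof -
 have g: "gr 3 A" "gr 3 B" using A by (auto simp: near_def)
 obtain a where a: "a:ln x A" "col y a" using A(1) by (auto simp: near_def)
 obtain b where b: "b:ln x B" "col y b" using A(2) by (auto simp: near_def)
 note n = near_ne[OF a] near_ne[OF b]
 have ab: "a ~= b" using ln_inj[OF xy(1) g a(1) _ n(1)] b(1) A(3) by blast
 obtain k where k: "k:lines G" "a:k" "b:k" using col_ln[OF xy(1) g a(1) b(1) n] A(4) ex_line ab by auto
 obtain z where z: "z:k" "z:ln x C"
  using pencil_ln[OF xy(1) g C(1) A(3,4) C(2,3) a(1) n(1) b(1) n(2) k] by blast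
 show ?thesis using z C(1) col_all[OF k ab a(2) b(2) z(1)] near_def by metis
qed

text \<open>The one-or-all axiom in the polar space of common neighbours, for a point and a line
  joining two members of the pencil.\<close>

lemma near_one:
 assumes C: "near x y C" and U: "gr 2 U" "gr 4 W" "U <= W" and all: "!!A. gr 3 A ==> U <= A ==> A <= W ==> near x y A"
 shows "EX A. gr 3 A & U <= A & A <= W & 2 <= dim (C Int A)"
proof -
 have s: "subspace U" "dim U = 2" "subspace W" "dim W = 4" using U by (auto simp: gr_def)
 obtain A where A: "gr 3 A" "U <= A" "A <= W"
  by (rule subspace_between[OF s(1,3) U(3), of 3]) (use s in auto)
 obtain w where w: "w:W" "w ~: A" using dim_ex[of A W] A s by (auto simp: gr_def)
 let ?B = "span (insert w U)"
 have B: "gr 3 ?B" using gr_ext[OF s(1,2), of w] w A by auto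
 have B': "U <= ?B" "?B <= W" using span_ins_le[OF w(1) U(3) s(3)] by (auto intro: span_base)
 have ne: "A ~= ?B" using w by (auto intro: span_base)
 note UW = pencil_eq[OF A(1) B ne U(1,2) A(2) B'(1) A(3) B'(2)]
 have adj: "2 <= dim (A Int ?B)" using UW(1) s by simp
 obtain a where a: "a:ln x A" "col y a" using all[OF A] by (auto simp: near_def)
 obtain b where b: "b:ln x ?B" "col y b" using all[OF B B'] by (auto simp: near_def)
 obtain c where c: "c:ln x C" "col y c" using C by (auto simp: near_def)
 have gC: "gr 3 C" using C by (simp add: near_def)
 note n = near_ne[OF a] near_ne[OF b] near_ne[OF c]
 have ab: "a ~= b" using ln_inj[OF xy(1) A(1) B a(1) _ n(1)] b(1) ne by blast
 have cab: "col a b" using col_ln[OF xy(1) A(1) B a(1) b(1) n(1,2)] adj by blast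
 then obtain k where k: "k:lines G" "a:k" "b:k" using ex_line ab by blast
 have cx: "col x a" "col x b" "col x c"
  using col_line[OF ln(1)[OF xy(1) A(1)] ln(2)[OF xy(1) A(1)] a(1)] col_line[OF ln(1)[OF xy(1) B] ln(2)[OF xy(1) B] b(1)]
   col_line[OF ln(1)[OF xy(1) gC] ln(2)[OF xy(1) gC] c(1)] by auto
 have k_all: "col x v & col y v" if "v:k" for v
  using col_all[OF k ab cx(1,2) that] col_all[OF k ab a(2) b(2) that] by blast
 obtain v where v: "v:k" "col c v"
  using polar_pencil[OF xy cx(1) a(2) cx(2) b(2) ab cx(3) c(2) k(1) k_all] by blast
 have vx: "v ~= x" using k_all[OF v(1)] xy(3) col_sym by blast
 obtain n where nn: "n:lines G" "x:n" "v:n" using ex_line k_all[OF v(1)] vx by metis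
 have neA: "ln x A ~= ln x ?B" using ne ln(3)[OF xy(1) A(1)] ln(3)[OF xy(1) B] by metis
 have 1: "U <= ph x n" "ph x n <= W" using nn v pencil_iff[OF ln(1)[OF xy(1) A(1)] ln(1)[OF xy(1) B] ln(2)[OF xy(1) A(1)] ln(2)[OF xy(1) B] neA a(1) n(1) b(1) n(2) cab k nn(1,2)] ln(3)[OF xy(1) A(1)] ln(3)[OF xy(1) B] UW by auto
 show ?thesis using col_ln[OF xy(1) gC phi_gr[OF nn(1,2)] c(1) _ n(3) vx] v(2) nn(3) ln_phi[OF nn(1,2)] 1 phi_gr[OF nn(1,2)] by auto
qed

text \<open>The roles are exchanged. If \<open>a\<close> and \<open>b\<close> are the noncollinear
  neighbours of \<open>y\<close> on the lines \<open>A\<close> and \<open>B\<close>, then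
  \<open>y\<close> and the whole line \<open>ln x C\<close> lie in the polar space of common
  neighbours of \<open>a\<close> and \<open>b\<close>, so \<open>y\<close> has a neighbour on that
  line.\<close>

lemma near_grid:
 assumes A: "near x y A" "near x y B" "dim (A Int B) < 2" and C: "gr 3 C" "2 <= dim (C Int A)" "2 <= dim (C Int B)"
 shows "near x y C"
proof -
 have g: "gr 3 A" "gr 3 B" using A by (auto simp: near_def)
 obtain a where a: "a:ln x A" "col y a" using A(1) by (auto simp: near_def)
 obtain b where b: "b:ln x B" "col y b" using A(2) by (auto simp: near_def)
 note n = near_ne[OF a] near_ne[OF b]
 have ab: "~ col a b" using col_ln[OF xy(1) g a(1) b(1) n] A(3) by simp
 have cx: "col a x" "col b x"
  using col_line[OF ln(1)[OF xy(1) g(1)] a(1) ln(2)[OF xy(1) g(1)]] col_line[OF ln(1)[OF xy(1) g(2)] b(1) ln(2)[OF xy(1) g(2)]] by auto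
 have pts: "a:points G" "b:points G" using a b ln(1)[OF xy(1)] g line_points by blast+
 have xney: "x ~= y" using xy(3) by auto
 have C2: "2 <= dim (A Int C)" "2 <= dim (B Int C)" using C by (simp_all add: Int_commute)
 have "EX v:ln x C. col y v"
 proof (rule polar_pencil[OF pts ab cx col_sym[OF a(2)] col_sym[OF b(2)] xney col_sym[OF a(2)] col_sym[OF b(2)] ln(1)[OF xy(1) C(1)]])
  show "col a v & col b v" if "v:ln x C" for v
   using col_ln_all[OF xy(1) g(1) C(1) a(1) that C2(1)] col_ln_all[OF xy(1) g(2) C(1) b(1) that C2(2)] by blast
 qed
 then show ?thesis using C(1) by (simp add: near_def)
qed

end

end

context subspace_calculus
begin

lemma gr_insert: "gr k A ==> x ~: A ==> gr (Suc k) (span (insert x A))"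
 using gr_ext[of A k x] by (simp add: gr_def)

lemma span_ins: "A <= span (insert x A)" "x:span (insert x A)"
 by (auto intro: span_base)

lemma gr_ex: "gr k A ==> gr l W ==> k < l ==> EX x:W. x ~: A"
 using dim_ex[of A W] by (auto simp: gr_def)

lemma gr_le: "gr k A ==> gr l B ==> A <= B ==> k <= l"
 using dim_subset[of A B] by (auto simp: gr_def)

lemma gr_ssum: "gr k A ==> gr l B ==> dim (A Int B) + n = k + l ==> gr n (A #+ B)"
 using dim_ssum_gr[of k A l B] by (simp add: gr_def)

lemma gr_dim_le: "A <= B ==> gr k B ==> dim A <= k"
 using dim_subset[of A B] by (simp add: gr_def)

lemma gr_dim_ge: "gr k A ==> A <= B ==> k <= dim B"
 using dim_subset[of A B] by (simp add: gr_def)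

lemma gr_sub: "gr k A ==> l <= k ==> B <= A ==> subspace B ==> dim B <= l ==> EX P. gr l P & B <= P & P <= A"
 by (rule subspace_between[of B A l]) (auto simp: gr_def)

lemma ssum_le: "A <= C ==> B <= C ==> gr k C ==> A #+ B <= C"
 by (rule ssum_least) (auto simp: gr_def)

text \<open>If the three do not share a 2-space, the 2-spaces \<open>A Int C\<close> and
  \<open>B Int C\<close> are different, and they generate \<open>C\<close> inside
  \<open>A #+ B\<close>.\<close>

lemma gr3_triple:
 assumes g: "gr 3 A" "gr 3 B" "gr 3 C" and ne: "A ~= B" "A ~= C" "B ~= C"
  and adj: "2 <= dim (A Int B)" "2 <= dim (A Int C)" "2 <= dim (B Int C)"
 shows "(A Int B <= C) | (C <= A #+ B & dim (A Int B Int C) = 1)"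
proof (cases "A Int B <= C")
 case False
 note ab = gr3_adj[OF g(1,2) ne(1) adj(1)] and ac = gr3_adj[OF g(1,3) ne(2) adj(2)] and bc = gr3_adj[OF g(2,3) ne(3) adj(3)]
 have i: "A Int B Int C = (A Int C) Int (B Int C)" by blast
 have d: "dim ((A Int C) #+ (B Int C)) + dim (A Int B Int C) = 4" using dim_ssum_gr[OF ac(1) bc(1)] i by simp
 have sub: "(A Int C) #+ (B Int C) <= C" using g(3) by (intro ssum_least) (auto simp: gr_def)
 have le3: "dim ((A Int C) #+ (B Int C)) <= 3" using dim_subset[OF sub] g(3) by (simp add: gr_def)
 have ne2: "dim (A Int B Int C) ~= 2" using gr_inter[OF ab(1) g(3)] gr_eqI[OF _ ab(1)] False by blast
 have "dim (A Int B Int C) <= 2" by (rule gr_dim_le[OF _ ab(1)]) blast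
 then have d1: "dim (A Int B Int C) = 1" using d le3 ne2 by linarith
 then have "(A Int C) #+ (B Int C) = C" using d gr_eqI[OF _ g(3) sub] by (simp add: gr_def)
 moreover have "(A Int C) #+ (B Int C) <= A #+ B" by (rule ssum_mono) auto
 ultimately show ?thesis using d1 by auto
qed simp

end

context locally_grassmannian
begin

context
 fixes x y assumes xy: "x:points G" "y:points G" "~ col x y"
begin

text \<open>Let \<open>P\<close> be the 2-space \<open>(C #+ A) Int B\<close>. The 3-space
  \<open>(C Int A) #+ P\<close> shares a 2-space with \<open>A\<close> and with \<open>B\<close>, so
  \<open>near_grid\<close> applies to it, and \<open>C\<close> belongs to the pencil that it forms
  with \<open>A\<close>.\<close>

lemma near_sigma1:
 assumes A: "near x y A" "near x y B" "dim (A Int B) = 1" and C: "gr 3 C" "A Int B <= C" "C <= A #+ B" "2 <= dim (C Int A)"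
 shows "near x y C"
proof (cases "C = A")
 case True then show ?thesis using A by simp
next
 case False
 have g: "gr 3 A" "gr 3 B" using A by (auto simp: near_def)
 have gW: "gr 5 (A #+ B)" by (rule gr_ssum[OF g]) (use A(3) in simp)
 note ca = gr3_adj[OF C(1) g(1) False C(4)]
 let ?W = "C #+ A" and ?P = "(C #+ A) Int B" and ?U = "C Int A"
 have "dim ?P < 3"
  proof (rule ccontr)
   assume "~ dim ?P < 3"
   moreover have "dim ?P <= 3" by (rule gr_dim_le[OF _ g(2)]) blast
   ultimately have "gr 3 ?P" using gr_inter[OF ca(2) g(2)] by simp
   then have "?P = B" using gr_eqI[OF _ g(2)] by blast
   then have "A #+ B <= ?W" by (intro ssum_le[OF _ _ ca(2)] ssum_ub2) blast
   then show False using gr_le[OF gW ca(2)] by simp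
  qed
 then have "dim ?P = 2" using gr_inter_ge[OF ca(2) g(2) ssum_le[OF C(3) ssum_ub1 gW] ssum_ub2 gW] by simp
 then have gP: "gr 2 ?P" by (rule gr_inter[OF ca(2) g(2)])
 have "?U Int ?P = A Int B" using C(2) ssum_ub1[of C A] by blast
 then have gE: "gr 3 (?U #+ ?P)" using gr_ssum[OF ca(1) gP] A(3) by simp
 have E: "2 <= dim ((?U #+ ?P) Int A)" "2 <= dim ((?U #+ ?P) Int B)"
  using gr_dim_ge[OF ca(1), of "(?U #+ ?P) Int A"] gr_dim_ge[OF gP, of "(?U #+ ?P) Int B"]
   ssum_ub1[of ?U ?P] ssum_ub2[of ?P ?U] by blast+
 have nE: "near x y (?U #+ ?P)" using near_grid[OF xy A(1,2) _ gE E] A(3) by simp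
 have ne: "A ~= ?U #+ ?P"
 proof
  assume "A = ?U #+ ?P"
  then show False using ssum_ub2[of ?P ?U] gr_le[OF gP gr_inter[OF g A(3)]] by simp
 qed
 have EW: "?U #+ ?P <= ?W" by (rule ssum_le[OF _ _ ca(2)]) (use ssum_ub1[of C A] in blast)+
 note pe = pencil_eq[OF g(1) gE ne ca(1,2) Int_lower2 ssum_ub1 ssum_ub2 EW]
 show ?thesis
  by (rule near_pencil[OF xy A(1) nE ne _ C(1)])
   (use pe E(1) ssum_ub1[of C A] in \<open>auto simp: Int_commute\<close>)
qed

text \<open>If \<open>C\<close> shares a 2-space with neither, an intermediate
  \<open>E = span {c,u,a}\<close> shares one with \<open>A\<close> and one with \<open>C\<close>.
  Together with \<open>B\<close> it generates the same interval as \<open>A\<close> does, so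
  \<open>near_sigma1\<close> can be applied twice.\<close>

lemma near_sigma2:
 assumes A: "near x y A" "near x y B" "dim (A Int B) = 1" and C: "gr 3 C" "A Int B <= C" "C <= A #+ B"
 shows "near x y C"
proof -
 have g: "gr 3 A" "gr 3 B" using A by (auto simp: near_def)
 have gW: "gr 5 (A #+ B)" by (rule gr_ssum[OF g]) (use A(3) in simp)
 have BA: "B #+ A = A #+ B" "B Int A = A Int B" by (simp_all add: ssum_commute Int_commute)
 show ?thesis
 proof (cases "2 <= dim (C Int A) | 2 <= dim (C Int B)")
  case True
  then show ?thesis using near_sigma1[OF A C] near_sigma1[OF A(2,1), of C] A(3) C BA by auto
 next
  case False
  obtain u where u: "A Int B = span {u}" "u ~= 0" using obtain_dim1[OF gr_inter[OF g A(3)]] by blast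
  have uI: "u:A" "u:B" "u:C" using u(1) C(2) span_base[of u "{u}"] by blast+
  obtain a where a: "a:A" "a ~: A Int B" using gr_ex[OF gr_inter[OF g A(3)] g(1)] by auto
  then have aB: "a ~: B" by blast
  note gG = gr_insert[OF g(2) aB]
  obtain c where c: "c:C" "c ~: span (insert a B)" using gr_inter_ge[OF C(1) g(2) _ span_ins(1) gG] False by auto
  have ua: "gr 2 (span {u,a})" using a(2) u(1) dim_ins[of a "{u}"] u(2) gr_span[of "{a,u}" 2] by (simp add: insert_commute)
  have uaG: "span {u,a} <= span (insert a B)" using uI by (intro span_mono) auto
  let ?E = "span {c,u,a}"
  have gE: "gr 3 ?E" using c(2) uaG gr_span[OF dim_ins] ua by (force simp: gr_def)
  have EA: "2 <= dim (?E Int A)"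
  proof (rule gr_dim_ge[OF ua])
   have "span {u,a} <= A" by (rule span_minimal) (use uI a g(1) in \<open>auto simp: gr_def\<close>)
   moreover have "span {u,a} <= ?E" by (rule span_mono) auto
   ultimately show "span {u,a} <= ?E Int A" by blast
  qed
  have uc: "gr 2 (span {c,u})"
  proof -
   have "dim {c,u} = 2" using c(2) uaG span_mono[of "{u}" "{u,a}"] dim_ins[of c "{u}"] u(2) by force
   then show ?thesis using gr_span by blast
  qed
  have CE: "2 <= dim (C Int ?E)"
  proof (rule gr_dim_ge[OF uc])
   have "span {c,u} <= C" by (rule span_minimal) (use uI c C(1) in \<open>auto simp: gr_def\<close>)
   moreover have "span {c,u} <= ?E" by (rule span_mono) auto
   ultimately show "span {c,u} <= C Int ?E" by blast
  qed
  have EW: "?E <= A #+ B"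
   by (rule span_minimal) (use c(1) C(3) uI(1) a(1) ssum_ub1[of A B] in auto)
  have dEB: "dim (?E Int B) = 1"
  proof -
   have "insert c (insert a B) <= ?E #+ B"
    using ssum_ub1[of ?E B] ssum_ub2[of B ?E] span_superset[of "{c,u,a}"] by blast
   then have "dim (insert c (insert a B)) <= dim (?E #+ B)" by (rule dim_subset)
   then show ?thesis using dim_ssum_gr[OF gE g(2)] dim_ins[OF c(2)] gG gr_dim_le[OF ssum_le[OF EW ssum_ub2 gW] gW] by (simp add: gr_def)
  qed
  have uE: "u:?E" by (rule span_base) simp
  have EBU: "?E Int B = A Int B"
   unfolding u(1) by (rule dim_le_1_span[of u]) (use uE uI u dEB gE g(2) subspace_inter in \<open>auto simp: gr_def\<close>)
  have EBW: "?E #+ B = A #+ B"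
   by (rule gr_eqI[OF gr_ssum[OF gE g(2)] gW ssum_le[OF EW ssum_ub2 gW]]) (use dEB in simp)
  have "near x y ?E" by (rule near_sigma1[OF A gE _ EW EA]) (use EBU in blast)
  then show ?thesis by (rule near_sigma1[OF _ A(2) dEB C(1)]) (use EBU EBW C CE in auto)
 qed
qed

text \<open>Every pencil inside the interval has a member that shares a 2-space with
  \<open>C\<close>, by \<open>near_one\<close>. Suitable pencils exclude a \<open>C\<close> that
  leaves the 5-space and a \<open>C\<close> that misses the 1-space.\<close>

lemma near_sigma3:
 assumes A: "near x y A" "near x y B" "dim (A Int B) = 1" and C: "near x y C"
 shows "A Int B <= C & C <= A #+ B"
proof -
 let ?U = "A Int B" and ?W = "A #+ B"
 have g: "gr 3 A" "gr 3 B" "gr 3 C" using A C by (auto simp: near_def)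
 have gU: "gr 1 ?U" by (rule gr_inter[OF g(1,2) A(3)])
 have gW: "gr 5 ?W" by (rule gr_ssum[OF g(1,2)]) (use A(3) in simp)
 have UW: "?U <= ?W" using ssum_ub1[of A B] by blast
 have meet: "EX D. gr 3 D & P <= D & D <= R & 2 <= dim (C Int D)"
  if P: "gr 2 P" "gr 4 R" "P <= R" "?U <= P" "R <= ?W" for P R
  by (rule near_one[OF xy C P(1-3)], rule near_sigma2[OF A]) (use P in auto)
 have CW: "C <= ?W"
 proof (rule ccontr)
  assume nC: "~ C <= ?W"
  have lt: "dim (C Int ?W) <= 2"
  proof (rule ccontr)
   assume "~ ?thesis"
   moreover have "dim (C Int ?W) <= 3" by (rule gr_dim_le[OF _ g(3)]) blast
   ultimately have "dim (C Int ?W) = 3" by linarith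
   then show False using gr_eqI[OF _ g(3)] nC gr_inter[OF g(3) gW] by auto
  qed
  obtain P0 where P0: "gr 2 P0" "?U <= P0" "P0 <= ?W"
   using gr_sub[OF gW, of 2 ?U] UW gU by (auto simp: gr_def)
  obtain R0 where R0: "gr 4 R0" "P0 <= R0" "R0 <= ?W"
   using gr_sub[OF gW, of 4 P0] P0 by (auto simp: gr_def)
  obtain D0 where D0: "gr 3 D0" "D0 <= R0" "2 <= dim (C Int D0)" using meet[OF P0(1) R0(1,2) P0(2) R0(3)] by blast
  have CD: "C Int D = C Int ?W" if D: "gr 3 D" "D <= ?W" "2 <= dim (C Int D)" for D
  proof -
   have "C Int D <= C Int ?W" using D by blast
   show ?thesis by (rule subspace_eqI[rotated 2]) (use g(3) D gW lt subspace_inter in \<open>auto simp: gr_def\<close>)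
  qed
  have gCW: "gr 2 (C Int ?W)"
   using gr_inter[OF g(3) gW] lt CD[OF D0(1) _ D0(3)] D0 R0(3) by auto
  obtain v where v: "v:C Int ?W" "v ~: ?U" using gr_ex[OF gU gCW] by auto
  \<comment> \<open>A member of a pencil below \<open>R\<close> meets \<open>C\<close> in the whole
    of \<open>C Int ?W\<close>, but that contains \<open>v\<close>, which \<open>R\<close>
    avoids.\<close>
  obtain R where R: "gr 4 R" "?U <= R" "R <= ?W" "v ~: R"
   using subspace_avoid[of ?U ?W v 4] gU gW UW v by (auto simp: gr_def)
  obtain P where P: "gr 2 P" "?U <= P" "P <= R"
   using gr_sub[OF R(1), of 2 ?U] R gU by (auto simp: gr_def)
  obtain D where D: "gr 3 D" "D <= R" "2 <= dim (C Int D)" using meet[OF P(1) R(1) P(3,2) R(3)] by blast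
  have "C Int D = C Int ?W" by (rule CD[OF D(1) _ D(3)]) (use D R in blast)
  then show False using v D R by blast
 qed
 have "?U <= C"
 proof (rule ccontr)
  assume nU: "~ ?U <= C"
  obtain u where u: "?U = span {u}" "u ~= 0" using obtain_dim1[OF gU] by blast
  have uC: "u ~: C" using nU u(1) span_minimal[of "{u}" C] g(3) by (auto simp: gr_def)
  have uW: "u:?W" using UW u(1) span_base[of u "{u}"] by blast
  let ?H = "span (insert u C)"
  have gH: "gr 4 ?H" using gr_insert[OF g(3) uC] by simp
  \<comment> \<open>A 3-space containing \<open>p\<close>, \<open>u\<close> and a 2-space of
    \<open>C\<close> would lie in \<open>?H\<close>, because \<open>u\<close> is not in
    \<open>C\<close>.\<close>
  obtain p where p: "p:?W" "p ~: ?H" using gr_ex[OF gH gW] by auto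
  have gP: "gr 2 (span {p,u})" using p(2) span_mono[of "{u}" "insert u C"] gr_span[OF dim_ins, of p "{u}"] u(2) by (auto simp: numeral_2_eq_2)
  have UP: "?U <= span {p,u}" unfolding u(1) by (rule span_mono) auto
  have PW: "span {p,u} <= ?W" by (rule span_minimal) (use p uW gW in \<open>auto simp: gr_def\<close>)
  obtain R where R: "gr 4 R" "span {p,u} <= R" "R <= ?W"
   using gr_sub[OF gW, of 4 "span {p,u}"] gP PW by (auto simp: gr_def)
  obtain D where D: "gr 3 D" "span {p,u} <= D" "2 <= dim (C Int D)" using meet[OF gP R(1,2) UP R(3)] by blast
  have uD: "u:D" "p:D" using D(2) span_superset[of "{p,u}"] by blast+
  have sCD: "span (C Int D) = C Int D" using subspace_inter g(3) D(1) by (simp add: gr_def)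
  have "dim (insert u (C Int D)) = Suc (dim (C Int D))" by (rule dim_ins) (unfold sCD, use uC in blast)
  then have "D = span (insert u (C Int D))"
   by (intro span_eq_if_dim) (use D uD in \<open>auto simp: gr_def\<close>)
  also have "... <= ?H" by (rule span_mono) auto
  finally show False using uD p by blast
 qed
 then show ?thesis using CW by blast
qed

end

theorem polar_type:
 assumes xy: "x:points G" "y:points G" "~ col x y" and z: "col x z" "col y z" "col x z'" "col y z'" "z ~= z'"
 shows "EX U W. gr 1 U & gr 5 W & U <= W & (ALL A. near x y A <-> gr 3 A & U <= A & A <= W)"
proof -
 obtain A B where A: "gr 3 A" "gr 3 B" "dim (A Int B) = 1" "EX a:ln x A. col y a" "EX b:ln x B. col y b"
  using polar_noncollinear[OF xy z] by blast
 have n: "near x y A" "near x y B" using A by (auto simp: near_def)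
 show ?thesis
 proof (rule exI[where x = "A Int B"], rule exI[where x = "A #+ B"], intro conjI allI iffI)
  show "gr 1 (A Int B)" by (rule gr_inter[OF A(1,2,3)])
  show "gr 5 (A #+ B)" by (rule gr_ssum[OF A(1,2)]) (use A(3) in simp)
  show "A Int B <= A #+ B" using ssum_ub1[of A B] by blast
  show "gr 3 C" if "near x y C" for C using that by (simp add: near_def)
  show "A Int B <= C" "C <= A #+ B" if "near x y C" for C using near_sigma3[OF xy n A(3) that] by auto
  show "near x y C" if "gr 3 C & A Int B <= C & C <= A #+ B" for C
   using near_sigma2[OF xy n A(3)] that by blast
 qed
qed

end

section \<open>The half-spin geometry\<close>

definition dotp :: "'k::field^'n => 'k^'n => 'k" where "dotp e w = (\<Sum>i\<in>UNIV. e $ i * w $ i)"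

lemma dotp_simps: "dotp (a + b) w = dotp a w + dotp b w" "dotp w (a + b) = dotp w a + dotp w b"
  "dotp (t *s a) w = t * dotp a w" "dotp w (t *s a) = t * dotp w a" "dotp 0 w = 0" "dotp w 0 = 0"
  "dotp (a - b) w = dotp a w - dotp b w" "dotp w (a - b) = dotp w a - dotp w b"
 by (simp_all add: dotp_def sum.distrib sum_subtractf sum_distrib_left algebra_simps)

lemma dotp_commute: "dotp a b = dotp b a" by (simp add: dotp_def mult.commute)

definition ann :: "('k::field^'n) set => ('k^'n) set" where "ann S = {w. ALL e:S. dotp e w = 0}"

text \<open>Linearity is demanded in the second argument only; antisymmetry carries it to the first.
  The diagonal condition is separate because antisymmetry does not imply it in characteristic two.
  Values outside \<open>Y\<close> are irrelevant.\<close>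

definition alt_on :: "('k::field^'n) set => ('k^'n => 'k^'n => 'k) => bool" where
 "alt_on Y g <-> (ALL a:Y. g a a = 0) & (ALL a:Y. ALL b:Y. g b a = - g a b & (ALL t. g a (t *s b) = t * g a b) & (ALL c:Y. g a (b + c) = g a b + g a c))"

lemma alt_onD:
 assumes "alt_on Y g" "vec.subspace Y" "a:Y" "b:Y"
 shows "g a a = 0" "g b a = - g a b" "g a (t *s b) = t * g a b" "g (t *s a) b = t * g a b" "g a 0 = 0" "g 0 a = 0"
  "c:Y ==> g a (b + c) = g a b + g a c" "c:Y ==> g (b + c) a = g b a + g c a"
proof -
 have A: "g u v = - g v u" "g u (t *s v) = t * g u v" "w:Y ==> g u (v + w) = g u v + g u w" if "u:Y" "v:Y" for u v w t
  using assms(1) that unfolding alt_on_def by blast+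
 note S = vec.subspace_scale[OF assms(2)] vec.subspace_add[OF assms(2)]
 show "g a a = 0" "g b a = - g a b" "g a (t *s b) = t * g a b" using assms(1,3,4) unfolding alt_on_def by blast+
 show "g (t *s a) b = t * g a b" using A(1)[OF S(1)[OF assms(3)] assms(4)] A(2)[OF assms(4,3)] A(1)[OF assms(4,3)] by simp
 show z: "g a 0 = 0" using A(2)[OF assms(3,4), of 0] by simp
 show "g 0 a = 0" using A(1)[OF vec.subspace_0[OF assms(2)] assms(3)] z by simp
 show "c:Y ==> g a (b + c) = g a b + g a c" using A(3)[OF assms(3,4)] .
 show "c:Y ==> g (b + c) a = g b a + g c a"
  using A(1)[OF S(2)[OF assms(4)] assms(3), of c] A(1)[OF assms(4,3)] A(1)[of c a] A(3)[OF assms(3,4)] assms(3) by simp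
qed

lemma alt_on_subset: "alt_on Y g ==> X <= Y ==> alt_on X g"
 unfolding alt_on_def by blast

context begin

interpretation subspace_calculus "(*s) :: 'k::field => 'k^'n => 'k^'n" cart_basis by unfold_locales

lemma functional_exists:
 fixes B :: "('k::field^'n) set" assumes "vec.independent B" shows "EX w. ALL e:B. dotp e w = h e"
proof -
 obtain g :: "'k^'n => 'k^1" where g: "Vector_Spaces.linear (*s) (*s) g" "ALL x:B. g x = (\<chi> i. h x)"
  using vec.linear_independent_extend[OF assms, of "%x. \<chi> i. h x"] by blast
 interpret g: Vector_Spaces.linear "(*s)" "(*s)" g by (rule g)
 define w :: "'k^'n" where "w = (\<chi> i. g (axis i 1) $ 1)"
 have "dotp e w = g e $ 1" for e
 proof -
  have "g e = g (\<Sum>i\<in>UNIV. e $ i *s axis i 1)" by (simp add: basis_expansion)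
  also have "... = (\<Sum>i\<in>UNIV. e $ i *s g (axis i 1))" by (simp add: g.sum g.scale)
  finally show ?thesis by (simp add: dotp_def w_def)
 qed
 then show ?thesis using g(2) by (intro exI[of _ w]) simp
qed

lemma ann_subspace [simp]: "vec.subspace (ann S)"
 by (rule vec.subspaceI) (simp_all add: ann_def dotp_simps)

lemma ann_gr:
 fixes S :: "('k::field^'n) set"
 shows "gr k S ==> gr (CARD('n) - k) (ann S) & k <= CARD('n)"
proof (induction k arbitrary: S)
 case 0
 then have "S = {0}" using vec.subspace_0[of S] by (auto simp: gr_def)
 then show ?case by (simp add: ann_def dotp_simps gr_def card_cart_basis)
next
 case (Suc k)
 obtain S' where S': "gr k S'" "S' <= S" using gr_sub[OF Suc.prems, of k "{0}"] vec.subspace_0[of S] Suc.prems by (auto simp: gr_def)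
 obtain x where x: "x:S" "x ~: S'" using gr_ex[OF S'(1) Suc.prems] by auto
 have Sx: "S = vec.span (insert x S')"
  by (rule gr_eqI[OF gr_insert[OF S'(1) x(2)] Suc.prems, symmetric]) (rule vec.span_minimal, use S'(2) x Suc.prems in \<open>auto simp: gr_def\<close>)
 obtain B where B: "B <= S'" "vec.independent B" "S' <= vec.span B" "card B = vec.dim S'" by (rule vec.basis_exists)
 have sB: "S' = vec.span B" using B vec.span_minimal[OF B(1)] S'(1) by (auto simp: gr_def)
 have iB: "vec.independent (insert x B)" using B(2) x(2) sB vec.independent_insert[of x B] by auto
 obtain f where f: "ALL e:insert x B. dotp e f = (if e = x then 1 else 0)" using functional_exists[OF iB, of "%e. if e = x then 1 else 0"] by (elim exE)
 have xB: "x ~: B" using x(2) B(1) by blast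
 have "S' <= {e. dotp e f = 0}" unfolding sB
  by (rule vec.span_minimal) (use f xB in \<open>auto simp: dotp_simps intro!: vec.subspaceI\<close>)
 then have fa: "f:ann S'" "dotp x f = 1" using f by (auto simp: ann_def)
 have e: "ann S = ann S' Int {w. dotp x w = 0}"
 proof -
  have "w:ann S" if "w:ann S'" "dotp x w = 0" for w
  proof -
   have "vec.span (insert x S') <= {e. dotp e w = 0}"
    by (rule vec.span_minimal) (use that in \<open>auto simp: ann_def dotp_simps intro!: vec.subspaceI\<close>)
   then show ?thesis unfolding Sx ann_def by blast
  qed
  then show ?thesis using S'(2) x(1) by (auto simp: ann_def)
 qed
 have fS: "f ~: ann S" using fa e by simp
 have "ann S' = vec.span (insert f (ann S))"
 proof
  show "vec.span (insert f (ann S)) <= ann S'" by (rule vec.span_minimal) (use fa e in auto)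
  show "ann S' <= vec.span (insert f (ann S))"
  proof
   fix w assume w: "w:ann S'"
   have "w - dotp x w *s f:ann S" using w fa e by (simp add: ann_def dotp_simps)
   then have "w - dotp x w *s f + dotp x w *s f:vec.span (insert f (ann S))" by (intro vec.span_add vec.span_scale vec.span_base) auto
   then show "w:vec.span (insert f (ann S))" by simp
  qed
 qed
 then show ?case using gr_insert[OF _ fS, of "vec.dim (ann S)"] Suc.IH[OF S'(1)] by (auto simp: gr_def)
qed

lemma ann_ann: assumes "vec.subspace (S :: ('k::field^'n) set)" shows "ann (ann S) = S"
proof -
 have g: "gr (vec.dim S) S" using assms by (simp add: gr_def)
 have "S <= ann (ann S)" by (auto simp: ann_def dotp_commute)
 then show ?thesis using gr_eqI[OF g, of "ann (ann S)"] ann_gr[OF g] ann_gr[of "CARD('n) - vec.dim S" "ann S"] by simp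
qed

lemma ann_mono: "A <= B ==> ann B <= ann A" by (auto simp: ann_def)

lemma ann_ssum: "ann (ssum A B) = ann A Int ann B"
proof
 show "ann (ssum A B) <= ann A Int ann B" using ann_mono[OF ssum_ub1] ann_mono[OF ssum_ub2] by blast
 show "ann A Int ann B <= ann (ssum A B)"
 proof
  fix w assume w: "w:ann A Int ann B"
  have "ssum A B <= {e. dotp e w = 0}"
   by (rule ssum_least) (use w in \<open>auto simp: ann_def dotp_simps intro!: vec.subspaceI\<close>)
  then show "w:ann (ssum A B)" by (auto simp: ann_def)
 qed
qed

text \<open>If \<open>h a b\<close> is nonzero, the perp of \<open>a\<close> and \<open>b\<close> is
  a complement of \<open>span {a, b}\<close> with the same radical as \<open>X\<close>, and its
  dimension is smaller by two.\<close>

lemma alt_rank_even: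
 fixes X :: "('k::field^'n) set"
 assumes "vec.subspace X" "alt_on X h" shows "even (vec.dim X + vec.dim {f:X. ALL e:X. h f e = 0})"
 using assms
proof (induction "vec.dim X" arbitrary: X rule: less_induct)
 case less
 note A = alt_onD[OF less.prems(2,1)] and S = less.prems(1)
 let ?R = "%X. {f:X. ALL e:X. h f e = 0}"
 show ?case
 proof (cases "ALL a:X. ALL b:X. h a b = 0")
  case True
  then have "?R X = X" by auto
  then show ?thesis by simp
 next
  case False
  then obtain a b where ab: "a:X" "b:X" "h a b ~= 0" by blast
  let ?X' = "{v:X. h a v = 0 & h b v = 0}"
  have S': "vec.subspace ?X'"
   by (rule vec.subspaceI) (use ab in \<open>simp_all add: A(3,5,7) vec.subspace_0[OF S] vec.subspace_add[OF S] vec.subspace_scale[OF S]\<close>)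
  have al: "alt_on ?X' h" by (rule alt_on_subset[OF less.prems(2)]) blast
  \<comment> \<open>The projection onto \<open>span {a, b}\<close> along the perp: it is determined
    by \<open>h a (t v) = h a v\<close> and \<open>h b (t v) = h b v\<close>.\<close>
  define t where "t v = inverse (h a b) *s (h a v *s b - h b v *s a)" for v
  have tX: "t v:X" "v - t v:?X'" if v: "v:X" for v
  proof -
   have 1: "- (h b v *s a):X" "h a v *s b:X" "h b v *s a:X" using S ab by (simp_all add: vec.subspace_neg vec.subspace_scale)
   have d: "h a v *s b - h b v *s a:X" using vec.subspace_diff[OF S 1(2,3)] .
   then show tX: "t v:X" unfolding t_def by (rule vec.subspace_scale[OF S])
   have lin: "h c (u - w) = h c u - h c w" if "c:X" "u:X" "w:X" for c u w
    using A(7)[OF that(1,2), of "(-1) *s w"] A(3)[OF that(1,3), of "-1"] vec.subspace_scale[OF S that(3), of "-1"] by simp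
   have ht: "h c (t v) = inverse (h a b) * (h a v * h c b - h b v * h c a)" if c: "c:X" for c
    unfolding t_def using A(3)[OF c d] lin[OF c 1(2,3)] A(3)[OF c ab(2)] A(3)[OF c ab(1)] by simp
   show "v - t v:?X'" using ht[OF ab(1)] ht[OF ab(2)] A(1)[OF ab(1,1)] A(1)[OF ab(2,2)] A(2)[OF ab(1,2)] ab(3) lin[OF ab(1) v tX] lin[OF ab(2) v tX] vec.subspace_diff[OF S v tX] by simp
  qed
  have tspan: "t v:vec.span {a, b}" for v unfolding t_def by (intro vec.span_scale vec.span_diff vec.span_base) auto
  have abX: "vec.span {a, b} <= X" by (rule vec.span_minimal) (use ab S in auto)
  have "ssum ?X' (vec.span {a, b}) = X"
  proof
   show "ssum ?X' (vec.span {a, b}) <= X" by (rule ssum_least[OF _ abX S]) auto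
   show "X <= ssum ?X' (vec.span {a, b})"
   proof
    fix v assume v: "v:X"
    have "v - t v + t v:ssum ?X' (vec.span {a, b})"
     by (rule vec.subspace_add[OF subspace_ssum subsetD[OF ssum_ub1 tX(2)[OF v]] subsetD[OF ssum_ub2 tspan]])
    then show "v:ssum ?X' (vec.span {a, b})" by simp
   qed
  qed
  moreover have comb: "h c (s *s a + r *s b) = s * h c a + r * h c b" if c: "c:X" for c s r
   using A(7)[OF c vec.subspace_scale[OF S ab(1)] vec.subspace_scale[OF S ab(2)]] A(3)[OF c ab(1)] A(3)[OF c ab(2)] by simp
  have sr: "s = 0 & r = 0" if "h a (s *s a + r *s b) = 0" "h b (s *s a + r *s b) = 0" for s r
   using comb[OF ab(1), of s r] comb[OF ab(2), of s r] A(1)[OF ab(2,2)] A(2)[OF ab(1,2)] ab(3) that by simp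
  have "?X' Int vec.span {a, b} = {0}"
  proof -
   have "v = 0" if v: "v:?X'" "v:vec.span {a, b}" for v
   proof -
    obtain s r where "v = s *s a + r *s b" using v(2) unfolding span_lin2 by (elim exE)
    then show ?thesis using sr[of s r] v(1) by simp
   qed
   then show ?thesis using vec.subspace_0[OF S'] vec.span_zero by blast
  qed
  moreover have "vec.dim {a, b} = 2" using A(6)[OF ab(2,2)] ab A(3)[OF ab(1,1)] A(1)[OF ab(1,1)] dim_ins[of b "{a}"]
   by (force simp: vec.span_singleton insert_commute)
  ultimately have dX: "vec.dim X = vec.dim ?X' + 2" using dim_ssum[OF S' vec.subspace_span, of "{a, b}"] by simp
  have "?R X = ?R ?X'"
  proof
   show "?R X <= ?R ?X'"
   proof
    fix f assume "f:?R X"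
    then have f: "f:X" "!!e. e:X ==> h f e = 0" by blast+
    then show "f:?R ?X'" using A(2)[OF f(1) ab(1)] A(2)[OF f(1) ab(2)] f(2)[OF ab(1)] f(2)[OF ab(2)] by simp
   qed
   show "?R ?X' <= ?R X"
   proof
    fix f assume f: "f:?R ?X'"
    then have fX: "f:X" "h a f = 0" "h b f = 0" by simp_all
    have "h f e = 0" if e: "e:X" for e
     using tspan[of e] comb[OF fX(1)] A(2)[OF ab(1) fX(1)] A(2)[OF ab(2) fX(1)] f A(7)[OF fX(1), of "e - t e" "t e"] tX[OF e] by (auto simp: span_lin2)
    then show "f:?R X" using fX(1) by simp
   qed
  qed
  then show ?thesis using less.hyps[OF _ S' al] dX by simp
 qed
qed

lemma rank_nullity:
 fixes T :: "'k::field^'n => 'k^'m"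
 assumes T: "Vector_Spaces.linear (*s) (*s) T" and S: "vec.subspace S"
 shows "vec.dim S = vec.dim (T ` S) + vec.dim {v:S. T v = 0}"
proof -
 interpret T: Vector_Spaces.linear "(*s)" "(*s)" T by (rule T)
 obtain B where B: "B <= T ` S" "vec.independent B" "T ` S <= vec.span B" "card B = vec.dim (T ` S)" by (rule vec.basis_exists)
 obtain L :: "'k^'m => 'k^'n" where L: "Vector_Spaces.linear (*s) (*s) L" "ALL b:B. L b = (SOME v. v:S & T v = b)"
  using vec.linear_independent_extend[OF B(2), of "%b. SOME v. v:S & T v = b"] by (elim exE conjE)
 interpret L: Vector_Spaces.linear "(*s)" "(*s)" L by (rule L)
 have LB: "L b:S & T (L b) = b" if b: "b:B" for b
 proof -
  have "EX v. v:S & T v = b" using B(1) b by blast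
  from someI_ex[OF this] show ?thesis using L(2) b by simp
 qed
 have "vec.span B <= {b. L b:S & T (L b) = b}"
  by (rule vec.span_minimal) (use LB in \<open>auto intro!: vec.subspaceI simp: L.add L.scale L.zero T.add T.scale T.zero vec.subspace_0[OF S] vec.subspace_add[OF S] vec.subspace_scale[OF S]\<close>)
 then have LS: "L b:S" "T (L b) = b" if "b:T ` S" for b using that B(3) by blast+
 let ?K = "{v:S. T v = 0}" and ?I = "L ` T ` S"
 have sK: "vec.subspace ?K" by (rule vec.subspaceI) (simp_all add: T.add T.scale T.zero vec.subspace_0[OF S] vec.subspace_add[OF S] vec.subspace_scale[OF S])
 have sI: "vec.subspace ?I" by (rule L.subspace_image[OF T.subspace_image[OF S]])
 have "ssum ?I ?K = S"
  proof
   show "ssum ?I ?K <= S" by (rule ssum_least[OF _ _ S]) (use LS in auto)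
   show "S <= ssum ?I ?K"
   proof
    fix v assume v: "v:S"
    have m: "L (T v):?I" "v - L (T v):?K" using v LS[of "T v"] by (simp_all add: vec.subspace_diff[OF S] T.diff)
    show "v:ssum ?I ?K" using vec.subspace_add[OF subspace_ssum subsetD[OF ssum_ub1 m(1)] subsetD[OF ssum_ub2 m(2)]] by simp
   qed
  qed
 moreover have "?I Int ?K = {0}"
  proof -
   have "v = 0" if v: "v:?I" "v:?K" for v using LS(2) that by auto
   then show ?thesis using vec.subspace_0[OF sI] vec.subspace_0[OF sK] by blast
  qed
 ultimately show ?thesis using dim_ssum[OF sI sK] LS(2) inj_on_inverseI[of _ T] vec.dim_image_eq[OF L(1)]
  by (simp add: vec.span_eq_iff[THEN iffD2, OF T.subspace_image[OF S]])
qed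

end

section \<open>Maximal totally singular subspaces from alternating forms\<close>

definition fv :: "'k::field^('m::finite+'m) => 'k^'m" where "fv v = (\<chi> i. v $ Inr i)"
definition wv :: "'k::field^('m::finite+'m) => 'k^'m" where "wv v = (\<chi> i. v $ Inl i)"
definition pr :: "'k::field^'m::finite => 'k^'m => 'k^('m+'m)" where
 "pr w f = (\<chi> k. case k of Inl i => w $ i | Inr i => f $ i)"

lemma pr_simps [simp]: "fv (pr w f) = f" "wv (pr w f) = w" "pr (wv v) (fv v) = v"
  "fv (u + v) = fv u + fv v" "wv (u + v) = wv u + wv v" "fv (t *s v) = t *s fv v" "wv (t *s v) = t *s wv v" "fv 0 = 0" "wv 0 = 0"
 by (auto simp: fv_def wv_def pr_def vec_eq_iff split: sum.splits)

text \<open>The polarization of \<open>hyperbolic_form\<close>, which in the coordinates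
  \<open>fv\<close>, \<open>wv\<close> is the pairing of the two halves.\<close>

definition bf :: "'k::field^('m::finite+'m) => 'k^('m+'m) => 'k" where
 "bf u v = dotp (fv u) (wv v) + dotp (fv v) (wv u)"

lemma form_add: "hyperbolic_form (u + v) = hyperbolic_form u + hyperbolic_form v + bf u v"
 and form_scale: "hyperbolic_form (t *s v) = t * t * hyperbolic_form v"
 and form_dotp: "hyperbolic_form v = dotp (fv v) (wv v)"
proof -
 show d: "hyperbolic_form v = dotp (fv v) (wv v)" for v :: "'a^('b::finite+'b)"
  by (simp add: hyperbolic_form_def dotp_def fv_def wv_def mult.commute)
 show "hyperbolic_form (u + v) = hyperbolic_form u + hyperbolic_form v + bf u v" by (simp add: d bf_def dotp_simps)
 show "hyperbolic_form (t *s v) = t * t * hyperbolic_form v" by (simp add: d dotp_simps)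
qed

lemma bf_simps: "bf (a + b) w = bf a w + bf b w" "bf w (a + b) = bf w a + bf w b" "bf (t *s a) w = t * bf a w" "bf w (t *s a) = t * bf w a"
  "bf a b = bf b a"
 by (simp_all add: bf_def dotp_simps algebra_simps)

lemma ts_bf: "totally_singular U ==> u:U ==> v:U ==> bf u v = 0"
 using form_add[of u v] vec.subspace_add[of U u v] unfolding totally_singular_def by force

text \<open>All maximal totally singular subspaces are of this form, with \<open>g\<close> alternating on \<open>Y\<close>.\<close>

definition mod_sp :: "('k::field^'m::finite) set => ('k^'m => 'k^'m => 'k) => ('k^('m+'m)) set" where
 "mod_sp Y g = {v. fv v:Y & (ALL e:Y. dotp e (wv v) = g (fv v) e)}"

lemma mod_sp_subspace: "vec.subspace Y ==> alt_on Y g ==> vec.subspace (mod_sp Y g)"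
 by (rule vec.subspaceI) (simp_all add: mod_sp_def dotp_simps alt_onD(4,6,8) vec.subspace_0 vec.subspace_add vec.subspace_scale)

lemma mod_sp_ts: "vec.subspace Y ==> alt_on Y g ==> totally_singular (mod_sp Y g)"
 using mod_sp_subspace[of Y g] alt_onD(1)[of Y g] unfolding totally_singular_def form_dotp by (auto simp: mod_sp_def)

context begin

interpretation subspace_calculus "(*s) :: 'k::field => 'k^'n => 'k^'n" cart_basis by unfold_locales

lemma functional_extend:
 fixes S :: "('k::field^'n) set"
 assumes S: "vec.subspace S" and h: "!!a b. a:S ==> b:S ==> h (a + b) = h a + h b" "!!a t. a:S ==> h (t *s a) = t * h a"
 shows "EX w. ALL e:S. dotp e w = h e"
proof -
 obtain B where B: "B <= S" "vec.independent B" "S <= vec.span B" "card B = vec.dim S" by (rule vec.basis_exists)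
 obtain w where w: "ALL e:B. dotp e w = h e" using functional_exists[OF B(2), of h] by (elim exE)
 have h0: "h 0 = 0" using h(2)[OF vec.subspace_0[OF S], of 0] by simp
 have "vec.span B <= {e:S. dotp e w = h e}"
  by (rule vec.span_minimal, use w B(1) in blast, rule vec.subspaceI)
   (simp_all add: dotp_simps h h0 vec.subspace_0[OF S] vec.subspace_add[OF S] vec.subspace_scale[OF S])
 then show ?thesis using B(3) by blast
qed

lemma ann_Int: "vec.subspace A ==> vec.subspace B ==> ann (A Int B) = ssum (ann A) (ann B)"
 using ann_ann[of "ssum (ann A) (ann B)"] ann_ssum[of "ann A" "ann B"] ann_ann[of A] ann_ann[of B] by simp

text \<open>The two functionals are represented by vectors \<open>w\<close> and \<open>w'\<close>
  that agree on the intersection of \<open>Y\<close> and \<open>Y'\<close>. Their difference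
  annihilates the intersection and hence splits into parts annihilating \<open>Y\<close> and
  \<open>Y'\<close>; moving one part to each side makes the vectors equal.\<close>

lemma mod_sp_lift:
 fixes Y Y' :: "('k::field^'m::finite) set"
 assumes Y: "vec.subspace Y" "alt_on Y g" "vec.subspace Y'" "alt_on Y' g'" and f: "f:Y" "f:Y'" "ALL e:Y Int Y'. g f e = g' f e"
 shows "EX w. (ALL e:Y. dotp e w = g f e) & (ALL e:Y'. dotp e w = g' f e)"
proof -
 obtain w where w: "ALL e:Y. dotp e w = g f e" using functional_extend[OF Y(1), of "g f"] alt_onD(3,7)[OF Y(2,1) f(1)] by blast
 obtain w' where w': "ALL e:Y'. dotp e w' = g' f e" using functional_extend[OF Y(3), of "g' f"] alt_onD(3,7)[OF Y(4,3) f(2)] by blast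
 have "w' - w:ann (Y Int Y')" using w w' f(3) by (simp add: ann_def dotp_simps)
 then obtain u u' where u: "u:ann Y" "u':ann Y'" "w' - w = u + u'" using ssum_eqD[OF _ ann_subspace ann_subspace] unfolding ann_Int[OF Y(1,3)] by blast
 have e: "w + u = w' - u'" using u(3) by (simp add: algebra_simps)
 have "ALL e:Y. dotp e (w + u) = g f e" using w u(1) by (simp add: ann_def dotp_simps)
 moreover have "ALL e:Y'. dotp e (w + u) = g' f e" unfolding e using w' u(2) by (simp add: ann_def dotp_simps)
 ultimately show ?thesis by blast
qed

lemma linear_fv: "Vector_Spaces.linear (*s) (*s) (fv :: 'k::field^('m::finite+'m) => _)"
 by unfold_locales simp_all

lemma linear_inl: "Vector_Spaces.linear (*s) (*s) (%w :: 'k::field^'m::finite. pr w 0)"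
 by unfold_locales (auto simp: pr_def vec_eq_iff split: sum.splits)

text \<open>Rank and nullity of \<open>fv\<close> on the intersection. By \<open>mod_sp_lift\<close>
  the image is the radical of the difference of the forms on \<open>Y Int Y'\<close>; the kernel is
  the annihilator of the sum of \<open>Y\<close> and \<open>Y'\<close>.\<close>

theorem mod_sp_dim:
 fixes Y Y' :: "('k::field^'m::finite) set"
 assumes Y: "vec.subspace Y" "alt_on Y g" "vec.subspace Y'" "alt_on Y' g'"
 shows "vec.dim (mod_sp Y g Int mod_sp Y' g') + vec.dim (ssum Y Y') = vec.dim {f:Y Int Y'. ALL e:Y Int Y'. g f e = g' f e} + CARD('m)"
proof -
 let ?S = "mod_sp Y g Int mod_sp Y' g'" and ?R = "{f:Y Int Y'. ALL e:Y Int Y'. g f e = g' f e}"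
 have S: "vec.subspace ?S" by (rule vec.subspace_inter[OF mod_sp_subspace mod_sp_subspace]) (rule Y)+
 have im: "fv ` ?S = ?R"
 proof
  show "fv ` ?S <= ?R" by (auto simp: mod_sp_def)
  show "?R <= fv ` ?S"
  proof
   fix f assume "f:?R"
   then have f: "f:Y" "f:Y'" "ALL e:Y Int Y'. g f e = g' f e" by blast+
   obtain w where "(ALL e:Y. dotp e w = g f e) & (ALL e:Y'. dotp e w = g' f e)" using mod_sp_lift[OF Y f] by (elim exE)
   then have "pr w f:?S" using f by (simp add: mod_sp_def)
   from imageI[OF this, of fv] show "f:fv ` ?S" by simp
  qed
 qed
 have g0: "g 0 e = 0" if "e:Y" for e using alt_onD(6)[OF Y(2,1) that that] .
 have g0': "g' 0 e = 0" if "e:Y'" for e using alt_onD(6)[OF Y(4,3) that that] .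
 have ker: "{v:?S. fv v = 0} = (%w. pr w 0) ` ann (ssum Y Y')"
 proof
  show "{v:?S. fv v = 0} <= (%w. pr w 0) ` ann (ssum Y Y')"
  proof
   fix v assume "v:{v:?S. fv v = 0}"
   then have v: "v = pr (wv v) 0" "wv v:ann (ssum Y Y')" unfolding ann_ssum
    by (auto simp: mod_sp_def ann_def g0 g0' intro: pr_simps(3)[symmetric, of v, THEN trans])
   then show "v:(%w. pr w 0) ` ann (ssum Y Y')" by blast
  qed
  show "(%w. pr w 0) ` ann (ssum Y Y') <= {v:?S. fv v = 0}"
   unfolding ann_ssum using vec.subspace_0[OF Y(1)] vec.subspace_0[OF Y(3)] by (auto simp: mod_sp_def ann_def g0 g0')
 qed
 have inj: "inj_on (%w :: 'k^'m. pr w 0) A" for A by (rule inj_on_inverseI[of _ wv]) simp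
 have "vec.dim ?S = vec.dim ?R + vec.dim (ann (ssum Y Y'))"
  using rank_nullity[OF linear_fv S] unfolding im ker vec.dim_image_eq[OF linear_inl inj] .
 moreover have "gr (vec.dim (ssum Y Y')) (ssum Y Y')" by (simp add: gr_def)
 have "vec.dim (ann (ssum Y Y')) + vec.dim (ssum Y Y') = CARD('m)" using ann_gr[of "vec.dim (ssum Y Y')" "ssum Y Y'"] by (auto simp: gr_def)
 ultimately show ?thesis by simp
qed

lemma mod_sp_card:
 fixes Y :: "('k::field^'m::finite) set"
 assumes Y: "vec.subspace Y" "alt_on Y g" shows "vec.dim (mod_sp Y g) = CARD('m)" using ssum_least[of Y Y Y] ssum_ub1[of Y Y] Y(1) mod_sp_dim[OF Y Y]
  by simp

text \<open>In \<open>mod_sp_dim\<close> the radical of the alternating difference has the parity of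
  \<open>dim (Y Int Y')\<close>. So the class of \<open>mod_sp Y g\<close> can depend only on the
  parity of \<open>dim Y\<close>.\<close>

lemma mod_sp_parity:
 fixes Y Y' :: "('k::field^'m::finite) set"
 assumes Y: "vec.subspace Y" "alt_on Y g" "vec.subspace Y'" "alt_on Y' g'"
 shows "even (vec.dim (mod_sp Y g Int mod_sp Y' g') + vec.dim Y + vec.dim Y' + CARD('m))"
proof -
 have a: "alt_on (Y Int Y') g" "alt_on (Y Int Y') g'" using alt_on_subset Y by blast+
 have "alt_on (Y Int Y') (%a b. g a b - g' a b)"
  unfolding alt_on_def
 proof (intro conjI ballI allI)
  note I = vec.subspace_inter[OF Y(1,3)]
  fix u assume u: "u:Y Int Y'"
  show "g u u - g' u u = 0" using alt_onD(1)[OF a(1) I u u] alt_onD(1)[OF a(2) I u u] by simp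
  fix v assume v: "v:Y Int Y'"
  note A = alt_onD[OF a(1) I u v] and A' = alt_onD[OF a(2) I u v]
  show "g v u - g' v u = - (g u v - g' u v)" unfolding A(2) A'(2) by simp
  show "g u (t *s v) - g' u (t *s v) = t * (g u v - g' u v)" for t unfolding A(3) A'(3) by (simp add: right_diff_distrib)
  show "g u (v + w) - g' u (v + w) = g u v - g' u v + (g u w - g' u w)" if "w:Y Int Y'" for w
   unfolding A(7)[OF that] A'(7)[OF that] by simp
 qed
 from alt_rank_even[OF vec.subspace_inter[OF Y(1,3)] this]
 have "even (vec.dim (Y Int Y') + vec.dim {f:Y Int Y'. ALL e:Y Int Y'. g f e = g' f e})" by simp
 moreover have "even (x + r) ==> i + s = r + c ==> s + x = a + b ==> even (i + a + b + c)" for x r i s c a b :: nat by presburger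
 ultimately show ?thesis using mod_sp_dim[OF Y] dim_ssum[OF Y(1,3)] by blast
qed

text \<open>A vector of a larger totally singular space is orthogonal to all \<open>pr w 0\<close>
  with \<open>w\<close> annihilating \<open>Y\<close>, so its \<open>fv\<close> part lies in
  \<open>Y\<close>. Orthogonality to the lifts \<open>pr w e\<close> of \<open>e\<close> in
  \<open>Y\<close> then fixes its \<open>wv\<close> part on \<open>Y\<close>.\<close>

lemma mod_sp_maximal:
 fixes Y :: "('k::field^'m::finite) set"
 assumes Y: "vec.subspace Y" "alt_on Y g" shows "maximal_totally_singular (mod_sp Y g)"
 unfolding maximal_totally_singular_def
proof (intro conjI allI impI)
 show "totally_singular (mod_sp Y g)" by (rule mod_sp_ts[OF Y])
 fix N assume N: "totally_singular N & mod_sp Y g <= N"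
 have "v:mod_sp Y g" if v: "v:N" for v
 proof -
  have b: "bf v u = 0" if "u:mod_sp Y g" for u using ts_bf[OF _ v] N that by blast
  have "dotp w (fv v) = 0" if w: "w:ann Y" for w
  proof -
   have "g 0 e = 0" if "e:Y" for e using alt_onD(6)[OF Y(2,1) that that] .
   then have "pr w 0:mod_sp Y g" using w vec.subspace_0[OF Y(1)] by (simp add: mod_sp_def ann_def)
   from b[OF this] show ?thesis by (simp add: bf_def dotp_simps dotp_commute)
  qed
  then have fY: "fv v:Y" using ann_ann[OF Y(1)] by (auto simp: ann_def)
  moreover have "dotp e (wv v) = g (fv v) e" if e: "e:Y" for e
  proof -
   obtain w where w: "ALL a:Y. dotp a w = g e a" using mod_sp_lift[OF Y Y e e] by blast
   have "pr w e:mod_sp Y g" using w e by (simp add: mod_sp_def)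
   from b[OF this] show ?thesis using w fY alt_onD(2)[OF Y(2,1) fY e] by (simp add: bf_def)
  qed
  ultimately show ?thesis by (simp add: mod_sp_def)
 qed
 then show "N = mod_sp Y g" using N by blast
qed

text \<open>\<open>Y\<close> is the image of \<open>M\<close> under \<open>fv\<close>, and the form
  pairs \<open>e\<close> with the \<open>wv\<close> part of a lift. Total singularity makes this
  independent of the lift and alternating; maximality turns the inclusion into an equality.\<close>

lemma maximal_mod_sp:
 fixes M :: "('k::field^('m::finite+'m)) set"
 assumes M: "maximal_totally_singular M" shows "EX Y g. vec.subspace Y & alt_on Y g & M = mod_sp Y g"
proof -
 have ts: "totally_singular M" "vec.subspace M" "!!v. v:M ==> dotp (fv v) (wv v) = 0"
  using M unfolding maximal_totally_singular_def totally_singular_def form_dotp by blast+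
 interpret F: Vector_Spaces.linear "(*s)" "(*s)" "fv :: 'k^('m+'m) => _" by (rule linear_fv)
 let ?Y = "fv ` M"
 have Y: "vec.subspace ?Y" by (rule F.subspace_image[OF ts(2)])
 define g where "g f e = dotp e (wv (SOME v. v:M & fv v = f))" for f e
 have g: "g (fv v) e = dotp e (wv v)" if v: "v:M" and e: "e:?Y" for v e
 proof -
  let ?u = "SOME u. u:M & fv u = fv v"
  have u: "?u:M & fv ?u = fv v" by (rule someI_ex) (use v in blast)
  obtain x where x: "x:M" "e = fv x" using e by blast
  have "bf x ?u = bf x v" using ts_bf[OF ts(1) x(1)] u v by simp
  then show ?thesis unfolding g_def using u x(2) by (simp add: bf_def)
 qed
 have "alt_on ?Y g"
  unfolding alt_on_def
 proof (intro conjI ballI allI)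
  fix a assume a: "a:?Y"
  then obtain x where x: "x:M" "a = fv x" by blast
  show "g a a = 0" using g[OF x(1) a] ts(3)[OF x(1)] x(2) by simp
  fix b assume b: "b:?Y"
  then obtain y where y: "y:M" "b = fv y" by blast
  show "g b a = - g a b" using g[OF x(1) b] g[OF y(1) a] ts_bf[OF ts(1) x(1) y(1)] x(2) y(2) by (simp add: bf_def eq_neg_iff_add_eq_0)
  show "g a (t *s b) = t * g a b" for t using g[OF x(1)] b vec.subspace_scale[OF Y b] x(2) by (simp add: dotp_simps)
  show "g a (b + c) = g a b + g a c" if "c:?Y" for c using g[OF x(1)] b that vec.subspace_add[OF Y b that] x(2) by (simp add: dotp_simps)
 qed
 moreover have "M <= mod_sp ?Y g" using g by (auto simp: mod_sp_def)
 ultimately show ?thesis using M mod_sp_ts[OF Y] Y unfolding maximal_totally_singular_def by metis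
qed

text \<open>The reference subspace in \<open>half_spin_points\<close> is \<open>mod_sp {0}\<close>
  with the zero form. It meets \<open>mod_sp Y g\<close> in a subspace of codimension
  \<open>dim Y\<close>.\<close>

lemma half_spin_iff:
 fixes Y :: "('k::field^'m::finite) set"
 assumes Y: "vec.subspace Y" "alt_on Y g" shows "mod_sp Y g:half_spin_points <-> even (vec.dim Y)"
proof -
 have Z: "vec.subspace {0 :: 'k^'m}" "alt_on {0 :: 'k^'m} (%a b. 0)" by (simp_all add: alt_on_def)
 have z: "{v :: 'k^('m+'m). ALL i. v $ Inr i = 0} = mod_sp {0} (%a b. 0)" by (auto simp: mod_sp_def fv_def vec_eq_iff dotp_simps)
 note d = mod_sp_dim[OF Y Z]
 have s: "ssum Y {0} = Y" using ssum_least[of Y Y "{0}"] ssum_ub1[of Y "{0}"] Y(1) vec.subspace_0[OF Y(1)] by blast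
 have R: "{f:Y Int {0}. ALL e:Y Int {0}. g f e = 0} = {0}" using vec.subspace_0[OF Y(1)] alt_onD(5)[OF Y(2,1)] by auto
 have "vec.dim (mod_sp Y g Int mod_sp {0} (%a b. 0)) + vec.dim Y = CARD('m)" using d unfolding s R by simp
 then have "vec.dim (mod_sp Y g) - vec.dim (mod_sp Y g Int mod_sp {0} (%a b. 0)) = vec.dim Y" unfolding mod_sp_card[OF Y] by linarith
 then show ?thesis unfolding half_spin_points_def same_class_def mem_Collect_eq z using mod_sp_maximal[OF Y] by simp
qed

lemma maximal_dim: "maximal_totally_singular (M :: ('k::field^('m::finite+'m)) set) ==> vec.dim M = CARD('m)"
 using maximal_mod_sp[of M] mod_sp_card by (metis (no_types))

lemma maximal_parity:
 fixes M N :: "('k::field^('m::finite+'m)) set"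
 assumes "maximal_totally_singular M" "maximal_totally_singular N"
 shows "even (vec.dim (M Int N) + CARD('m)) <-> (M:half_spin_points <-> N:half_spin_points)"
proof -
 obtain Y g where M: "vec.subspace Y" "alt_on Y g" "M = mod_sp Y g" using maximal_mod_sp[OF assms(1)] by (elim exE conjE)
 obtain Y' g' where N: "vec.subspace Y'" "alt_on Y' g'" "N = mod_sp Y' g'" using maximal_mod_sp[OF assms(2)] by (elim exE conjE)
 show ?thesis unfolding M(3) N(3) half_spin_iff[OF M(1,2)] half_spin_iff[OF N(1,2)] using mod_sp_parity[OF M(1,2) N(1,2)] by presburger
qed

end

section \<open>Collinearity and lines in the half-spin geometry\<close>

context begin

interpretation subspace_calculus "(*s) :: 'k::field => 'k^'n => 'k^'n" cart_basis by unfold_locales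

lemma tsD: "totally_singular U ==> vec.subspace U" "totally_singular U ==> u:U ==> hyperbolic_form u = 0"
 unfolding totally_singular_def by simp_all

lemma maxD: "maximal_totally_singular M ==> totally_singular M"
 unfolding maximal_totally_singular_def by simp

lemma ts_insert:
 assumes U: "totally_singular U" and v: "hyperbolic_form v = 0" "!!u. u:U ==> bf v u = 0"
 shows "totally_singular (vec.span (insert v U))"
 unfolding totally_singular_def
proof (intro conjI ballI)
 fix x assume "x:vec.span (insert v U)"
 then obtain t where "x - t *s v:vec.span U" unfolding vec.span_insert by blast
 then have "x - t *s v:U" unfolding vec.span_eq_iff[THEN iffD2, OF tsD(1)[OF U]] .
 then have "hyperbolic_form (t *s v + (x - t *s v)) = 0"
  unfolding form_add using tsD(2)[OF U] v by (simp add: form_scale bf_simps(3))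
 then show "hyperbolic_form x = 0" by simp
qed simp

lemma max_absorb:
 assumes M: "maximal_totally_singular M" and C: "totally_singular C" "!!c m. c:C ==> m:M ==> bf c m = 0"
 shows "C <= M"
proof
 fix c assume c: "c:C"
 have "totally_singular (vec.span (insert c M))" by (rule ts_insert[OF maxD[OF M] tsD(2)[OF C(1) c] C(2)[OF c]])
 moreover have "M <= vec.span (insert c M)" using vec.span_superset[of "insert c M"] by blast
 ultimately have "vec.span (insert c M) = M" using M unfolding maximal_totally_singular_def by blast
 then show "c:M" using vec.span_superset[of "insert c M"] by blast
qed

lemma bf_ssum: "(!!a. a:A ==> bf c a = 0) ==> (!!b. b:B ==> bf c b = 0) ==> x:ssum A B ==> bf c x = 0"
proof -
 assume h: "!!a. a:A ==> bf c a = 0" "!!b. b:B ==> bf c b = 0" "x:ssum A B"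
 have "bf c 0 = 0" using bf_simps(4)[of c 0 c] by simp
 then have "vec.subspace {x. bf c x = 0}" by (intro vec.subspaceI) (simp_all add: bf_simps(2,4))
 then have "ssum A B <= {x. bf c x = 0}" by (rule ssum_least[rotated 2]) (use h in auto)
 then show ?thesis using h(3) by blast
qed

lemma ts_in_max: "totally_singular (U :: ('k::field^('m::finite+'m)) set) ==> EX M. maximal_totally_singular M & U <= M"
proof -
 assume U: "totally_singular U"
 have "vec.dim N <= CARD('m+'m)" for N :: "('k^('m+'m)) set" using vec.dim_subset_UNIV[of N] by (simp add: vec.dimension_def card_cart_basis)
 then obtain N where N: "totally_singular N & U <= N" "ALL N'. totally_singular N' & U <= N' --> vec.dim N' <= vec.dim N"
  using ex_has_greatest_nat[of "%N. totally_singular N & U <= N" U vec.dim "Suc CARD('m+'m)"] U by (metis le_imp_less_Suc order_refl)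
 have "N' = N" if "totally_singular N'" "N <= N'" for N'
  using subspace_eqI[OF tsD(1) tsD(1) that(2)] N that by blast
 then show ?thesis using N unfolding maximal_totally_singular_def by blast
qed

text \<open>Exchanging the two halves of the coordinates turns \<open>bf\<close> into
  \<open>dotp\<close>, so the dimension is that of an annihilator.\<close>

lemma polar_gr:
 fixes U :: "('k::field^('m::finite+'m)) set"
 assumes "gr k U" shows "gr (2 * CARD('m) - k) {v. ALL u:U. bf v u = 0}"
proof -
 let ?s = "%v :: 'k^('m+'m). pr (fv v) (wv v)"
 have ls: "Vector_Spaces.linear (*s) (*s) ?s" by unfold_locales (auto simp: pr_def fv_def wv_def vec_eq_iff split: sum.splits)
 interpret s: Vector_Spaces.linear "(*s)" "(*s)" ?s by (rule ls)
 have inj: "inj_on ?s A" for A by (rule inj_on_inverseI[of _ ?s]) simp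
 have "bf v u = dotp (?s u) v" for v u :: "'k^('m+'m)"
  unfolding dotp_def[of "?s u"] by (subst UNIV_Plus_UNIV[symmetric], subst sum.Plus) (simp_all add: pr_def bf_def dotp_def fv_def wv_def mult.commute)
 then show ?thesis using ann_gr[of k "?s ` U"] vec.dim_image_eq[OF ls inj, of U] s.subspace_image[of U] assms by (simp add: ann_def gr_def)
qed

lemma ts_dim_max:
 fixes N :: "('k::field^('m::finite+'m)) set"
 assumes "totally_singular N" "vec.dim N = CARD('m)" shows "maximal_totally_singular N"
proof -
 obtain M where M: "maximal_totally_singular M" "N <= M" using ts_in_max[OF assms(1)] by blast
 have "N = M" by (rule subspace_eqI[OF tsD(1)[OF assms(1)] tsD(1)[OF maxD[OF M(1)]] M(2)]) (simp add: maximal_dim[OF M(1)] assms(2))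
 then show ?thesis using M by simp
qed

text \<open>The perp of the hyperplane \<open>H\<close> of \<open>M\<close> is larger than
  \<open>M\<close>. A vector of it outside \<open>M\<close> becomes singular after adding a multiple
  of some \<open>m\<close> in \<open>M\<close>, and together with \<open>H\<close> it spans the
  other maximal subspace.\<close>

lemma max_swap:
 fixes M :: "('k::field^('m::finite+'m)) set"
 assumes M: "maximal_totally_singular M" and H: "gr k H" "H <= M" "Suc k = CARD('m)"
 shows "EX N. maximal_totally_singular N & M Int N = H"
proof -
 note tM = maxD[OF M]
 have gM: "gr CARD('m) M" using maximal_dim[OF M] tsD(1)[OF tM] by (simp add: gr_def)
 obtain v where v: "ALL u:H. bf v u = 0" "v ~: M" using H(3) polar_gr[OF H(1)] gr_ex[OF gM] by force
 have gp: "gr CARD('m) {v. ALL u:M. bf v u = 0}" using polar_gr[OF gM] by simp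
 obtain m where m: "m:M" "bf v m ~= 0" using ts_bf[OF tM] gr_eqI[OF gM gp] v(2) by auto
 \<comment> \<open>Since \<open>m\<close> is singular, the form takes the value
   \<open>hyperbolic_form v + c * bf v m\<close> at \<open>v + c *s m\<close>; this \<open>c\<close>
   makes it vanish.\<close>
 define c where "c = - (inverse (bf v m) * hyperbolic_form v)"
 have cm: "c *s m:M" using vec.subspace_scale[OF tsD(1)[OF tM] m(1)] .
 let ?v = "v + c *s m"
 have "hyperbolic_form ?v = hyperbolic_form v + c * bf v m" unfolding form_add form_scale bf_simps(4) using tsD(2)[OF tM m(1)] by simp
 also have "... = 0" unfolding c_def using m(2) by simp
 finally have Q: "hyperbolic_form ?v = 0" .
 have tH: "totally_singular H" using tM H unfolding totally_singular_def gr_def by blast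
 have vH: "bf ?v h = 0" if "h:H" for h
  using v(1) ts_bf[OF tM m(1), of h] that H(2) unfolding bf_simps(1,3) by auto
 let ?N = "vec.span (insert ?v H)"
 have nv: "?v ~: M" using v(2) vec.subspace_diff[OF tsD(1)[OF tM] _ cm, of ?v] by auto
 then have "?v ~: H" using H(2) by blast
 from gr_insert[OF H(1) this] have dN: "vec.dim ?N = CARD('m)" unfolding H(3) by (simp only: gr_def)
 have "x:H" if x: "x:M" "x:?N" for x
 proof -
  obtain t where "x - t *s ?v:vec.span H" using x(2) unfolding vec.span_insert by blast
  then have t: "x - t *s ?v:H" unfolding vec.span_eq_iff[THEN iffD2, OF tsD(1)[OF tH]] .
  have "t = 0"
  proof (rule ccontr)
   assume "t ~= 0"
   have "inverse t *s (t *s ?v):M" using vec.subspace_scale[OF tsD(1)[OF tM], of "t *s ?v" "inverse t"] vec.subspace_diff[OF tsD(1)[OF tM] x(1) subsetD[OF H(2) t]] by simp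
   then show False using nv \<open>t ~= 0\<close> by (simp only: vec.scale_scale) simp
  qed
  then show ?thesis using t by simp
 qed
 then show ?thesis using H(2) vec.span_superset[of "insert ?v H"] ts_dim_max[OF ts_insert[OF tH Q vH] dN] by auto
qed

text \<open>The intersection of two points has odd dimension, so the bound leaves 3 for different
  collinear points and 5 for equal ones; like \<open>col\<close> the relation is reflexive on
  points.\<close>

definition hcol :: "('k::field^(5+5)) set => ('k^(5+5)) set => bool" where "hcol M N <-> 3 <= vec.dim (M Int N)"

lemma ptsD:
 assumes "M:half_spin_points" shows "maximal_totally_singular M" "gr 5 (M :: ('k::field^(5+5)) set)" "vec.subspace M" "totally_singular M"
proof -
 show 1: "maximal_totally_singular M" using assms unfolding half_spin_points_def by simp
 show "gr 5 M" "vec.subspace M" "totally_singular M" using maximal_dim[OF 1] tsD(1)[OF maxD[OF 1]] maxD[OF 1] by (simp_all add: gr_def)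
qed

lemma pts_odd:
 fixes M N :: "('k::field^(5+5)) set"
 assumes "M:half_spin_points" "N:half_spin_points" shows "odd (vec.dim (M Int N))"
 using maximal_parity[OF ptsD(1)[OF assms(1)] ptsD(1)[OF assms(2)]] assms by simp

lemma hcolI: "M:half_spin_points ==> N:half_spin_points ==> 2 <= vec.dim (M Int N) ==> hcol M N"
 using pts_odd[of M N] unfolding hcol_def by (cases "vec.dim (M Int N) = 2") auto

lemma hcol_sub: "gr k U ==> 2 <= k ==> U <= M ==> U <= N ==> M:half_spin_points ==> N:half_spin_points ==> hcol M N"
 by (rule hcolI) (auto intro: order_trans[OF _ gr_dim_ge[of k U "M Int N"]])

lemma hcol_dim:
 assumes M: "M:half_spin_points" "N:half_spin_points" "hcol M N" "M ~= (N :: ('k::field^(5+5)) set)"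
 shows "gr 3 (M Int N)"
proof -
 note g = ptsD(2)[OF M(1)] ptsD(2)[OF M(2)]
 have "vec.dim (M Int N) <= 5" by (rule gr_dim_le[OF Int_lower1 g(1)])
 moreover have "vec.dim (M Int N) ~= 5"
 proof
  assume "vec.dim (M Int N) = 5"
  note h = gr_inter[OF g this]
  show False using gr_eqI[OF h g(1)] gr_eqI[OF h g(2)] M(4) by blast
 qed
 moreover have "vec.dim (M Int N) ~= 4" using pts_odd[OF M(1,2)] by auto
 ultimately have "vec.dim (M Int N) = 3" using M(3) unfolding hcol_def by linarith
 then show ?thesis by (rule gr_inter[OF g])
qed

lemma hcol_dim3:
 "M:half_spin_points ==> N:half_spin_points ==> hcol M N ==> M ~= (N :: ('k::field^(5+5)) set) ==> vec.dim (M Int N) = 3"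
 using hcol_dim[of M N] by (simp add: gr_def)

text \<open>\<open>C\<close> is orthogonal to \<open>X\<close> inside \<open>L\<close> and to
  \<open>B\<close> inside \<open>N\<close>, hence to all of \<open>M\<close>, and a maximal totally
  singular subspace absorbs such a \<open>C\<close>.\<close>

lemma max_triangle:
 fixes M :: "('k::field^('m::finite+'m)) set"
 assumes M: "maximal_totally_singular M" and L: "totally_singular L" "totally_singular N"
  and X: "X <= L" "B <= N" "ssum X B = M" and C: "C <= L" "C <= N" "vec.subspace C"
 shows "C <= M"
proof (rule max_absorb[OF M])
 show "totally_singular C" using C L(1) unfolding totally_singular_def by blast
 fix c m assume c: "c:C" and m: "m:M"
 show "bf c m = 0" by (rule bf_ssum[of X c B]) (use c m X C ts_bf[OF L(1)] ts_bf[OF L(2)] in blast)+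
qed

text \<open>Two exchanges, over a 4-space \<open>H\<close> to \<open>L\<close> and over a 4-space
  \<open>K\<close> of \<open>L\<close> to \<open>N\<close>, with \<open>H Int K = X\<close>. By
  \<open>max_triangle\<close> the intersection of \<open>M\<close> and \<open>N\<close> lies in
  \<open>L\<close>, hence in \<open>X\<close>; two exchanges lead back to the same class.\<close>

lemma pts_through:
 fixes M :: "('k::field^(5+5)) set"
 assumes M: "M:half_spin_points" and X: "gr 3 X" "X <= M" shows "EX N:half_spin_points. M Int N = X"
proof -
 note m = ptsD[OF M]
 obtain H where H: "gr 4 H" "X <= H" "H <= M" using gr_sub[OF m(2) _ X(2) grD(1)[OF X(1)], of 4] X(1) by (auto simp: gr_def)
 obtain L where L: "maximal_totally_singular L" "M Int L = H" using max_swap[OF m(1) H(1,3)] by auto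
 have gL: "gr 5 L" using maximal_dim[OF L(1)] tsD(1)[OF maxD[OF L(1)]] by (simp add: gr_def)
 have XL: "X <= L" "H <= L" using H L(2) by blast+
 obtain v where v: "v:L" "v ~: H" using gr_ex[OF H(1) gL] by auto
 have vX: "v ~: X" using v(2) H(2) by blast
 let ?K = "vec.span (insert v X)"
 have K: "gr 4 ?K" using gr_insert[OF X(1) vX] by simp
 have KL: "?K <= L" "X <= ?K" "v:?K"
  by (rule vec.span_minimal, use v XL grD(1)[OF gL] in \<open>simp_all add: vec.span_base subset_iff\<close>)
 obtain N where N: "maximal_totally_singular N" "L Int N = ?K" using max_swap[OF L(1) K KL(1)] by auto
 have HK: "H ~= ?K" using v(2) KL(3) by blast
 have "vec.dim (H Int ?K) <= 4" by (rule gr_dim_le[OF Int_lower1 H(1)])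
 moreover have "vec.dim (H Int ?K) ~= 4"
  proof
   assume "vec.dim (H Int ?K) = 4"
   note h = gr_inter[OF H(1) K this]
   show False using gr_eqI[OF h H(1)] gr_eqI[OF h K] HK by blast
  qed
 ultimately have d: "vec.dim (H Int ?K) = 3" using gr_inter_ge[OF H(1) K XL(2) KL(1) gL] by simp
 have XHK: "X = H Int ?K" by (rule gr_eqI[OF X(1) gr_inter[OF H(1) K d]]) (use H(2) KL(2) in blast)
 have "gr 5 (ssum H ?K)" by (rule gr_ssum[OF H(1) K]) (use d in simp)
 then have "ssum H ?K = L" by (rule gr_eqI[OF _ gL]) (rule ssum_le[OF XL(2) KL(1) gL])
 then have "M Int N <= L"
  by (intro max_triangle[OF L(1) m(4) maxD[OF N(1)] H(3)] vec.subspace_inter) (use N m tsD(1)[OF maxD[OF N(1)]] in auto)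
 then have "M Int N = X" using L(2) N(2) XHK by blast
 then show ?thesis using maximal_parity[OF m(1) L(1)] maximal_parity[OF L(1) N(1)] M L(2) N(2) H(1) K gr_def by metis
qed

text \<open>A line is the set of points collinear with all common neighbours of two of its points.
  If \<open>K\<close> is collinear with \<open>M\<close> and \<open>N\<close>, then either it
  contains a 2-space of \<open>M Int N\<close>, or its intersections with \<open>M\<close> and
  \<open>N\<close> generate it, and then \<open>max_triangle\<close> puts \<open>M Int N\<close>
  into \<open>K\<close>. Conversely, if \<open>L\<close> misses a vector of \<open>M Int N\<close>,
  a neighbour \<open>K\<close> of \<open>M\<close> and \<open>N\<close> is built whose intersection
  with \<open>L\<close> is too small.\<close>

theorem pts_line:
 fixes M N :: "('k::field^(5+5)) set"
 assumes M: "M:half_spin_points" "N:half_spin_points" "hcol M N" "M ~= N" and L: "L:half_spin_points"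
 shows "M Int N <= L <-> (ALL K:half_spin_points. hcol K M --> hcol K N --> hcol K L)"
proof -
 let ?U = "M Int N"
 note U = hcol_dim[OF M] and m = ptsD[OF M(1)] and n = ptsD[OF M(2)] and l = ptsD[OF L]
 show ?thesis
 proof (intro iffI ballI impI)
  fix K assume UL: "?U <= L" and K: "K:half_spin_points" "hcol K M" "hcol K N"
  note k = ptsD[OF K(1)]
  let ?A = "K Int M" and ?B = "K Int N"
  have gA: "gr (vec.dim ?A) ?A" "gr (vec.dim ?B) ?B" using k m n by (simp_all add: gr_def vec.subspace_inter)
  have i: "?A Int ?B = K Int ?U" by blast
  show "hcol K L"
  proof (cases "2 <= vec.dim (K Int ?U)")
   case True
   have "vec.dim (K Int ?U) <= vec.dim (K Int L)" by (rule vec.dim_subset) (use UL in blast)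
   then show ?thesis using True by (intro hcolI[OF K(1) L]) linarith
  next
   case False
   have s: "ssum ?A ?B <= K" by (rule ssum_least[OF _ _ k(3)]) auto
   have e: "ssum ?A ?B = K" using subspace_eqI[OF _ k(3) s] k(2) dim_ssum_gr[OF gA] i False K(2,3) by (simp add: gr_def hcol_def)
   have "?U <= K" by (rule max_triangle[OF k(1) m(4) n(4) _ _ e]) (use m n in \<open>auto intro: vec.subspace_inter\<close>)
   then have "K Int ?U = ?U" by blast
   then show ?thesis using False U by (simp add: gr_def)
  qed
 next
  assume h: "ALL K:half_spin_points. hcol K M --> hcol K N --> hcol K L"
  show "?U <= L"
  proof (rule ccontr)
   assume nU: "~ ?U <= L"
   let ?B = "M Int L"
   have B: "gr 3 ?B" using m(2) h M(1,3) hcol_dim[OF M(1) L] nU by (auto simp: gr_def hcol_def)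
   obtain u where u: "u:?U" "u ~: L" using nU by blast
   have uB: "u ~: ?B" "u ~= 0" using u(2) vec.subspace_0[OF l(3)] by auto
   have "gr 1 (vec.span {u})" using uB by (simp add: gr_def)
   then obtain w where w: "w:?U" "w ~: vec.span {u}" using gr_ex[OF _ U, of 1] by auto
   let ?P = "vec.span {u, w}"
   have P: "gr 2 ?P" using dim_ins[OF w(2)] uB(2) by (simp add: gr_def insert_commute)
   have PU: "?P <= ?U" by (rule vec.span_minimal) (use u w grD(1)[OF U] in auto)
   have PM: "?P <= M" using PU by blast
   let ?S = "ssum ?P ?B"
   have gS: "gr (vec.dim ?S) ?S" by (simp add: gr_def)
   have g4: "gr 4 (vec.span (insert u ?B))" using gr_insert[OF B uB(1)] by simp
   have "vec.span (insert u ?B) <= ?S"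
    by (rule vec.span_minimal) (use ssum_ub2[of ?B ?P] subsetD[OF ssum_ub1[of ?P ?B] vec.span_base[of u "{u, w}"]] in auto)
   then have S4: "4 <= vec.dim ?S" by (rule gr_dim_ge[OF g4])
   \<comment> \<open>\<open>x\<close> makes \<open>?X\<close> and \<open>?B\<close> generate
     \<open>M\<close>. They then meet in a 1-space, and \<open>max_triangle\<close> forces
     \<open>K Int L\<close> into this 1-space.\<close>
   obtain x where x: "x:M" "x ~: ?P" "?S = M | x ~: ?S"
   proof (cases "?S = M")
    case True then show ?thesis using gr_ex[OF P m(2)] that by auto
   next
    case False then show ?thesis using that ssum_le[OF PM Int_lower1 m(2)] ssum_ub1[of ?P ?B] by blast
   qed
   let ?X = "vec.span (insert x ?P)"
   have X: "gr 3 ?X" using gr_insert[OF P x(2)] by simp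
   have XM: "?X <= M" by (rule vec.span_minimal) (use x(1) PM m(3) in auto)
   have PX: "?P <= ?X" "x:?X" by (rule span_ins)+
   have XB: "ssum ?X ?B = M"
   proof
    show le: "ssum ?X ?B <= M" by (rule ssum_le[OF XM Int_lower1 m(2)])
    have ge: "?S <= ssum ?X ?B" "x:ssum ?X ?B" using ssum_mono[OF PX(1), of ?B ?B] subsetD[OF ssum_ub1 PX(2)] by auto
    show "M <= ssum ?X ?B"
    proof (cases "?S = M")
     case False
     then have "gr (Suc (vec.dim ?S)) (vec.span (insert x ?S))" using gr_insert[OF gS] x(3) by blast
     moreover have "vec.span (insert x ?S) <= ssum ?X ?B" by (rule vec.span_minimal) (use ge in auto)
     ultimately have "Suc (vec.dim ?S) <= vec.dim (ssum ?X ?B)" by (rule gr_dim_ge)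
     then show ?thesis using subspace_eqI[OF _ m(3) le] m(2) S4 by (simp add: gr_def)
    qed (use ge in simp)
   qed
   obtain K where K: "K:half_spin_points" "M Int K = ?X" using pts_through[OF M(1) X XM] by blast
   note k = ptsD[OF K(1)]
   have XK: "?X <= K" using K(2) by blast
   have "hcol K M" by (rule hcol_sub[OF X _ XK XM K(1) M(1)]) simp
   moreover have "hcol K N" by (rule hcol_sub[OF P _ _ _ K(1) M(2)]) (use PX XK PU in auto)
   ultimately have KL: "hcol K L" using h K(1) by blast
   show False using K(2) KL vec.dim_subset[of "K Int L" "?X Int ?B"] dim_ssum_gr[OF X B] XB m(2) max_triangle[OF m(1) k(4) l(4) XK Int_lower2 XB Int_lower1 Int_lower2 vec.subspace_inter[OF k(3) l(3)]] by (auto simp: gr_def hcol_def)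
  qed
 qed
qed

lemma pts_meet:
 assumes U: "totally_singular (U :: ('k::field^(5+5)) set)" "vec.dim U = 3"
 shows "EX M:half_spin_points. EX N:half_spin_points. M ~= N & M Int N = U"
proof -
 have gU: "gr 3 U" using U tsD(1)[OF U(1)] by (simp add: gr_def)
 obtain M where M: "maximal_totally_singular M" "U <= M" using ts_in_max[OF U(1)] by blast
 have gM: "gr 5 M" using maximal_dim[OF M(1)] tsD(1)[OF maxD[OF M(1)]] by (simp add: gr_def)
 have "EX M:half_spin_points. U <= M"
 proof (cases "M:half_spin_points")
  case False
  obtain H where H: "gr 4 H" "U <= H" "H <= M" using gr_sub[OF gM _ M(2) grD(1)[OF gU], of 4] gU by (auto simp: gr_def)
  obtain N where N: "maximal_totally_singular N" "M Int N = H" using max_swap[OF M(1) H(1,3)] by auto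
  then show ?thesis using maximal_parity[OF M(1) N(1)] H by (auto simp: gr_def)
 qed (use M in blast)
 then obtain M where M: "M:half_spin_points" "U <= M" by blast
 obtain N where N: "N:half_spin_points" "M Int N = U" using pts_through[OF M(1) gU M(2)] by blast
 have "M ~= N" using N(2) gU ptsD(2)[OF M(1)] by (auto simp: gr_def)
 then show ?thesis using M(1) N by blast
qed

end

section \<open>Solids and spinor subspaces\<close>

context subspace_calculus
begin

lemma gr3_pencil:
 assumes "4 <= dimension" "gr 3 A" "gr 3 B" "2 <= dim (A Int B)"
 shows "EX U W. gr 2 U & gr 4 W & U <= A & U <= B & A <= W & B <= W"
proof (cases "A = B")
 case False
 show ?thesis using gr3_adj[OF assms(2,3) False assms(4)] ssum_ub1[of A B] ssum_ub2[of B A] by blast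
next
 case True
 obtain U where "gr 2 U" "U <= A"
  using gr_sub[OF assms(2), of 2 "{0}"] subspace_0[OF grD(1)[OF assms(2)]] by auto
 moreover have "gr dimension UNIV" by (simp only: gr_def dimension_def dim_UNIV) simp
 then obtain W where "gr 4 W" "A <= W"
  using gr_sub[of dimension UNIV 4 A] assms by (auto simp: gr_def)
 ultimately show ?thesis using True by blast
qed

lemma gr3_two_pencils:
 assumes "gr 3 A" "gr 3 B" "gr 3 C" "A ~= B" "A Int B <= C" "2 <= dim (A Int B)" "~ C <= A #+ B"
 shows "gr 5 (A #+ B #+ C)" "(A #+ B) Int C = A Int B"
proof -
 note ab = gr3_adj[OF assms(1,2,4,6)]
 have "dim ((A #+ B) Int C) = 2"
 proof (rule antisym)
  show "2 <= dim ((A #+ B) Int C)" by (rule gr_dim_ge[OF ab(1)]) (use assms(5) ssum_ub1[of A B] in blast)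
  show "dim ((A #+ B) Int C) <= 2"
  proof (rule ccontr)
   assume "~ ?thesis"
   moreover have "dim ((A #+ B) Int C) <= 3" by (rule gr_dim_le[OF _ assms(3)]) blast
   ultimately have "dim ((A #+ B) Int C) = 3" by linarith
   then show False using gr_eqI[OF gr_inter[OF ab(2) assms(3)] assms(3)] assms(7) by auto
  qed
 qed
 then have g: "gr 2 ((A #+ B) Int C)" by (rule gr_inter[OF ab(2) assms(3)])
 show "(A #+ B) Int C = A Int B" using assms(5) ssum_ub1[of A B] gr_eqI[OF ab(1) g] by auto
 show "gr 5 (A #+ B #+ C)" by (rule gr_ssum[OF ab(2) assms(3)]) (use g in \<open>simp add: gr_def\<close>)
qed

end

section \<open>Directions and solids\<close>

context locally_grassmannian
begin

definition dir :: "'p => 'p => 'v set" where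
 "dir p a = ph p (SOME l. l:lines G & p:l & a:l)"

lemma dir:
 assumes "col p a" "a ~= p"
 shows "gr 3 (dir p a)" "a:ln p (dir p a)" "ln p (dir p a):lines G" "p:ln p (dir p a)"
proof -
 let ?l = "SOME l. l:lines G & p:l & a:l"
 have "EX l. l:lines G & p:l & a:l" using ex_line[OF assms(1)] assms(2) by blast
 then have l: "?l:lines G & p:?l & a:?l" by (rule someI_ex)
 have e: "ln p (dir p a) = ?l" unfolding dir_def using ln_phi l by blast
 show "gr 3 (dir p a)" unfolding dir_def using phi_gr l by blast
 show "a:ln p (dir p a)" "ln p (dir p a):lines G" "p:ln p (dir p a)" using e l by simp_all
qed

lemma dir_eqI:
 assumes "p:points G" "gr 3 A" "a:ln p A" "a ~= p"
 shows "dir p a = A" "col p a"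
proof -
 show c: "col p a" by (rule col_line[OF ln(1)[OF assms(1,2)] ln(2)[OF assms(1,2)] assms(3)])
 show "dir p a = A" using ln_inj[OF assms(1) dir(1)[OF c assms(4)] assms(2) dir(2)[OF c assms(4)] assms(3,4)] .
qed

lemma dir_phi:
 assumes "l:lines G" "p:l" "a:l" "a ~= p" shows "dir p a = ph p l"
 by (rule dir_eqI[OF line_points[OF assms(1,2)] phi_gr[OF assms(1,2)]])
  (use assms ln_phi[OF assms(1,2)] in simp_all)

lemma col_dir:
 assumes "p:points G" "col p a" "a ~= p" "col p b" "b ~= p"
 shows "col a b <-> 2 <= dim (dir p a Int dir p b)"
 by (rule col_ln[OF assms(1) dir(1)[OF assms(2,3)] dir(1)[OF assms(4,5)] dir(2)[OF assms(2,3)] dir(2)[OF assms(4,5)] assms(3,5)])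

lemma dir_pencil:
 assumes p: "p:points G" and a: "col p a" "a ~= p" and b: "col p b" "b ~= p" and ab: "col a b" "dir p a ~= dir p b"
  and k: "k:lines G" "a:k" "b:k"
 shows "s:k ==> s ~= p & col p s & dir p a Int dir p b <= dir p s & dir p s <= dir p a #+ dir p b"
  and "gr 3 C ==> dir p a Int dir p b <= C ==> C <= dir p a #+ dir p b ==> EX s:k. s ~= p & col p s & dir p s = C"
proof -
 note A = dir[OF a] and B = dir[OF b]
 have ne: "ln p (dir p a) ~= ln p (dir p b)" using ln(3)[OF p A(1)] ln(3)[OF p B(1)] ab(2) by metis
 have anb: "a ~= b" using ab(2) by blast
 have pab: "2 <= dim (dir p a Int dir p b)" using col_dir[OF p a b] ab(1) by blast
 {
  assume s: "s:k"
  have sp: "s ~= p" using s line_eq[OF k(1) A(3) _ A(4) k(2) A(2)] line_eq[OF k(1) B(3) _ B(4) k(3) B(2)] a b ne by auto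
  note S = dir[OF col_all[OF k anb a(1) b(1) s] sp]
  show "s ~= p & col p s & dir p a Int dir p b <= dir p s & dir p s <= dir p a #+ dir p b"
   using S s pencil_iff[OF A(3) B(3) A(4) B(4) ne A(2) a(2) B(2) b(2) ab(1) k S(3,4)] ln(3)[OF p A(1)] ln(3)[OF p B(1)] ln(3)[OF p S(1)] col_all[OF k anb a(1) b(1) s] sp
   by auto
 }
 assume C: "gr 3 C" "dir p a Int dir p b <= C" "C <= dir p a #+ dir p b"
 obtain s where "s:k" "s:ln p C" "s ~= p"
  using pencil_ln[OF p A(1) B(1) C(1) ab(2) pab C(2,3) A(2) a(2) B(2) b(2) k] by blast
 then show "EX s:k. s ~= p & col p s & dir p s = C" using dir_eqI[OF p C(1)] by blast
qed

definition coplanar :: "'p set => bool" where "coplanar S <-> (EX X:planes G. S <= X)"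

lemma coplanarI:
 assumes p: "p:points G" and S: "!!a. a:S ==> a = p | col p a & U <= dir p a & dir p a <= W" and U: "gr 2 U" "gr 4 W" "U <= W"
 shows "coplanar S"
proof -
 obtain X where X: "X:planes G" "p:X" "ALL l:lines G. p:l --> (l <= X <-> U <= ph p l & ph p l <= W)"
  using pencil_plane[OF p U] by (elim bexE conjE)
 have "a:X" if "a:S" for a
 proof (cases "a = p")
  case True then show ?thesis using X(2) by simp
 next
  case False
  then have h: "col p a" "U <= dir p a" "dir p a <= W" using S[OF that] by auto
  note A = dir[OF h(1) False]
  show ?thesis using X(3) A(3,4) h ln(3)[OF p A(1)] A(2) by auto
 qed
 then show ?thesis unfolding coplanar_def using X(1) by blast
qed

lemma coplanarD:
 assumes "coplanar S" "p:S" "p:points G"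
 shows "EX U W. gr 2 U & gr 4 W & (ALL a:S. a ~= p --> U <= dir p a & dir p a <= W)"
proof -
 obtain X where X: "X:planes G" "S <= X" using assms(1) unfolding coplanar_def by blast
 have pX: "p:X" using X assms(2) by blast
 obtain U W where U: "gr 2 U" "gr 4 W" "U <= W" "ALL l:lines G. p:l --> (l <= X <-> U <= ph p l & ph p l <= W)"
  using plane_pencil[OF pX X(1) assms(3)] by (elim exE conjE)
 have "U <= dir p a & dir p a <= W" if a: "a:S" "a ~= p" for a
 proof -
  have aX: "a:X" using a X by blast
  obtain l where l: "l:lines G" "l <= X" "p:l" "a:l" using plane_line[OF X(1) pX aX] a(2) by metis
  then show ?thesis using U(4) dir_phi[OF l(1,3,4) a(2)] by simp
 qed
 then show ?thesis using U(1,2) by blast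
qed

definition tetra :: "'p => 'p => 'p => 'p => bool" where
 "tetra p a b c <-> p:points G & a:points G & b:points G & c:points G &
   p ~= a & p ~= b & p ~= c & a ~= b & a ~= c & b ~= c &
   col p a & col p b & col p c & col a b & col a c & col b c & ~ coplanar {p,a,b,c}"

lemma tetra_perm: "tetra p a b c ==> tetra a p b c" "tetra p a b c ==> tetra p b a c" "tetra p a b c ==> tetra p a c b"
 unfolding tetra_def using col_commute by (simp_all add: insert_commute) blast+

text \<open>By \<open>tetra_type\<close> it has dimension 5 if the three directions share a 2-space,
  and 4 otherwise. These are the two kinds of solids as seen from \<open>p\<close>.\<close>

definition tsum :: "'p => 'p => 'p => 'p => 'v set" where
 "tsum p a b c = dir p a #+ dir p b #+ dir p c"

lemma ssum_assoc: "A #+ B #+ C = A #+ (B #+ C)"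
proof
 show "A #+ B #+ C <= A #+ (B #+ C)"
  by (intro ssum_least subspace_ssum ssum_ub1) (meson ssum_ub1 ssum_ub2 subset_trans)+
 show "A #+ (B #+ C) <= A #+ B #+ C"
  by (intro ssum_least subspace_ssum ssum_ub2) (meson ssum_ub1 ssum_ub2 subset_trans)+
qed

lemma tsum_perm: "tsum p a b c = tsum p b a c" "tsum p a b c = tsum p a c b"
 unfolding tsum_def by (simp_all only: ssum_assoc ssum_commute) (metis ssum_assoc ssum_commute)+

lemma tsum_upper: "dir p a <= tsum p a b c" "dir p b <= tsum p a b c" "dir p c <= tsum p a b c"
 unfolding tsum_def by (meson ssum_ub1 ssum_ub2 subset_trans)+

lemma tetra_dirs:
 assumes "tetra p a b c"
 shows "gr 3 (dir p a)" "gr 3 (dir p b)" "gr 3 (dir p c)" "dir p a ~= dir p b" "dir p a ~= dir p c" "dir p b ~= dir p c"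
  "2 <= dim (dir p a Int dir p b)" "2 <= dim (dir p a Int dir p c)" "2 <= dim (dir p b Int dir p c)"
  "~ (dir p a Int dir p b <= dir p c & dir p c <= dir p a #+ dir p b)"
proof -
 have p: "p:points G" and ne: "a ~= p" "b ~= p" "c ~= p" and co: "col p a" "col p b" "col p c" "col a b" "col a c" "col b c"
  and np: "~ coplanar {p,a,b,c}" using assms unfolding tetra_def by auto
 show g: "gr 3 (dir p a)" "gr 3 (dir p b)" "gr 3 (dir p c)" using dir(1) co ne by blast+
 show adj: "2 <= dim (dir p a Int dir p b)" "2 <= dim (dir p a Int dir p c)" "2 <= dim (dir p b Int dir p c)"
  using col_dir[OF p] co ne by blast+
 have copl: False if U: "gr 2 U" "gr 4 W" "U <= dir p a" "U <= dir p b" "U <= dir p c" "dir p a <= W" "dir p b <= W" "dir p c <= W" for U W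
 proof -
  have "coplanar {p,a,b,c}" by (rule coplanarI[OF p _ U(1,2)]) (use U co in auto)
  then show False using np by blast
 qed
 have d4: "4 <= dimension" using dim7 by simp
 show "dir p a ~= dir p b" using gr3_pencil[OF d4 g(1,3) adj(2)] copl by metis
 show "dir p a ~= dir p c" using gr3_pencil[OF d4 g(1,2) adj(1)] copl by metis
 show "dir p b ~= dir p c" using gr3_pencil[OF d4 g(1,2) adj(1)] copl by metis
 show "~ (dir p a Int dir p b <= dir p c & dir p c <= dir p a #+ dir p b)"
 proof
  assume h: "dir p a Int dir p b <= dir p c & dir p c <= dir p a #+ dir p b"
  note ab = gr3_adj[OF g(1,2) \<open>dir p a ~= dir p b\<close> adj(1)]
  show False by (rule copl[OF ab _ _ _ ssum_ub1 ssum_ub2]) (use h in auto)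
 qed
qed

lemma tetra_type:
 assumes "tetra p a b c"
 shows "dir p a Int dir p b <= dir p c & gr 5 (tsum p a b c) & (dir p a #+ dir p b) Int dir p c = dir p a Int dir p b |
  dim (dir p a Int dir p b Int dir p c) = 1 & gr 4 (tsum p a b c) & tsum p a b c = dir p a #+ dir p b"
proof -
 note t = tetra_dirs[OF assms]
 show ?thesis
 proof (cases "dir p a Int dir p b <= dir p c")
  case True
  then show ?thesis using t(10) gr3_two_pencils[OF t(1,2,3,4) True t(7)] by (simp add: tsum_def)
 next
  case False
  then have h: "dir p c <= dir p a #+ dir p b" "dim (dir p a Int dir p b Int dir p c) = 1"
   using gr3_triple[OF t(1-9)] by auto
  show ?thesis using h gr3_adj[OF t(1,2,4,7)] antisym[OF ssum_least[OF subset_refl h(1) subspace_ssum] ssum_ub1] by (simp add: tsum_def)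
 qed
qed

lemma tetraI:
 assumes p: "p:points G" and g: "gr 3 A" "gr 3 B" "gr 3 C" and adj: "2 <= dim (A Int B)" "2 <= dim (A Int C)" "2 <= dim (B Int C)"
  and ne: "A ~= B" "A ~= C" "B ~= C" and n: "~ (A Int B <= C & C <= A #+ B)"
  and a: "a:ln p A" "b:ln p B" "c:ln p C" "a ~= p" "b ~= p" "c ~= p"
 shows "tetra p a b c"
proof -
 have pts: "a:points G" "b:points G" "c:points G" using a ln(1)[OF p] g line_points by blast+
 note A = dir_eqI[OF p g(1) a(1,4)] and B = dir_eqI[OF p g(2) a(2,5)] and C = dir_eqI[OF p g(3) a(3,6)]
 have "~ coplanar {p,a,b,c}"
   proof
    assume "coplanar {p,a,b,c}"
    then obtain U W where U: "gr 2 U" "gr 4 W" "ALL x:{p,a,b,c}. x ~= p --> U <= dir p x & dir p x <= W"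
     using coplanarD[OF _ _ p, of "{p,a,b,c}"] by blast
    then have u: "U <= A" "U <= B" "U <= C" "A <= W" "B <= W" "C <= W" using A B C a by auto
    show False using pencil_eq[OF g(1,2) ne(1) U(1,2) u(1,2,4,5)] n u by blast
   qed
 then show ?thesis unfolding tetra_def using p pts A B C a col_dir[OF p] adj ne by auto
qed

text \<open>Intrinsic form of the statement that the singular 3-space on \<open>p, a, b, c\<close> lies in a
 singular 5-space, which is what distinguishes the two kinds of singular 3-spaces when \<open>n > 6\<close>.\<close>

definition extensible :: "'p => 'p => 'p => 'p => bool" where
 "extensible p a b c <-> (EX d e. tetra p a d e & col b d & col b e & col c d & col c e &
   (ALL k:lines G. ALL k':lines G. b:k --> c:k --> d:k' --> e:k' -->
    (ALL s:k. ALL t:k'. ~ coplanar {p,a,s,t})))"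

text \<open>The point of the intrinsic condition: it treats the vertices \<open>p\<close> and
  \<open>a\<close> alike, whereas the dimension of \<open>tsum\<close> refers to \<open>p\<close>
  alone.\<close>

lemma extensible_sym: "extensible p a b c ==> extensible a p b c"
proof -
 assume "extensible p a b c"
 then obtain d e where de: "tetra p a d e" "col b d" "col b e" "col c d" "col c e"
  "ALL k:lines G. ALL k':lines G. b:k --> c:k --> d:k' --> e:k' --> (ALL s:k. ALL t:k'. ~ coplanar {p,a,s,t})"
  unfolding extensible_def by (elim exE conjE)
 have "{a,p,s,t} = {p,a,s,t}" for s t by blast
 then show ?thesis unfolding extensible_def using de tetra_perm(1)[OF de(1)]
  by (intro exI[of _ d] exI[of _ e]) simp
qed

text \<open>The points \<open>d0\<close>, \<open>e0\<close> are taken in directions that contain the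
  common 2-space \<open>?U\<close> and leave \<open>?W\<close> independently. If \<open>p\<close>,
  \<open>a\<close>, \<open>s\<close>, \<open>u\<close> were coplanar, the direction of
  \<open>u\<close> would be a 3-space of \<open>?W\<close> inside \<open>?D #+ ?E\<close>, but only
  a 2-space of that sum lies in \<open>?W\<close>.\<close>

lemma extensible_if_5:
 assumes t: "tetra p a b c" and 5: "gr 5 (tsum p a b c)"
 shows "extensible p a b c"
proof -
 let ?A = "dir p a" and ?B = "dir p b" and ?C = "dir p c"
 have p: "p:points G" and ne: "a ~= p" "b ~= p" "c ~= p" and co: "col p a" "col p b" "col p c" "col a b" "col a c" "col b c"
  using t unfolding tetra_def by auto
 have t': "tetra p b c a" using tetra_perm(2,3) t by blast
 note D = tetra_dirs[OF t']
 have g4: "~ gr 4 (tsum p a b c)" using 5 by (auto simp: gr_def)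
 have perm: "tsum p b c a = tsum p a b c" using tsum_perm by metis
 let ?U = "?B Int ?C"
 have UA: "?U <= ?A" and BC: "(?B #+ ?C) Int ?A = ?U"
  using tetra_type[OF t'] g4 perm by auto
 note bc = gr3_adj[OF D(1,2,4,7)]
 let ?W = "tsum p a b c"
 have gU: "gr dimension UNIV" by (simp only: gr_def dimension_def dim_UNIV) simp
 \<comment> \<open>Here \<open>n > 6\<close> enters: \<open>d\<close> and \<open>e\<close> are
   independent modulo the 5-space \<open>?W\<close>.\<close>
 obtain d where d: "d ~: ?W" using gr_ex[OF 5 gU] dim7 by auto
 have W6: "gr 6 (span (insert d ?W))" using gr_insert[OF 5 d] by simp
 obtain e where e: "e ~: span (insert d ?W)" using gr_ex[OF W6 gU] dim7 by auto
 have W7: "gr 7 (span (insert e (span (insert d ?W))))" using gr_insert[OF W6 e] by simp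
 have AW: "?A <= ?W" "?B <= ?W" "?C <= ?W" by (rule tsum_upper)+
 have UW: "?U <= ?W" using AW by blast
 let ?D = "span (insert d ?U)" and ?E = "span (insert e ?U)"
 have dU: "d ~: ?U" "e ~: ?U" using d e UW span_ins(1)[of ?W d] by blast+
 have gD: "gr 3 ?D" "gr 3 ?E" using gr_insert[OF bc(1) dU(1)] gr_insert[OF bc(1) dU(2)] by simp_all
 have UD: "?U <= ?D" "?U <= ?E" by (rule span_ins)+
 have dD: "d:?D" "e:?E" by (rule span_ins)+
 have adj: "2 <= dim (X Int Y)" if "?U <= X" "?U <= Y" for X Y
  by (rule gr_dim_ge[OF bc(1)]) (use that in blast)
 have D6: "?D <= span (insert d ?W)" by (rule span_mono) (use UW in blast)
 have DE: "?D ~= ?E" using dD D6 e by blast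
 have AD: "?A ~= ?D" "?A ~= ?E" using dD AW d e span_ins(1)[of ?W d] by blast+
 obtain d0 where d0: "d0:ln p ?D" "d0 ~= p" using ln_other[OF p gD(1)] by blast
 obtain e0 where e0: "e0:ln p ?E" "e0 ~= p" using ln_other[OF p gD(2)] by blast
 have tet: "tetra p a d0 e0"
 proof (rule tetraI[OF p D(3) gD adj[OF UA UD(1)] adj[OF UA UD(2)] adj[OF UD] AD DE _ dir(2)[OF co(1) ne(1)] d0(1) e0(1) ne(1) d0(2) e0(2)])
  have "?A #+ ?D <= span (insert d ?W)" by (rule ssum_le[OF _ D6 W6]) (use AW span_ins(1)[of ?W d] in blast)
  then show "~ (?A Int ?D <= ?E & ?E <= ?A #+ ?D)" using dD e by blast
 qed
 note DD = dir_eqI[OF p gD(1) d0] and EE = dir_eqI[OF p gD(2) e0]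
 have cols: "col b d0" "col b e0" "col c d0" "col c e0"
  using col_dir[OF p co(2) ne(2) DD(2) d0(2)] col_dir[OF p co(2) ne(2) EE(2) e0(2)]
   col_dir[OF p co(3) ne(3) DD(2) d0(2)] col_dir[OF p co(3) ne(3) EE(2) e0(2)] adj UD DD(1) EE(1) by simp_all
 have de: "col d0 e0" using tet unfolding tetra_def by blast
 have "~ coplanar {p,a,s,u}" if k: "k:lines G" "b:k" "c:k" "s:k" and k': "k':lines G" "d0:k'" "e0:k'" "u:k'"
  for k k' s u
 proof
  assume "coplanar {p,a,s,u}"
  then obtain P R where P: "gr 2 P" "gr 4 R" "ALL x:{p,a,s,u}. x ~= p --> P <= dir p x & dir p x <= R"
   using coplanarD[OF _ _ p, of "{p,a,s,u}"] by blast
  have s: "s ~= p" "col p s" "?U <= dir p s" "dir p s <= ?B #+ ?C"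
   using dir_pencil(1)[OF p co(2) ne(2) co(3) ne(3) co(6) D(4) k(1-3) k(4)] by auto
  have u: "u ~= p" "col p u" "dir p u <= ?D #+ ?E"
   using dir_pencil(1)[OF p DD(2) d0(2) EE(2) e0(2) de _ k'(1-3) k'(4)] DD(1) EE(1) DE by auto
  let ?S = "dir p s" and ?T = "dir p u"
  have gS: "gr 3 ?S" "gr 3 ?T" using dir(1) s u by blast+
  have RS: "?A <= R" "?S <= R" "?T <= R" using P(3) ne s u by auto
  have nAS: "?A ~= ?S" using s BC gr_le[OF D(3) bc(1)] by auto
  have RW: "R <= ?W" using gr3_adj[OF D(3) gS(1) nAS adj[OF UA s(3)]] gr_eqI[OF _ P(2)] ssum_le[OF RS(1,2) P(2)] ssum_le[OF AW(1) _ 5] s(4) ssum_le[OF AW(2,3) 5] by blast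
  have gDE: "gr 4 (?D #+ ?E)" using gr3_adj[OF gD DE adj[OF UD]] by blast
  have "insert e (span (insert d ?W)) <= ?W #+ (?D #+ ?E)"
  proof -
   have "?W <= ?W #+ (?D #+ ?E)" by (rule ssum_ub1)
   moreover have "?D <= ?W #+ (?D #+ ?E)" "?E <= ?W #+ (?D #+ ?E)"
    by (meson ssum_ub1 ssum_ub2 subset_trans)+
   ultimately have "insert d ?W <= ?W #+ (?D #+ ?E)" "e:?W #+ (?D #+ ?E)" using dD by blast+
   then show ?thesis using span_minimal[OF _ subspace_ssum] by blast
  qed
  then have "span (insert e (span (insert d ?W))) <= ?W #+ (?D #+ ?E)" by (rule span_minimal) simp
  then have "7 <= dim (?W #+ (?D #+ ?E))" by (rule gr_dim_ge[OF W7])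
  then have "dim (?W Int (?D #+ ?E)) <= 2" using dim_ssum_gr[OF 5 gDE] by linarith
  moreover have "3 <= dim (?W Int (?D #+ ?E))" by (rule gr_dim_ge[OF gS(2)]) (use RS RW u in blast)
  ultimately show False by simp
 qed
 then show ?thesis unfolding extensible_def using tet cols by blast
qed

text \<open>All directions involved are hyperplanes of the 4-space \<open>?W\<close>, that is,
  points of a projective 3-space. There the plane through \<open>A\<close>, \<open>B\<close>,
  \<open>C\<close> and the plane through \<open>A\<close>, \<open>D\<close>, \<open>E\<close> share
  a line through \<open>A\<close>, given by the 2-space \<open>P\<close>, and this line meets both
  \<open>BC\<close> and \<open>DE\<close>. The two meeting points are coplanar with \<open>p\<close>
  and \<open>a\<close>.\<close>

lemma extensible_not_4:
 assumes t: "tetra p a b c" and 4: "gr 4 (tsum p a b c)"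
 shows "~ extensible p a b c"
proof
 assume "extensible p a b c"
 then obtain d e where de: "tetra p a d e" "col b d" "col b e" "col c d" "col c e"
  "ALL k:lines G. ALL k':lines G. b:k --> c:k --> d:k' --> e:k' --> (ALL s:k. ALL t:k'. ~ coplanar {p,a,s,t})"
  unfolding extensible_def by (elim exE conjE)
 let ?A = "dir p a" and ?B = "dir p b" and ?C = "dir p c" and ?D = "dir p d" and ?E = "dir p e" and ?W = "tsum p a b c"
 have p: "p:points G" and ne: "a ~= p" "b ~= p" "c ~= p" and co: "col p a" "col p b" "col p c" "col a b" "col a c" "col b c"
  and bc: "b ~= c" using t unfolding tetra_def by auto
 have ne': "d ~= p" "e ~= p" and co': "col p d" "col p e" "col a d" "col a e" "col d e" and dne: "d ~= e"
  using de(1) unfolding tetra_def by auto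
 note T = tetra_dirs[OF t] and T' = tetra_dirs[OF de(1)]
 have AW: "?A <= ?W" "?B <= ?W" "?C <= ?W" by (rule tsum_upper)+
 have R1: "dim (?A Int ?B Int ?C) = 1" using 4 tetra_type[OF t] by (simp add: gr_def)
 \<comment> \<open>A direction outside \<open>?W\<close> meets it in at most a 2-space. This would
   be its intersection with each of \<open>A\<close>, \<open>B\<close>, \<open>C\<close>, which
   share only a 1-space.\<close>
 have inW: "dir p x <= ?W" if x: "x ~= p" "col p x" "col a x" "col b x" "col c x" for x
 proof (rule ccontr)
  assume n: "~ dir p x <= ?W"
  let ?X = "dir p x"
  have gX: "gr 3 ?X" using dir(1) x by blast
  have le: "dim (?X Int ?W) <= 2"
  proof (rule ccontr)
   assume "~ ?thesis"
   moreover have "dim (?X Int ?W) <= 3" by (rule gr_dim_le[OF _ gX]) blast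
   ultimately have "dim (?X Int ?W) = 3" by linarith
   then show False using gr_eqI[OF gr_inter[OF gX 4] gX] n by auto
  qed
  have eq: "?X Int Y = ?X Int ?W" if Y: "gr 3 Y" "Y <= ?W" "2 <= dim (Y Int ?X)" for Y
  proof (rule subspace_eqI)
   show "dim (?X Int ?W) <= dim (?X Int Y)" using le Y(3) by (simp add: Int_commute)
  qed (use Y gX 4 subspace_inter in \<open>auto simp: gr_def\<close>)
  have d: "2 <= dim (?A Int ?X)" "2 <= dim (?B Int ?X)" "2 <= dim (?C Int ?X)"
   using col_dir[OF p co(1) ne(1) x(2,1)] col_dir[OF p co(2) ne(2) x(2,1)] col_dir[OF p co(3) ne(3) x(2,1)] x by blast+
  have e: "?X Int ?A = ?X Int ?W" "?X Int ?B = ?X Int ?W" "?X Int ?C = ?X Int ?W"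
   by (rule eq[OF T(1) AW(1) d(1)], rule eq[OF T(2) AW(2) d(2)], rule eq[OF T(3) AW(3) d(3)])
  have ge: "2 <= dim (?X Int ?A)" using d(1) by (simp add: Int_commute)
  have "?X Int ?A <= ?A Int ?B Int ?C" using e by blast
  then have "dim (?X Int ?A) <= 1" using dim_subset R1 by metis
  then show False using ge by simp
 qed
 have DW: "?D <= ?W" "?E <= ?W" by (rule inW; use ne' co' de in blast)+
 have "tsum p a d e <= ?W" unfolding tsum_def[of p a d e] by (intro ssum_le[OF _ _ 4] AW DW)
 then have R2: "dim (?A Int ?D Int ?E) = 1" using gr_le[OF _ 4] tetra_type[OF de(1)] by force
 note B = gr3_adj[OF T(2,3,6,9)] and E = gr3_adj[OF T'(2,3,6,9)]
 have WB: "?B #+ ?C = ?W" "?D #+ ?E = ?W"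
  using gr_eqI[OF B(2) 4] gr_eqI[OF E(2) 4] ssum_le[OF AW(2,3) 4] ssum_le[OF DW 4] by blast+
 let ?R = "?A Int ?B Int ?C" and ?R' = "?A Int ?D Int ?E"
 have gR: "gr 1 ?R" "gr 1 ?R'"
  using R1 R2 T(1-3) T'(1-3) subspace_inter by (simp_all add: gr_def)
 have "?R #+ ?R' <= ?A" by (rule ssum_le[OF _ _ T(1)]) auto
 then obtain P where P: "gr 2 P" "?R #+ ?R' <= P" "P <= ?A" using gr_sub[OF T(1), of 2 "?R #+ ?R'"] dim_ssum_gr[OF gR] by auto
 have RP: "?R <= P" "?R' <= P" using P(2) ssum_ub1[of ?R ?R'] ssum_ub2[of ?R' ?R] by blast+
 have ext: "EX S. gr 3 S & Q <= S & P <= S & S <= ?W" if Q: "gr 2 Q" "Q <= ?W" "1 <= dim (Q Int P)" for Q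
 proof -
  have PW: "P <= ?W" using P(3) AW(1) by blast
  obtain S where "gr 3 S" "Q #+ P <= S" "S <= ?W" using gr_sub[OF 4, of 3 "Q #+ P"] dim_ssum_gr[OF Q(1) P(1)] Q(3) ssum_le[OF Q(2) PW 4] by auto
  then show ?thesis using ssum_ub1[of Q P] ssum_ub2[of P Q] by blast
 qed
 have i: "1 <= dim ((?B Int ?C) Int P)" "1 <= dim ((?D Int ?E) Int P)"
  by (rule gr_dim_ge[OF gR(1)], use RP in blast, rule gr_dim_ge[OF gR(2)], use RP in blast)
 obtain S where S: "gr 3 S" "?B Int ?C <= S" "P <= S" "S <= ?W" using ext[OF B(1) _ i(1)] AW by blast
 obtain S' where S': "gr 3 S'" "?D Int ?E <= S'" "P <= S'" "S' <= ?W" using ext[OF E(1) _ i(2)] DW by blast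
 obtain k where k: "k:lines G" "b:k" "c:k" using ex_line[OF co(6) bc] by blast
 obtain k' where k': "k':lines G" "d:k'" "e:k'" using ex_line[OF co'(5) dne] by blast
 obtain s where s: "s:k" "s ~= p" "col p s" "dir p s = S"
  using dir_pencil(2)[OF p co(2) ne(2) co(3) ne(3) co(6) T(6) k S(1,2)] S(4) WB by auto
 obtain u where u: "u:k'" "u ~= p" "col p u" "dir p u = S'"
  using dir_pencil(2)[OF p co'(1) ne'(1) co'(2) ne'(2) co'(5) T'(6) k' S'(1,2)] S'(4) WB by auto
 have PW: "P <= ?W" using P(3) AW(1) by blast
 have "coplanar {p,a,s,u}"
  by (rule coplanarI[OF p _ P(1) 4 PW]) (use S S' s u P AW co in auto)
 then show False using de(6) k k' s u by blast
qed

theorem tetra_5_iff: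
 assumes t: "tetra p a b c"
 shows "gr 5 (tsum p a b c) <-> gr 5 (tsum a p b c)"
proof -
 have t': "tetra a p b c" using tetra_perm(1)[OF t] .
 have "gr 5 (tsum q x y z) <-> extensible q x y z" if "tetra q x y z" for q x y z
  using extensible_if_5[OF that] extensible_not_4[OF that] tetra_type[OF that] by (auto simp: gr_def)
 then show ?thesis using t t' extensible_sym by blast
qed

text \<open>Transports the 5-space \<open>W\<close> at \<open>p\<close> to a 5-space
  \<open>W'\<close> at the neighbour \<open>q\<close> by means of a solid on the line
  \<open>pq\<close>. That the solid does not matter is \<open>link_functional\<close>.\<close>

definition link :: "'p => 'v set => 'p => 'v set => bool" where
 "link p W q W' <-> (EX a b. tetra p q a b & gr 5 (tsum p q a b) & W = tsum p q a b & W' = tsum q p a b)"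

lemma linkD: "link p W q W' ==> gr 5 W" "link p W q W' ==> gr 5 W'"
  "link p W q W' ==> p:points G" "link p W q W' ==> q:points G" "link p W q W' ==> p ~= q" "link p W q W' ==> col p q"
  "link p W q W' ==> dir p q <= W" "link p W q W' ==> dir q p <= W'"
proof -
 assume "link p W q W'"
 then obtain a b where t: "tetra p q a b" "gr 5 (tsum p q a b)" "W = tsum p q a b" "W' = tsum q p a b"
  unfolding link_def by (elim exE conjE)
 show "gr 5 W" "gr 5 W'" using t tetra_5_iff[OF t(1)] by simp_all
 show "dir p q <= W" "dir q p <= W'" using t(3,4) tsum_upper(1) by simp_all
 show "p:points G" "q:points G" "p ~= q" "col p q" using t(1) by (simp_all add: tetra_def)
qed

lemma link_sym: "link p W q W' ==> link q W' p W"
 unfolding link_def using tetra_5_iff tetra_perm(1) by (elim exE conjE) metis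

lemma solidI:
 assumes p: "p:points G" and W: "gr 5 W" and g: "gr 3 A" "gr 3 B" "gr 3 C" "A <= W" "B <= W" "C <= W" "A ~= B"
  and U: "gr 2 U" "U <= A" "U <= B" "U <= C" and C: "~ C <= A #+ B"
  and a: "a:ln p A" "a ~= p" "b:ln p B" "b ~= p" "c:ln p C" "c ~= p"
 shows "tetra p a b c" "tsum p a b c = W"
proof -
 have adj: "2 <= dim (A Int B)" "2 <= dim (A Int C)" "2 <= dim (B Int C)"
  by (rule gr_dim_ge[OF U(1)], use U(2-4) in simp)+
 note ab = gr3_adj[OF g(1,2,7) adj(1)]
 have UC: "A Int B <= C" using gr_eqI[OF U(1) ab(1)] U(2-4) by simp
 have ne: "A ~= C" "B ~= C" using C ssum_ub1[of A B] ssum_ub2[of B A] by blast+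
 show t: "tetra p a b c" by (rule tetraI[OF p g(1,2,3) adj g(7) ne _ a(1,3,5,2,4,6)]) (use C in blast)
 have e: "tsum p a b c = A #+ B #+ C"
  unfolding tsum_def using dir_eqI(1)[OF p g(1) a(1,2)] dir_eqI(1)[OF p g(2) a(3,4)] dir_eqI(1)[OF p g(3) a(5,6)] by simp
 have 5: "gr 5 (A #+ B #+ C)" by (rule gr3_two_pencils(1)[OF g(1,2,3,7) UC adj(1) C])
 show "tsum p a b c = W" using gr_eqI[OF 5 W] e ssum_le[OF _ _ W] g by simp
qed

lemma link_solid:
 assumes p: "p:points G" and W: "gr 5 W" and g: "gr 3 A" "gr 3 B" "A <= W" "B <= W" "A ~= B" "2 <= dim (A Int B)"
  and a: "a:ln p A" "a ~= p" and b: "b:ln p B" "b ~= p"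
 shows "EX c. tetra p a b c & tsum p a b c = W"
proof -
 note ab = gr3_adj[OF g(1,2,5,6)]
 obtain x where x: "x:W" "x ~: A #+ B" using gr_ex[OF ab(2) W] by auto
 let ?C = "span (insert x (A Int B))"
 have xU: "x ~: A Int B" using x ssum_ub1[of A B] by blast
 have gC: "gr 3 ?C" using gr_insert[OF ab(1) xU] by simp
 have UC: "A Int B <= ?C" "x:?C" by (rule span_ins)+
 obtain c where c: "c:ln p ?C" "c ~= p" using ln_other[OF p gC] by blast
 have CW: "?C <= W" by (rule span_ins_le[OF x(1)]) (use g W in \<open>auto simp: gr_def\<close>)
 have nC: "~ ?C <= A #+ B" using UC(2) x(2) by blast
 show ?thesis
  using solidI[OF p W g(1,2) gC g(3,4) CW g(5) ab(1) _ _ UC(1) nC a b c] by blast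
qed

lemma link_exists:
 assumes p: "p:points G" and W: "gr 5 W" and q: "col p q" "q ~= p" "dir p q <= W"
 shows "EX W'. link p W q W'"
proof -
 note Q = dir[OF q(1,2)]
 obtain U where U: "gr 2 U" "U <= dir p q" using gr_sub[OF Q(1), of 2 "{0}"] subspace_0[OF grD(1)[OF Q(1)]] by auto
 obtain x where x: "x:W" "x ~: dir p q" using gr_ex[OF Q(1) W] by auto
 let ?A = "span (insert x U)"
 have gA: "gr 3 ?A" using x U gr_insert[OF U(1)] by auto
 have AW: "?A <= W" by (rule span_ins_le[OF x(1)]) (use U q W in \<open>auto simp: gr_def\<close>)
 have ne: "dir p q ~= ?A" using span_ins(2)[of x U] x(2) by blast
 have adj: "2 <= dim (dir p q Int ?A)" by (rule gr_dim_ge[OF U(1)]) (use U span_ins(1)[of U x] in blast)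
 obtain a where a: "a:ln p ?A" "a ~= p" using ln_other[OF p gA] by blast
 obtain c where "tetra p q a c" "tsum p q a c = W"
  using link_solid[OF p W Q(1) gA q(3) AW ne adj Q(2) q(2) a] by blast
 then show ?thesis unfolding link_def using W by blast
qed

text \<open>In the solid, the plane containing \<open>p\<close>, \<open>q\<close> and the line
  \<open>px\<close> meets the line \<open>ab\<close> in a point \<open>s\<close>. Up to replacing
  \<open>x\<close> by a point \<open>z\<close> of the line \<open>px\<close>, the line
  \<open>qs\<close> goes through \<open>z\<close>, so \<open>dir q x\<close> lies in the sum of
  \<open>dir q p\<close> and \<open>dir q s\<close>; the latter lies in
  \<open>dir q a #+ dir q b\<close>.\<close>

lemma link_near1:
 assumes t: "tetra p q a b" "gr 5 (tsum p q a b)"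
  and x: "col p x" "x ~= p" "x ~= q" "dir p q Int dir p a <= dir p x" "dir p x <= tsum p q a b"
 shows "col q x & dir q x <= tsum q p a b"
proof -
 let ?T = "dir p q" and ?A = "dir p a" and ?B = "dir p b" and ?X = "dir p x"
 have p: "p:points G" "q:points G" and ne: "q ~= p" "a ~= p" "b ~= p" "a ~= q" "b ~= q" "a ~= b"
  and co: "col p q" "col p a" "col p b" "col q a" "col q b" "col a b" using t(1) unfolding tetra_def by auto
 have cq: "col q p" using co(1) col_sym by blast
 have T4: "~ gr 4 (tsum p q a b)" using t(2) by (auto simp: gr_def)
 note T = tetra_dirs[OF t(1)]
 note X = dir[OF x(1,2)]
 note qa = gr3_adj[OF T(1,2,4,7)]
 let ?U = "?T Int ?A"
 have t': "tetra p a b q" "tetra q a b p" "tetra q p a b" using tetra_perm t(1) by blast+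
 have UB: "?U <= ?B" and AB: "(?A #+ ?B) Int ?T = ?A Int ?B" using tetra_type[OF t(1)] tetra_type[OF t'(1)] T4 tsum_perm by auto
 note ab = gr3_adj[OF T(2,3,6,9)]
 have U_ab: "?A Int ?B = ?U" using gr_eqI[OF qa(1) ab(1)] UB by blast
 have adjX: "2 <= dim (?T Int ?X)" by (rule gr_dim_ge[OF qa(1)]) (use x(4) in blast)
 have cqx: "col q x" using col_dir[OF p(1) co(1) ne(1) x(1,2)] adjX by blast
 show ?thesis
 proof (cases "?X = ?T")
  case True
  have "dir q x = dir q p"
  proof -
   let ?l = "ln p ?T"
   note L = dir[OF co(1) ne(1)]
   show ?thesis using X(2) True dir_phi[OF L(3) L(2) _ x(3)] dir_phi[OF L(3,2,4) ne(1)[symmetric]] by simp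
  qed
  then show ?thesis using cqx tsum_upper by simp
 next
  case False
  have gTX: "gr 4 (?T #+ ?X)" using gr3_adj[OF T(1) X(1) False[symmetric] adjX] by blast
  let ?S = "(?T #+ ?X) Int (?A #+ ?B)"
  have sub: "?T #+ ?X <= tsum p q a b" "?A #+ ?B <= tsum p q a b"
   by (rule ssum_le[OF tsum_upper(1) x(5) t(2)], rule ssum_le[OF tsum_upper(2) tsum_upper(3) t(2)])
  have "3 <= dim ?S" using gr_inter_ge[OF gTX ab(2) sub t(2)] by simp
  then obtain S where S: "gr 3 S" "?U <= S" "S <= ?S"
  proof -
   have gS: "gr (dim ?S) ?S" by (rule gr_inter[OF gTX ab(2) refl])
   have US: "?U <= ?S" using ssum_ub1[of ?T ?X] ssum_ub1[of ?A ?B] by blast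
   obtain S where "gr 3 S" "?U <= S" "S <= ?S"
    using gr_sub[OF gS \<open>3 <= dim ?S\<close> US] qa(1) by (auto simp: gr_def)
   then show thesis by (rule that)
  qed
  obtain k where k: "k:lines G" "a:k" "b:k" using ex_line[OF co(6) ne(6)] by blast
  obtain s where s: "s:k" "s ~= p" "col p s" "dir p s = S"
   using dir_pencil(2)[OF p(1) co(2) ne(2) co(3) ne(3) co(6) T(6) k S(1)] S(2,3) U_ab by auto
  have nST: "S ~= ?T" using S(3) AB gr_le[OF T(1) ab(1)] by auto
  have adjS: "2 <= dim (?T Int S)" by (rule gr_dim_ge[OF qa(1)]) (use S(2) in blast)
  note ts' = gr3_adj[OF T(1) S(1) nST[symmetric] adjS]
  have TS: "?T #+ S = ?T #+ ?X"
   by (rule gr_eqI[OF ts'(2) gTX]) (rule ssum_le[OF ssum_ub1 _ gTX], use S(3) in blast)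
  have TSU: "?T Int S = ?U" using gr_eqI[OF qa(1) ts'(1)] S(2) by blast
  have cqs: "col q s" using col_dir[OF p(1) co(1) ne(1) s(3,2)] adjS s(4) by simp
  have sq: "s ~= q" using s(4) nST by blast
  obtain k' where k': "k':lines G" "q:k'" "s:k'" using ex_line[OF cqs] sq by blast
  obtain z where z: "z:k'" "z ~= p" "col p z" "dir p z = ?X" using dir_pencil(2)[OF p(1) co(1) ne(1) s(3,2) cqs _ k' X(1)] s(4) nST TSU x(4) ssum_ub2
   by (auto simp: TS)
  have zq: "z ~= q" using z(4) False by blast
  have zl: "z:ln p ?X" using dir(2)[OF z(3,2)] z(4) by simp
  have qs: "dir q s = dir q z" using dir_phi[OF k'(1,2,3) sq] dir_phi[OF k'(1,2) z(1) zq] by simp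
  have px: "x:ln p ?X" "p:ln p ?X" "ln p ?X:lines G" by (rule X)+
  have nd: "dir q p ~= dir q z" using dir[OF col_line[OF k'(1,2) z(1)] zq] dir[OF cq ne(1)[symmetric]] dir_phi[of "ln q (dir q p)" p q] dir_phi[of "ln q (dir q p)" p z] ne(1) z(2) z(4) False by auto
  have "dir q x <= dir q p #+ dir q z"
   using dir_pencil(1)[OF p(2) cq ne(1)[symmetric] col_line[OF k'(1,2) z(1)] zq z(3) nd px(3,2) zl px(1)] by blast
  moreover have "dir q s <= dir q a #+ dir q b"
   using dir_pencil(1)[OF p(2) co(4) ne(4) co(5) ne(5) co(6) _ k s(1)] tetra_dirs(4)[OF t'(2)] by blast
  moreover have g5: "gr 5 (tsum q p a b)" using tetra_5_iff[OF t(1)] t(2) by simp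
  have "dir q a #+ dir q b <= tsum q p a b" by (rule ssum_le[OF tsum_upper(2) tsum_upper(3) g5])
  ultimately have "dir q z <= tsum q p a b" using qs by (metis subset_trans)
  then show ?thesis using cqx \<open>dir q x <= dir q p #+ dir q z\<close> ssum_le[OF tsum_upper(1) _ g5] by auto
 qed
qed

text \<open>If \<open>dir p x\<close> does not contain the 2-space of the solid, pick
  \<open>y\<close> whose direction contains that 2-space and a vector of \<open>dir p x\<close>. The
  solid \<open>p\<close>, \<open>q\<close>, \<open>x\<close>, \<open>y\<close> has a 4-dimensional
  sum at \<open>p\<close>, hence also at \<open>q\<close>, so \<open>dir q x\<close> is contained in
  \<open>dir q p #+ dir q y\<close>; the point \<open>y\<close> is covered by
  \<open>link_near1\<close>.\<close>

lemma link_near2: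
 assumes l: "link p W q W'" and x: "col p x" "x ~= p" "x ~= q" "dir p x <= W" "2 <= dim (dir p q Int dir p x)"
 shows "col q x & dir q x <= W'"
proof -
 obtain a b where t: "tetra p q a b" "gr 5 (tsum p q a b)" "W = tsum p q a b" "W' = tsum q p a b"
  using l unfolding link_def by blast
 let ?T = "dir p q" and ?A = "dir p a" and ?X = "dir p x"
 have p: "p:points G" "q:points G" and ne: "q ~= p" and co: "col p q" using t(1) unfolding tetra_def by auto

 note T = tetra_dirs[OF t(1)]
 note X = dir[OF x(1,2)]
 note qa = gr3_adj[OF T(1,2,4,7)]
 show ?thesis
 proof (cases "?T Int ?A <= ?X")
  case True show ?thesis using link_near1[OF t(1,2) x(1-3) True] x(4) t by blast
 next
  case False
  have TX: "?T ~= ?X" using False by blast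
  note tx = gr3_adj[OF T(1) X(1) TX x(5)]
  obtain v where v: "v:?X" "v ~: ?T" using gr_eqI[OF X(1) T(1)] TX by auto
  let ?Y = "span (insert v (?T Int ?A))"
  have gY: "gr 3 ?Y" using gr_insert[OF qa(1), of v] v by simp
  have UY: "?T Int ?A <= ?Y" "v:?Y" by (rule span_ins)+
  have YW: "?Y <= W" by (rule span_ins_le) (use v x(4) t tsum_upper[of p q a b] in \<open>auto simp: gr_def\<close>)
  obtain y where y: "y:ln p ?Y" "y ~= p" using ln_other[OF p(1) gY] by blast
  note Y = dir_eqI[OF p(1) gY y]
  have yq: "y ~= q" using Y(1) v UY by blast
  have YTX: "?Y <= ?T #+ ?X" by (rule span_ins_le) (use v ssum_ub1[of ?T ?X] ssum_ub2[of ?X ?T] in auto)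
  have TY: "?T ~= ?Y" using v UY by blast
  have XY: "?X ~= ?Y" using UY False by blast
  have 1: "2 <= dim (?T Int ?Y)" by (rule gr_dim_ge[OF qa(1)]) (use UY in blast)
  have 2: "2 <= dim (?X Int ?Y)" using gr_inter_ge[OF X(1) gY ssum_ub2 YTX tx(2)] by simp
  have n: "~ (?T Int ?X <= ?Y & ?Y <= ?T #+ ?X)"
  proof
   assume "?T Int ?X <= ?Y & ?Y <= ?T #+ ?X"
   then have "?T Int ?X <= ?T Int ?Y" by blast
   moreover note ty = gr3_adj[OF T(1) gY TY 1]
   ultimately have "?T Int ?X = ?T Int ?Y" using gr_eqI[OF tx(1) ty(1)] by blast
   then show False using False UY by auto
  qed
  have tet: "tetra p q x y"
   by (rule tetraI[OF p(1) T(1) X(1) gY x(5) 1 2 TX TY XY n dir(2)[OF co ne] X(2) y(1) ne x(2) y(2)])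
  have "gr 5 (tsum p q x y) ==> False"
  proof -
   assume 5: "gr 5 (tsum p q x y)"
   show False using gr_le[OF 5 tx(2)] ssum_le[OF subset_refl YTX tx(2)] by (simp add: tsum_def[of p q x y] Y(1))
  qed
  then have n5: "~ gr 5 (tsum q p x y)" using tetra_5_iff[OF tet] by blast
  have tet': "tetra q p y x" using tetra_perm tet by blast
  have e: "tsum q p y x = dir q p #+ dir q y"
   using tetra_type[OF tet'] n5 tsum_perm(2) by metis
  have y': "col q y & dir q y <= W'"
   using link_near1[OF t(1,2) Y(2) y(2) yq] Y(1) UY YW t by simp
  have "dir q x <= dir q p #+ dir q y" using tsum_upper(3)[of q x p y] e by simp
  also have "... <= W'" by (rule ssum_le[OF linkD(8)[OF l] _ linkD(2)[OF l]]) (use y' in blast)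
  finally show ?thesis using tet unfolding tetra_def by blast
 qed
qed

lemma link_functional:
 assumes "link p W q W1" "link p W q W2" shows "W1 = W2"
proof -
 obtain a b where t: "tetra p q a b" "gr 5 (tsum p q a b)" "W = tsum p q a b" "W1 = tsum q p a b"
  using assms(1) unfolding link_def by blast
 have co: "col p a" "col p b" "a ~= p" "b ~= p" "a ~= q" "b ~= q" using t(1) unfolding tetra_def by auto
 note T = tetra_dirs[OF t(1)]
 have W: "dir p a <= W" "dir p b <= W" using t(3) tsum_upper(2,3) by simp_all
 show ?thesis using link_near2[OF assms(2) co(1,3,5) W(1) T(7)] link_near2[OF assms(2) co(2,4,6) W(2) T(8)] ssum_le[OF _ _ linkD(2)[OF assms(2)]] linkD(8)[OF assms(2)] gr_eqI[OF linkD(2)[OF assms(1)] linkD(2)[OF assms(2)]] t(4) tsum_def by metis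
qed

definition sigma :: "'p => 'p => 'v set => 'v set => bool" where
 "sigma x y U W <-> x:points G & y:points G & ~ col x y & gr 1 U & gr 5 W & U <= W &
   (ALL A. near x y A <-> gr 3 A & U <= A & A <= W)"

definition spinor_set :: "'p => 'v set => 'p set" where
 "spinor_set p W = {p} Un {x. x ~= p & col p x & dir p x <= W} Un {y. EX U. sigma p y U W}"

lemma sigma_exists:
 assumes "x:points G" "y:points G" "~ col x y" "col x z" "col y z" "col x z'" "col y z'" "z ~= z'"
 shows "EX U W. sigma x y U W"
 using polar_type[OF assms] assms(1-3) unfolding sigma_def by (elim exE conjE) blast

lemma sigma_dir:
 assumes s: "sigma x y U W" and z: "col x z" "col y z"
 shows "z ~= x" "z ~= y" "gr 3 (dir x z)" "U <= dir x z" "dir x z <= W"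
proof -
 have n: "~ col x y" "x:points G" using s unfolding sigma_def by simp_all
 show zx: "z ~= x" "z ~= y" using n z col_sym by blast+
 show g: "gr 3 (dir x z)" by (rule dir(1)[OF z(1) zx(1)])
 show "U <= dir x z" "dir x z <= W" using g dir(2)[OF z(1) zx(1)] z(2) s by (auto simp: near_def sigma_def)
qed

lemma sigma_near:
 assumes s: "sigma x y U W" and A: "gr 3 A" "U <= A" "A <= W"
 shows "EX z. col x z & z ~= x & z:ln x A & dir x z = A & col y z & z ~= y"
proof -
 have "near x y A" "x:points G" using s A unfolding sigma_def by simp_all
 then obtain z where z: "z:ln x A" "col y z" unfolding near_def by blast
 have c: "col x z" by (rule col_line[OF ln(1)[OF \<open>x : points G\<close> A(1)] ln(2)[OF \<open>x : points G\<close> A(1)] z(1)])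
 note n = sigma_dir[OF s c z(2)]
 show ?thesis using z c n(1,2) dir_eqI(1)[OF \<open>x : points G\<close> A(1) z(1) n(1)] by blast
qed

text \<open>The 3-spaces between \<open>U\<close> and \<open>W'\<close> generate \<open>W'\<close>,
  so the pair determines its 5-space.\<close>

lemma sigma_least:
 assumes s: "sigma x y U W'" and W: "gr 5 W" and le: "!!A. gr 3 A ==> U <= A ==> A <= W' ==> A <= W"
 shows "W' = W"
proof (rule gr_eqI)
 show U5: "gr 5 W'" using s by (simp add: sigma_def)
 have U: "gr 1 U" "U <= W'" using s by (simp_all add: sigma_def)
 show "W' <= W"
 proof
  fix w assume w: "w:W'"
  have sw: "span {w} <= W'" by (rule span_minimal) (use w U5 in \<open>auto simp: gr_def\<close>)
  obtain A where A: "gr 3 A" "U #+ span {w} <= A" "A <= W'"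
   using gr_sub[OF U5, of 3 "U #+ span {w}"] dim_le_card'[of "{w}"] dim_ssum[of U "span {w}"] U(1) ssum_le[OF U(2) sw U5] by (auto simp: gr_def)
  have "U <= A" "w:A"
   using A(2) ssum_ub1[of U "span {w}"] ssum_ub2[of "span {w}" U] span_base[of w "{w}"] by blast+
  then show "w:W" using le[OF A(1) _ A(3)] by blast
 qed
qed (rule W)

end

context subspace_calculus
begin

text \<open>The 2-spaces \<open>C Int P\<close> and \<open>C Int Z\<close> meet in at most a 1-space
  and therefore generate \<open>C\<close>; counting inside \<open>C\<close> also shows that
  \<open>P\<close> and \<open>Z\<close> do meet.\<close>

lemma gr3_bridge:
 assumes g: "gr 3 P" "gr 3 Z" "gr 3 C" and d: "2 <= dim (C Int P)" "2 <= dim (C Int Z)" "dim (P Int Z) <= 1"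
 shows "C <= P #+ Z" "gr 5 (P #+ Z)"
proof -
 have g2: "gr (dim (C Int P)) (C Int P)" "gr (dim (C Int Z)) (C Int Z)"
  by (rule gr_inter[OF g(3,1) refl], rule gr_inter[OF g(3,2) refl])
 have "dim (C Int P) + dim (C Int Z) <= 3 + dim ((C Int P) Int (C Int Z))"
  by (rule gr_inter_ge[OF g2 _ _ g(3)]) auto
 moreover have "dim ((C Int P) Int (C Int Z)) <= dim (P Int Z)" by (rule dim_subset) blast
 ultimately have 1: "dim (P Int Z) = 1" "dim ((C Int P) Int (C Int Z)) <= 1" using d by linarith+
 show "gr 5 (P #+ Z)" by (rule gr_ssum[OF g(1,2)]) (use 1 in simp)
 have s: "(C Int P) #+ (C Int Z) <= C" by (rule ssum_le[OF _ _ g(3)]) auto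
 have "(C Int P) #+ (C Int Z) <= P #+ Z" by (rule ssum_mono) auto
 then show "C <= P #+ Z" using dim_ssum_gr[OF g2] 1(2) d gr_eqI[OF _ g(3) s] gr_dim_le[OF s g(3)] by (simp add: gr_def)
qed

end

section \<open>Independence of the spinor subspaces from the base point\<close>

context locally_grassmannian
begin

lemma spinor_col: "x:spinor_set p W ==> x ~= p ==> col p x ==> dir p x <= W"
 unfolding spinor_set_def sigma_def by blast

lemma spinor_far: "x:spinor_set p W ==> ~ col p x ==> EX U. sigma p x U W"
 unfolding spinor_set_def by auto

lemma spinor_colI: "col p x ==> x ~= p ==> dir p x <= W ==> x:spinor_set p W"
 unfolding spinor_set_def by simp

lemma spinor_farI: "sigma p x U W ==> x:spinor_set p W"
 unfolding spinor_set_def by blast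

text \<open>\<open>W'\<close> is generated by the directions at \<open>q\<close> of
  \<open>p\<close>, \<open>c\<close> and \<open>d\<close>. If \<open>z\<close> is collinear with
  \<open>q\<close>, two bridges put these directions into the 5-space spanned by
  \<open>dir q p\<close> and \<open>dir q z\<close>. Otherwise \<open>z\<close> has neighbours in
  all three directions, so they lie in the 5-space of the pair \<open>q\<close>, \<open>z\<close>.
  Either 5-space must be \<open>W'\<close>.\<close>

lemma link_transfer:
 assumes l: "link p W q W'" and t: "tetra p q c d" "tsum p q c d = W"
  and z: "z:points G" "z ~= q" "col z c" "col z d" "col q z ==> ~ col p z"
   "~ col q z ==> EX s:ln p (dir p q). s ~= q & col z s"
 shows "z:spinor_set q W'"
proof -
 have p: "q:points G" "p:points G" and cp: "col p q" "p ~= q" and ne: "c ~= q" "d ~= q" "c ~= d"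
  and co: "col q c" "col q d" using t(1) unfolding tetra_def by auto
 have W': "W' = tsum q p c d" using linkD(1)[OF l] t link_functional[OF l] link_def by metis
 note T = tetra_dirs[OF tetra_perm(1)[OF t(1)]]
 show ?thesis
 proof (cases "col q z")
  case True
  note Z = dir(1)[OF True z(2)]
  have d1: "dim (dir q p Int dir q z) <= 1" using col_dir[OF p(1) col_sym[OF cp(1)] cp(2) True z(2)] z(5)[OF True] by simp
  have d2: "2 <= dim (dir q c Int dir q z)" "2 <= dim (dir q d Int dir q z)"
   using col_dir[OF p(1) co(1) ne(1) True z(2)] col_dir[OF p(1) co(2) ne(2) True z(2)] z(3,4) col_sym by blast+
  have d3: "2 <= dim (dir q c Int dir q p)" "2 <= dim (dir q d Int dir q p)" using T(7,8) by (simp_all add: Int_commute)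
  note B = gr3_bridge[OF T(1) Z T(2) d3(1) d2(1) d1] gr3_bridge(1)[OF T(1) Z T(3) d3(2) d2(2) d1]
  show ?thesis using ssum_le[OF _ _ B(2)] ssum_ub1 B(1,3) gr_eqI[OF linkD(2)[OF l] B(2)] ssum_ub2 spinor_colI[OF True z(2)] W' tsum_def by metis
 next
  case False
  obtain U W'' where s: "sigma q z U W''" using sigma_exists[OF p(1) z(1) False co(1) z(3) co(2) z(4) ne(3)] by (elim exE)
  obtain s' where s': "s':ln p (dir p q)" "s' ~= q" "col z s'" using z(6)[OF False] by blast
  note L = dir(2-4)[OF cp(1) cp(2)[symmetric]]
  have e: "dir q s' = dir q p" "col q s'"
   using dir_phi[OF L(2,1) s'(1,2)] dir_phi[OF L(2,1,3) cp(2)] col_line[OF L(2,1) s'(1)] by simp_all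
  have W2: "gr 5 W''" using s by (simp add: sigma_def)
  show ?thesis using ssum_le[OF _ _ W2] sigma_dir(5)[OF s e(2) s'(3)] sigma_dir(5)[OF s co(1) z(3)] sigma_dir(5)[OF s co(2) z(4)] e(1) spinor_farI[OF s] gr_eqI[OF linkD(2)[OF l] W2] by (simp add: W' tsum_def)
 qed
qed

text \<open>In the remaining case the directions of \<open>q\<close> and \<open>x\<close> share a
  1-space \<open>?u\<close>. Take a 2-space \<open>S\<close> with \<open>?u <= S <= ?T\<close> and
  add to it two vectors of \<open>?X\<close>. The resulting \<open>?C\<close> and \<open>?D\<close>
  form a solid with \<open>?T\<close>, and each shares a 2-space with \<open>?X\<close>, so the
  points \<open>c\<close>, \<open>d\<close> are collinear with \<open>x\<close> and
  \<open>link_transfer\<close> applies.\<close>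

lemma link_near:
 assumes l: "link p W q W'" and x: "col p x" "x ~= p" "dir p x <= W"
 shows "x:spinor_set q W'"
proof -
 let ?T = "dir p q" and ?X = "dir p x"
 note L = linkD[OF l]
 note T = dir(1,2)[OF L(6) L(5)[symmetric]] and X = dir(1,2)[OF x(1,2)]
 show ?thesis
 proof (cases "x = q | 2 <= dim (?T Int ?X)")
  case True
  show ?thesis
  proof (cases "x = q")
   case True then show ?thesis by (simp add: spinor_set_def)
  next
   case False
   then show ?thesis using link_near2[OF l x(1,2) False x(3)] True spinor_colI[of q x W'] by blast
  qed
 next
  case False
  have d: "dim (?T Int ?X) = 1" using False gr_inter_ge[OF T(1) X(1) L(7) x(3) L(1)] by simp
  let ?u = "?T Int ?X"
  have u: "gr 1 ?u" by (rule gr_inter[OF T(1) X(1) d])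
  have g5: "gr 5 (?T #+ ?X)" by (rule gr_ssum[OF T(1) X(1)]) (use d in simp)
  obtain S where S: "gr 2 S" "?u <= S" "S <= ?T" using gr_sub[OF T(1), of 2 ?u] u by (auto simp: gr_def)
  have "~ ?X <= ?T"
  proof
   assume "?X <= ?T"
   then have "?u = ?X" by blast
   then show False using d X(1) by (simp add: gr_def)
  qed
  then obtain x1 where x1: "x1:?X" "x1 ~: ?T" by blast
  let ?P = "span (insert x1 ?u)"
  have x1u: "x1 ~: ?u" "x1 ~: S" using x1 S by blast+
  have gP: "gr 2 ?P" using gr_insert[OF u x1u(1)] by (simp add: numeral_2_eq_2)
  have PX: "?P <= ?X" by (rule span_ins_le[OF x1(1)]) (use X in \<open>auto simp: gr_def\<close>)
  obtain x2 where x2: "x2:?X" "x2 ~: ?P" using gr_ex[OF gP X(1)] by auto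
  have x2u: "x2 ~: ?u" using x2(2) span_ins(1)[of ?u x1] by blast
  have x2S: "x2 ~: S" using x2u x2(1) S(3) by blast
  let ?Q = "span (insert x2 ?u)"
  have gQ: "gr 2 ?Q" using gr_insert[OF u x2u] by (simp add: numeral_2_eq_2)
  have QX: "?Q <= ?X" by (rule span_ins_le[OF x2(1)]) (use X in \<open>auto simp: gr_def\<close>)
  let ?C = "span (insert x1 S)" and ?D = "span (insert x2 S)"
  have gC: "gr 3 ?C" "gr 3 ?D" using gr_insert[OF S(1) x1u(2)] gr_insert[OF S(1) x2S] by simp_all
  have SC: "S <= ?C" "S <= ?D" "x1:?C" "x2:?D" by (rule span_ins)+
  have sub: "subspace ?C" "subspace ?D" "subspace W" using L(1) by (simp_all add: gr_def)
  have x12: "x1:W" "x2:W" "S <= W" using x1 x2 x(3) S(3) L(7) by blast+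
  have CW: "?C <= W" "?D <= W" by (rule span_ins_le[OF _ x12(3) sub(3)]; rule x12)+
  have TC: "?T ~= ?C" using SC(3) x1(2) by blast
  have adjTC: "2 <= dim (?T Int ?C)" by (rule gr_dim_ge[OF S(1)]) (use S SC in blast)
  note tc = gr3_adj[OF T(1) gC(1) TC adjTC]
  have nD: "~ ?D <= ?T #+ ?C"
  proof
   assume D: "?D <= ?T #+ ?C"
   have us: "?u <= ?T #+ ?C" using ssum_ub1[of ?T ?C] by blast
   have P': "?P <= ?T #+ ?C" by (rule span_ins_le[OF _ us subspace_ssum]) (use ssum_ub2 SC in blast)
   let ?R = "span (insert x2 ?P)"
   have gR: "gr 3 ?R" using gr_insert[OF gP x2(2)] by simp
   have "?R <= ?X" by (rule span_ins_le[OF x2(1) PX]) (use X in \<open>auto simp: gr_def\<close>)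
   then have "?R = ?X" by (rule gr_eqI[OF gR X(1)])
   moreover have "?R <= ?T #+ ?C" by (rule span_ins_le[OF _ P' subspace_ssum]) (use D SC in blast)
   ultimately have "?T #+ ?X <= ?T #+ ?C" using ssum_le[OF ssum_ub1 _ tc(2)] by simp
   then show False using gr_le[OF g5 tc(2)] by simp
  qed
  obtain c where c: "c:ln p ?C" "c ~= p" using ln_other[OF L(3) gC(1)] by blast
  obtain d where d: "d:ln p ?D" "d ~= p" using ln_other[OF L(3) gC(2)] by blast
  note t = solidI[OF L(3,1) T(1) gC L(7) CW TC S(1,3) SC(1,2) nD T(2) L(5)[symmetric] c d]
  have PC: "?P <= ?C" by (rule span_ins_le[OF SC(3) _ sub(1)]) (use S SC in blast)
  have QD: "?Q <= ?D" by (rule span_ins_le[OF SC(4) _ sub(2)]) (use S SC in blast)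
  have "2 <= dim (?X Int ?C)" by (rule gr_dim_ge[OF gP]) (use PX PC in blast)
  then have xc: "col x c" by (rule col_ln_all[OF L(3) X(1) gC(1) X(2) c(1)])
  have "2 <= dim (?X Int ?D)" by (rule gr_dim_ge[OF gQ]) (use QX QD in blast)
  then have xd: "col x d" by (rule col_ln_all[OF L(3) X(1) gC(2) X(2) d(1)])
  have nq: "~ col q x" using col_dir[OF L(3,6) L(5)[symmetric] x(1,2)] False by simp
  have "EX s:ln p ?T. s ~= q & col x s"
   by (rule bexI[of _ p]) (use dir(4)[OF L(6) L(5)[symmetric]] L(5) col_sym[OF x(1)] in simp_all)
  then show ?thesis
   by (intro link_transfer[OF l t col_point[OF x(1) L(3)] _ xc xd]) (use False nq in simp_all)
 qed
qed

text \<open>The solid is chosen with all directions between \<open>U\<close> and \<open>W\<close>.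
  By \<open>sigma\<close> each of these three lines on \<open>p\<close> has a point collinear with
  \<open>y\<close>, as \<open>link_transfer\<close> requires.\<close>

lemma link_far1:
 assumes l: "link p W q W'" and y: "sigma p y U W" "U <= dir p q"
 shows "y:spinor_set q W'"
proof -
 let ?T = "dir p q"
 note L = linkD[OF l]
 note T = dir(1,2)[OF L(6) L(5)[symmetric]]
 have U: "gr 1 U" "y:points G" "~ col p y" using y unfolding sigma_def by simp_all
 obtain S where S: "gr 2 S" "U <= S" "S <= ?T" using gr_sub[OF T(1), of 2 U] U(1) y(2) by (auto simp: gr_def)
 obtain x1 where x1: "x1:W" "x1 ~: ?T" using gr_ex[OF T(1) L(1)] by auto
 have x1S: "x1 ~: S" using x1 S by blast
 let ?C = "span (insert x1 S)"
 have gC: "gr 3 ?C" using gr_insert[OF S(1) x1S] by simp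
 have SC: "S <= ?C" "x1:?C" by (rule span_ins)+
 have TC: "?T ~= ?C" using SC(2) x1(2) by blast
 have adjTC: "2 <= dim (?T Int ?C)" by (rule gr_dim_ge[OF S(1)]) (use S SC in blast)
 note tc = gr3_adj[OF T(1) gC TC adjTC]
 obtain x2 where x2: "x2:W" "x2 ~: ?T #+ ?C" using gr_ex[OF tc(2) L(1)] by auto
 have x2S: "x2 ~: S" using x2(2) S(3) ssum_ub1[of ?T ?C] by blast
 let ?D = "span (insert x2 S)"
 have gD: "gr 3 ?D" using gr_insert[OF S(1) x2S] by simp
 have SD: "S <= ?D" "x2:?D" by (rule span_ins)+
 have nD: "~ ?D <= ?T #+ ?C" using SD x2 by blast
 have sub: "subspace W" "S <= W" using L(1,7) S(3) by (auto simp: gr_def)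
 have CW: "?C <= W" "?D <= W" by (rule span_ins_le[OF x1(1) sub(2,1)], rule span_ins_le[OF x2(1) sub(2,1)])
 have US: "U <= ?C" "U <= ?D" using S SC SD by blast+
 obtain c where c: "c:ln p ?C" "c ~= p" "col y c" using sigma_near[OF y(1) gC US(1) CW(1)] by blast
 obtain d where d: "d:ln p ?D" "d ~= p" "col y d" using sigma_near[OF y(1) gD US(2) CW(2)] by blast
 obtain s where s: "s:ln p ?T" "col y s" using sigma_near[OF y(1) T(1) y(2) L(7)] by blast
 note t = solidI[OF L(3,1) T(1) gC gD L(7) CW TC S(1,3) SC(1) SD(1) nD T(2) L(5)[symmetric] c(1,2) d(1,2)]
 have yq: "y ~= q" using U(3) L(6) by blast
 show ?thesis
 proof (rule link_transfer[OF l t U(2) yq c(3) d(3)])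
  show "~ col p y" by (rule U(3))
  assume "~ col q y"
  then show "EX s:ln p ?T. s ~= q & col y s" using col_sym[OF s(2)] s by auto
 qed
qed

text \<open>If \<open>U\<close> is not in the direction of \<open>q\<close>, a detour is made
  through \<open>r\<close>, whose direction contains \<open>U\<close> and shares the 2-space
  \<open>S\<close> with that of \<open>q\<close>. One solid on \<open>p\<close>, \<open>q\<close>,
  \<open>r\<close> supplies the links from \<open>p\<close> to \<open>r\<close> and from
  \<open>r\<close> to \<open>q\<close>; \<open>y\<close> is collinear with \<open>r\<close>, so
  \<open>link_near\<close> covers the second.\<close>

lemma link_far:
 assumes l: "link p W q W'" and y: "sigma p y U W"
 shows "y:spinor_set q W'"
proof (cases "U <= dir p q")
 case True then show ?thesis by (rule link_far1[OF l y])
next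
 case False
 let ?T = "dir p q"
 note L = linkD[OF l]
 note T = dir(1,2)[OF L(6) L(5)[symmetric]]
 have U: "gr 1 U" "y:points G" "~ col p y" "U <= W" using y unfolding sigma_def by simp_all
 obtain S where S: "gr 2 S" "S <= ?T" using gr_sub[OF T(1), of 2 "{0}"] subspace_0[OF grD(1)[OF T(1)]] by auto
 let ?R = "U #+ S"
 have "dim (U Int S) <= 1" by (rule gr_dim_le[OF _ U(1)]) blast
 moreover have "dim (U Int S) ~= 1" using gr_eqI[OF gr_inter[OF U(1) S(1)] U(1)] S(2) False by auto
 ultimately have gR: "gr 3 ?R" by (intro gr_ssum[OF U(1) S(1)]) linarith
 have UR: "U <= ?R" "S <= ?R" by (rule ssum_ub1, rule ssum_ub2)
 have RW: "?R <= W" by (rule ssum_le[OF U(4) _ L(1)]) (use S L in blast)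
 have TR: "?T ~= ?R" using UR False by blast
 have adj: "2 <= dim (?T Int ?R)" by (rule gr_dim_ge[OF S(1)]) (use S UR in blast)
 obtain r where r: "col p r" "r ~= p" "r:ln p ?R" "dir p r = ?R" "col y r" "r ~= y"
  using sigma_near[OF y gR UR(1) RW] by blast
 obtain s where s: "tetra p q r s" "tsum p q r s = W"
  using link_solid[OF L(3,1) T(1) gR L(7) RW TR adj T(2) L(5)[symmetric] r(3,2)] by blast
 have s': "tetra p r q s" "tetra r q p s" "tetra q p r s" using tetra_perm s(1) by blast+
 have gW: "gr 5 (tsum p q r s)" "gr 5 (tsum p r q s)" using s(2) L(1) tsum_perm(1)[of p q r s] by simp_all
 have W': "W' = tsum q p r s" using s gW link_functional[OF l] by (auto simp: link_def)
 have l1: "link p W r (tsum r p q s)" unfolding link_def using s(2) tsum_perm(1)[of p q r s] s'(1) gW(2) by auto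
 have l2: "link r (tsum r p q s) q W'" unfolding link_def using linkD(2)[OF l1] s'(2) tsum_perm(1) W' by metis
 have "y:spinor_set r (tsum r p q s)" by (rule link_far1[OF l1 y]) (use r UR in simp)
 then show ?thesis using spinor_col col_sym[OF r(5)] r(6) link_near[OF l2 col_sym[OF r(5)] r(6)[symmetric]] by simp
qed

lemma link_subset: "link p W q W' ==> spinor_set p W <= spinor_set q W'"
proof
 fix x assume l: "link p W q W'" and x: "x:spinor_set p W"
 then consider "x = p" | "x ~= p" "col p x" "dir p x <= W" | U where "sigma p x U W"
  unfolding spinor_set_def by blast
 then show "x:spinor_set q W'" using linkD[OF l] col_sym[OF linkD(6)[OF l]] spinor_colI link_near[OF l] link_far[OF l] by metis
qed

lemma link_spinor: "link p W q W' ==> spinor_set q W' = spinor_set p W"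
 using link_subset[of p W q W'] link_subset[of q W' p W] link_sym[of p W q W'] by blast

text \<open>A point of the set is reached from \<open>p\<close> by at most two links, a far one
  through a common neighbour, and \<open>link_spinor\<close> says that each link preserves the
  set.\<close>

lemma spinor_base:
 assumes p: "p:points G" "gr 5 W" and q: "q:spinor_set p W"
 shows "EX W'. gr 5 W' & spinor_set q W' = spinor_set p W"
proof -
 have near: "EX W'. gr 5 W' & spinor_set x W' = spinor_set r V"
  if V: "r:points G" "gr 5 V" "x:spinor_set r V" "col r x" for x r V
 proof (cases "x = r")
  case True then show ?thesis using V(2) by blast
 next
  case False
  obtain W' where "link r V x W'" using link_exists[OF V(1,2,4) False spinor_col[OF V(3) False V(4)]] by blast
  then show ?thesis using link_spinor linkD(2) by blast
 qed
 show ?thesis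
 proof (cases "col p q")
  case True then show ?thesis using near[OF p q] by blast
 next
  case False
  obtain U where s: "sigma p q U W" using spinor_far[OF q False] by blast
  have U: "gr 1 U" "U <= W" using s by (simp_all add: sigma_def)
  obtain A where A: "gr 3 A" "U <= A" "A <= W" using gr_sub[OF p(2), of 3 U] U by (auto simp: gr_def)
  obtain z where z: "col p z" "z ~= p" "dir p z = A" "col q z" using sigma_near[OF s A] by blast
  obtain V where V: "gr 5 V" "spinor_set z V = spinor_set p W"
   using near[OF p _ z(1)] spinor_colI[OF z(1,2)] A(3) z(3) by blast
  show ?thesis using near[OF col_point[OF z(1) p(1)] V(1) _ col_sym[OF z(4)]] V(2) q by simp
 qed
qed

lemma spinor_points: "p:points G ==> spinor_set p W <= points G"
 unfolding spinor_set_def sigma_def using col_point by blast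

text \<open>After moving the base point to \<open>x\<close>, the claims about lines on
  \<open>x\<close> and about common neighbours of \<open>x\<close> and \<open>y\<close> can be read
  off from the definition.\<close>

lemma spinor_two_convex:
 assumes p: "p:points G" "gr 5 W"
 shows "two_convex_subspace G (spinor_set p W)"
proof -
 let ?D = "spinor_set p W"

 have "l <= ?D" if l: "l:lines G" "x:l Int ?D" "y:l Int ?D" "x ~= y" for l x y
 proof
  fix z assume z: "z:l"
  have m: "x:l" "y:l" "x:?D" "y:?D" using l by blast+
  obtain V where V: "gr 5 V" "spinor_set x V = ?D" using spinor_base[OF p m(3)] by blast
  have "dir x y <= V" by (rule spinor_col[OF _ l(4)[symmetric] col_line[OF l(1) m(1,2)]]) (use V m in simp)
  show "z:?D"
  proof (cases "z = x")
   case False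
   show ?thesis using dir_phi[OF l(1) m(1) z False] dir_phi[OF l(1) m(1,2) l(4)[symmetric]] spinor_colI[OF col_line[OF l(1) m(1) z] False] \<open>dir x y <= V\<close> V by auto
  qed (use m in simp)
 qed
 then have "is_subspace G ?D" unfolding is_subspace_def using spinor_points[OF p(1)] by blast
 moreover have "perp G x Int perp G y <= ?D" if xy: "x:?D" "y:?D" "distance G x y = 2" for x y
 proof
  fix z assume "z:perp G x Int perp G y"
  then have z: "col x z" "col y z" by (simp_all add: perp_col)
  obtain V where V: "gr 5 V" "spinor_set x V = ?D" using spinor_base[OF p xy(1)] by blast
  obtain U where s: "sigma x y U V" using xy(3) distance_2 spinor_far[of y x V] V xy(2) by auto
  show "z:?D" using V spinor_colI[OF z(1) sigma_dir(1)[OF s z] sigma_dir(5)[OF s z]] by simp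
 qed
 ultimately show ?thesis unfolding two_convex_subspace_def by blast
qed

definition spinor_sets :: "'p set set" where
 "spinor_sets = {spinor_set p W |p W. p:points G & gr 5 W}"

text \<open>A polar pair \<open>x\<close>, \<open>y\<close> of the symplecton determines
  \<open>W\<close>, and any member containing the symplecton has the same \<open>W\<close> at
  \<open>x\<close> by \<open>sigma_least\<close>. For the inclusion, one-or-all first puts the
  neighbours of \<open>x\<close> in the symplecton into the member. Any other point is collinear
  with two noncollinear points already known to lie there.\<close>

lemma symplecton_unique:
 assumes S: "S:symplecta G"
 shows "EX! D. D:spinor_sets & S <= D"
proof -
 obtain x y where xy: "x:S" "y:S" "polar_pair G x y" and conv: "two_convex_subspace G S"
  and pol: "nondegenerate_polar_space (subgeometry G S)" using S unfolding symplecta_def by blast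
 have sub: "is_subspace G S" using conv unfolding two_convex_subspace_def by simp
 have p: "x:points G" "y:points G" "~ col x y" using xy(3) unfolding polar_pair_def distance_2 by simp_all
 obtain l where l: "l:lines G" "ALL v:l. col x v & col y v" using polar_rank_line[OF xy(3)] by blast
 obtain z where z: "z:l" using line_other[OF l(1)] by blast
 obtain z' where z': "z':l" "z' ~= z" using line_other[OF l(1)] by blast
 obtain U W where s: "sigma x y U W"
  using sigma_exists[OF p, of z z'] l(2) z z' by metis
 have W5: "gr 5 W" using s by (simp add: sigma_def)
 let ?D = "spinor_set x W"
 have dsub: "is_subspace G ?D" using spinor_two_convex[OF p(1) W5] unfolding two_convex_subspace_def by simp
 have conD: "v:?D" if "u:?D" "w:?D" "~ col u w" "col u v" "col w v" for u v w
  using spinor_two_convex[OF p(1) W5] that distance_2 unfolding two_convex_subspace_def perp_col using col_sym by blast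
 have conS: "v:S" if "u:S" "w:S" "~ col u w" "col u v" "col w v" for u v w
  using conv that distance_2 unfolding two_convex_subspace_def perp_col using col_sym by blast
 have inD: "x:?D" "y:?D" using spinor_farI[OF s] by (simp_all add: spinor_set_def)
 have near: "v:?D" if v: "v:S" "col x v" for v
 proof (cases "v = x")
  case True then show ?thesis using inD by simp
 next
  case False
  obtain m where m: "m:lines G" "x:m" "v:m" using ex_line[OF v(2)] False by blast
  have mS: "m <= S" by (rule subspace_line[OF sub m xy(1) v(1)]) (use False in simp)
  obtain w where w: "w:m" "col y w" using polar_one_or_all[OF sub pol xy(2) m(1) mS] by blast
  have wx: "w ~= x" using w(2) p(3) col_sym by blast
  have "w:?D" by (rule conD[OF inD p(3) col_line[OF m(1,2) w(1)] w(2)])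
  then have "m <= ?D" by (intro subspace_line[OF dsub m(1,2) w(1) inD(1)]) (use wx in simp_all)
  then show ?thesis using m(3) by blast
 qed
 have SD: "S <= ?D"
 proof
  fix v assume v: "v:S"
  obtain A B where A: "gr 3 A" "gr 3 B" "dim (A Int B) = 1" "EX a:ln x A. col y a" "EX b:ln x B. col y b"
   using polar_noncollinear[OF p, of z z'] l(2) z z' by metis
  have on: "EX w:ln x C. w ~= x & col v w & w:S" if C: "gr 3 C" "EX c:ln x C. col y c" and nv: "~ col x v" for C
  proof -
   obtain c where c: "c:ln x C" "col y c" using C(2) by blast
   note m = ln(1,2)[OF p(1) C(1)]
   have cx: "c ~= x" using c(2) p(3) col_sym by blast
   have "c:S" by (rule conS[OF xy(1,2) p(3) col_line[OF m c(1)] c(2)])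
   then have mS: "ln x C <= S" by (intro subspace_line[OF sub m c(1) xy(1)]) (use cx in simp_all)
   obtain w where w: "w:ln x C" "col v w" using polar_one_or_all[OF sub pol v m(1) mS] by blast
   then show ?thesis using mS nv col_sym[OF w(2)] by auto
  qed
  show "v:?D"
  proof (cases "col x v")
   case False
   obtain a where a: "a:ln x A" "a ~= x" "col v a" "a:S" using on[OF A(1,4) False] by blast
   obtain b where b: "b:ln x B" "b ~= x" "col v b" "b:S" using on[OF A(2,5) False] by blast
   have ab: "~ col a b" using col_ln[OF p(1) A(1,2) a(1) b(1) a(2) b(2)] A(3) by simp
   have "a:?D" "b:?D" using near a(4) b(4) dir_eqI(2)[OF p(1) A(1) a(1,2)] dir_eqI(2)[OF p(1) A(2) b(1,2)] by blast+
   then show ?thesis using conD[OF _ _ ab col_sym[OF a(3)] col_sym[OF b(3)]] by blast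
  qed (use near v in blast)
 qed
 moreover have "?D:spinor_sets" unfolding spinor_sets_def using p(1) W5 by blast
 moreover have "D' = ?D" if D': "D':spinor_sets" "S <= D'" for D'
 proof -
  obtain q V where q: "q:points G" "gr 5 V" "D' = spinor_set q V" using D'(1) unfolding spinor_sets_def by blast
  obtain W' where W': "gr 5 W'" "spinor_set x W' = D'" using D' q xy spinor_base[OF q(1,2)] by blast
  then obtain U' where s': "sigma x y U' W'" using spinor_far[of y x W'] p(3) D'(2) xy(2) by blast
  have "W = W'"
  proof (rule sigma_least[OF s W'(1)])
   fix A assume "gr 3 A" "U <= A" "A <= W"
   then show "A <= W'" using s s' sigma_def by metis
  qed
  then show ?thesis using W'(2) by simp
 qed
 ultimately show ?thesis by blast
qed

end

section \<open>Spinor geometries\<close>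

context subspace_calculus
begin

lemma gr_span2I: "a ~= 0 ==> b ~: span {a} ==> gr 2 (span {a, b})"
 using dim_ins[of b "{a}"] by (simp add: gr_def insert_commute)

lemma span2D: "K = span {a, b} ==> v:K ==> EX s t. v = scale s a + scale t b"
 by (simp add: span_lin2)

lemma scale_solve: "x ~= 0 ==> scale x t = scale y t' ==> t = scale (inverse x * y) t'"
 by (metis left_inverse scale_one scale_scale)

lemma gr2_eq_span: "gr 2 K ==> a:K ==> b:K ==> a ~= 0 ==> b ~: span {a} ==> K = span {a, b}"
 using gr_eqI[OF gr_span2I[of a b], of K] span_minimal[of "{a,b}" K] grD(1)[of 2 K] by simp

lemma meetE: "A Int B ~= {0} ==> subspace A ==> subspace B ==> EX v. v ~= 0 & v:A & v:B"
 using subspace_0[of A] subspace_0[of B] by auto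

lemma meetI: "v ~= 0 ==> v:A ==> v:B ==> A Int B ~= {0}"
 by blast

lemma disjD: "A Int B = {0} ==> x:A ==> x:B ==> x = 0"
 by blast

lemma disj_zero: "A Int B = {0} ==> subspace A ==> subspace B ==> a:A ==> b:B ==> a + b = 0 ==> a = 0 & b = 0"
proof -
 assume h: "A Int B = {0}" "subspace A" "a:A" "b:B" "a + b = 0"
 have "b:A Int B" using h(5) subspace_neg[OF h(2,3)] h(4) minus_unique by auto
 then show ?thesis using h(1) h(5) by simp
qed

lemma disj_span:
 assumes "A Int B = {0}" "subspace A" "subspace B" "a:A" "b:B" "a ~= 0" "b ~= 0"
 shows "b ~: span {a}" "gr 2 (span {a, b})" using assms span_minimal[of "{a}" A] gr_span2I by auto

lemma transversal:
 assumes K: "gr 2 K" and s: "subspace T" "subspace A" "subspace B" and d: "T Int A = {0}" "T Int B = {0}" "A Int B = {0}"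
  and m: "K Int T ~= {0}" "K Int A ~= {0}" "K Int B ~= {0}"
 shows "EX t:T. EX a:A. t ~= 0 & a ~= 0 & t + a:B & K = span {t, a}"
proof -
 note sK = grD(1)[OF K]
 obtain t where t: "t ~= 0" "t:K" "t:T" using meetE[OF m(1) sK s(1)] by (elim exE conjE)
 obtain a where a: "a ~= 0" "a:K" "a:A" using meetE[OF m(2) sK s(2)] by (elim exE conjE)
 obtain b where b: "b ~= 0" "b:K" "b:B" using meetE[OF m(3) sK s(3)] by (elim exE conjE)
 have Kta: "K = span {t, a}" using gr2_eq_span[OF K t(2) a(2) t(1) disj_span(1)[OF d(1) s(1,2) t(3) a(3) t(1) a(1)]] .
 obtain l n where ln: "b = scale l t + scale n a" using span2D[OF Kta b(2)] by (elim exE)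
 have tT: "scale l t:T" "scale n a:A" "scale l t:K" "scale n a:K"
  using t a s sK subspace_scale by blast+
 have n0: "scale n a ~= 0" using tT(1) disjD[OF d(2) _ b(3)] b(1) by (auto simp: ln)
 have l0: "scale l t ~= 0" using tT(2) disjD[OF d(3) _ b(3)] b(1) by (auto simp: ln)
 show ?thesis using tT n0 l0 ln b(3) gr2_eq_span[OF K tT(3,4) l0 disj_span(1)[OF d(1) s(1,2) tT(1,2) l0 n0]] by blast
qed

text \<open>If \<open>A\<close> and \<open>B\<close> were disjoint, then
  \<open>K = span {t, a}\<close> and \<open>L = span {t', a'}\<close> with \<open>t + a\<close> and
  \<open>t' + a'\<close> in \<open>B\<close>. Writing a common vector of \<open>K\<close> and
  \<open>L\<close> in both ways gives proportional \<open>T\<close>-parts and proportional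
  \<open>A\<close>-parts. Depending on which part is nonzero, a combination in
  \<open>T Int B\<close> or \<open>A Int B\<close> must vanish, and then \<open>K\<close> and
  \<open>L\<close> coincide.\<close>

lemma transversals_meet:
 assumes K: "gr 2 K" "gr 2 L" "K ~= L" "K Int L ~= {0}" and s: "subspace T" "subspace A" "subspace B" and d: "T Int A = {0}" "T Int B = {0}"
  and m: "K Int T ~= {0}" "K Int A ~= {0}" "K Int B ~= {0}" "L Int T ~= {0}" "L Int A ~= {0}" "L Int B ~= {0}"
 shows "A Int B ~= {0}"
proof
 assume AB: "A Int B = {0}"
 obtain t a where K': "t:T" "a:A" "t ~= 0" "a ~= 0" "t + a:B" "K = span {t, a}"
  using transversal[OF K(1) s d AB m(1-3)] by blast
 obtain t' a' where L': "t':T" "a':A" "t' ~= 0" "a' ~= 0" "t' + a':B" "L = span {t', a'}"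
  using transversal[OF K(2) s d AB m(4-6)] by blast
 obtain v where v: "v ~= 0" "v:K" "v:L" using meetE[OF K(4) grD(1)[OF K(1)] grD(1)[OF K(2)]] by (elim exE conjE)
 obtain al be where ab: "v = scale al t + scale be a" using span2D[OF K'(6) v(2)] by (elim exE)
 obtain ga de where cd: "v = scale ga t' + scale de a'" using span2D[OF L'(6) v(3)] by (elim exE)
 have e: "scale al t = scale ga t'" "scale be a = scale de a'"
  using ab cd disj_zero[OF d(1) s(1,2), of "scale al t - scale ga t'" "scale be a - scale de a'"] K' L' s
  by (auto simp: algebra_simps subspace_diff subspace_scale)
 have par: "K = L" if p: "scale x t = scale y t'" "scale x' a = scale y' a'" "x ~= 0" "x' ~= 0" for x y x' y'
 proof -
  have "t':L" "a':L" unfolding L'(6) by (simp_all add: span_base)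
  then have "{t, a} <= L" using subspace_scale[OF grD(1)[OF K(2)]] scale_solve p by blast
  then show ?thesis using span_minimal grD(1)[OF K(2)] gr_eqI[OF K(1,2)] by (simp add: K'(6))
 qed
 have diff: "scale x (t + a) - scale y (t' + a'):B" for x y
  using K'(5) L'(5) s(3) by (simp add: subspace_diff subspace_scale)
 consider "be ~= 0" | "al ~= 0" using v(1) ab by force
 then show False
 proof cases
  case 1
  have "scale be t - scale de t':T Int B" using e(2) diff[of be de] K'(1) L'(1) s(1) by (simp add: scale_right_distrib subspace_diff subspace_scale)
  then show False using d(2) par[OF _ e(2) 1 1] K(3) by auto
 next
  case 2
  have "scale al a - scale ga a':A Int B" using e(1) diff[of al ga] K'(2) L'(2) s(2) by (simp add: scale_right_distrib subspace_diff subspace_scale)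
  then show False using AB par[OF e(1) _ 2 2] K(3) by auto
 qed
qed

text \<open>For \<open>x\<close> in \<open>A\<close> and a basis \<open>t\<close>, \<open>t'\<close>
  of \<open>T\<close>, some \<open>x + scale l t\<close> and some \<open>x + scale l' t'\<close> lie
  in \<open>B\<close>. Their difference lies in \<open>T Int B = {0}\<close>, so both coefficients
  vanish.\<close>

lemma same_transversals:
 assumes g: "gr 2 T" "gr 2 A" "gr 2 B" and d: "T Int A = {0}" "T Int B = {0}"
  and m: "!!K. gr 2 K ==> K Int T ~= {0} ==> K Int A ~= {0} ==> K Int B ~= {0}"
 shows "A = B"
proof (rule gr_eqI[OF g(2,3)], rule subsetI)
 fix x assume x: "x:A"
 note s = grD(1)[OF g(1)] grD(1)[OF g(2)] grD(1)[OF g(3)]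
 have *: "EX l. x + scale l t:B" if t: "t:T" "t ~= 0" and x0: "x ~= 0" for t
 proof -
  let ?K = "span {t, x}"
  have gK: "gr 2 ?K" by (rule disj_span(2)[OF d(1) s(1,2) t(1) x t(2) x0])
  have KB: "?K Int B ~= {0}" using m[OF gK meetI[OF t(2) _ t(1)] meetI[OF x0 _ x]] by (simp add: span_base)
  obtain b where b: "b ~= 0" "b:?K" "b:B" using meetE[OF KB grD(1)[OF gK] s(3)] by (elim exE conjE)
  obtain l n where ln: "b = scale l t + scale n x" using span2D[OF refl b(2)] by (elim exE)
  have n: "n ~= 0"
  proof
   assume "n = 0"
   then have "b:T Int B" using b ln t s by (simp add: subspace_scale)
   then show False using d b by simp
  qed
  have "scale (inverse n) b = x + scale (inverse n * l) t" using n ln by (simp add: scale_right_distrib)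
  then show ?thesis using subspace_scale[OF s(3) b(3)] by metis
 qed
 show "x:B"
 proof (cases "x = 0")
  case True then show ?thesis using subspace_0 s by simp
 next
  case False
  obtain t t' where t: "t ~= 0" "T = span {t, t'}" "t' ~: span {t}"
  proof -
   obtain t where t: "t:T" "t ~= 0" using dim_pos[of T] g(1) by (auto simp: gr_def)
   obtain t' where "t':T" "t' ~: span {t}" using t gr_ex[OF _ g(1), of 1 "span {t}"] by (auto simp: gr_def)
   then show thesis using that[of t t'] gr2_eq_span[OF g(1) t(1) _ t(2)] t by blast
  qed
  have tT: "t:T" "t':T" "t' ~= 0" using t by (auto simp: span_base span_zero)
  obtain l where l: "x + scale l t:B" using *[OF tT(1) t(1) False] by blast
  obtain l' where l': "x + scale l' t':B" using *[OF tT(2,3) False] by blast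
  have "scale l t - scale l' t':B" using subspace_diff[OF s(3) l l'] by simp
  then have e: "scale l t = scale l' t'" using disjD[OF d(2)] right_minus_eq tT s subspace_diff subspace_scale by metis
  have "l' = 0"
  proof (rule ccontr)
   assume n: "l' ~= 0"
   then have "t' = scale (inverse l' * l) t" using e by (metis scale_one scale_scale left_inverse)
   then show False using t(3) by (simp add: span_scale span_base)
  qed
  then show ?thesis using l' by simp
 qed
qed

text \<open>For \<open>t\<close> in \<open>T\<close> but not in \<open>T'\<close>, joining
  \<open>t\<close> to a vector outside the sum of \<open>T'\<close> and \<open>t\<close> gives a
  2-space that meets \<open>T\<close> and misses \<open>T'\<close>.\<close>

lemma meets_determine:
 assumes g: "gr 2 T" "gr 2 T'" and n: "4 <= dimension" and m: "!!K. gr 2 K ==> K Int T ~= {0} ==> K Int T' ~= {0}"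
 shows "T = T'"
proof (rule gr_eqI[OF g], rule subsetI, rule ccontr)
 fix t assume t: "t:T" "t ~: T'"
 have t0: "t ~= 0" using t subspace_0[OF grD(1)[OF g(2)]] by blast
 have g3: "gr 3 (span (insert t T'))" using gr_insert[OF g(2) t(2)] by simp
 have "gr dimension UNIV" by (simp only: gr_def dimension_def dim_UNIV) simp
 then obtain w where w: "w ~: span (insert t T')" using gr_ex[OF g3, of dimension UNIV] n by auto
 have gK: "gr 2 (span {t, w})" using w span_mono[of "{t}" "insert t T'"] gr_span2I[OF t0] by auto
 have wT: "span {t, w} Int T' ~= {0}" by (rule m[OF gK meetI[OF t0 span_base t(1)]]) simp
 obtain v where v: "v ~= 0" "v:span {t, w}" "v:T'" using meetE[OF wT subspace_span grD(1)[OF g(2)]] by (elim exE conjE)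
 obtain l n where ln: "v = scale l t + scale n w" using span2D[OF refl v(2)] by (elim exE)
 show False
 proof (cases "n = 0")
  case True
  then have "t = scale (inverse l) v" using v ln by simp
  then show False using t(2) subspace_scale[OF grD(1)[OF g(2)] v(3)] by simp
 next
  case False
  have "w = scale (inverse n) (v - scale l t)" using ln False by simp
  also have "... : span (insert t T')" by (intro span_scale span_diff span_base) (use v in auto)
  finally show False using w by simp
 qed
qed

lemma disjoint_exists:
 assumes A: "gr 2 A" "A <= Y" and Y: "gr 4 Y"
 shows "EX K. gr 2 K & K <= Y & K Int A = {0}"
proof -
 obtain u where u: "u:Y" "u ~: A" using gr_ex[OF A(1) Y] by auto
 have g3: "gr 3 (span (insert u A))" using gr_insert[OF A(1) u(2)] by simp
 obtain w where w: "w:Y" "w ~: span (insert u A)" using gr_ex[OF g3 Y] by auto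
 have u0: "u ~= 0" using u(2) subspace_0[OF grD(1)[OF A(1)]] by blast
 have wu: "w ~: span {u}" using w(2) span_mono[of "{u}" "insert u A"] by blast
 have "v = 0" if v: "v:span {u, w}" "v:A" for v
 proof -
  obtain s t where st: "v = scale s u + scale t w" using span2D[OF refl v(1)] by (elim exE)
  have t0: "t = 0"
  proof (rule ccontr)
   assume "t ~= 0"
   then have "w = scale (inverse t) (v - scale s u)" using st by simp
   also have "... : span (insert u A)" by (intro span_scale span_diff span_base) (use v in auto)
   finally show False using w(2) by simp
  qed
  have "s = 0"
  proof (rule ccontr)
   assume "s ~= 0"
   then have "u = scale (inverse s) v" using st t0 by simp
   then show False using u(2) subspace_scale[OF grD(1)[OF A(1)] v(2)] by simp
  qed
  then show ?thesis using st t0 by simp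
 qed
 then have "span {u, w} Int A = {0}" using subspace_0[OF grD(1)[OF A(1)]] span_zero by fast
 moreover have "span {u, w} <= Y" by (rule span_minimal) (use u w grD(1)[OF Y] in auto)
 ultimately show ?thesis using gr_span2I[OF u0 wu] by blast
qed

lemma gr2_meet_in_3: "gr 2 A ==> gr 2 B ==> A <= W ==> B <= W ==> gr 3 W ==> A Int B ~= {0}"
proof
 assume h: "gr 2 A" "gr 2 B" "A <= W" "B <= W" "gr 3 W" and e: "A Int B = {0}"
 show False using gr_inter_ge[OF h] by (simp add: e)
qed

lemma gr2_adj:
 assumes "gr 2 A" "gr 2 B" "A ~= B" "A Int B ~= {0}"
 shows "gr 1 (A Int B)" "gr 3 (A #+ B)"
proof -
 have le: "dim (A Int B) <= 2" by (rule gr_dim_le[OF _ assms(1)]) blast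
 have "dim (A Int B) ~= 2"
  proof
   assume "dim (A Int B) = 2"
   then have g: "gr 2 (A Int B)" by (rule gr_inter[OF assms(1,2)])
   show False using gr_eqI[OF g assms(1)] gr_eqI[OF g assms(2)] assms(3) by blast
  qed
 then have d: "dim (A Int B) = 1" using le dim_pos_iff[OF subspace_inter[OF grD(1)[OF assms(1)] grD(1)[OF assms(2)]]] assms(4) by simp
 show "gr 1 (A Int B)" by (rule gr_inter[OF assms(1,2) d])
 show "gr 3 (A #+ B)" by (rule gr_ssum[OF assms(1,2)]) (use d in simp)
qed

text \<open>Split a common vector of \<open>K\<close> and \<open>L\<close> into its
  \<open>T\<close>-part and its \<open>A\<close>-part; both lie in \<open>K Int L\<close>. The first
  is excluded by hypothesis, so the second is nonzero.\<close>

lemma transversals_common: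
 assumes K: "gr 2 K" "gr 2 L" and s: "subspace T" "subspace A" and d: "T Int A = {0}"
  and m: "K Int T ~= {0}" "K Int A ~= {0}" "L Int T ~= {0}" "L Int A ~= {0}" "K Int L ~= {0}" and n: "T Int K Int L = {0}"
 shows "A Int K Int L ~= {0}"
proof
 assume n': "A Int K Int L = {0}"
 note sK = grD(1)[OF K(1)] and sL = grD(1)[OF K(2)]
 obtain t where t: "t ~= 0" "t:K" "t:T" using meetE[OF m(1) sK s(1)] by (elim exE conjE)
 obtain a where a: "a ~= 0" "a:K" "a:A" using meetE[OF m(2) sK s(2)] by (elim exE conjE)
 obtain t' where t': "t' ~= 0" "t':L" "t':T" using meetE[OF m(3) sL s(1)] by (elim exE conjE)
 obtain a' where a': "a' ~= 0" "a':L" "a':A" using meetE[OF m(4) sL s(2)] by (elim exE conjE)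
 obtain v where v: "v ~= 0" "v:K" "v:L" using meetE[OF m(5) sK sL] by (elim exE conjE)
 have Ks: "K = span {t, a}" using gr2_eq_span[OF K(1) t(2) a(2) t(1) disj_span(1)[OF d s t(3) a(3) t(1) a(1)]] .
 have Ls: "L = span {t', a'}" using gr2_eq_span[OF K(2) t'(2) a'(2) t'(1) disj_span(1)[OF d s t'(3) a'(3) t'(1) a'(1)]] .
 obtain x y where xy: "v = scale x t + scale y a" using span2D[OF Ks v(2)] by (elim exE)
 obtain x' y' where xy': "v = scale x' t' + scale y' a'" using span2D[OF Ls v(3)] by (elim exE)
 have z: "(scale x t - scale x' t') + (scale y a - scale y' a') = 0" using xy xy' by (simp add: algebra_simps)
 have e: "scale x t = scale x' t'" "scale y a = scale y' a'" using t t' a a' s disj_zero[OF d s _ _ z] by (auto simp: subspace_diff subspace_scale)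
 have "scale x t = 0" using e(1) subspace_scale[OF sK t(2), of x] subspace_scale[OF sL t'(2), of x'] subspace_scale[OF s(1) t(3), of x] disjD[OF n]
  by force
 moreover have "scale y a:A Int K Int L"
  using e(2) subspace_scale[OF sK a(2), of y] subspace_scale[OF sL a'(2), of y'] subspace_scale[OF s(2) a(3), of y] by simp
 then have "scale y a = 0" using disjD[OF n'] by blast
 ultimately show False using xy v(1) by (simp only: add_0_left)
qed

end

text \<open>The 2-space \<open>d x y\<close> represents the line through \<open>x\<close> and \<open>y\<close> among the lines on \<open>x\<close>; its value is irrelevant unless \<open>x\<close>, \<open>y\<close> are
 collinear and distinct.\<close>

locale spinor_geometry = gamma_geometry H + subspace_calculus "(*s) :: 'k::field => 'k^5 => 'k^5" cart_basis
 for H :: "'p geometry" +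
 fixes d :: "'p => 'p => ('k::field^5) set"
 assumes d_gr: "x:points H ==> col x y ==> y ~= x ==> gr 2 (d x y)"
  and d_surj: "x:points H ==> gr 2 A ==> EX y. col x y & y ~= x & d x y = A"
  and d_line: "l:lines H ==> x:l ==> y:l ==> z:l ==> y ~= x ==> z ~= x ==> d x y = d x z"
  and d_eq: "x:points H ==> col x y ==> y ~= x ==> col x z ==> z ~= x ==> d x y = d x z ==> EX l:lines H. x:l & y:l & z:l"
  and d_col: "x:points H ==> col x y ==> y ~= x ==> col x z ==> z ~= x ==> col y z <-> d x y Int d x z ~= {0}"
  and d_pencil: "p:points H ==> col p a ==> a ~= p ==> col p b ==> b ~= p ==> col a b ==> d p a ~= d p b ==>
    k:lines H ==> a:k ==> b:k ==> s:k ==> s ~= p & col p s & d p a Int d p b <= d p s & d p s <= ssum (d p a) (d p b)"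
  and d_pencil_ex: "p:points H ==> col p a ==> a ~= p ==> col p b ==> b ~= p ==> col a b ==> d p a ~= d p b ==>
    k:lines H ==> a:k ==> b:k ==> gr 2 C ==> d p a Int d p b <= C ==> C <= ssum (d p a) (d p b) ==>
    EX s:k. s ~= p & col p s & d p s = C"
  and pasch: "l:lines H ==> m:lines H ==> p:l ==> p:m ==> l ~= m ==> x:l ==> x ~= p ==> y:m ==> y ~= p ==>
    col x y ==> k:lines H ==> x:k ==> y:k ==> k':lines H ==> x':k' ==> y':k' ==> x':l ==> y':m ==>
    x' ~= p ==> y' ~= p ==> k Int k' ~= {}"
  and far_ex: "x:points H ==> y:points H ==> ~ col x y ==>
    EX Y. gr 4 Y & (ALL A. gr 2 A --> (EX s. col x s & d x s = A & col s y) <-> A <= Y)"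
  and d_type: "p:points H ==> col p a ==> col p b ==> col p c ==> col a b ==> col a c ==> col b c ==>
    p ~= a ==> p ~= b ==> p ~= c ==> a ~= b ==> a ~= c ==> b ~= c ==>
    d p a Int d p b Int d p c = {0} ==> d a p Int d a b Int d a c = {0}"
begin

notation ssum (infixl "#+" 65)

lemma dim5: "dimension = 5" "gr 5 UNIV" by (auto simp: card_cart_basis gr_def dimension_def)

lemma far_ne: "~ col x y ==> col s y ==> s ~= x" by blast

text \<open>The directions at \<open>x\<close> towards the common neighbours of \<open>x\<close> and
  \<open>y\<close>: in dual form, the 1-space \<open>U\<close> of \<open>sigma\<close>.\<close>

definition fs :: "'p => 'p => ('k^5) set" where
 "fs x y = (SOME Y. gr 4 Y & (ALL A. gr 2 A --> (EX s. col x s & d x s = A & col s y) <-> A <= Y))"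

lemma fs:
 assumes "x:points H" "y:points H" "~ col x y"
 shows "gr 4 (fs x y)" "gr 2 A ==> A <= fs x y ==> EX s. col x s & s ~= x & d x s = A & col s y"
  "col x s ==> col s y ==> d x s <= fs x y"
proof -
 have h: "gr 4 (fs x y) & (ALL A. gr 2 A --> (EX s. col x s & d x s = A & col s y) <-> A <= fs x y)"
  unfolding fs_def by (rule someI_ex[OF far_ex[OF assms]])
 then show "gr 4 (fs x y)" by simp
 show "EX s. col x s & s ~= x & d x s = A & col s y" if "gr 2 A" "A <= fs x y"
  using h that far_ne[OF assms(3)] by metis
 show "d x s <= fs x y" if "col x s" "col s y"
  using h that d_gr[OF assms(1) that(1) far_ne[OF assms(3) that(2)]] by blast
qed

lemma dir_unique:
 assumes "p:points H" "col p a" "a ~= p" "col p b" "b ~= p" "d p a = d p b" "col a y" "col b y" "~ col p y"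
 shows "a = b"
proof (rule ccontr)
 assume ne: "a ~= b"
 obtain l where l: "l:lines H" "p:l" "a:l" "b:l" using d_eq[OF assms(1-6)] by blast
 show False using col_all[OF l(1,3,4) ne col_sym[OF assms(7)] col_sym[OF assms(8)] l(2)] assms(9) col_sym by blast
qed

text \<open>For \<open>v\<close> in \<open>fs p y\<close> outside \<open>d p r\<close>, join
  \<open>v\<close> to a vector of \<open>d p r\<close>. The neighbour of \<open>y\<close> in this
  direction is also collinear with \<open>r\<close>, hence with the whole line and with
  \<open>y'\<close>.\<close>

lemma fs_line:
 assumes p: "p:points H" and l: "l:lines H" "y:l" "y':l" "r:l" and n: "~ col p y" "~ col p y'" "col p r"
 shows "fs p y = fs p y'"
proof -
 have sub: "fs p y <= fs p y'" if l: "y:l" "y':l" and n: "~ col p y" "~ col p y'" for y y'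
 proof
  fix v assume v: "v:fs p y"
  have py: "y:points H" "y':points H" using line_points[OF assms(2)] l by blast+
  have ry: "col r y" "col r y'" using col_line[OF assms(2,5)] l by blast+
  have rp: "r ~= p" "r ~= y" using ry n assms(8) by blast+
  note F = fs[OF p py(1) n(1)] fs[OF p py(2) n(2)]
  have R: "d p r <= fs p y" "d p r <= fs p y'" by (rule F(3)[OF assms(8) ry(1)], rule F(6)[OF assms(8) ry(2)])
  note gr = d_gr[OF p assms(8) rp(1)]
  show "v:fs p y'"
  proof (cases "v:d p r")
   case False
   obtain e where e: "e:d p r" "e ~= 0" using dim_pos[of "d p r"] gr by (auto simp: gr_def)
   have ve: "v ~: span {e}" using False e span_minimal[of "{e}" "d p r"] grD(1)[OF gr] by blast
   let ?F = "span {e, v}"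
   have "?F <= fs p y" by (rule span_minimal) (use e R v grD(1)[OF F(1)] in auto)
   then obtain s where s: "col p s" "s ~= p" "d p s = ?F" "col s y" using F(2)[OF gr_span2I[OF e(2) ve]] by blast
   show ?thesis using d_col[OF p s(1,2) assms(8) rp(1)] s(3) meetI[OF e(2) span_base e(1)] col_all[OF assms(2) assms(5) l(1) rp(2) _ s(4) l(2)] F(6)[OF s(1)] by (auto simp: span_base)
  qed (use R in blast)
 qed
 show ?thesis using sub[OF l(2,3) n(1,2)] sub[OF l(3,2) n(2,1)] by blast
qed

text \<open>Seen from \<open>y\<close>, the points \<open>r'\<close> and \<open>p\<close> lie on a
  line through the neighbour \<open>r\<close>, so \<open>fs y r' = fs y p\<close> by
  \<open>fs_line\<close>. The direction of \<open>k\<close> at \<open>y\<close> leads to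
  \<open>y'\<close>, a neighbour of \<open>r'\<close>, hence it also leads to a neighbour of
  \<open>p\<close>.\<close>

lemma far_line_meets:
 assumes p: "p:points H" and k: "k:lines H" "y:k" "y':k" "y ~= y'" and n: "~ col p y" "~ col p y'"
  and l: "l:lines H" "p:l" "r:l" "r':l" "r ~= r'" and c: "col r y" "col r' y'"
 shows "EX s:k. col p s"
proof -
 have pts: "y:points H" "r':points H" "r:points H" using line_points k l by blast+
 have cy: "col y r" "~ col y p" using c(1) n(1) col_sym by blast+
 have nr: "~ col y r'" using col_all[OF l(1,3,4,5) cy(1) _ l(2)] cy(2) by blast
 have cy': "col y y'" using col_line k by blast
 obtain s where s: "col y s" "s ~= y" "d y s = d y y'" "col s p"
  using fs(3)[OF pts(1,2) nr cy' col_sym[OF c(2)]] fs_line[OF pts(1) l(1,4,2,3) nr cy(2,1)] fs(2)[OF pts(1) p cy(2) d_gr[OF pts(1) cy' k(4)[symmetric]]]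
  by auto
 obtain m where m: "m:lines H" "y:m" "s:m" "y':m" using d_eq[OF pts(1) s(1,2) cy' k(4)[symmetric] s(3)] by blast
 show ?thesis using m(3) col_sym[OF s(4)] line_eq[OF m(1) k(1) m(2) k(2) m(4) k(3,4)] by auto
qed

text \<open>The line \<open>px\<close> has a point collinear with \<open>y'\<close>. If it were not
  \<open>x\<close>, \<open>far_line_meets\<close> would give a point of \<open>k\<close> collinear
  with \<open>p\<close>.\<close>

lemma far_same:
 assumes p: "p:points H" and k: "k:lines H" "y:k" "y':k" and n: "~ (EX s:k. col p s)"
  and x: "col p x" "col x y" "d p x <= fs p y'"
 shows "col x y'"
proof (cases "y = y'")
 case False
 have n': "~ col p y" "~ col p y'" using n k by blast+
 have y': "y':points H" using line_points k by blast
 have xp: "x ~= p" using x(2) n' by blast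
 obtain x' where x': "col p x'" "x' ~= p" "d p x' = d p x" "col x' y'" using fs(2)[OF p y' n'(2) d_gr[OF p x(1) xp] x(3)] by blast
 obtain l where l: "l:lines H" "p:l" "x':l" "x:l" using d_eq[OF p x'(1,2) x(1) xp x'(3)] by blast
 show ?thesis using far_line_meets[OF p k False n' l(1,2,4,3) _ x(2) x'(4)] n x'(4) by auto
qed (use x in simp)

text \<open>At \<open>r\<close> the common neighbours of \<open>p\<close> and \<open>y\<close>
  correspond to the transversals of \<open>d r p\<close> and \<open>d r y\<close>, so this is
  \<open>same_transversals\<close>.\<close>

lemma trace_dir:
 assumes p: "p:points H" "col p r" "r ~= p" and y: "col r y" "~ col p y" "col r y'" "~ col p y'"
  and tr: "!!x. col p x ==> col r x ==> col x y ==> col x y'"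
 shows "d r y = d r y'"
proof -
 have r: "r:points H" "col r p" "p ~= r" "y ~= r" "y' ~= r" using col_point[OF p(2,1)] p col_sym y by blast+
 note g = d_gr[OF r(1,2,3)] d_gr[OF r(1) y(1) r(4)] d_gr[OF r(1) y(3) r(5)]
 show ?thesis
 proof (rule same_transversals[OF g])
  show "d r p Int d r y = {0}" "d r p Int d r y' = {0}"
   using d_col[OF r(1,2,3) y(1) r(4)] d_col[OF r(1,2,3) y(3) r(5)] y by blast+
  fix K assume K: "gr 2 K" "K Int d r p ~= {0}" "K Int d r y ~= {0}"
  obtain x where x: "col r x" "x ~= r" "d r x = K" using d_surj[OF r(1) K(1)] by blast
  show "K Int d r y' ~= {0}" using d_col[OF r(1) x(1,2) r(2,3)] d_col[OF r(1) x(1,2) y(1) r(4)] K x(3) tr[OF col_sym x(1)] d_col[OF r(1) x(1,2) y(3) r(5)]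
   by simp
 qed
qed

text \<open>Otherwise \<open>far_same\<close> makes \<open>y\<close> and \<open>y'\<close> collinear
  with the same neighbours of \<open>p\<close>. They then have the same direction at such a
  neighbour \<open>r\<close>, which puts \<open>r\<close> itself on \<open>k\<close>.\<close>

lemma fs_eq_meets:
 assumes p: "p:points H" and k: "k:lines H" "y:k" "y':k" "y ~= y'" and n: "~ col p y" "~ col p y'" and e: "fs p y = fs p y'"
 shows "EX s:k. col p s"
proof (rule ccontr)
 assume nk: "~ ?thesis"
 have py: "y:points H" "y':points H" using line_points k by blast+
 note F = fs[OF p py(1) n(1)]
 obtain A where A: "gr 2 A" "A <= fs p y" using gr_sub[OF F(1), of 2 "{0}"] subspace_0[OF grD(1)[OF F(1)]] by auto
 obtain r where r: "col p r" "r ~= p" "d p r = A" "col r y" using F(2)[OF A] by blast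
 have s: "col x y'" if "col p x" "col x y" for x
  using far_same[OF p k(1-3) nk that] F(3)[OF that] e by simp
 have "d r y = d r y'" by (rule trace_dir[OF p r(1,2,4) n(1) s[OF r(1,4)] n(2)]) (rule s)
 then obtain l where l: "l:lines H" "r:l" "y:l" "y':l"
  using d_eq[OF col_point[OF r(1) p] r(4) _ s[OF r(1,4)]] r(1) n by blast
 show False using nk l(2) r(1) line_eq[OF l(1) k(1) l(3) k(2) l(4) k(3,4)] by simp
qed

lemma far_exists: "p:points H ==> EX y:points H. ~ col p y"
proof -
 assume p: "p:points H"
 have "subspace {0}" by (rule subspace_single_0)
 obtain Y where Y: "gr 4 Y" using gr_sub[OF dim5(2), of 4 "{0}"] by auto
 obtain A where A: "gr 2 A" "A <= Y" using gr_sub[OF Y, of 2 "{0}"] subspace_0[OF grD(1)[OF Y]] by auto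
 obtain B where B: "gr 2 B" "B Int A = {0}" using disjoint_exists[OF A Y] by blast
 obtain x where x: "col p x" "x ~= p" "d p x = A" using d_surj[OF p A(1)] by blast
 obtain x' where x': "col p x'" "x' ~= p" "d p x' = B" using d_surj[OF p B(1)] by blast
 have n: "~ col x x'" using d_col[OF p x(1,2) x'(1,2)] x(3) x'(3) B(2) by (simp add: Int_commute)
 have px: "x:points H" "x':points H" using col_point p x x' by blast+
 note F = fs[OF px n]
 have T: "gr 2 (d x p)" "d x p <= fs x x'" using d_gr[OF px(1) col_sym[OF x(1)]] x(2) F(3)[OF col_sym[OF x(1)] x'(1)] by auto
 obtain K where K: "gr 2 K" "K <= fs x x'" "K Int d x p = {0}" using disjoint_exists[OF T F(1)] by blast
 obtain s where s: "col x s" "s ~= x" "d x s = K" using F(2)[OF K(1,2)] by blast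
 show ?thesis using d_col[OF px(1) s(1,2) col_sym[OF x(1)] x(2)[symmetric]] s(3) K(3) col_point[OF s(1) px(1)] col_sym by auto
qed

end

section \<open>A singular subspace opposite to p and the choice of origins\<close>

context spinor_geometry
begin

lemma span2_sub: "a:A ==> b:A ==> gr k A ==> span {a, b} <= A"
 by (rule span_minimal) (auto simp: gr_def)

lemma gr2_nz: "gr 2 A ==> EX a. a ~= 0 & a:A"
 using dim_pos[of A] by (auto simp: gr_def)

lemma triangle:
 assumes W: "gr 3 W" and f: "f:W" "f ~= 0"
 shows "EX A B C. gr 2 A & gr 2 B & gr 2 C & A ~= B & A ~= C & B ~= C & A <= W & B <= W & C <= W & f:A & A Int B Int C = {0}"
proof -
 have g1: "gr 1 (span {f})" using f by (simp add: gr_def)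
 obtain a where a: "a:W" "a ~: span {f}" using gr_ex[OF g1 W] by auto
 let ?A = "span {f, a}"
 have A: "gr 2 ?A" by (rule gr_span2I[OF f(2) a(2)])
 obtain b where b: "b:W" "b ~: ?A" using gr_ex[OF A W] by auto
 have fA: "f:?A" "a:?A" by (simp_all add: span_base)
 have a0: "a ~= 0" using a(2) span_zero by blast
 have bf: "b ~: span {f}" "b ~: span {a}" using b(2) span_mono[of "{f}" "{f,a}"] span_mono[of "{a}" "{f,a}"] by blast+
 let ?B = "span {f, b}" and ?C = "span {a, b}"
 have B: "gr 2 ?B" "gr 2 ?C" by (rule gr_span2I[OF f(2) bf(1)], rule gr_span2I[OF a0 bf(2)])
 have bB: "b:?B" "b:?C" "f:?B" "a:?C" by (simp_all add: span_base)
 have AB: "?A ~= ?B" "?A ~= ?C" using b(2) bB by blast+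
 have i1: "?A Int ?B = span {f}"
 proof -
  note g = gr2_adj(1)[OF A B(1) AB(1) meetI[OF f(2) fA(1) bB(3)]]
  show ?thesis using span_mono[of "{f}" "{f,a}"] span_mono[of "{f}" "{f,b}"] gr_eqI[OF g1 g] by simp
 qed
 have fC: "f ~: ?C" using span2_sub[OF _ bB(4) B(2)] gr_eqI[OF A B(2)] AB(2) by force
 then have BC: "?B ~= ?C" using bB(3) by blast
 have "v = 0" if v: "v:span {f}" "v:?C" for v
 proof (rule ccontr)
  assume v0: "v ~= 0"
  obtain l where l: "v = l *s f" using v(1) by (auto simp: span_singleton)
  have "f = inverse l *s v" using l v0 by force
  then show False using fC v(2) span_scale by metis
 qed
 then have "?A Int ?B Int ?C = {0}" unfolding i1 using span_zero by fast
 moreover have "?A <= W" "?B <= W" "?C <= W" using span2_sub[OF _ _ W] f a b by blast+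
 ultimately show ?thesis using A B AB BC fA(1) by (intro exI conjI)
qed

context
 fixes p y0 e'
 assumes p: "p:points H" and y0: "y0:points H" "~ col p y0" and e': "e' ~: fs y0 p"
begin

lemma y0p: "~ col y0 p" using y0 col_sym by blast

lemma e'_nz: "e' ~= 0" using e' subspace_0[OF grD(1)[OF fs(1)[OF y0(1) p y0p]]] by blast

text \<open>The union of the lines on \<open>y0\<close> whose 2-spaces contain \<open>e'\<close>.
  Since \<open>e'\<close> is not in \<open>fs y0 p\<close>, this singular subspace has no point
  collinear with \<open>p\<close>, and \<open>opp_onto\<close> shows that every 4-space is
  \<open>fs p n\<close> for one of its points \<open>n\<close>. Its neighbours around
  \<open>p\<close> will be the origins of coordinates.\<close>

definition opp_space :: "'p set" where
 "opp_space = {n. n = y0 | col y0 n & n ~= y0 & e':d y0 n}"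

lemma opp_far: "n:opp_space ==> ~ col p n"
proof
 assume n: "n:opp_space" and c: "col p n"
 then have h: "col y0 n" "n ~= y0" "e':d y0 n" using y0 unfolding opp_space_def by auto
 then show False using fs(3)[OF y0(1) p y0p h(1) col_sym[OF c]] e' by blast
qed

lemma opp_points: "n:opp_space ==> n:points H"
 unfolding opp_space_def using y0(1) col_point by blast

lemma opp_col: "n:opp_space ==> m:opp_space ==> col n m"
proof -
 assume "n:opp_space" "m:opp_space"
 then consider "n = y0" "col y0 m" | "m = y0" "col y0 n" | "col y0 n" "n ~= y0" "e':d y0 n" "col y0 m" "m ~= y0" "e':d y0 m"
  unfolding opp_space_def by auto
 then show "col n m"
 proof cases
  case 3
  then show ?thesis using d_col[OF y0(1) 3(1,2,4,5)] meetI[OF e'_nz] by blast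
 qed (use col_sym in auto)
qed

lemma opp_line:
 assumes n: "n:opp_space" "m:opp_space" "n ~= m" and k: "k:lines H" "n:k" "m:k" and s: "s:k"
 shows "s:opp_space"
proof (cases "s = y0")
 case True then show ?thesis by (simp add: opp_space_def)
next
 case sy: False
 have dirl: "s:opp_space" if x: "x:opp_space" "x:k" "y0:k" "x ~= y0" for x using x d_line[OF k(1) x(3,2) s x(4) sy] col_line[OF k(1) x(3) s]
  by (simp add: opp_space_def)
 show ?thesis
 proof (cases "y0:k")
  case True
  show ?thesis using dirl[OF n(1) k(2) True] dirl[OF n(2) k(3) True] n(3) by metis
 next
  case False
  have ne: "n ~= y0" "m ~= y0" using False k by blast+
  have c: "col y0 n" "e':d y0 n" "col y0 m" "e':d y0 m" using n ne unfolding opp_space_def by simp_all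
  have nd: "d y0 n ~= d y0 m"
  proof
   assume "d y0 n = d y0 m"
   then obtain l where l: "l:lines H" "y0:l" "n:l" "m:l" using d_eq[OF y0(1) c(1) ne(1) c(3) ne(2)] by blast
   then show False using line_eq[OF l(1) k(1) l(3) k(2) l(4) k(3) n(3)] False by simp
  qed
  have "col y0 s" "d y0 n Int d y0 m <= d y0 s"
   using d_pencil[OF y0(1) c(1) ne(1) c(3) ne(2) opp_col[OF n(1,2)] nd k s] by blast+
  then show ?thesis unfolding opp_space_def using c by blast
 qed
qed

lemma opp_same:
 assumes n: "n:opp_space" "m:opp_space" and x: "col p x" "col x n" "d p x <= fs p m"
 shows "col x m"
proof (cases "n = m")
 case False
 obtain k where k: "k:lines H" "n:k" "m:k" using ex_line[OF opp_col[OF n] False] by blast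
 have nk: "~ (EX s:k. col p s)" using opp_line[OF n False k] opp_far by blast
 show ?thesis by (rule far_same[OF p k nk x])
qed (use x in simp)

text \<open>Three directions forming a triangle in \<open>W\<close> give common neighbours
  \<open>a\<close>, \<open>b\<close>, \<open>c\<close> of \<open>p\<close> and \<open>y0\<close>.
  Their directions at \<open>y0\<close> share a vector \<open>q\<close>, so every point of the
  opposite subspace in the direction \<open>span {q, e'}\<close> is collinear with all three, and
  its \<open>fs\<close> contains the triangle and therefore \<open>W\<close>.\<close>

lemma opp_vertex:
 assumes W: "gr 3 W" "W <= fs p y0" and f: "f:W" "f ~= 0"
 shows "EX m r. col y0 m & m ~= y0 & e':d y0 m & col p r & f:d p r & d p r <= W & col r y0 & col r m &
  (ALL n. n:opp_space --> d y0 n = d y0 m --> W <= fs p n)"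
proof -
 obtain A B C where t: "gr 2 A" "gr 2 B" "gr 2 C" "A ~= B" "A ~= C" "B ~= C" "A <= W" "B <= W" "C <= W" "f:A" "A Int B Int C = {0}"
  using triangle[OF W(1) f] by (elim exE conjE)
 note F = fs[OF p y0]
 have "A <= fs p y0" "B <= fs p y0" "C <= fs p y0" using t(7-9) W(2) by blast+
 then obtain a b c where a: "col p a" "a ~= p" "d p a = A" "col a y0" and b: "col p b" "b ~= p" "d p b = B" "col b y0"
  and c: "col p c" "c ~= p" "d p c = C" "col c y0" using F(2)[OF t(1)] F(2)[OF t(2)] F(2)[OF t(3)] by metis
 have m: "A Int B ~= {0}" "A Int C ~= {0}" "B Int C ~= {0}"
  by (rule gr2_meet_in_3[OF t(1,2,7,8) W(1)], rule gr2_meet_in_3[OF t(1,3,7,9) W(1)], rule gr2_meet_in_3[OF t(2,3,8,9) W(1)])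
 have co: "col a b" "col a c" "col b c"
  using d_col[OF p a(1,2) b(1,2)] d_col[OF p a(1,2) c(1,2)] d_col[OF p b(1,2) c(1,2)] a b c m by simp_all
 have ne: "a ~= b" "a ~= c" "b ~= c" using t(4-6) a(3) b(3) c(3) by blast+
 have ny: "a ~= y0" "b ~= y0" "c ~= y0" using a b c y0 by blast+
 have pa: "a:points H" "col a p" "p ~= a" using col_point[OF a(1) p] col_sym a by auto
 have tri: "d p a Int d p b Int d p c = {0}" using t(11) a(3) b(3) c(3) by simp
 note g = d_gr[OF pa] d_gr[OF pa(1) a(4) ny(1)[symmetric]] d_gr[OF pa(1) co(1) ne(1)[symmetric]] d_gr[OF pa(1) co(2) ne(2)[symmetric]]
 note dc = d_col[OF pa(1)]
 \<comment> \<open>Seen from \<open>p\<close> the triangle has no common vector, and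
   \<open>d_type\<close> carries this to the vertex \<open>a\<close>. So the meeting point of the
   transversals \<open>d a b\<close> and \<open>d a c\<close> is not on \<open>d a p\<close>; by
   \<open>transversals_common\<close> it is on \<open>d a y0\<close>. Another use of
   \<open>d_type\<close> transfers this to \<open>y0\<close>.\<close>
 have "d a y0 Int d a b Int d a c ~= {0}"
 proof (rule transversals_common[OF g(3,4) grD(1)[OF g(1)] grD(1)[OF g(2)] _ _ _ _ _ _ d_type[OF p a(1) b(1) c(1) co a(2)[symmetric] b(2)[symmetric] c(2)[symmetric] ne tri]])
  show "d a p Int d a y0 = {0}" using dc[OF pa(2,3) a(4) ny(1)[symmetric]] y0 by blast
  show "d a b Int d a p ~= {0}" "d a b Int d a y0 ~= {0}" "d a c Int d a p ~= {0}" "d a c Int d a y0 ~= {0}" "d a b Int d a c ~= {0}"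
   using dc[OF co(1) ne(1)[symmetric] pa(2,3)] dc[OF co(1) ne(1)[symmetric] a(4) ny(1)[symmetric]]
    dc[OF co(2) ne(2)[symmetric] pa(2,3)] dc[OF co(2) ne(2)[symmetric] a(4) ny(1)[symmetric]]
    dc[OF co(1) ne(1)[symmetric] co(2) ne(2)[symmetric]] col_sym[OF b(1)] col_sym[OF c(1)] b(4) c(4) co(3) by simp_all
 qed
 then have "d y0 a Int d y0 b Int d y0 c ~= {0}"
  using d_type[OF y0(1) col_sym[OF a(4)] col_sym[OF b(4)] col_sym[OF c(4)] co ny[symmetric] ne] by blast
 moreover have sub: "subspace (d y0 a)" "subspace (d y0 b)" "subspace (d y0 c)"
  using grD(1)[OF d_gr[OF y0(1) col_sym]] a(4) b(4) c(4) ny by blast+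
 then have "0:d y0 a Int d y0 b Int d y0 c" using subspace_0 by simp
 ultimately obtain q where q: "q ~= 0" "q:d y0 a" "q:d y0 b" "q:d y0 c" by blast
 have gk: "gr 2 (span {q, e'})" using e' span_minimal[of "{q}" "fs y0 p"] q(2) grD(1)[OF fs(1)[OF y0(1) p y0p]] fs(3)[OF y0(1) p y0p col_sym[OF a(4)] pa(2)] gr_span2I[OF q(1)] by auto
 obtain m where m: "col y0 m" "m ~= y0" "d y0 m = span {q, e'}" using d_surj[OF y0(1) gk] by blast
 have qe: "q:span {q, e'}" "e':span {q, e'}" by (simp_all add: span_base)
 have near: "col x n" if "n ~= y0" "col y0 n" "d y0 n = d y0 m" "x:{a, b, c}" for x n
 proof -
  have x: "col y0 x" "x ~= y0" "q:d y0 x" using that(4) a b c ny q col_sym by auto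
  show ?thesis using d_col[OF y0(1) x(1,2) that(2,1)] meetI[OF q(1) x(3)] that(3) m(3) qe by simp
 qed
 have "W <= fs p n" if n: "n:opp_space" "d y0 n = d y0 m" for n
 proof (cases "n = y0")
  case False
  have cn: "col y0 n" using n False unfolding opp_space_def by simp
  note Fn = fs[OF p opp_points[OF n(1)] opp_far[OF n(1)]]
  show ?thesis using Fn(3)[OF a(1)] Fn(3)[OF b(1)] near[OF False cn n(2)] a(3) b(3) ssum_le[OF _ _ Fn(1)] gr_eqI[OF gr2_adj(2)[OF t(1,2,4) \<open>A Int B ~= {0}\<close>] W(1) ssum_le[OF t(7,8) W(1)]] by blast
 qed (use W in simp)
 moreover have "col a m" using near[OF m(2,1)] by simp
 ultimately show ?thesis using m qe(2) a t by blast
qed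

text \<open>By \<open>opp_vertex\<close> a whole line \<open>k\<close> of the opposite subspace
  satisfies \<open>W <= fs p n\<close>, where \<open>W\<close> is a 3-space common to
  \<open>Y\<close> and \<open>fs p y0\<close>. It remains to find \<open>n\<close> on
  \<open>k\<close> for which \<open>fs p n\<close> also contains a vector \<open>g\<close> of
  \<open>Y\<close> outside \<open>fs p y0\<close>, that is, a neighbour \<open>x\<close> of
  \<open>n\<close> with direction \<open>span {f, g}\<close>.\<close>

lemma opp_onto:
 assumes Y: "gr 4 Y"
 shows "EX n:opp_space. fs p n = Y"
proof (cases "Y = fs p y0")
 case True then show ?thesis by (intro bexI[of _ y0]) (simp_all add: opp_space_def)
next
 case False
 note F0 = fs[OF p y0]
 let ?W0 = "Y Int fs p y0"
 obtain W where W: "gr 3 W" "W <= ?W0" using gr_sub[OF gr_inter[OF Y F0(1) refl], of 3 "{0}"] subspace_0[OF grD(1)[OF Y]] subspace_0[OF grD(1)[OF F0(1)]] gr_inter_ge[OF Y F0(1) subset_UNIV subset_UNIV dim5(2)] by auto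
 obtain g where g: "g:Y" "g ~: fs p y0" using gr_eqI[OF Y F0(1)] False by blast
 obtain f where f: "f:W" "f ~= 0" using dim_pos[of W] W(1) by (auto simp: gr_def)
 have Wf: "W <= fs p y0" using W(2) by blast
 obtain m r where m: "col y0 m" "m ~= y0" "e':d y0 m" and r: "col p r" "f:d p r" "d p r <= W" "col r y0" "col r m"
  and all: "ALL n. n:opp_space --> d y0 n = d y0 m --> W <= fs p n"
  using opp_vertex[OF W(1) Wf f] by (elim exE conjE)
 have mo: "m:opp_space" "y0:opp_space" using m unfolding opp_space_def by simp_all
 have rp: "r ~= p" "r ~= y0" "r ~= m" using r y0 opp_far[OF mo(1)] by blast+
 have R: "r:points H" "col r p" "p ~= r" "y0 ~= r" "m ~= r" using col_point[OF r(1) p] col_sym r rp by auto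
 have nf: "g ~: span {f}" using g(2) f(1) Wf span_minimal[of "{f}" "fs p y0"] grD(1)[OF F0(1)] by blast
 let ?F = "span {f, g}"
 have fF: "f:?F" "g:?F" by (simp_all add: span_base)
 obtain k where k: "k:lines H" "y0:k" "m:k" using ex_line[OF m(1)] m(2) by blast
 note gT = d_gr[OF R(1-3)] and gA = d_gr[OF R(1) r(4) R(4)] and gB = d_gr[OF R(1) r(5) R(5)]
 let ?T = "d r p" and ?A = "d r y0" and ?B = "d r m"
 have AB: "?A ~= ?B"
 proof
  assume "?A = ?B"
  then obtain l where l: "l:lines H" "r:l" "y0:l" "m:l" using d_eq[OF R(1) r(4) R(4) r(5) R(5)] by blast
  have "d y0 r = d y0 m" by (rule d_line[OF l(1,3,2,4)]) (use R m in auto)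
  then show False using fs(3)[OF y0(1) p y0p col_sym[OF r(4)] R(2)] m(3) e' by blast
 qed
 have mAB: "?A Int ?B ~= {0}" using d_col[OF R(1) r(4) R(4) r(5) R(5)] m(1) by simp
 note ab = gr2_adj[OF gA gB AB mAB]
 note pen = d_pencil_ex[OF R(1) r(4) R(4) r(5) R(5) m(1) AB k]
 have onk: "n:opp_space" if "n:k" for n using opp_line[OF mo(2,1) m(2)[symmetric] k that] .
 obtain c where c: "c ~= 0" "c:?A" "c:?B" using meetE[OF mAB grD(1)[OF gA] grD(1)[OF gB]] by (elim exE conjE)
 have cAB: "?A Int ?B = span {c}" by (rule dim_le_1_span) (use c ab(1) in \<open>auto simp: gr_def\<close>)
 have pick: "EX n:k. n ~= r & col r n & a:d r n" if a: "a:?A #+ ?B" "a ~: span {c}" for a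
 proof -
  have "span {c, a} <= ?A #+ ?B" by (rule span_minimal) (use c a ssum_ub1[of ?A ?B] in auto)
  moreover have "?A Int ?B <= span {c, a}" unfolding cAB by (rule span_mono) simp
  ultimately show ?thesis using pen[OF gr_span2I[OF c(1) a(2)]] span_base[of a "{c,a}"] by auto
 qed
 have dTA: "?T Int ?A = {0}" using d_col[OF R(1-3) r(4) R(4)] y0 by blast
 obtain x0 where x0: "col p x0" "x0 ~= p" "d p x0 = ?F" using d_surj[OF p gr_span2I[OF f(2) nf]] by blast
 have cx0: "col r x0" using d_col[OF p r(1) rp(1) x0(1,2)] meetI[OF f(2) r(2) fF(1)] x0(3) by simp
 have nxr: "d p r ~= d p x0" using x0(3) fF(2) g(2) r(3) Wf by blast
 then have x0r: "x0 ~= r" by blast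
 obtain h where h: "h:lines H" "p:h" "x0:h" using ex_line[OF x0(1)] x0(2) by blast
 let ?X = "d r x0"
 note gX = d_gr[OF R(1) cx0 x0r]
 have TX: "?T ~= ?X"
 proof
  assume "?T = ?X"
  then obtain l where l: "l:lines H" "r:l" "p:l" "x0:l" using d_eq[OF R(1-3) cx0 x0r] by blast
  show False using d_line[OF l(1,3,2,4) rp(1) x0(2)] nxr by simp
 qed
 have mTX: "?T Int ?X ~= {0}" using d_col[OF R(1-3) cx0 x0r] x0(1) by simp
 note tx = gr2_adj[OF gT gX TX mTX]
 \<comment> \<open>Seen from \<open>r\<close>, the lines \<open>k\<close> and \<open>h\<close> span
   3-spaces of a 5-space, so these share a vector. It singles out points \<open>n\<close> of
   \<open>k\<close> and \<open>x\<close> of \<open>h\<close> whose directions at \<open>r\<close>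
   meet, and which are therefore collinear.\<close>
 obtain a where a: "a:?A #+ ?B" "a:?T #+ ?X" "a ~= 0"
  using dim_pos[of "(?A #+ ?B) Int (?T #+ ?X)"] gr_inter_ge[OF ab(2) tx(2) subset_UNIV subset_UNIV dim5(2)] by auto
 have aT: "a ~: ?T"
 proof
  assume aT: "a:?T"
  obtain n where n: "n:k" "n ~= r" "col r n" "a:d r n" using cAB disjD[OF dTA aT] a(3) pick[OF a(1)] by auto
  show False using d_col[OF R(1-3) n(3,2)] meetI[OF a(3) aT n(4)] opp_far[OF onk[OF n(1)]] by simp
 qed
 obtain t where t: "t ~= 0" "t:?T" "t:?X" using meetE[OF mTX grD(1)[OF gT] grD(1)[OF gX]] by (elim exE conjE)
 have tTX: "?T Int ?X = span {t}" by (rule dim_le_1_span) (use t tx(1) in \<open>auto simp: gr_def\<close>)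
 have gK: "gr 2 (span {t, a})" using aT t(2) span_minimal[of "{t}" ?T] grD(1)[OF gT] gr_span2I[OF t(1)] by auto
 have "span {t, a} <= ?T #+ ?X" by (rule span_minimal) (use t a ssum_ub1[of ?T ?X] in auto)
 moreover have "?T Int ?X <= span {t, a}" unfolding tTX by (rule span_mono) simp
 ultimately obtain x where x: "x:h" "x ~= r" "col r x" "d r x = span {t, a}"
  using d_pencil_ex[OF R(1-3) cx0 x0r x0(1) TX h gK] by blast
 have aK: "a:d r x" using x(4) by (simp add: span_base)
 have xp: "x ~= p" using aK aT by blast
 have dpx: "d p x = ?F" "col p x" using d_line[OF h(1,2) x(1) h(3) xp x0(2)] x0(3) col_line[OF h(1,2) x(1)] by simp_all
 obtain n where n: "n:k" "n ~= r" "col r n" "a:d r n"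
 proof (cases "a:span {c}")
  case True
  then show ?thesis using cAB that[OF k(2) R(4) r(4)] by auto
 next
  case False then show ?thesis using pick[OF a(1)] that by blast
 qed
 have xn: "col x n" using d_col[OF R(1) x(3,2) n(3,2)] meetI[OF a(3) aK n(4)] by simp
 have no: "n:opp_space" by (rule onk[OF n(1)])
 note Fn = fs[OF p opp_points[OF no] opp_far[OF no]]
 have FF: "?F <= fs p n" using Fn(3)[OF dpx(2) xn] dpx(1) by simp
 have n0: "n ~= y0" using FF fF(2) g(2) by blast
 have WF: "W <= fs p n" using all no d_line[OF k(1,2) n(1) k(3) n0 m(2)] by simp
 have gW: "g ~: W" using g(2) Wf by blast
 have g4: "gr 4 (span (insert g W))" using gr_insert[OF W(1) gW] by simp
 have "span (insert g W) <= Y" "span (insert g W) <= fs p n"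
  by (rule span_minimal, use W(2) g grD(1)[OF Y] in auto, rule subsetD[OF span_minimal], use WF FF fF(2) grD(1)[OF Fn(1)] in auto)
 then show ?thesis using gr_eqI[OF g4 Y] gr_eqI[OF g4 Fn(1)] no by blast
qed

end

text \<open>\<open>r F\<close> is the point over \<open>F\<close> with a neighbour in the opposite
  subspace; by \<open>opp_same\<close> it is then collinear with every point \<open>n\<close> of
  that subspace with \<open>F <= fs p n\<close>. Pencils are respected because the joining line of
  two origins is collinear with one such \<open>n\<close>.\<close>

theorem section_exists:
 assumes p: "p:points H"
 shows "EX r. (ALL F. gr 2 F --> col p (r F) & r F ~= p & d p (r F) = F) &
   (ALL F1 F2 F3 k. gr 2 F1 --> gr 2 F2 --> gr 2 F3 --> F1 ~= F2 --> F1 Int F2 ~= {0} --> F1 Int F2 <= F3 --> F3 <= F1 #+ F2 -->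
    k:lines H --> r F1:k --> r F2:k --> r F3:k) &
   (ALL Y. gr 4 Y --> (EX n:points H. ~ col p n & fs p n = Y & (ALL F. gr 2 F --> F <= Y --> col n (r F))))"
proof -
 obtain y0 where y0: "y0:points H" "~ col p y0" using far_exists[OF p] by blast
 have yp: "~ col y0 p" using y0 col_sym by blast
 obtain e where e: "e ~: fs y0 p" using gr_ex[OF fs(1)[OF y0(1) p yp] dim5(2)] by auto
 note c = p y0 e
 let ?N = "opp_space y0 e"
 have ex4: "EX Y. gr 4 Y & F <= Y" if "subspace F" "dim F <= 4" for F
  using gr_sub[OF dim5(2) _ subset_UNIV that] by auto
 have nb: "EX x. col p x & x ~= p & d p x = F & (EX n:?N. col n x)" if F: "gr 2 F" for F
 proof -
  obtain Y where Y: "gr 4 Y" "F <= Y" using ex4[OF grD(1)[OF F]] F by (auto simp: gr_def)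
  obtain n where n: "n:?N" "fs p n = Y" using opp_onto[OF c Y(1)] by blast
  obtain x where "col p x" "x ~= p" "d p x = F" "col x n"
   using fs(2)[OF p opp_points[OF c n(1)] opp_far[OF c n(1)] F] Y(2) n(2) by blast
  then show ?thesis using n(1) col_sym by blast
 qed
 define r where "r F = (SOME x. col p x & x ~= p & d p x = F & (EX n:?N. col n x))" for F
 have r: "col p (r F)" "r F ~= p" "d p (r F) = F" "EX n:?N. col n (r F)" if "gr 2 F" for F
  using someI_ex[OF nb[OF that]] unfolding r_def by blast+
 have rn: "col (r F) n" if F: "gr 2 F" and n: "n:?N" "F <= fs p n" for F n
 proof -
  obtain m where m: "m:?N" "col m (r F)" using r(4)[OF F] by blast
  show ?thesis by (rule opp_same[OF c m(1) n(1) r(1)[OF F] col_sym[OF m(2)]]) (use r(3)[OF F] n in simp)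
 qed
 have pen: "r F3:k" if F: "gr 2 F1" "gr 2 F2" "gr 2 F3" "F1 ~= F2" "F1 Int F2 ~= {0}" "F1 Int F2 <= F3" "F3 <= F1 #+ F2"
  and k: "k:lines H" "r F1:k" "r F2:k" for F1 F2 F3 k
 proof -
  obtain Y where Y: "gr 4 Y" "F1 #+ F2 <= Y" using ex4[of "F1 #+ F2"] gr2_adj(2)[OF F(1,2,4,5)] by (auto simp: gr_def)
  obtain n where n: "n:?N" "fs p n = Y" using opp_onto[OF c Y(1)] by blast
  have sub: "F1 <= fs p n" "F2 <= fs p n" "F3 <= fs p n"
   using Y(2) n(2) F(7) ssum_ub1[of F1 F2] ssum_ub2[of F2 F1] by blast+
  note r1 = r[OF F(1)] and r2 = r[OF F(2)]
  have c12: "col (r F1) (r F2)" using d_col[OF p r1(1,2) r2(1,2)] r1(3) r2(3) F(5) by simp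
  obtain s where s: "s:k" "s ~= p" "col p s" "d p s = F3"
   using d_pencil_ex[OF p r1(1,2) r2(1,2) c12 _ k F(3)] r1(3) r2(3) F(4,6,7) by auto
  have ne: "r F1 ~= r F2" using r1(3) r2(3) F(4) by metis
  have "col n s" by (rule col_all[OF k ne col_sym[OF rn[OF F(1) n(1) sub(1)]] col_sym[OF rn[OF F(2) n(1) sub(2)]] s(1)])
  then have "s = r F3"
   by (intro dir_unique[OF p s(3,2) r(1)[OF F(3)] r(2)[OF F(3)] _ col_sym rn[OF F(3) n(1) sub(3)] opp_far[OF c n(1)]])
    (use s r(3)[OF F(3)] in simp_all)
  then show ?thesis using s(1) by simp
 qed
 have "EX n:points H. ~ col p n & fs p n = Y & (ALL F. gr 2 F --> F <= Y --> col n (r F))" if Y: "gr 4 Y" for Y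
 proof -
  obtain n where n: "n:?N" "fs p n = Y" using opp_onto[OF c Y] by blast
  show ?thesis using opp_points[OF c n(1)] opp_far[OF c n(1)] n(2) rn[OF _ n(1)] col_sym by blast
 qed
 then show ?thesis
  by (intro exI[of _ r] conjI allI impI) (simp_all add: r(1-3), rule pen)
qed

end

section \<open>Independent lists and pencils of 2-spaces\<close>

context subspace_calculus
begin

definition ind :: "'b list => bool" where "ind xs <-> dim (set xs) = length xs"

lemma ind_sub: "ind xs ==> set ys <= set xs ==> (distinct xs ==> distinct ys) ==> ind ys"
 unfolding ind_def using dim_sub dim_dist by metis

lemma ind_Cons: "ind (x # xs) <-> ind xs & x ~: span (set xs)"
proof
 assume h: "ind (x # xs)"
 have "dim (set xs) <= length xs" by (rule order_trans[OF dim_le_card' card_length]) simp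
 then show "ind xs & x ~: span (set xs)" using dim_sub1[of x "set xs" "length xs"] h dim_notin[of x "set xs"] by (simp add: ind_def)
next
 assume "ind xs & x ~: span (set xs)"
 then show "ind (x # xs)" using dim_ins[of x "set xs"] by (simp add: ind_def)
qed

lemma ind_gr: "ind xs ==> length xs = k ==> gr k (span (set xs))"
 by (simp add: ind_def gr_def)

lemma ind2: "ind [a, b] ==> gr 2 (span {a, b})"
 using ind_gr[of "[a,b]" 2] by simp

lemma ind2_iff: "ind [a, b] <-> gr 2 (span {a, b})"
 by (simp add: ind_def gr_def numeral_2_eq_2)

lemma ind3: "ind [a, b, c] ==> gr 3 (span {a, b, c})"
 using ind_gr[of "[a,b,c]" 3] by simp

lemma span_sub: "set xs <= span S ==> span (set xs) <= span S"
 by (rule span_minimal) auto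

lemma ind_exchange:
 assumes "ind xs" "set xs <= span (set ys)" "length ys = length xs"
 shows "ind ys"
proof -
 have "dim (set ys) <= length ys" by (rule order_trans[OF dim_le_card' card_length]) simp
 then show ?thesis using assms(3) dim_subset[OF assms(2)] assms(1) by (simp add: ind_def)
qed

lemma span2_eqI: "v:span {x, y} ==> w:span {x, y} ==> x:span {v, w} ==> y:span {v, w} ==> span {x, y} = span {v, w}"
 using span_minimal[of "{x,y}" "span {v,w}"] span_minimal[of "{v,w}" "span {x,y}"] by simp

lemma ind_extend: "length xs < dimension ==> ind xs ==> EX e. ind (e # xs)"
proof -
 assume l: "length xs < dimension" and i: "ind xs"
 have "gr dimension UNIV" by (simp only: gr_def dimension_def dim_UNIV) simp
 then obtain e where "e ~: span (set xs)" using gr_ex[OF ind_gr[OF i refl] _ l] by auto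
 then show ?thesis using i by (auto simp: ind_Cons)
qed

text \<open>Formulated with unspecified ends so that all permutations are immediate;
  \<open>penD\<close> recovers the ends as an intersection and a sum.\<close>

definition pen :: "'b set => 'b set => 'b set => bool" where
 "pen A B C <-> gr 2 A & gr 2 B & gr 2 C & A ~= B & A ~= C & B ~= C &
   (EX U W. gr 1 U & gr 3 W & U <= A Int B Int C & A <= W & B <= W & C <= W)"

lemma pen_perm: "pen A B C ==> pen B A C" "pen A B C ==> pen A C B" unfolding pen_def by (auto simp: Int_commute)

lemma penD:
 assumes "pen A B C"
 shows "gr 2 A" "gr 2 B" "gr 2 C" "A ~= B" "A ~= C" "B ~= C" "A Int B ~= {0}" "A Int B <= C" "C <= A #+ B"
proof -
 obtain U W where U: "gr 1 U" "gr 3 W" "U <= A Int B Int C" "A <= W" "B <= W" "C <= W"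
  using assms unfolding pen_def by (elim conjE exE)
 show g: "gr 2 A" "gr 2 B" "gr 2 C" "A ~= B" "A ~= C" "B ~= C" using assms unfolding pen_def by simp_all
 show m: "A Int B ~= {0}" by (rule gr2_meet_in_3[OF g(1,2) U(4,5,2)])
 note ab = gr2_adj[OF g(1,2,4) m]
 show "A Int B <= C" using gr_eqI[OF U(1) ab(1)] U(3) by blast
 show "C <= A #+ B" using gr_eqI[OF ab(2) U(2) ssum_le[OF U(4,5,2)]] U(6) by simp
qed

lemma penI:
 assumes g: "gr 2 A" "gr 2 B" "gr 2 C" and n: "A ~= B" "A ~= C" "B ~= C" "A Int B ~= {0}" "A Int B <= C" "C <= A #+ B"
 shows "pen A B C" using n(5) g n(1-3,6) gr2_adj[OF g(1,2) n(1,4)] ssum_ub1[of A B] ssum_ub2[of B A] exI[of _ "A Int B"] exI[of _ "A #+ B"]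
  by (simp add: pen_def)

lemma star_pen:
 assumes "ind [a, b, c]"
 shows "pen (span {a, b}) (span {a, c}) (span {a, b - c})"
proof -
 let ?A = "span {a, b}" and ?B = "span {a, c}" and ?C = "span {a, b - c}" and ?W = "span {a, b, c}"
 have i: "ind [a, b]" "ind [a, c]" by (rule ind_sub[OF assms], auto)+
 have "ind [c, b, a]" "ind [b, c, a]" by (rule ind_sub[OF assms], auto)+
 then have n: "c ~: ?A" "b ~: ?B" by (simp_all add: ind_Cons insert_commute)
 have m: "a:?A" "b:?A" "a:?B" "c:?B" "a:?C" "b - c:?C" by (simp_all add: span_base)
 have bc: "b - c ~: ?A" "b - c ~: ?B"
  using span_diff[OF m(2), of "b - c"] span_add[OF m(4), of "b - c"] n by auto
 have a1: "ind [a]" using ind_sub[OF i(1), of "[a]"] by simp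
 have gC: "gr 2 ?C" using bc(1) span_mono[of "{a}" "{a,b}"] a1 ind2[of "b - c" a] by (auto simp: ind_Cons insert_commute)
 have "?A ~= ?B" "?A ~= ?C" "?B ~= ?C" using n bc m by blast+
 moreover have "?A <= ?W" "?B <= ?W" by (rule span_mono, simp)+
 ultimately show ?thesis unfolding pen_def
  using ind2[OF i(1)] ind2[OF i(2)] gC ind3[OF assms] exI[of _ "span {a}"] exI[of _ ?W] span_mono[of "{a}" "{a,b}"] span_mono[of "{a}" "{a,c}"] span_mono[of "{a}" "{a,b-c}"] ind_gr[OF a1] span_sub[of "[a, b - c]" "{a,b,c}"]
  by (simp add: span_base span_diff)
qed

end

section \<open>Coordinates at a point\<close>

text \<open>The points \<open>r F\<close> serve as the origins of the lines through \<open>p\<close>.\<close>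

locale pointed_spinor = spinor_geometry H d
 for H :: "'p geometry" and d :: "'p => 'p => ('k::field^5) set" +
 fixes p :: 'p and r :: "('k::field^5) set => 'p"
 assumes p: "p:points H" and r_over: "gr 2 F ==> col p (r F) & r F ~= p & d p (r F) = F"
  and r_pen: "gr 2 F1 ==> gr 2 F2 ==> gr 2 F3 ==> F1 ~= F2 ==> F1 Int F2 ~= {0} ==> F1 Int F2 <= F3 ==> F3 <= ssum F1 F2 ==>
    k:lines H ==> r F1:k ==> r F2:k ==> r F3:k"
  and r_far: "gr 4 Y ==> EX n:points H. ~ col p n & fs p n = Y & (ALL F. gr 2 F --> F <= Y --> col n (r F))"
begin

notation ssum (infixl "#+" 65)

definition over :: "('k^5) set => 'p => bool" where
 "over F x <-> col p x & x ~= p & d p x = F"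

definition lin :: "'p => 'p => 'p => bool" where
 "lin x y z <-> (EX k:lines H. x:k & y:k & z:k)"

lemma lin_perm: "lin x y z ==> lin y x z" "lin x y z ==> lin x z y" by (auto simp: lin_def)

lemma over_r: "gr 2 F ==> over F (r F)" unfolding over_def by (rule r_over)

lemma over_gr: "over F x ==> gr 2 F" unfolding over_def using d_gr[OF p] by blast

lemma over_col: "over A x ==> over B y ==> A Int B ~= {0} ==> col x y"
 unfolding over_def using d_col[OF p] by blast

lemma over_ne: "over A x ==> over B y ==> A ~= B ==> x ~= y"
 unfolding over_def by blast

lemma over_line:
 assumes "pen A B C" "over A x" "over B z"
 shows "EX k:lines H. x:k & z:k"
 using ex_line[OF over_col[OF assms(2,3) penD(7)[OF assms(1)]] over_ne[OF assms(2,3) penD(4)[OF assms(1)]]] .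

lemma over_pencil:
 assumes P: "pen A B C" and x: "over A x" "over B z" and k: "k:lines H" "x:k" "z:k"
 shows "EX s:k. over C s" "s:k ==> EX D. over D s & A Int B <= D & D <= A #+ B"
  "s:k ==> s':k ==> over D s ==> over D s' ==> s = s'"
proof -
 note h = penD[OF P]
 have o: "col p x" "x ~= p" "d p x = A" "col p z" "z ~= p" "d p z = B" using x unfolding over_def by simp_all
 have ne: "d p x ~= d p z" using o h(4) by simp
 note pen = d_pencil[OF p o(1,2,4,5) over_col[OF x h(7)] ne k]
 show "EX s:k. over C s" using d_pencil_ex[OF p o(1,2,4,5) over_col[OF x h(7)] ne k h(3)] h(8,9) o unfolding over_def by blast
 show "EX D. over D s & A Int B <= D & D <= A #+ B" if "s:k" using pen[OF that] o(3,6) unfolding over_def by blast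
 assume s: "s:k" "s':k" "over D s" "over D s'"
 show "s = s'"
 proof (rule ccontr)
  assume n: "s ~= s'"
  obtain l where l: "l:lines H" "p:l" "s:l" "s':l" using d_eq[OF p, of s s'] s unfolding over_def by blast
  show False using pen[of p] l(2) line_eq[OF l(1) k(1) l(3) s(1) l(4) s(2) n] by simp
 qed
qed

lemma lin_r:
 assumes P: "pen A B C" and x: "over C x" and l: "lin (r A) (r B) x"
 shows "x = r C"
proof -
 note h = penD[OF P]
 obtain k where k: "k:lines H" "r A:k" "r B:k" "x:k" using l unfolding lin_def by blast
 show ?thesis using over_pencil(3)[OF P over_r[OF h(1)] over_r[OF h(2)] k(1-3) k(4) _ x over_r[OF h(3)]] r_pen[OF h(1-4,7-9) k(1-3)] by simp
qed

text \<open>\<open>y\<close> is the point over \<open>B\<close> on the line joining \<open>x\<close>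
  to the origin over \<open>C\<close>: projection from an origin transports the scale of one line on
  \<open>p\<close> to another.\<close>

lemma flat_ex:
 assumes P: "pen A B C" and x: "over A x" "x ~= r A"
 shows "EX y. over B y & y ~= r B & lin x y (r C)"
proof -
 note h = penD[OF P]
 note P' = pen_perm(2)[OF P]
 obtain k where k: "k:lines H" "x:k" "r C:k" using over_line[OF P' x(1) over_r[OF h(3)]] by blast
 obtain y where y: "y:k" "over B y" using over_pencil(1)[OF P' x(1) over_r[OF h(3)] k] by blast
 show ?thesis using k y lin_r[OF pen_perm(2)[OF pen_perm(1)[OF P]] x(1)] x(2) lin_def by blast
qed

lemma flat_unique:
 assumes P: "pen A B C" and x: "over A x" and y: "over B y" "over B y'" "lin x y (r C)" "lin x y' (r C)"
 shows "y = y'"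
proof -
 note h = penD[OF P]
 obtain k where k: "k:lines H" "x:k" "y:k" "r C:k" using y(3) unfolding lin_def by blast
 obtain k' where k': "k':lines H" "x:k'" "y':k'" "r C:k'" using y(4) unfolding lin_def by blast
 have "k = k'" using line_eq[OF k(1) k'(1) k(2) k'(2) k(4) k'(4) over_ne[OF x over_r[OF h(3)] h(5)]] .
 then show ?thesis using over_pencil(3)[OF P x y(1) k(1-3) k(3) _ y(1,2)] k'(3) by blast
qed

text \<open>By \<open>pasch\<close> the line \<open>yz\<close> meets the line joining the origins
  over \<open>R\<close> and \<open>S\<close>. The direction of the meeting point lies in the pencils
  of \<open>B\<close>, \<open>C\<close> and of \<open>R\<close>, \<open>S\<close>. Both contain
  \<open>Q\<close> and they are different, so the meeting point is the origin over
  \<open>Q\<close>.\<close>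

lemma desargues:
 assumes P: "pen A B R" "pen A C S" "pen B C Q" "pen R S Q" and n: "B Int C ~= R Int S | B #+ C ~= R #+ S"
  and x: "over A x" "over B y" "over C z" "x ~= r A" and l: "lin x y (r R)" "lin x z (r S)"
 shows "lin y z (r Q)"
proof -
 note h1 = penD[OF P(1)] and h2 = penD[OF P(2)] and h3 = penD[OF P(3)] and h4 = penD[OF P(4)]
 note oR = over_r[OF h1(3)] and oS = over_r[OF h2(3)] and oQ = over_r[OF h3(3)]
 obtain k where k: "k:lines H" "x:k" "y:k" "r R:k" using l(1) unfolding lin_def by blast
 obtain m where m: "m:lines H" "x:m" "z:m" "r S:m" using l(2) unfolding lin_def by blast
 have ne: "y ~= x" "z ~= x" "r R ~= x" "r S ~= x"
  using over_ne[OF x(1,2) h1(4)] over_ne[OF x(1,3) h2(4)] over_ne[OF x(1) oR h1(5)] over_ne[OF x(1) oS h2(5)] by auto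
 \<comment> \<open>Equality would put \<open>x\<close> on the line of origins through
   \<open>r R\<close> and \<open>r S\<close>, and \<open>lin_r\<close> would make \<open>x\<close>
   an origin itself.\<close>
 have km: "k ~= m"
 proof
  assume e: "k = m"
  have "lin (r R) (r S) x" using k m e unfolding lin_def by blast
  have "pen R S A"
  proof (rule penI[OF h4(1,2) h1(1) h4(4) h1(5)[symmetric] h2(5)[symmetric] h4(7)])
   obtain D where D: "over D x" "R Int S <= D" "D <= R #+ S"
    using over_pencil(2)[OF P(4) oR oS k(1,4) _ k(2)] m e by blast
   show "R Int S <= A" "A <= R #+ S" using x(1) D by (auto simp: over_def)
  qed
  then show False using lin_r[OF _ x(1) \<open>lin (r R) (r S) x\<close>] x(4) by blast
 qed
 obtain j where j: "j:lines H" "y:j" "z:j" using over_line[OF P(3) x(2,3)] by blast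
 obtain i where i: "i:lines H" "r R:i" "r S:i" using over_line[OF P(4) oR oS] by blast
 obtain s where s: "s:j" "s:i" using pasch[OF k(1) m(1) k(2) m(2) km k(3) ne(1) m(3) ne(2) over_col[OF x(2,3) h3(7)] j i k(4) m(4) ne(3,4)] by auto
 obtain D where D: "over D s" "B Int C <= D" "D <= B #+ C" using over_pencil(2)[OF P(3) x(2,3) j s(1)] by blast
 obtain D' where "over D' s" "R Int S <= D'" "D' <= R #+ S" using over_pencil(2)[OF P(4) oR oS i s(2)] by blast
 then have D': "R Int S <= D" "D <= R #+ S" using D(1) unfolding over_def by simp_all
 \<comment> \<open>Two different members of a pencil determine both of its ends, and the two pencils
   differ in at least one.\<close>
 have DQ: "D = Q"
 proof (rule ccontr)
  assume nDQ: "D ~= Q"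
  note gD = over_gr[OF D(1)]
  have m: "D Int Q ~= {0}"
   using h3(7,8) D(2) subspace_0[OF grD(1)[OF h3(1)]] subspace_0[OF grD(1)[OF h3(2)]] by auto
  note dq = gr2_adj[OF gD h3(3) nDQ m]
  note bc = gr2_adj[OF h3(1,2,4,7)] and rs = gr2_adj[OF h4(1,2,4,7)]
  show False using gr_eqI[OF dq(2) bc(2)] gr_eqI[OF dq(2) rs(2)] ssum_le[OF D(3) h3(9) bc(2)] ssum_le[OF D'(2) h4(9) rs(2)] n gr_eqI[OF bc(1) dq(1)] gr_eqI[OF rs(1) dq(1)] D(2) D'(1) h3(8) h4(8) by simp
 qed
 show ?thesis using over_pencil(3)[OF P(4) oR oS i s(2) _ D(1)] oQ DQ j s(1) r_pen[OF h4(1-4,7-9) i] lin_def by metis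
qed

text \<open>Three bivectors with the common factor \<open>a\<close>; their differences are
  \<open>a\<close> wedged with \<open>b - c\<close>, \<open>b - e\<close> and \<open>c - e\<close>,
  which form a pencil.\<close>

lemma desargues_star:
 assumes i: "ind [a, b, c, e]" and x: "over (span {a, b}) x" "over (span {a, c}) y" "over (span {a, e}) z" "x ~= r (span {a, b})"
  and l: "lin x y (r (span {a, b - c}))" "lin x z (r (span {a, b - e}))"
 shows "lin y z (r (span {a, c - e}))"
proof (rule desargues[OF _ _ _ _ _ x l])
 have i3: "ind [a, b, c]" "ind [a, b, e]" "ind [a, c, e]" "ind [c, a, e]" "ind [a, e]" "ind [b, a, c, e]" "ind [c, e, a]" by (rule ind_sub[OF i], auto)+
 show "pen (span {a, b}) (span {a, c}) (span {a, b - c})" "pen (span {a, b}) (span {a, e}) (span {a, b - e})"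
  "pen (span {a, c}) (span {a, e}) (span {a, c - e})" using i3 star_pen by blast+
 have bn: "b ~: span {a, c, e}" using i3(6) by (simp add: ind_Cons)

 have s: "a:span {a, c, e}" "c:span {a, c, e}" "e:span {a, c, e}" by (simp_all add: span_base)
 have bc: "b - c ~: span {a, c, e}" using span_add[OF s(2), of "b - c"] bn by auto
 have "ind [b, a, b - e, b - c]"
 proof (rule ind_exchange[OF i])
  let ?S = "span (set [b, a, b - e, b - c])"
  have m: "b:?S" "a:?S" "b - e:?S" "b - c:?S" by (simp_all add: span_base)
  show "set [a, b, c, e] <= ?S" using m span_diff[OF m(1,3)] span_diff[OF m(1,4)] by simp
 qed simp
 then have "ind [a, b - e, b - c]" by (simp add: ind_Cons)
 from star_pen[OF this] show "pen (span {a, b - c}) (span {a, b - e}) (span {a, c - e})" using pen_perm(1) by simp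
 show "span {a, c} Int span {a, e} ~= span {a, b - c} Int span {a, b - e} | span {a, c} #+ span {a, e} ~= span {a, b - c} #+ span {a, b - e}"
 proof (rule disjI2, rule notI)
  assume e: "span {a, c} #+ span {a, e} = span {a, b - c} #+ span {a, b - e}"
  have "b - c:span {a, b - c} #+ span {a, b - e}" using ssum_ub1 span_base[of "b - c" "{a, b - c}"] by blast
  then have "b - c:span ({a, c} Un {a, e})" using e by (simp add: ssum_span)
  moreover have "{a, c} Un {a, e} = {a, c, e}" by auto
  ultimately show False using bc by simp
 qed
qed

text \<open>Three bivectors of one 3-space. Up to sign their differences are the wedges of
  \<open>e\<close> and \<open>a - b\<close>, of \<open>a\<close> and \<open>b + e\<close>, and of
  \<open>b\<close> and \<open>e - a\<close>; the corresponding 2-spaces all contain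
  \<open>a - b - e\<close>, which makes them a pencil.\<close>

lemma desargues_plane:
 assumes i: "ind [e, a, b]" and x: "over (span {e, a}) x" "over (span {e, b}) y" "over (span {a, b}) z" "x ~= r (span {e, a})"
  and l: "lin x y (r (span {e, a - b}))" "lin x z (r (span {a, b + e}))"
 shows "lin y z (r (span {b, e - a}))"
proof (rule desargues[OF _ _ _ _ _ x l])
 have neg: "span {v, - w} = span {v, w}" for v w :: "'k^5" using span_sub[of "[v, - w]" "{v,w}" for w] by (force simp: span_base span_neg)
 have ineg: "ind [v, w, - u]" if "ind [v, w, u]" for v w u :: "'k^5"
 proof -
  have "ind [u, v, w]" by (rule ind_sub[OF that]) auto
  then have "ind [- u, v, w]" using span_neg[of "-u" "{v,w}"] by (auto simp: ind_Cons)
  then show ?thesis by (rule ind_sub) auto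
 qed
 have i3: "ind [e, a, b]" "ind [a, b, e]" "ind [b, e, a]" "ind [b, a, e]" by (rule ind_sub[OF i], auto)+
 show "pen (span {e, a}) (span {e, b}) (span {e, a - b})" by (rule star_pen[OF i])
 show "pen (span {e, a}) (span {a, b}) (span {a, b + e})"
  using pen_perm(1)[OF star_pen[OF ineg[OF i3(2)]]] by (simp add: neg insert_commute)
 show "pen (span {e, b}) (span {a, b}) (span {b, e - a})"
  using star_pen[OF i3(3)] by (simp add: insert_commute)
 let ?u = "a - b - e"
 have m: "x:span {x, y}" "y:span {x, y}" for x y :: "'k^5" by (simp_all add: span_base)
 have "ind [?u, e, a]"
 proof (rule ind_exchange[OF i])
  let ?S = "span (set [?u, e, a])"
  have m: "?u:?S" "e:?S" "a:?S" by (simp_all add: span_base)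
  show "set [e, a, b] <= ?S" using m span_diff[OF span_diff[OF m(3,2)] m(1)] by simp
 qed simp
 moreover have "span {?u, e} = span {e, a - b}"
  using span_add[OF m(1)[of ?u e] m(2)] span_diff[OF m(2)[of "a - b" e] m(1)] by (intro span2_eqI) (simp_all add: m)
 moreover have "span {?u, a} = span {a, b + e}"
  using span_diff[OF m(2)[of a ?u] m(1)] span_diff[OF m(1)[of a "b + e"] m(2)] by (intro span2_eqI) (simp_all add: m diff_diff_eq)
 moreover have "span {?u, e - a} = span {b, e - a}"
  using span_neg[OF span_add[OF m(1)[of ?u "e - a"] m(2)]] span_neg[OF span_add[OF m(1)[of b "e - a"] m(2)]]
  by (intro span2_eqI) (simp_all add: m algebra_simps)
 ultimately show "pen (span {e, a - b}) (span {a, b + e}) (span {b, e - a})" using star_pen[of ?u e a] by simp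
 show "span {e, b} Int span {a, b} ~= span {e, a - b} Int span {a, b + e} | span {e, b} #+ span {a, b} ~= span {e, a - b} #+ span {a, b + e}"
 proof (rule disjI1, rule notI)
  assume "span {e, b} Int span {a, b} = span {e, a - b} Int span {a, b + e}"
  then have b: "b:span (set [e, a - b])" using span_base[of b "{e,b}"] span_base[of b "{a,b}"] by auto
  show False using b span_add[OF b, of "a - b"] dim_subset[of "{e,a,b}" "span {e, a - b}"] i dim_le2[of e "a - b"] by (simp add: span_base ind_def)
 qed
qed

end

section \<open>Simultaneous scaling of the lines on p\<close>

context pointed_spinor
begin

lemma span_shift: "span {a, b + t *s a} = span {a, b}"
proof -
 let ?S = "span {a, b + t *s a}" and ?T = "span {a, b}"
 have m: "a:?S" "b + t *s a:?S" "a:?T" "b:?T" by (simp_all add: span_base)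
 have "b + t *s a - t *s a:?S" by (intro span_diff m span_scale)
 then show ?thesis using span2_eqI[of a a "b + t *s a" b] m span_add span_scale by simp
qed

lemma span_scale2: "t ~= 0 ==> span {a, t *s b} = span {a, b}"
 using span_scale[OF span_base[of "t *s b" "{a, t *s b}"], of "inverse t"]
 by (intro span2_eqI) (simp_all add: span_base span_scale)

lemma span_neg2: "span {a, - b} = span {a, b}"
 using span_scale2[of "-1" a b] by simp

text \<open>The vectors \<open>a\<close>, \<open>b\<close> stand for the bivector \<open>a \<and> b\<close>; \<open>fl a b c x y\<close> says that the points over \<open>a \<and> b\<close> and \<open>a \<and> c\<close>
 have the same scale.\<close>

definition pt :: "'k^5 => 'k^5 => 'p => bool" where
 "pt a b x <-> over (span {a, b}) x & x ~= r (span {a, b})"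

definition fl :: "'k^5 => 'k^5 => 'k^5 => 'p => 'p => bool" where
 "fl a b c x y <-> lin x y (r (span {a, b - c}))"

lemma fl_sym: "fl a b c x y ==> fl a c b y x"
 unfolding fl_def using lin_perm(1) span_neg2[of a "b - c"] by simp

lemma tr_ex: "ind [a, b, c] ==> pt a b x ==> EX! y. pt a c y & fl a b c x y"
 unfolding pt_def fl_def using flat_ex[OF star_pen] flat_unique[OF star_pen] by (metis (no_types))

lemma fl_unique: "ind [a, b, c] ==> pt a b x ==> pt a c y ==> pt a c y' ==> fl a b c x y ==> fl a b c x y' ==> y = y'"
 using tr_ex by blast

lemma fl_tri:
 assumes "ind [a, b, c, e]" "pt a b x" "pt a c y" "pt a e z" "fl a b c x y" "fl a b e x z" shows "fl a c e y z"
 using desargues_star[OF assms(1)] assms(2-) unfolding pt_def fl_def by blast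

text \<open>A third point on the line through \<open>p\<close> and the origin. It is found from a
  neighbour \<open>?z\<close> of both: the points of the line correspond to a pencil at
  \<open>?z\<close>, which has the third member \<open>span {u, v - w}\<close>.\<close>

lemma pt_ex:
 assumes "ind [a, b]" shows "EX x. pt a b x"
proof -
 obtain c where "ind [c, a, b]" using ind_extend[OF _ assms] dim5(1) by auto
 then have i: "ind [a, b, c]" by (rule ind_sub) auto
 note h = penD[OF star_pen[OF i]]
 let ?x = "r (span {a, b})" and ?z = "r (span {a, c})"
 note ox = over_r[OF h(1)] and oz = over_r[OF h(2)]
 have o: "col p ?x" "?x ~= p" "col p ?z" "?z ~= p" using ox oz unfolding over_def by simp_all
 obtain k where k: "k:lines H" "p:k" "?x:k" using ex_line[OF o(1)] o(2) by blast
 have z: "?z:points H" by (rule col_point[OF o(3) p])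
 have c: "col ?z p" "p ~= ?z" "col ?z ?x" "?x ~= ?z"
  using col_sym[OF o(3)] o(4) col_sym[OF over_col[OF ox oz h(7)]] over_ne[OF ox oz h(4)] by auto
 have ne: "d ?z p ~= d ?z ?x"
 proof
  assume "d ?z p = d ?z ?x"
  then obtain l where l: "l:lines H" "?z:l" "p:l" "?x:l" using d_eq[OF z c] by blast
  show False using d_line[OF l(1,3,4,2) o(2,4)] ox oz h(4) unfolding over_def by simp
 qed
 note g = d_gr[OF z c(1,2)] d_gr[OF z c(3,4)]
 have m: "d ?z p Int d ?z ?x ~= {0}" using d_col[OF z c] o(1) by simp
 obtain u where u: "u ~= 0" "u:d ?z p" "u:d ?z ?x" using meetE[OF m grD(1)[OF g(1)] grD(1)[OF g(2)]] by (elim exE conjE)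
 obtain v where v: "v:d ?z p" "v ~: d ?z ?x" using gr_eqI[OF g] ne by blast
 obtain w where w: "w:d ?z ?x" "w ~: d ?z p" using gr_eqI[OF g(2,1)] ne by blast
 have "v ~: span {u}" "w ~: span {u}" using u v w span_minimal[of "{u}"] grD(1)[OF g(1)] grD(1)[OF g(2)] by blast+
 then have e: "d ?z p = span {u, v}" "d ?z ?x = span {u, w}" using gr2_eq_span[OF g(1) u(2) v(1) u(1)] gr2_eq_span[OF g(2) u(3) w(1) u(1)] by simp_all
 have "ind [u, v]" using g(1) unfolding e by (simp add: ind2_iff)
 then have "ind [w, u, v]" using w(2) unfolding e by (simp add: ind_Cons)
 then have i': "ind [u, v, w]" by (rule ind_sub) auto
 note P = penD[OF star_pen[OF i'], folded e]
 obtain s where s: "s:k" "s ~= ?z" "d ?z s = span {u, v - w}" using d_pencil_ex[OF z c o(1) ne k P(3,8,9)] by blast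
 have sp: "s ~= p" "s ~= ?x" using s(3) P(5,6) by auto
 show ?thesis using sp col_line[OF k(1,2) s(1)] ox d_line[OF k(1,2) s(1) k(3) sp(1) o(2)] by (auto simp: pt_def over_def)
qed

lemma pt_shift: "pt a (b + t *s a) = pt a b" unfolding pt_def span_shift ..

text \<open>One point over the wedge of \<open>a0\<close> and \<open>b0\<close> is transported to
  the other bivectors with factor \<open>a0\<close>. Transport is transitive by
  \<open>fl_tri\<close> only for independent vectors; when \<open>b\<close> and \<open>c\<close> are
  dependent modulo \<open>a0\<close> and \<open>b0\<close>, an auxiliary vector \<open>e\<close>
  outside their span mediates.\<close>

lemma star_section:
 assumes a0: "a0 ~= 0"
 shows "EX s. ALL b. ind [a0, b] --> pt a0 b (s b) & (ALL c. ind [a0, b, c] --> fl a0 b c (s b) (s c)) & (ALL t. s (b + t *s a0) = s b)"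
proof -
 obtain b0 where "ind [b0, a0]" using a0 ind_extend[of "[a0]"] dim5(1) by (auto simp: ind_def)
 then obtain c0 where "ind [c0, b0, a0]" using ind_extend[of "[b0, a0]"] dim5(1) by auto
 then have i0: "ind [a0, b0, c0]" by (rule ind_sub) auto
 have i0': "ind [a0, b0]" by (rule ind_sub[OF i0]) auto
 obtain x0 where x0: "pt a0 b0 x0" using pt_ex[OF i0'] by blast
 define s1 where "s1 b = (THE y. pt a0 b y & fl a0 b0 b x0 y)" for b
 have s1: "pt a0 b (s1 b)" "fl a0 b0 b x0 (s1 b)" if "ind [a0, b0, b]" for b
  using theI'[OF tr_ex[OF that x0]] unfolding s1_def by blast+
 have ext: "EX e. ind [e, a0, b, c]" if "ind [a0, b, c]" for b c using ind_extend[OF _ that] dim5(1) by simp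
 have c1: "fl a0 b c (s1 b) (s1 c)" if i: "ind [a0, b0, b]" "ind [a0, b0, c]" "ind [a0, b, c]" for b c
 proof (cases "ind [a0, b0, b, c]")
  case True then show ?thesis using fl_tri[OF True x0] s1 i by blast
 next
  case False
  obtain e where e: "ind [e, a0, b, c]" using ext[OF i(3)] by blast
  have b0: "b0:span {a0, b, c}"
  proof (rule ccontr)
   assume "b0 ~: span {a0, b, c}"
   then have "ind [b0, a0, b, c]" using i(3) by (simp add: ind_Cons)
   then have "ind [a0, b0, b, c]" by (rule ind_sub) auto
   then show False using False by simp
  qed
  have sub: "span {a0, b0, v} <= span {a0, b, c}" if "v = b | v = c" for v
   using span_sub[of "[a0, b0, v]" "{a0, b, c}"] b0 that by (auto simp: span_base)
  have i4: "ind [a0, b0, e, b]" "ind [a0, b0, e, c]" "ind [a0, b0, e]" "ind [a0, e, b, c]"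
   using e sub i ind_sub[of "[e, a0, b0, b]" "[a0, b0, e, b]"] ind_sub[of "[e, a0, b0, c]" "[a0, b0, e, c]"] ind_sub[of "[e, a0, b0, b]" "[a0, b0, e]"] ind_sub[OF e, of "[a0, e, b, c]"]
   by (auto simp: ind_Cons)
  note se = s1[OF i4(3)] and sb = s1[OF i(1)] and sc = s1[OF i(2)]
  have "fl a0 e b (s1 e) (s1 b)" "fl a0 e c (s1 e) (s1 c)"
   by (rule fl_tri[OF i4(1) x0 se(1) sb(1) se(2) sb(2)], rule fl_tri[OF i4(2) x0 se(1) sc(1) se(2) sc(2)])
  then show ?thesis by (rule fl_tri[OF i4(4) se(1) sb(1) sc(1)])
 qed
 \<comment> \<open>For \<open>b\<close> in the plane of \<open>a0\<close> and \<open>b0\<close>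
   there is no direct transport from \<open>b0\<close>; the detour through \<open>c0\<close>
   replaces it.\<close>
 define s where "s b = (if ind [a0, b0, b] then s1 b else THE y. pt a0 b y & fl a0 c0 b (s1 c0) y)" for b
 have s_1: "s b = s1 b" if "ind [a0, b0, b]" for b using that unfolding s_def by simp
 note sc0 = s1[OF i0]
 have par: "span {a0, b} = span {a0, b0}" if "ind [a0, b]" "~ ind [a0, b0, b]" for b
 proof -
  have "b:span {a0, b0}"
  proof (rule ccontr)
   assume "b ~: span {a0, b0}"
   then have "ind [b, a0, b0]" using i0' by (simp add: ind_Cons)
   then have "ind [a0, b0, b]" by (rule ind_sub) auto
   then show False using that by simp
  qed
  then have "span {a0, b} <= span {a0, b0}" by (intro span2_sub[OF _ _ ind2[OF i0']]) (simp_all add: span_base)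
  then show ?thesis by (rule gr_eqI[OF ind2[OF that(1)] ind2[OF i0']])
 qed
 have par3: "ind [a0, b0, c] <-> ind [a0, b, c]" if "ind [a0, b]" "~ ind [a0, b0, b]" for b c
 proof -
  have "ind [a0, v, c] <-> ind [c, a0, v]" for v using ind_sub[of "[a0, v, c]" "[c, a0, v]"] ind_sub[of "[c, a0, v]" "[a0, v, c]"] by auto
  then show ?thesis using par[OF that] i0' that(1) by (simp add: ind_Cons)
 qed
 have s2: "pt a0 b (s b)" "fl a0 c0 b (s1 c0) (s b)" if i: "ind [a0, b]" "~ ind [a0, b0, b]" for b
 proof -
  have "ind [a0, b, c0]" using par3[OF i] i0 by simp
  then have "ind [a0, c0, b]" by (rule ind_sub) auto
  then show "pt a0 b (s b)" "fl a0 c0 b (s1 c0) (s b)" using theI'[OF tr_ex[OF _ sc0(1)]] i(2) unfolding s_def by simp_all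
 qed
 have s_pt: "pt a0 b (s b)" if "ind [a0, b]" for b using s2(1)[OF that] s1(1)[of b] s_1[of b] by (cases "ind [a0, b0, b]") simp_all
 have c2: "fl a0 b c (s b) (s c)" if i: "ind [a0, b]" "~ ind [a0, b0, b]" and ic: "ind [a0, b, c]" for b c
 proof -
  have j: "fl a0 e b (s e) (s b)" if "ind [a0, c0, e, b]" for e
  proof -
   have k: "ind [a0, b, e]" "ind [a0, b, c0]" "ind [a0, c0, e]" by (rule ind_sub[OF that], auto)+
   then have k': "ind [a0, b0, e]" using par3[OF i] by blast
   show ?thesis using s1(1)[OF k'] s_1[OF k'] fl_tri[OF that sc0(1) _ s2(1)[OF i] _ s2(2)[OF i]] c1[OF i0 k' k(3)] by simp
  qed
  have kc: "ind [a0, b0, c]" using par3[OF i] ic by blast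
  show ?thesis
  proof (cases "ind [a0, c0, c, b]")
   case True then show ?thesis using fl_sym[OF j] by blast
  next
   case False
   have bc0: "ind [a0, b, c0]" using par3[OF i] i0 by simp
   obtain e where e: "ind [e, a0, b, c0]" using ext[OF bc0] by blast
   have c: "c:span {a0, b, c0}"
   proof (rule ccontr)
    assume "c ~: span {a0, b, c0}"
    then have "ind [c, a0, b, c0]" using bc0 by (simp add: ind_Cons)
    then have "ind [a0, c0, c, b]" by (rule ind_sub) auto
    then show False using False by simp
   qed
   have "ind [e, a0, b, c]" using span_sub[of "[a0, b, c]" "{a0, b, c0}"] c e ic by (auto simp: span_base ind_Cons)
   then have k: "ind [a0, e, b, c]" "ind [a0, e, c]" "ind [a0, b, e]" by (rule ind_sub, auto)+
   have ke: "ind [a0, b0, e]" using par3[OF i] k(3) by blast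
   have k0: "ind [a0, c0, e, b]" by (rule ind_sub[OF e]) auto
   show ?thesis using c1[OF ke kc k(2)] s_1[OF ke] s_1[OF kc] fl_tri[OF k(1) _ s2(1)[OF i] _ j[OF k0]] s1(1)[OF ke] s1(1)[OF kc] by simp
  qed
 qed
 have c: "fl a0 b c (s b) (s c)" if ic: "ind [a0, b, c]" for b c
 proof -
  have k: "ind [a0, b]" "ind [a0, c]" "ind [a0, c, b]" by (rule ind_sub[OF ic], auto)+
  show ?thesis
  proof (cases "ind [a0, b0, b]")
   case True
   show ?thesis
   proof (cases "ind [a0, b0, c]")
    case True then show ?thesis using c1[OF \<open>ind [a0, b0, b]\<close> True ic] s_1 \<open>ind [a0, b0, b]\<close> by simp
   next
    case False then show ?thesis using fl_sym[OF c2[OF k(2) False k(3)]] by blast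
   qed
  qed (rule c2[OF k(1) _ ic])
 qed
 have "s (b + t *s a0) = s b" if i: "ind [a0, b]" for b t
 proof -
  obtain c where c': "ind [c, a0, b]" using ind_extend[OF _ i] dim5(1) by auto
  then have ic: "ind [a0, c, b]" "ind [a0, c]" by (rule ind_sub, auto)+
  have e: "span {a0, b + t *s a0} = span {a0, b}" by (rule span_shift)
  have ib: "ind [a0, b + t *s a0]" using i by (simp add: ind2_iff e)
  then have "ind [c, a0, b + t *s a0]" using c' by (simp add: ind_Cons[of c] e)
  then have ic': "ind [a0, c, b + t *s a0]" by (rule ind_sub) auto
  show ?thesis using c[OF ic'] span_shift[of a0 "c - b" "- t"] fl_unique[OF ic(1) s_pt[OF ic(2)] _ s_pt[OF i] _ c[OF ic(1)]] s_pt[OF ib] pt_shift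
   by (simp add: algebra_simps fl_def)
 qed
 then show ?thesis using s_pt c by (intro exI[of _ s] allI impI conjI)
qed

text \<open>The diagonal matrix with entries \<open>m\<close> and \<open>inverse m\<close> is a
  product of shears; the rotation turns shears in one variable into shears in the other.\<close>

lemma shear_invariant:
 fixes Z :: "'k^5 => 'k^5 => 'q"
 assumes sh: "!!a b t. ind [a, b] ==> Z a (b + t *s a) = Z a b" and rot: "!!a b. ind [a, b] ==> Z b (- a) = Z a b"
  and i: "ind [a, b]" and m: "m ~= 0"
 shows "Z (m *s a) (inverse m *s b) = Z a b"
proof -
 have i1: "ind [a, b + t *s a]" if "ind [a, b]" for a b t using that by (simp add: ind2_iff span_shift)
 have comm: "ind [b, a]" if "ind [a, b]" for a b by (rule ind_sub[OF that]) auto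
 have i2: "ind [a + t *s b, b]" if "ind [a, b]" for a b t using comm[OF i1[OF comm[OF that]]] .
 have ir: "ind [b, - a]" if "ind [a, b]" for a b using comm[OF that] by (simp add: ind2_iff span_neg2)
 have sh': "Z (a + t *s b) b = Z a b" if "ind [a, b]" for a b t using rot[OF i2[OF that, of t]] sh[OF ir[OF that], of "- t"] rot[OF that] by simp
 \<comment> \<open>Determined by \<open>a1 - m *s b1 = m *s a\<close>; a last shear takes
   \<open>b1\<close> to \<open>inverse m *s b\<close>.\<close>
 define s where "s = (1 - m) / m"
 define a1 b1 where "a1 = a + 1 *s b" and "b1 = b + s *s a1"
 have j: "ind [a1, b]" "ind [a1, b1]" unfolding b1_def a1_def using i2[OF i] i1 by blast+
 have "Z a1 b1 = Z a b" unfolding b1_def using sh[OF j(1), of s] sh'[OF i, of 1] unfolding a1_def by simp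
 moreover have ms: "m * s = 1 - m" unfolding s_def using m by simp
 have "Z (m *s a) b1 = Z a1 b1" "ind [m *s a, b1]" using sh'[OF j(2), of "- m"] i2[OF j(2), of "- m"] by (auto simp: b1_def ms a1_def)
 moreover have "b1 + (- (s / m)) *s (m *s a) = inverse m *s b" using m vec.scale_left_distrib[of 1 s b]
  by (simp add: field_simps vec.scale_right_distrib s_def b1_def a1_def)
 ultimately show ?thesis using sh[of "m *s a" b1 "- (s / m)"] by simp
qed

text \<open>\<open>Z a b\<close> is the point standing for the bivector of \<open>a\<close> and
  \<open>b\<close>. It is read off from the star of a fixed \<open>a0\<close> if \<open>a0\<close>
  lies in \<open>span {a, b}\<close>, and otherwise transported from that star. Shears and rotations
  express that only the bivector matters; the rotation is the place where
  \<open>desargues_plane\<close> is needed.\<close>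

theorem scale_exists:
 "EX Z. ALL a b. ind [a, b] --> pt a b (Z a b) & (ALL t. Z a (b + t *s a) = Z a b) & Z b (- a) = Z a b &
   (ALL c. ind [a, b, c] --> fl a b c (Z a b) (Z a c))"
proof -
 obtain a0 :: "'k^5" where "a0 ~: {0}" using gr_ex[of 0 "{0}" 5 UNIV] dim5(2) by (auto simp: gr_def)
 then have a0: "a0 ~= 0" by simp
 obtain s where s: "ALL b. ind [a0, b] --> pt a0 b (s b) & (ALL c. ind [a0, b, c] --> fl a0 b c (s b) (s c)) & (ALL t. s (b + t *s a0) = s b)"
  using star_section[OF a0] by (elim exE)
 have s_pt: "pt a0 b (s b)" and s_fl: "ind [a0, b, c] ==> fl a0 b c (s b) (s c)" and s_sh: "s (b + t *s a0) = s b" if "ind [a0, b]" for b c t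
  using s that by blast+
 \<comment> \<open>Says that the bivector of \<open>a\<close> and \<open>b\<close> equals that of
   \<open>a0\<close> and \<open>v\<close>. The two alternatives avoid dividing by a zero
   coefficient, and \<open>v\<close> is unique only up to multiples of \<open>a0\<close>.\<close>
 define V where "V a b v <-> (EX al be. a0 = al *s a + be *s b & (al ~= 0 & v = inverse al *s b | be ~= 0 & v = - (inverse be *s a)))" for a b v
 have V_rot: "V b (- a) = V a b" for a b
 proof (rule ext)
  have *: "V a b v" if "a0 = al *s b + be *s (- a) & (al ~= 0 & v = inverse al *s (- a) | be ~= 0 & v = - (inverse be *s b))" for al be v
   unfolding V_def by (rule exI[of _ "- be"], rule exI[of _ al]) (use that in auto)
  have **: "V b (- a) v" if "a0 = al *s a + be *s b & (al ~= 0 & v = inverse al *s b | be ~= 0 & v = - (inverse be *s a))" for al be v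
   unfolding V_def by (rule exI[of _ "be"], rule exI[of _ "- al"]) (use that in auto)
  fix v
  show "V b (- a) v = V a b v"
  proof
   assume "V b (- a) v"
   then show "V a b v" unfolding V_def[of b "- a"] by (elim exE) (rule *)
  next
   assume "V a b v"
   then show "V b (- a) v" unfolding V_def[of a b] by (elim exE) (rule **)
  qed
 qed
 have V_ex: "EX v. V a b v" if ab: "a0:span {a, b}" for a b
 proof -
  obtain al be where e: "a0 = al *s a + be *s b" using span2D[OF refl ab] by blast
  have "al ~= 0 | be ~= 0" using e a0 by auto
  then show ?thesis unfolding V_def using e by blast
 qed
 have V_span: "span {a0, v} = span {a, b}" "ind [a0, v]" if i: "ind [a, b]" and v: "V a b v" for a b v
 proof -
  obtain al be where e: "a0 = al *s a + be *s b" "al ~= 0 & v = inverse al *s b | be ~= 0 & v = - (inverse be *s a)"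
   using v unfolding V_def by blast
  have m: "a0:span {a0, v}" "v:span {a0, v}" "a:span {a, b}" "b:span {a, b}" by (simp_all add: span_base)
  have "a0:span {a, b}" unfolding e(1) by (intro span_add span_scale m)
  moreover have "v:span {a, b}" using e(2) by (auto intro!: span_scale span_neg m(3,4))
  moreover have "a:span {a0, v} & b:span {a0, v}"
   using e(2)
  proof
   assume h: "al ~= 0 & v = inverse al *s b"
   then have b: "b = al *s v" by simp
   have bm: "b:span {a0, v}" unfolding b by (rule span_scale[OF m(2)])
   have "a = inverse al *s (a0 - be *s b)" using e(1) h by simp
   then show ?thesis using bm span_scale[OF span_diff[OF m(1) span_scale[OF bm]]] by metis
  next
   assume h: "be ~= 0 & v = - (inverse be *s a)"
   then have b: "a = (- be) *s v" by simp
   have bm: "a:span {a0, v}" unfolding b by (rule span_scale[OF m(2)])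
   have "b = inverse be *s (a0 - al *s a)" using e(1) h by simp
   then show ?thesis using bm span_scale[OF span_diff[OF m(1) span_scale[OF bm]]] by metis
  qed
  ultimately show "span {a0, v} = span {a, b}" using span2_eqI[of a0 a b v] by simp
  then show "ind [a0, v]" using i by (simp add: ind2_iff)
 qed
 have uniq: "al = al' & be = be'" if "ind [a, b]" "al *s a + be *s b = al' *s a + be' *s b" for a b :: "'k^5" and al be al' be'
 proof -
  have "ind [b, a]" by (rule ind_sub[OF that(1)]) auto
  then have bn: "b ~: span {a}" "a ~= 0" by (auto simp: ind_Cons)
  have e: "(be - be') *s b = (al' - al) *s a" using that(2) by (simp add: algebra_simps)
  show ?thesis using scale_solve[OF _ e] bn e by (force simp: span_singleton)
 qed
 have V_shift: "EX t. v' = v + t *s a0" if i: "ind [a, b]" and v: "V a b v" "V a b v'" for a b v v'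
 proof -
  obtain al be where e: "a0 = al *s a + be *s b" "al ~= 0 & v = inverse al *s b | be ~= 0 & v = - (inverse be *s a)"
   using v(1) unfolding V_def by blast
  obtain al' be' where e': "a0 = al' *s a + be' *s b" "al' ~= 0 & v' = inverse al' *s b | be' ~= 0 & v' = - (inverse be' *s a)"
   using v(2) unfolding V_def by blast
  have q: "al' = al" "be' = be" using uniq[OF i, of al be al' be'] e e' by simp_all
  have d: "inverse al *s b + inverse be *s a = (inverse al * inverse be) *s a0" if "al ~= 0" "be ~= 0"
  proof -
   have h: "inverse al * inverse be * al = inverse be" "inverse al * inverse be * be = inverse al" using that by simp_all
   show ?thesis by (simp only: e(1) vec.scale_right_distrib vec.scale_scale h add.commute)
  qed
  consider "v' = v" | "al ~= 0" "be ~= 0" "v = inverse al *s b" "v' = - (inverse be *s a)" | "al ~= 0" "be ~= 0" "v' = inverse al *s b" "v = - (inverse be *s a)"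
   using e(2) e'(2) q by metis
  then show ?thesis
  proof cases
   case 1 then show ?thesis by (intro exI[of _ 0]) simp
  next
   case 2
   then show ?thesis using d by (intro exI[of _ "- (inverse al * inverse be)"]) (simp add: algebra_simps flip: d)
  next
   case 3
   then show ?thesis using d by (intro exI[of _ "inverse al * inverse be"]) (simp add: algebra_simps flip: d)
  qed
 qed
 \<comment> \<open>In the second case the partner is the bivector of \<open>a\<close> and
   \<open>- a0\<close>, which is that of \<open>a0\<close> and \<open>a\<close> and so has the point
   \<open>s a\<close>.\<close>
 define Z where "Z a b = (if a0:span {a, b} then s (SOME v. V a b v) else (THE z. pt a b z & fl a b (- a0) z (s a)))" for a b
 have ZV: "Z a b = s v" if i: "ind [a, b]" and v: "V a b v" for a b v
 proof -
  obtain t where "(SOME v. V a b v) = v + t *s a0" using V_shift[OF i v someI[of "V a b", OF v]] by blast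
  then show ?thesis unfolding Z_def using s_sh[OF V_span(2)[OF i v], of t] V_span(1)[OF i v] span_base[of a0 "{a0, v}"] by simp
 qed
 have span_neg_iff: "- c:span S <-> c:span S" for c :: "'k^5" and S by (metis span_neg minus_minus)
 have i_neg: "ind [a, b, - c] <-> ind [a, b, c]" for a b c :: "'k^5"
 proof -
  have "ind [a, b, u] <-> ind [u, a, b]" for u using ind_sub[of "[a, b, u]" "[u, a, b]"] ind_sub[of "[u, a, b]" "[a, b, u]"] by auto
  then have "ind [a, b, u] <-> ind [a, b] & u ~: span {a, b}" for u using ind_Cons[of u "[a, b]"] by simp
  then show ?thesis using span_neg_iff[of c "{a, b}"] by blast
 qed
 have i_rot: "ind [a0, a, b] <-> ind [a, b, a0]" "ind [b, a, a0] <-> ind [a, b, a0]" for a b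
  by (rule iffI; erule ind_sub; auto)+
 have out: "ind [a, b, a0]" if "ind [a, b]" "a0 ~: span {a, b}" for a b
 proof -
  have "ind [a0, a, b]" using that by (simp add: ind_Cons)
  then show ?thesis by (rule ind_sub) auto
 qed
 have sa: "pt a (- a0) (s a)" "pt a a0 (s a)" if "ind [a, b, a0]" for a b
 proof -
  have "ind [a0, a]" by (rule ind_sub[OF that]) auto
  then have "pt a0 a (s a)" by (rule s_pt)
  then show "pt a a0 (s a)" "pt a (- a0) (s a)" unfolding pt_def span_neg2 by (simp_all add: insert_commute)
 qed
 have Zo: "pt a b (Z a b) & fl a b (- a0) (Z a b) (s a)" if i: "ind [a, b, a0]" for a b
 proof -
  have j: "ind [a, - a0, b]" using i_neg[of a b a0] i ind_sub[of "[a, b, - a0]" "[a, - a0, b]"] by auto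
  have n: "a0 ~: span {a, b}" using i unfolding i_rot(1)[symmetric] by (simp add: ind_Cons)
  have "EX! z. pt a b z & fl a b (- a0) z (s a)" using tr_ex[OF j sa(1)[OF i]] fl_sym by metis
  from theI'[OF this] show ?thesis using n unfolding Z_def by simp
 qed
 have Zou: "z = Z a b" if i: "ind [a, b, a0]" and z: "pt a b z" "fl a b (- a0) z (s a)" for a b z
 proof -
  have j: "ind [a, - a0, b]" using i_neg[of a b a0] i ind_sub[of "[a, b, - a0]" "[a, - a0, b]"] by auto
  show ?thesis using fl_unique[OF j sa(1)[OF i] z(1) _ fl_sym[OF z(2)] fl_sym] Zo[OF i] by blast
 qed
 have Z_pt: "pt a b (Z a b)" if i: "ind [a, b]" for a b
 proof (cases "a0:span {a, b}")
  case True
  then obtain v where v: "V a b v" using V_ex by blast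
  show ?thesis using ZV[OF i v] s_pt[OF V_span(2)[OF i v]] V_span(1)[OF i v] unfolding pt_def by simp
 next
  case False show ?thesis using Zo[OF out[OF i False]] by blast
 qed
 have Z_sh: "Z a (b + t *s a) = Z a b" if i: "ind [a, b]" for a b t
 proof (cases "a0:span {a, b}")
  case False
  have e: "span {a, b + t *s a} = span {a, b}" by (rule span_shift)
  show ?thesis using span_shift[of a "b - - a0" t] False by (simp add: algebra_simps Z_def pt_def fl_def e)
 next
  case True
  obtain al be where e: "a0 = al *s a + be *s b" using span2D[OF refl True] by blast
  have e': "a0 = (al - be * t) *s a + be *s (b + t *s a)" unfolding e by (simp add: vec.scale_left_diff_distrib vec.scale_right_distrib)
  have i': "ind [a, b + t *s a]" using i by (simp add: ind2_iff span_shift)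
  show ?thesis
  proof (cases "be = 0")
   case False
   then have "V a b (- (inverse be *s a))" "V a (b + t *s a) (- (inverse be *s a))" unfolding V_def using e e' by blast+
   then show ?thesis using ZV[OF i] ZV[OF i'] by simp
  next
   case True
   then have al: "al ~= 0" using e a0 by auto
   have v: "V a b (inverse al *s b)" unfolding V_def using e al by blast
   have v': "V a (b + t *s a) (inverse al *s (b + t *s a))" unfolding V_def by (rule exI[of _ al], rule exI[of _ 0]) (use e' al True in simp)
   have "inverse al *s (b + t *s a) = inverse al *s b + (inverse al * t * inverse al) *s a0"
    unfolding e True using al by (simp add: vec.scale_right_distrib)
   then show ?thesis using ZV[OF i v] ZV[OF i' v'] s_sh[OF V_span(2)[OF i v]] by simp
  qed
 qed
 have Z_rot: "Z b (- a) = Z a b" if i: "ind [a, b]" for a b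
 proof -
  have ib: "ind [b, - a]" using ind_sub[OF i, of "[b, a]"] by (auto simp: ind2_iff span_neg2)
  have sp: "span {b, - a} = span {a, b}" unfolding span_neg2 by (simp add: insert_commute)
  show ?thesis
  proof (cases "a0:span {a, b}")
   case True
   then obtain v where v: "V a b v" using V_ex by blast
   show ?thesis using ZV[OF i v] ZV[OF ib, of v] v V_rot by simp
  next
   case False
   note o = out[OF i False]
   have o': "ind [b, - a, a0]" using out[OF ib] False sp by simp
   have ab: "ind [a0, a, b]" using o i_rot by simp
   have k: "ind [a0, a]" "ind [a0, b]" by (rule ind_sub[OF ab], auto)+
   note h = s_pt[OF k(1)] s_pt[OF k(2)] Zo[OF o]
   have l1: "lin (s a) (s b) (r (span {a0, a - b}))" using s_fl[OF k(1) ab] unfolding fl_def .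
   have l2: "lin (s a) (Z a b) (r (span {a, b + a0}))" using fl_sym h(3) unfolding fl_def by (metis lin_perm(1) diff_minus_eq_add)
   have "pt b (- a) (Z a b)" using h(3) unfolding pt_def sp by simp
   then show ?thesis using Zou[OF o'] desargues_plane[OF ab _ _ _ _ l1 l2] h lin_perm(1) by (simp add: pt_def fl_def)
  qed
 qed
 have Z_scale: "Z (m *s a) (inverse m *s b) = Z a b" if "ind [a, b]" "m ~= 0" for a b m
  by (rule shear_invariant[OF Z_sh Z_rot that])
 have F1: "fl a b c (Z a b) (Z a c)" if i: "ind [a, b, c]" and n: "a0 ~: span {a, b, c}" for a b c
 proof -
  have "ind [a0, a, b, c]" using i n by (simp add: ind_Cons)
  then have k: "ind [a, a0, b, c]" "ind [a, b, a0]" "ind [a, c, a0]" by (rule ind_sub, auto)+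
  have "ind [- a0, a, b, c]" using i n by (simp add: ind_Cons span_neg_iff)
  then have k': "ind [a, - a0, b, c]" by (rule ind_sub) auto
  show ?thesis using fl_tri[OF k' sa(1)[OF k(2)]] Zo[OF k(2)] Zo[OF k(3)] fl_sym by blast
 qed
 \<comment> \<open>\<open>a0\<close> lies in the plane of \<open>a\<close> and \<open>b\<close>.
   Rescaling \<open>a\<close> and \<open>c\<close> inversely turns the claim into the defining
   relation of \<open>Z\<close> for the pair outside \<open>a0\<close>.\<close>
 have F3: "fl a b c (Z a b) (Z a c)" if i: "ind [a, b, c]" and n: "a0:span {a, b}" "a0 ~: span {a}" for a b c
 proof -
  obtain al be where e: "a0 = al *s a + be *s b" using span2D[OF refl n(1)] by blast
  have b: "be ~= 0" using e n(2) by (auto simp: span_singleton)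
  have k: "ind [a, b]" "ind [a, c]" "ind [b, a, c]" by (rule ind_sub[OF i], auto)+
  have Zab: "Z a b = s (- (inverse be *s a))" by (rule ZV[OF k(1)]) (use e b in \<open>auto simp: V_def\<close>)
  let ?a = "(- inverse be) *s a" and ?c = "(- be) *s c"
  have Zc: "Z ?a ?c = Z a c" using Z_scale[OF k(2), of "- inverse be"] b by simp
  have "a0 ~: span {a, c}"
  proof
   assume h: "a0:span {a, c}"
   have "b = inverse be *s (a0 - al *s a)" using e b by simp
   also have "... : span {a, c}" using span_scale[OF span_diff[OF h span_scale[OF span_base[of a "{a, c}"]]]] by simp
   finally show False using k(3) by (simp add: ind_Cons)
  qed
  then have "ind [a0, a, c]" using k(2) by (simp add: ind_Cons)
  then have "ind [a0, ?a, ?c]"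
  proof (rule ind_exchange)
   show "set [a0, a, c] <= span (set [a0, ?a, ?c])"
    using b span_scale[OF span_base[of ?a "{a0, ?a, ?c}"], of "- be"] span_scale[OF span_base[of ?c "{a0, ?a, ?c}"], of "- inverse be"]
    by (simp add: span_base)
  qed simp
  then have "fl ?a ?c (- a0) (Z ?a ?c) (s ?a)" using Zo i_rot(1) by blast
  moreover have "span {?a, ?c + a0} = span {a, b - c}"
  proof -
   have q: "?c + a0 = be *s (b - c) + al *s a" unfolding e by (simp add: vec.scale_right_diff_distrib)
   have "span {?a, ?c + a0} = span {a, ?c + a0}" using span_scale2[of "- inverse be" "?c + a0" a] b by (simp add: insert_commute)
   then show ?thesis unfolding q using span_shift[of a "be *s (b - c)" al] span_scale2[OF b, of a "b - c"] by simp
  qed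
  ultimately show ?thesis unfolding fl_def Zab using Zc lin_perm(1) by simp
 qed
 have Z_fl: "fl a b c (Z a b) (Z a c)" if i: "ind [a, b, c]" for a b c
 proof -
  have k: "ind [a, b]" "ind [a, c]" "ind [a, c, b]" by (rule ind_sub[OF i], auto)+
  consider "a0:span {a}" | "a0 ~: span {a}" "a0:span {a, b}" | "a0 ~: span {a}" "a0:span {a, c}"
   | "a0 ~: span {a, b, c}" | "a0 ~: span {a, b}" "a0 ~: span {a, c}" "a0:span {a, b, c}" by blast
  then show ?thesis
  proof cases
   case 1
   then obtain al where e: "a0 = al *s a" by (auto simp: span_singleton)
   then have al: "al ~= 0" using a0 by auto
   let ?b = "inverse al *s b" and ?c = "inverse al *s c"
   have V1: "V a u (inverse al *s u)" for u
    unfolding V_def by (rule exI[of _ al], rule exI[of _ 0]) (use e al in simp)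
   have Z: "Z a b = s ?b" "Z a c = s ?c"
    using ZV[OF k(1), of ?b] ZV[OF k(2), of ?c] V1 by blast+
   have "ind [a0, ?b, ?c]"
   proof (rule ind_exchange[OF i])
    let ?S = "span (set [a0, ?b, ?c])"
    have m: "a0:?S" "?b:?S" "?c:?S" by (simp_all add: span_base)
    show "set [a, b, c] <= ?S" using e al span_scale[OF m(1), of "inverse al"] span_scale[OF m(2), of al] span_scale[OF m(3), of al] by simp
   qed simp
   then have "fl a0 ?b ?c (s ?b) (s ?c)" by (intro s_fl) (rule ind_sub, assumption, auto)
   then show ?thesis unfolding fl_def Z using span_scale2[of "inverse al" a0 "b - c"] al e span_scale2[OF al, of "b - c" a] by (simp add: insert_commute)
  next
   case 2 then show ?thesis using F3[OF i] by blast
  next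
   case 3 then show ?thesis using fl_sym[OF F3[OF k(3)]] by blast
  next
   case 4 then show ?thesis using F1[OF i] by blast
  next
   case 5
   obtain e where e: "ind [e, a, b, c]" using ind_extend[OF _ i] dim5(1) by auto
   have j: "ind [a, e, b, c]" "ind [a, e, b]" "ind [a, e, c]" "ind [e, a, c, b]" "ind [a, e]" by (rule ind_sub[OF e], auto)+
   \<comment> \<open>In the remaining position \<open>a0\<close> is in the 3-space but in neither
     plane; a vector \<open>e\<close> outside gives triples avoiding \<open>a0\<close>, to which
     \<open>F1\<close> applies.\<close>
   have nn: "a0 ~: span {a, e, v}" if v: "ind [e, a, v, w]" "a0:span {w, a, v}" "a0 ~: span {a, v}" for v w
   proof
    assume h: "a0:span {a, e, v}"
    have "ind [w, e, a, v]" by (rule ind_sub[OF v(1)]) auto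
    moreover obtain l where l: "a0 - l *s w:span {a, v}" using v(2) unfolding span_breakdown_eq[of a0 w "{a, v}"] by (elim exE)
    then have "l ~= 0" using v(3) by (metis diff_zero vec.scale_zero_left)
    moreover have "w = inverse l *s (a0 - (a0 - l *s w))" using \<open>l ~= 0\<close> by simp
    have "inverse l *s (a0 - (a0 - l *s w)):span {a, e, v}" using l span_mono[of "{a,v}" "{a,e,v}"] span_scale[OF span_diff[OF h]] by blast
    then have "w:span {e, a, v}" using \<open>w = inverse l *s (a0 - (a0 - l *s w))\<close> by (simp add: insert_commute)
    ultimately show False by (simp add: ind_Cons)
   qed
   have s3: "a0:span {c, a, b}" "a0:span {b, a, c}" using 5(3) by (simp_all add: insert_commute)
   have "fl a e b (Z a e) (Z a b)" "fl a e c (Z a e) (Z a c)"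
    using F1[OF j(2) nn[OF e s3(1) 5(1)]] F1[OF j(3) nn[OF j(4) s3(2) 5(2)]] .
   then show ?thesis by (rule fl_tri[OF j(1) Z_pt[OF j(5)] Z_pt[OF k(1)] Z_pt[OF k(2)]])
  qed
 qed
 show ?thesis using Z_pt Z_sh Z_rot Z_fl by (intro exI[of _ Z] allI impI conjI)
qed

text \<open>By \<open>pasch\<close> the line \<open>xy\<close> meets the line joining the origins
  over the same two lines on \<open>p\<close>, and the meeting point is an origin. Its direction is
  neither that of \<open>x\<close> nor that of \<open>y\<close>, so both coefficients are
  nonzero.\<close>

lemma r_on_line:
 assumes i: "ind [a, b, c]" and x: "pt a b x" and y: "pt a c y"
 shows "EX s. s ~= 0 & lin x y (r (span {a, s *s b - c}))"
proof -
 let ?A = "span {a, b}" and ?B = "span {a, c}"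
 note P = star_pen[OF i]
 note h = penD[OF P]
 have o: "over ?A x" "over ?B y" "x ~= r ?A" "y ~= r ?B" using x y unfolding pt_def by simp_all
 note ra = over_r[OF h(1)] and rb = over_r[OF h(2)]
 obtain k where k: "k:lines H" "x:k" "y:k" using over_line[OF P o(1,2)] by blast
 obtain k' where k': "k':lines H" "r ?A:k'" "r ?B:k'" using over_line[OF P ra rb] by blast
 have c: "col p x" "x ~= p" "col p (r ?A)" "r ?A ~= p" "d p x = d p (r ?A)" "col p y" "y ~= p" "col p (r ?B)" "r ?B ~= p" "d p y = d p (r ?B)"
  using o ra rb unfolding over_def by simp_all
 obtain l where l: "l:lines H" "p:l" "x:l" "r ?A:l" using d_eq[OF p c(1-5)] by blast
 obtain m where m: "m:lines H" "p:m" "y:m" "r ?B:m" using d_eq[OF p c(6-10)] by blast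
 have lm: "l ~= m" using d_line[OF l(1-3) _ c(2,7)] m(3) o(1,2) h(4) unfolding over_def by blast
 obtain s where s: "s:k" "s:k'" using pasch[OF l(1) m(1) l(2) m(2) lm l(3) c(2) m(3) c(7) over_col[OF o(1,2) h(7)] k k' l(4) m(4) c(4,9)] by auto
 obtain D where D: "over D s" "?A Int ?B <= D" "D <= ?A #+ ?B" using over_pencil(2)[OF P ra rb k' s(2)] by blast
 have sD: "s = r D" using over_pencil(3)[OF P ra rb k' s(2) _ D(1) over_r[OF over_gr[OF D(1)]]] r_pen[OF h(1,2) over_gr[OF D(1)] h(4,7) D(2,3) k'] by simp
 have nD: "D ~= ?A" "D ~= ?B"
  using over_pencil(3)[OF P o(1,2) k s(1) k(2) _ o(1)] over_pencil(3)[OF P o(1,2) k s(1) k(3) _ o(2)] D(1) sD o(3,4) by blast+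
 have aD: "a:D" using D(2) span_base[of a "{a,b}"] span_base[of a "{a,c}"] by blast
 have a0: "ind [a]" by (rule ind_sub[OF i]) auto
 then have a0': "a ~= 0" by (auto simp: ind_def)
 have ga: "gr 1 (span {a})" using ind_gr[OF a0] by simp
 obtain w where w: "w:D" "w ~: span {a}" using gr_ex[OF ga over_gr[OF D(1)]] by auto
 have "{a, b} Un {a, c} = {a, b, c}" by auto
 then have "w:span {a, b, c}" using w(1) D(3) by (auto simp: ssum_span)
 then obtain al be ga where e: "w = al *s a + be *s b + ga *s c" using span_lin3 by blast
 have D': "D = span {a, be *s b + ga *s c}" unfolding gr2_eq_span[OF over_gr[OF D(1)] aD w(1) a0' w(2)] e using span_shift[of a "be *s b + ga *s c" al]
  by (simp add: algebra_simps)
 have be: "be ~= 0"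
 proof
  assume z: "be = 0"
  show False
  proof (cases "ga = 0")
   case True then show False using w(2) e z by (simp add: span_scale span_base)
  next
   case False then show False using nD(2) D' z span_scale2 by simp
  qed
 qed
 have ga: "ga ~= 0" using nD(1) D' be span_scale2 by fastforce
 let ?s = "- be / ga"
 have "D = span {a, ?s *s b - c}" using ga D' span_scale2[of "- ga" a "?s *s b - c"] by (simp add: vec.scale_right_diff_distrib)
 then show ?thesis using k s sD be ga unfolding lin_def by (intro exI[of _ ?s]) auto
qed

text \<open>\<open>P s a b\<close> is the point whose alternating form will take the value
  \<open>s\<close> on \<open>(a, b)\<close>. This explains invariance under shears and rotations,
  the homogeneity in \<open>b\<close>, and the additivity along a line.\<close>

theorem param_exists:
 "EX P. ALL a b. ind [a, b] --> (ALL s. over (span {a, b}) (P s a b)) & (ALL x. over (span {a, b}) x --> (EX! s. x = P s a b)) &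
   (ALL s t. P s a (b + t *s a) = P s a b) & (ALL s. P s b (- a) = P s a b) & (ALL s m. m ~= 0 --> P (m * s) a (m *s b) = P s a b) &
   (ALL c s t. ind [a, b, c] --> lin (P s a b) (P t a c) (P (s + t) a (b + c)))"
proof -
 obtain Z where Z: "ALL a b. ind [a, b] --> pt a b (Z a b) & (ALL t. Z a (b + t *s a) = Z a b) & Z b (- a) = Z a b &
   (ALL c. ind [a, b, c] --> fl a b c (Z a b) (Z a c))" using scale_exists by (elim exE)
 have Z_pt: "pt a b (Z a b)" and Z_sh: "Z a (b + t *s a) = Z a b" and Z_rot: "Z b (- a) = Z a b"
  and Z_fl: "ind [a, b, c] ==> fl a b c (Z a b) (Z a c)" if "ind [a, b]" for a b c t using Z that by blast+
 \<comment> \<open>The origin belongs to the zero form and \<open>Z a b\<close> to value 1. A form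
   with value \<open>s\<close> on \<open>(a, b)\<close> has value 1 on
   \<open>(a, inverse s *s b)\<close>, hence the inverse.\<close>
 define P where "P s a b = (if s = 0 then r (span {a, b}) else Z a (inverse s *s b))" for s a b
 have isc: "ind [a, t *s b]" if "ind [a, b]" "t ~= 0" for a b t using that by (simp add: ind2_iff span_scale2)
 have sub2: "ind [a, b]" "ind [a, c]" if "ind [a, b, c]" for a b c by (rule ind_sub[OF that], auto)+
 have isc3: "ind [a, s *s b, t *s c]" if i: "ind [a, b, c]" and st: "s ~= 0" "t ~= 0" for a b c s t
 proof (rule ind_exchange[OF i])
  let ?S = "span (set [a, s *s b, t *s c])"
  have "a:?S" "inverse s *s (s *s b):?S" "inverse t *s (t *s c):?S" by (intro span_scale span_base; simp)+
  then show "set [a, b, c] <= ?S" using st by simp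
 qed simp
 have ext: "EX c. ind [a, b, c]" if i: "ind [a, b]" for a b
 proof -
  obtain c where "ind [c, a, b]" using ind_extend[OF _ i] dim5(1) by auto
  then have "ind [a, b, c]" by (rule ind_sub) auto
  then show ?thesis by blast
 qed
 have P_pt: "over (span {a, b}) (P s a b)" "s ~= 0 ==> pt a b (P s a b)" if i: "ind [a, b]" for a b s
 proof -
  show *: "pt a b (P s a b)" if s: "s ~= 0" using Z_pt[OF isc[OF i, of "inverse s"]] s unfolding P_def pt_def by (simp add: span_scale2)
  then show "over (span {a, b}) (P s a b)" using over_r[OF ind2[OF i]] unfolding P_def pt_def by (cases "s = 0") simp_all
 qed
 \<comment> \<open>The origin lies over \<open>a\<close> and \<open>t *s b - s *s c\<close>, the
   combination on which a form with values \<open>s\<close> on \<open>(a, b)\<close> and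
   \<open>t\<close> on \<open>(a, c)\<close> vanishes.\<close>
 have P_fl: "lin (P s a b) (P t a c) (r (span {a, t *s b - s *s c}))" if i: "ind [a, b, c]" and st: "s ~= 0 | t ~= 0" for a b c s t
 proof -
  note P = star_pen[OF i]
  obtain k where k: "k:lines H" "P s a b:k" "P t a c:k" using over_line[OF P P_pt(1)[OF sub2(1)[OF i]] P_pt(1)[OF sub2(2)[OF i]]] by blast
  consider "s = 0" "t ~= 0" | "t = 0" "s ~= 0" | "s ~= 0" "t ~= 0" using st by blast
  then show ?thesis
  proof cases
   case 1
   then show ?thesis using k by (auto simp: span_scale2 P_def lin_def)
  next
   case 2
   then show ?thesis using span_scale2[of "- s" a c] k by (auto simp: P_def lin_def)
  next
   case 3
   note j = isc3[OF i, of "inverse s" "inverse t"]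
   have h: "s * t * inverse s = t" "s * t * inverse t = s" using 3 by simp_all
   have "(s * t) *s (inverse s *s b - inverse t *s c) = t *s b - s *s c" by (simp only: vec.scale_right_diff_distrib vec.scale_scale h)
   then show ?thesis using span_scale2[of "s * t" a "inverse s *s b - inverse t *s c"] 3 Z_fl[OF sub2(1)[OF j] j] by (simp add: fl_def P_def)
  qed
 qed
 \<comment> \<open>Two parameters for one point would put two different origins on its line to
   \<open>P 1 a c\<close>, and then \<open>P 1 a c\<close> would be an origin.\<close>
 have P_inj: "s = s'" if i: "ind [a, b]" and e: "P s a b = P s' a b" for a b s s'
 proof (rule ccontr)
  assume n: "s ~= s'"
  obtain c where c: "ind [a, b, c]" using ext[OF i] by blast
  have l: "lin (P s a b) (P 1 a c) (r (span {a, b - s *s c}))" "lin (P s a b) (P 1 a c) (r (span {a, b - s' *s c}))"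
   using P_fl[OF c, of s 1] P_fl[OF c, of s' 1] e by simp_all
  obtain k where k: "k:lines H" "P s a b:k" "P 1 a c:k" "r (span {a, b - s *s c}):k" using l(1) unfolding lin_def by blast
  obtain k' where k': "k':lines H" "P s a b:k'" "P 1 a c:k'" "r (span {a, b - s' *s c}):k'" using l(2) unfolding lin_def by blast
  note o = P_pt(1)[OF sub2(1)[OF c]] P_pt[OF sub2(2)[OF c]]
  have l3: "lin (r (span {a, b - s *s c})) (r (span {a, b - s' *s c})) (P 1 a c)"
   using k k' line_eq[OF k(1) k'(1) k(2) k'(2) k(3) k'(3) over_ne[OF o(1,2) penD(4)[OF star_pen[OF c]]]] by (auto simp: lin_def)
  have j: "ind [a, b - s *s c, b - s' *s c]"
  proof (rule ind_exchange[OF c])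
   let ?S = "span (set [a, b - s *s c, b - s' *s c])"
   have m: "a:?S" "b - s *s c:?S" "b - s' *s c:?S" by (simp_all add: span_base)
   have "(b - s *s c) - (b - s' *s c) = (s' - s) *s c" by (simp add: vec.scale_left_diff_distrib)
   then have "inverse (s' - s) *s ((b - s *s c) - (b - s' *s c)) = c" using n by (simp only: vec.scale_scale) simp
   then have cS: "c:?S" using span_scale[OF span_diff[OF m(2,3)]] by metis
   show "set [a, b, c] <= ?S" using span_add[OF m(2) span_scale[OF cS, of s]] cS m by simp
  qed simp
  show False using span_scale2[of "s' - s" a c] n lin_r[OF star_pen[OF j], of "P 1 a c"] l3 o(3) by (simp add: pt_def)
 qed
 have P_ex: "EX s. x = P s a b" if i: "ind [a, b]" and x: "over (span {a, b}) x" for a b x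
 proof (cases "x = r (span {a, b})")
  case True then show ?thesis by (intro exI[of _ 0]) (simp add: P_def)
 next
  case False
  obtain c where c: "ind [a, b, c]" using ext[OF i] by blast
  have y: "pt a c (P 1 a c)" using P_pt(2)[OF sub2(2)[OF c], of 1] by simp
  obtain s where s: "s ~= 0" "lin x (P 1 a c) (r (span {a, s *s b - c}))" using r_on_line[OF c _ y, of x] x False unfolding pt_def by blast
  have l: "lin (P 1 a c) (P (inverse s) a b) (r (span {a, s *s b - c}))"
   using span_scale2[of s a "b - inverse s *s c"] s(1) lin_perm(1) P_fl[OF c, of "inverse s" 1] by (simp add: vec.scale_right_diff_distrib)
  have "ind [a, c, s *s b]" using isc3[OF c s(1), of 1] ind_sub[of "[a, s *s b, c]" "[a, c, s *s b]"] by auto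
  from pen_perm(1)[OF star_pen[OF this]] have pn: "pen (span {a, c}) (span {a, b}) (span {a, s *s b - c})"
   using span_scale2[OF s(1)] span_neg2[of a "c - s *s b"] pen_perm(1) by simp
  show ?thesis using flat_unique[OF pn _ x P_pt(1)[OF i] lin_perm(1)[OF s(2)] l] y by (auto simp: pt_def)
 qed
 have P_add: "lin (P s a b) (P t a c) (P (s + t) a (b + c))" if i: "ind [a, b, c]" for a b c s t
 proof -
  have ibc: "ind [a, b, b + c]" "ind [a, c, b + c]" "ind [a, b, - c]"
  proof -
   have m: "a:span {a, b, b + c}" "b:span {a, b, b + c}" "b + c:span {a, b, b + c}" "a:span {a, c, b + c}" "c:span {a, c, b + c}" "b + c:span {a, c, b + c}"
    by (simp_all add: span_base)
   show "ind [a, b, b + c]" by (rule ind_exchange[OF i]) (use m span_diff[OF m(3,2)] in simp_all)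
   show "ind [a, c, b + c]" by (rule ind_exchange[OF i]) (use m span_diff[OF m(6,5)] in simp_all)
   show "ind [a, b, - c]" using isc3[OF i, of 1 "-1"] by simp
  qed
  note o = P_pt(1)[OF sub2(1)[OF i]] P_pt(1)[OF sub2(2)[OF i]] P_pt(1)[OF sub2(2)[OF ibc(1)]]
  note pn = star_pen[OF i]
  obtain k where k: "k:lines H" "P s a b:k" "P t a c:k" using over_line[OF pn o(1,2)] by blast
  have pbc: "pen (span {a, b}) (span {a, c}) (span {a, b + c})" using star_pen[OF ibc(3)] span_neg2[of a c] by simp
  show ?thesis
  proof (cases "s = 0 & t = 0")
   case True
   show ?thesis using r_pen[OF penD(1-4,7-9)[OF pbc] k(1)] True k by (auto simp: P_def lin_def)
  next
   case False
   \<comment> \<open>The line through the two given points is recognized by its origin: the line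
     joining one of them to \<open>P (s + t) a (b + c)\<close> has an origin over the same
     2-space.\<close>
   let ?D = "span {a, t *s b - s *s c}"
   obtain j where j: "j:lines H" "P s a b:j" "P t a c:j" "r ?D:j" using P_fl[OF i] False by (auto simp: lin_def)
   have gD: "gr 2 ?D & (s ~= 0 --> ?D ~= span {a, b}) & (t ~= 0 --> ?D ~= span {a, c})"
   proof -
    consider "s = 0" "t ~= 0" | "t = 0" "s ~= 0" | "s ~= 0" "t ~= 0" using False by blast
    then show ?thesis
    proof cases
     case 1 then show ?thesis using span_scale2[OF 1(2), of a b] penD(1,4)[OF pn] by simp
    next
     case 2 then show ?thesis using span_scale2[of "- s" a c] penD(2,4)[OF pn] by simp
    next
     case 3
     have "ind [a, t *s b, s *s c]" by (rule isc3[OF i]) (use 3 in simp_all)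
     from penD[OF star_pen[OF this]] show ?thesis using 3 by (simp add: span_scale2)
    qed
   qed
   note oD = over_r[of ?D]
   have "P (s + t) a (b + c):j"
   proof (cases "s = 0")
    case sn: False
    have "lin (P s a b) (P (s + t) a (b + c)) (r (span {a, (s + t) *s b - s *s (b + c)}))" by (rule P_fl[OF ibc(1)]) (use sn in simp)
    then obtain i where i: "i:lines H" "P s a b:i" "P (s + t) a (b + c):i" "r ?D:i" unfolding lin_def by (auto simp: vec.scale_left_distrib)
    show ?thesis using line_eq[OF i(1) j(1) i(2) j(2) i(4) j(4) over_ne[OF o(1) oD]] gD sn i by auto
   next
    case True
    then have tn: "t ~= 0" using False by simp
    have "lin (P t a c) (P (s + t) a (b + c)) (r (span {a, (s + t) *s c - t *s (b + c)}))" by (rule P_fl[OF ibc(2)]) (use tn in simp)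
    moreover have "(s + t) *s c - t *s (b + c) = - (t *s b - s *s c)" by (simp add: vec.scale_left_distrib)
    ultimately obtain i where i: "i:lines H" "P t a c:i" "P (s + t) a (b + c):i" "r ?D:i" unfolding lin_def by (auto simp only: span_neg2)
    show ?thesis using line_eq[OF i(1) j(1) i(2) j(3) i(4) j(4) over_ne[OF o(2) oD]] gD tn i by auto
   qed
   then show ?thesis using j unfolding lin_def by blast
  qed
 qed
 have "P s a (b + t *s a) = P s a b" if i: "ind [a, b]" for s a b t using Z_sh[OF isc[OF i, of "inverse s"], of "inverse s * t"] unfolding P_def
  by (simp add: span_shift)
 moreover have "P s b (- a) = P s a b" if i: "ind [a, b]" for s a b
 proof (cases "s = 0")
  case True then show ?thesis unfolding P_def by (simp add: span_neg2 insert_commute)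
 next
  case False
  have "ind [b, a]" by (rule ind_sub[OF i]) auto
  then have "ind [inverse s *s a, b]" using isc[of b a "inverse s"] False ind_sub[of "[b, inverse s *s a]" "[inverse s *s a, b]"] by auto
  from Z_rot[OF this] have "Z b (inverse s *s (- a)) = Z (inverse s *s a) b" by simp
  also have "... = Z a (inverse s *s b)"
   using shear_invariant[OF Z_sh Z_rot, of a "inverse s *s b" "inverse s"] isc[OF i, of "inverse s"] False by simp
  finally show ?thesis using False unfolding P_def by simp
 qed
 moreover have "P (m * s) a (m *s b) = P s a b" if "m ~= 0" for m s a b
 proof -
  have "inverse (m * s) * m = inverse s" if "s ~= 0" using \<open>m ~= 0\<close> by (simp add: field_simps)
  then show ?thesis using that unfolding P_def by (cases "s = 0") (simp_all only: span_scale2 vec.scale_scale mult_eq_0_iff if_True if_False simp_thms)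
 qed
 ultimately show ?thesis using P_pt(1) P_ex P_inj P_add by (intro exI[of _ P] allI impI conjI) (auto intro: ex_ex1I)
qed

end

section \<open>Alternating forms\<close>

locale scaled_spinor = pointed_spinor H d p r
 for H :: "'p geometry" and d :: "'p => 'p => ('k::field^5) set" and p r +
 fixes P :: "'k => 'k^5 => 'k^5 => 'p"
 assumes P: "ind [a, b] ==> (ALL s. over (vec.span {a, b}) (P s a b)) & (ALL x. over (vec.span {a, b}) x --> (EX! s. x = P s a b)) &
   (ALL s t. P s a (b + t *s a) = P s a b) & (ALL s. P s b (- a) = P s a b) & (ALL s m. m ~= 0 --> P (m * s) a (m *s b) = P s a b) &
   (ALL c s t. ind [a, b, c] --> lin (P s a b) (P t a c) (P (s + t) a (b + c)))"
begin

notation ssum (infixl "#+" 65)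

text \<open>Only meaningful for points over the span of \<open>a\<close> and \<open>b\<close>.\<close>

definition co :: "'p => 'k^5 => 'k^5 => 'k" where "co x a b = (THE s. x = P s a b)"

lemma P_over: "ind [a, b] ==> over (span {a, b}) (P s a b)" using P by blast

lemma co_P: "ind [a, b] ==> co (P s a b) a b = s" using P unfolding co_def by (intro the_equality) blast+

lemma P_co: "ind [a, b] ==> over (span {a, b}) x ==> P (co x a b) a b = x"
 using P co_P by metis

lemma co_inj: "ind [a, b] ==> over (span {a, b}) x ==> over (span {a, b}) y ==> co x a b = co y a b <-> x = y"
 using P_co by metis

lemma co_shift: "ind [a, b] ==> over (span {a, b}) x ==> co x a (b + t *s a) = co x a b"
 using co_P[of a "b + t *s a" "co x a b"] P_co[of a b x] P[of a b] by (simp add: ind2_iff span_shift)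

lemma co_scale: "ind [a, b] ==> over (span {a, b}) x ==> m ~= 0 ==> co x a (m *s b) = m * co x a b"
 using co_P[of a "m *s b" "m * co x a b"] P_co[of a b x] P[of a b] by (simp add: ind2_iff span_scale2)

lemma co_swap: assumes "ind [a, b]" "over (span {a, b}) x" shows "co x b a = - co x a b"
proof -
 have e: "span {b, - a} = span {a, b}" "span {b, a} = span {a, b}" using span_neg2[of b a] by (simp_all add: insert_commute)
 have j: "ind [b, - a]" "ind [b, a]" using assms(1) by (simp_all add: ind2_iff e)
 show ?thesis using co_P[OF j(1), of "co x a b"] P_co[OF assms] P[OF assms(1)] co_scale[OF j(1), of x "-1"] assms(2) e by auto
qed

lemma co_add:
 assumes i: "ind [a, b, c]" and x: "over (span {a, b}) x" "over (span {a, c}) y" "over (span {a, b + c}) z" and k: "k:lines H" "x:k" "y:k" "z:k"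
 shows "co z a (b + c) = co x a b + co y a c"
proof -
 have j: "ind [a, b]" "ind [a, c]" by (rule ind_sub[OF i], auto)+
 have jz: "ind [a, b + c]" using over_gr[OF x(3)] by (simp add: ind2_iff)
 note pn = star_pen[OF i]
 obtain m where m: "m:lines H" "x:m" "y:m" "P (co x a b + co y a c) a (b + c):m"
  using P[OF j(1)] i P_co[OF j(1) x(1)] P_co[OF j(2) x(2)] unfolding lin_def by metis
 show ?thesis using over_pencil(3)[OF pn x(1,2) k(1-4) _ x(3) P_over[OF jz]] m(4) co_P[OF jz] line_eq[OF m(1) k(1) m(2) k(2) m(3) k(3) over_ne[OF x(1,2) penD(4)[OF pn]]] by simp
qed

definition supp :: "'p => ('k^5) set" where
 "supp x = (if x = p then {0} else if col p x then d p x else fs p x)"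

text \<open>If \<open>x\<close> is collinear with \<open>p\<close>, then \<open>F\<close> is meant to be the support of \<open>x\<close> itself.\<close>

definition nb :: "'p => ('k^5) set => 'p" where
 "nb x F = (if col p x then x else THE s. over F s & col s x)"

definition form :: "'p => 'k^5 => 'k^5 => 'k" where
 "form x a b = (if ind [a, b] then co (nb x (span {a, b})) a b else 0)"

lemma supp_gr: "x:points H ==> x = p & supp x = {0} | col p x & x ~= p & supp x = d p x & gr 2 (supp x) | ~ col p x & supp x = fs p x & gr 4 (supp x)"
 unfolding supp_def using d_gr[OF p] fs(1)[OF p] by auto

lemma far_supp: "x:points H ==> ~ col p x ==> supp x = fs p x" "x:points H ==> ~ col p x ==> gr 4 (supp x)"
 using supp_gr[of x] col_refl[of p] by metis+

lemma supp_subspace: "x:points H ==> subspace (supp x)"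
 using supp_gr[of x] grD(1) subspace_single_0 by auto

lemma nb: assumes x: "x:points H" and F: "gr 2 F" "F <= supp x"
 shows "over F (nb x F)" "col (nb x F) x"
proof -
 have "over F (nb x F) & col (nb x F) x"
 proof (cases "col p x")
  case True
  have "x ~= p"
  proof
   assume "x = p"
   then have "dim F = 0" using F(2) unfolding supp_def by simp
   then show False using grD(2)[OF F(1)] by linarith
  qed
  then show ?thesis using F gr_eqI[OF F(1) d_gr[OF p True]] True by (simp add: supp_def nb_def over_def)
 next
  case False
  have xp: "supp x = fs p x" using False unfolding supp_def by auto
  obtain s where s: "col p s" "s ~= p" "d p s = F" "col s x" using fs(2)[OF p x False F(1)] F(2) xp by auto
  have "EX! s. over F s & col s x"
  proof (rule ex1I[of _ s])
   show "t = s" if "over F t & col t x" for t using dir_unique[OF p, of t s x] that s False unfolding over_def by simp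
  qed (use s in \<open>simp add: over_def\<close>)
  from theI'[OF this] show ?thesis unfolding nb_def using False by simp
 qed
 then show "over F (nb x F)" "col (nb x F) x" by simp_all
qed

lemma nb_eq: "x:points H ==> ~ col p x ==> over F s ==> col s x ==> nb x F = s & F <= supp x"
proof -
 assume h: "x:points H" "~ col p x" "over F s" "col s x"
 have s: "col p s" "s ~= p" "d p s = F" using h(3) unfolding over_def by simp_all
 have F: "F <= supp x" using fs(3)[OF p h(1,2) s(1) h(4)] s(3) h(2) unfolding supp_def by auto
 note n = nb[OF h(1) over_gr[OF h(3)] F]
 show ?thesis using dir_unique[OF p _ _ s(1,2), of "nb x F" x] n s(3) h(2,4) F unfolding over_def by simp
qed

text \<open>Additivity is the essential point. The neighbours of a far \<open>x\<close> over
  \<open>span {a, b}\<close> and \<open>span {a, c}\<close> lie on a line of neighbours of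
  \<open>x\<close>. The point of this line over \<open>span {a, b + c}\<close> is the neighbour
  there, and \<open>co_add\<close> adds the coordinates.\<close>

lemma form_alt:
 assumes x: "x:points H" shows "alt_on (supp x) (form x)"
proof -
 note S = supp_subspace[OF x]
 have ov: "over (span {a, b}) (nb x (span {a, b}))" "col (nb x (span {a, b})) x" if "ind [a, b]" "a:supp x" "b:supp x" for a b
  using nb[OF x ind2[OF that(1)] span_minimal] that S by simp_all
 have lin_form: "form x a (m *s b + t *s a) = m * form x a b" if h: "a:supp x" "b:supp x" for a b m t
 proof (cases "m = 0")
  case True
  have "~ ind [a, t *s a]"
  proof
   assume "ind [a, t *s a]"
   then have "ind [t *s a, a]" by (rule ind_sub) auto
   then show False by (simp add: ind_Cons span_base span_scale)
  qed
  then show ?thesis using True by (simp add: form_def)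
 next
  case False
  have e: "span {a, m *s b + t *s a} = span {a, b}" by (simp add: span_shift span_scale2[OF False])
  then have i: "ind [a, m *s b + t *s a] <-> ind [a, b]" by (simp add: ind2_iff)
  show ?thesis
  proof (cases "ind [a, b]")
   case True
   note o = ov(1)[OF True h]
   show ?thesis using co_shift[of a "m *s b"] co_scale[OF True o False] o span_scale2[OF False, of a b] by (simp add: ind2_iff form_def e)
  qed (simp add: form_def i)
 qed
 have swap: "form x b a = - form x a b" if "a:supp x" "b:supp x" for a b using co_swap[OF _ ov(1)[OF _ that]]
  by (simp add: insert_commute ind2_iff form_def)
 have diag: "form x a a = 0" for a by (simp add: form_def ind_def)
 have add: "form x a (b + c) = form x a b + form x a c" if h: "a:supp x" "b:supp x" "c:supp x" for a b c
 proof (cases "ind [a, b]")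
  case False
  consider "a = 0" | t where "b = t *s a" using gr_span2I False ind2_iff by (fastforce simp: span_singleton)
  then show ?thesis
  proof cases
   case 1
   have "~ ind [a, v]" for v using 1 ind_sub[of "[a, v]" "[a]"] by (auto simp: ind_def)
   then show ?thesis by (simp add: form_def)
  next
   case 2
   then show ?thesis using lin_form[OF h(1,3), of 1 t] lin_form[OF h(1,3), of 0 t] by (simp add: add.commute)
  qed
 next
  case True
  show ?thesis
  proof (cases "c:span {a, b}")
   case c: True
   obtain s t where "c = s *s a + t *s b" using span2D[OF refl c] by (elim exE)
   then have e: "c = t *s b + s *s a" "b + c = (1 + t) *s b + s *s a" by (simp_all add: algebra_simps)
   have "form x a (b + c) = (1 + t) * form x a b" unfolding e(2) by (rule lin_form[OF h(1,2)])
   then show ?thesis unfolding e(1) using lin_form[OF h(1,2)] by (simp add: distrib_right)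
  next
   case False
   then have "ind [c, a, b]" using True by (simp add: ind_Cons)
   then have i: "ind [a, b, c]" "ind [a, c]" "ind [a, c, b]" by (rule ind_sub, auto)+
   have "ind [a, b + c, b]"
   proof (rule ind_exchange[OF i(1)])
    have m: "a:span {a, b + c, b}" "b:span {a, b + c, b}" "b + c:span {a, b + c, b}" by (simp_all add: span_base)
    show "set [a, b, c] <= span (set [a, b + c, b])" using m span_diff[OF m(3,2)] by simp
   qed simp
   then have k: "ind [a, b + c]" by (rule ind_sub) auto

   have far: "~ col p x"
   proof
    assume "col p x"
    then have "dim (supp x) <= 2" using supp_gr[OF x] grD(2)[of 2 "supp x"] by force
    moreover have "span {a, b, c} <= supp x" by (rule span_minimal) (use h S in auto)
    then have "3 <= dim (supp x)" by (rule gr_dim_ge[OF ind3[OF i(1)]])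
    ultimately show False by linarith
   qed
   note o = ov[OF True h(1,2)] and o' = ov[OF i(2) h(1,3)]
   note pn = star_pen[OF i(1)]
   obtain l where l: "l:lines H" "nb x (span {a, b}):l" "nb x (span {a, c}):l" using over_line[OF pn o(1) o'(1)] by blast
   have "ind [a, b, - c]"
   proof -
    have "ind [- c, a, b]" using \<open>ind [c, a, b]\<close> span_neg[of "- c" "{a, b}"] by (auto simp: ind_Cons)
    then show ?thesis by (rule ind_sub) auto
   qed
   then have pn': "pen (span {a, b}) (span {a, c}) (span {a, b + c})" using star_pen[of a b "- c"] span_neg2[of a c] by simp
   obtain z where z: "z:l" "over (span {a, b + c}) z" using over_pencil(1)[OF pn' o(1) o'(1) l] by blast
   show ?thesis using nb_eq[OF x far z(2) col_sym] True i(2) k co_add[OF i(1) o(1) o'(1) z(2) l z(1)] col_all[OF l over_ne[OF o(1) o'(1) penD(4)[OF pn]] col_sym[OF o(2)] col_sym[OF o'(2)] z(1)] form_def by metis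
  qed
 qed
 have scale: "form x a (t *s b) = t * form x a b" if "a:supp x" "b:supp x" for a b t using lin_form[OF that, of t 0] by simp
 show ?thesis unfolding alt_on_def using diag swap add scale by blast
qed

lemma form_nb:
 assumes "x:points H" "y:points H" "ind [a, b]" "a:supp x" "b:supp x" "a:supp y" "b:supp y"
 shows "form x a b = form y a b <-> nb x (span {a, b}) = nb y (span {a, b})"
  using span_minimal[of "{a,b}"] supp_subspace assms co_inj[OF assms(3)] nb(1)[OF assms(1) ind2[OF assms(3)]] nb(1)[OF assms(2) ind2[OF assms(3)]]
  by (simp add: form_def)

definition rad :: "'p => 'p => ('k^5) set" where
 "rad x y = {f:supp x Int supp y. ALL e:supp x Int supp y. form x f e = form y f e}"

lemma rad_commute: "rad x y = rad y x" unfolding rad_def by (auto simp: Int_commute)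

lemma rad_subspace:
 assumes "x:points H" "y:points H" shows "subspace (rad x y)"
proof -
 have ax: "form x (f + h) e = form x f e + form x h e" "form x (t *s f) e = t * form x f e" "form x 0 e = 0"
  if "x:points H" "f:supp x" "h:supp x" "e:supp x" for x f h e t
 proof -
  note S = supp_subspace[OF that(1)]
  have A: "form x u e = - form x e u" "form x e (t *s u) = t * form x e u" "v:supp x ==> form x e (u + v) = form x e u + form x e v"
   if "u:supp x" for u v t using form_alt[OF \<open>x : points H\<close>] that \<open>e : supp x\<close> unfolding alt_on_def by blast+
  show "form x (f + h) e = form x f e + form x h e"
   using A(1)[OF subspace_add[OF S that(2,3)]] A(1)[OF that(2)] A(1)[OF that(3)] A(3)[OF that(2,3)] by simp
  show 1: "form x (t *s f) e = t * form x f e" for t using A(1)[OF subspace_scale[OF S that(2)]] A(1,2)[OF that(2)] by simp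
  show "form x 0 e = 0" using 1[of 0] by simp
 qed
 note S = supp_subspace[OF assms(1)] supp_subspace[OF assms(2)]
 show ?thesis unfolding rad_def
  by (rule subspaceI) (auto simp: ax assms subspace_0[OF S(1)] subspace_0[OF S(2)] subspace_add[OF S(1)] subspace_add[OF S(2)] subspace_scale[OF S(1)] subspace_scale[OF S(2)])
qed

lemma rad_nb:
 assumes x: "x:points H" "y:points H" and F: "F <= supp x Int supp y" "subspace F"
 shows "F <= rad x y <-> (ALL K. gr 2 K --> K <= supp x Int supp y --> K Int F ~= {0} --> nb x K = nb y K)"
proof
 assume R: "F <= rad x y"
 show "ALL K. gr 2 K --> K <= supp x Int supp y --> K Int F ~= {0} --> nb x K = nb y K"
 proof (intro allI impI)
  fix K assume K: "gr 2 K" "K <= supp x Int supp y" "K Int F ~= {0}"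
  obtain a where a: "a ~= 0" "a:K" "a:F" using meetE[OF K(3) grD(1)[OF K(1)] F(2)] by (elim exE conjE)
  obtain b where b: "b:K" "b ~: span {a}" using a(1) gr_ex[OF _ K(1)] by (force simp: gr_def)
  have i: "ind [a, b]" using K(1) unfolding gr2_eq_span[OF K(1) a(2) b(1) a(1) b(2)] by (simp add: ind2_iff)
  show "nb x K = nb y K" using R a(3) b(1) K(2) form_nb[OF x i] by (auto simp: rad_def gr2_eq_span[OF K(1) a(2) b(1) a(1) b(2)])
 qed
next
 assume h: "ALL K. gr 2 K --> K <= supp x Int supp y --> K Int F ~= {0} --> nb x K = nb y K"
 note S = subspace_inter[OF supp_subspace[OF x(1)] supp_subspace[OF x(2)]]
 have "form x a b = form y a b" if "a:F" "b:supp x Int supp y" for a b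
 proof (cases "ind [a, b]")
  case True
  have "a ~= 0" using ind_sub[OF True, of "[a]"] by (auto simp: ind_def)
  then have "span {a, b} Int F ~= {0}" by (rule meetI[OF _ span_base that(1)]) simp
  moreover have "span {a, b} <= supp x Int supp y" by (rule span_minimal) (use that F S in auto)
  ultimately show ?thesis using h ind2[OF True] form_nb[OF x True] that F by blast
 qed (simp add: form_def)
 then show "F <= rad x y" unfolding rad_def using F by blast
qed

text \<open>The neighbours of \<open>x\<close> and \<open>y\<close> over \<open>F\<close> coincide
  in a point \<open>s\<close>. Every common neighbour of \<open>p\<close>, \<open>s\<close> and
  \<open>x\<close> has a direction meeting \<open>F\<close>, so it is a neighbour of
  \<open>y\<close> too, and \<open>trace_dir\<close> applies at \<open>s\<close>.\<close>

lemma far_dir_eq: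
 assumes x: "x:points H" "y:points H" "~ col p x" "~ col p y" "supp x = supp y" and F: "gr 2 F" "F <= rad x y"
 shows "EX s. over F s & col s x & col s y & d s x = d s y"
proof -
 have FS: "F <= supp x Int supp y" using F(2) unfolding rad_def by blast
 note R = rad_nb[OF x(1,2) FS grD(1)[OF F(1)]]
 obtain a where "a ~= 0" "a:F" using gr2_nz[OF F(1)] by (elim exE conjE)
 then have FF: "F Int F ~= {0}" by blast
 have e: "nb x F = nb y F" using R F FS FF by blast
 let ?s = "nb x F"
 have s: "over F ?s" "col ?s x" "col ?s y" using nb[OF x(1) F(1)] nb[OF x(2) F(1)] FS e by simp_all
 have so: "col p ?s" "?s ~= p" "d p ?s = F" using s(1) unfolding over_def by simp_all
 have "col z y" if z: "col p z" "col ?s z" "col z x" for z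
 proof -
  have zp: "z ~= p" using z(3) x(3) by blast
  have o: "over (d p z) z" unfolding over_def using z zp by simp
  note n = nb_eq[OF x(1,3) o z(3)]
  show ?thesis using d_col[OF p z(1) zp so(1,2)] so(3) col_sym[OF z(2)] R F(2) over_gr[OF o] n x(5) nb(2)[OF x(2) over_gr[OF o]] by auto
 qed
 from trace_dir[OF p so(1,2) s(2) x(3) s(3) x(4) this] show ?thesis using s by blast
qed

text \<open>A line joining two such points contains a neighbour of \<open>p\<close> by
  \<open>fs_eq_meets\<close>, and the direction of that neighbour lies in the radical. Conversely a
  2-space in the radical gives, by \<open>far_dir_eq\<close>, a point that sees \<open>x\<close> and
  \<open>y\<close> in the same direction.\<close>

lemma col_far_same:
 assumes x: "x:points H" "y:points H" "~ col p x" "~ col p y" "supp x = supp y"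
 shows "col x y <-> 2 <= dim (rad x y)"
proof
 assume c: "col x y"
 show "2 <= dim (rad x y)"
 proof (cases "x = y")
  case True
  then show ?thesis using far_supp(2)[OF x(1,3)] by (simp add: gr_def rad_def)
 next
  case False
  have fe: "fs p x = fs p y" using far_supp(1)[OF x(1,3)] far_supp(1)[OF x(2,4)] x(5) by simp
  obtain k where k: "k:lines H" "x:k" "y:k" using ex_line[OF c False] by blast
  obtain s where s: "s:k" "col p s" using fs_eq_meets[OF p k False x(3,4) fe] by blast
  have sp: "s ~= p" "s ~= x" using s k x(3) col_line by blast+
  let ?F = "d p s"
  have o: "over ?F s" unfolding over_def using s sp by simp
  note n = nb_eq[OF x(1,3) o col_line[OF k(1) s(1) k(2)]]
  have "?F <= rad x y"
  proof (subst rad_nb[OF x(1,2) _ grD(1)[OF over_gr[OF o]]])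
   show "ALL K. gr 2 K --> K <= supp x Int supp y --> K Int ?F ~= {0} --> nb x K = nb y K"
   proof (intro allI impI)
    fix K assume K: "gr 2 K" "K <= supp x Int supp y" "K Int ?F ~= {0}"
    have z: "over K (nb x K)" "col (nb x K) x" using nb[OF x(1) K(1)] K(2) by simp_all
    show "nb x K = nb y K" using nb_eq[OF x(2,4) z(1)] col_all[OF k(1) s(1) k(2) sp(2) over_col[OF z(1) o K(3)] z(2) k(3)] by simp
   qed
  qed (use n x(5) in simp)
  then show ?thesis by (rule gr_dim_ge[OF over_gr[OF o]])
 qed
next
 assume "2 <= dim (rad x y)"
 moreover have "gr (dim (rad x y)) (rad x y)" using rad_subspace[OF x(1,2)] by (simp add: gr_def)
 ultimately obtain F where F: "gr 2 F" "F <= rad x y" using gr_sub[of _ "rad x y" 2 "{0}"] subspace_0[OF rad_subspace[OF x(1,2)]] by auto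
 obtain s where s: "over F s" "col s x" "col s y" "d s x = d s y" using far_dir_eq[OF x F] by blast
 show "col x y" using s(1) x(3,4) col_point[OF _ p] d_eq[OF _ s(2) _ s(3) _ s(4)] col_line by (auto simp: over_def)
qed

text \<open>Collinear points with different supports are joined by a line without neighbours of
  \<open>p\<close>, and \<open>far_same\<close> makes their neighbours agree on the common support.
  Conversely a triangle in the common support gives common neighbours \<open>?a\<close>,
  \<open>?b\<close>, \<open>?c\<close>. At \<open>?a\<close> the directions of \<open>?b\<close> and
  \<open>?c\<close> are meeting transversals, so \<open>transversals_meet\<close> makes the
  directions of \<open>x\<close> and \<open>y\<close> meet.\<close>

lemma col_far_diff:
 assumes x: "x:points H" "y:points H" "~ col p x" "~ col p y" "supp x ~= supp y"
 shows "col x y <-> supp x Int supp y <= rad x y"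
proof -
 have sf: "supp x = fs p x" "supp y = fs p y" "gr 4 (supp x)" "gr 4 (supp y)" using far_supp[OF x(1,3)] far_supp[OF x(2,4)] by simp_all
 let ?W = "supp x Int supp y"
 obtain W where W: "gr 3 W" "W <= ?W" using gr_sub[OF gr_inter[OF sf(3,4) refl], of 3 "{0}"] subspace_0[OF grD(1)[OF sf(3)]] subspace_0[OF grD(1)[OF sf(4)]] gr_inter_ge[OF sf(3,4) subset_UNIV subset_UNIV dim5(2)] by auto
 note R = rad_nb[OF x(1,2) subset_refl subspace_inter[OF grD(1)[OF sf(3)] grD(1)[OF sf(4)]]]
 show ?thesis
 proof
  assume c: "col x y"
  obtain k where k: "k:lines H" "x:k" "y:k" using x(5) ex_line[OF c] by auto
  have nk: "~ (EX s:k. col p s)" using fs_line[OF p k _ x(3,4)] x(5) sf by blast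
  have "nb x K = nb y K" if K: "gr 2 K" "K <= ?W" for K
  proof -
   have z: "over K (nb x K)" "col (nb x K) x" using nb[OF x(1) K(1)] K(2) by simp_all
   show ?thesis using far_same[OF p k nk _ z(2)] z(1) K(2) sf(2) nb_eq[OF x(2,4) z(1)] by (simp add: over_def)
  qed
  then show "?W <= rad x y" using R by blast
 next
  assume "?W <= rad x y"
  then have ag: "nb x K = nb y K" if "gr 2 K" "K <= ?W" for K using R that gr2_nz[OF that(1)] by blast
  obtain f where f: "f ~= 0" "f:W" using dim_pos[of W] W(1) by (auto simp: gr_def)
  obtain A B C where t: "gr 2 A" "gr 2 B" "gr 2 C" "A ~= B" "A ~= C" "B ~= C" "A <= W" "B <= W" "C <= W" "A Int B Int C = {0}"
   using triangle[OF W(1) f(2,1)] by (elim exE conjE)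
  have sb: "A <= ?W" "B <= ?W" "C <= ?W" using t(7-9) W(2) by blast+
  let ?a = "nb x A" and ?b = "nb x B" and ?c = "nb x C"
  have o: "over A ?a" "over B ?b" "over C ?c" "col ?a x" "col ?b x" "col ?c x" "col ?a y" "col ?b y" "col ?c y"
   using nb[OF x(1) t(1)] nb[OF x(1) t(2)] nb[OF x(1) t(3)] nb(2)[OF x(2) t(1)] nb(2)[OF x(2) t(2)] nb(2)[OF x(2) t(3)]
    ag[OF t(1) sb(1)] ag[OF t(2) sb(2)] ag[OF t(3) sb(3)] sb by simp_all
  have m: "A Int B ~= {0}" "A Int C ~= {0}" "B Int C ~= {0}"
   by (rule gr2_meet_in_3[OF t(1,2,7,8) W(1)], rule gr2_meet_in_3[OF t(1,3,7,9) W(1)], rule gr2_meet_in_3[OF t(2,3,8,9) W(1)])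
  have op: "col p ?a" "?a ~= p" "col p ?b" "col p ?c" using o unfolding over_def by simp_all
  have a: "?a:points H" "col ?a p" "p ~= ?a" "x ~= ?a" "y ~= ?a" using col_point[OF op(1) p] col_sym[OF op(1)] op(1,2) x(3,4) by auto
  have bc: "col ?a ?b" "?b ~= ?a" "col ?a ?c" "?c ~= ?a" "col ?b ?c"
   using over_col[OF o(1,2) m(1)] over_col[OF o(1,3) m(2)] over_col[OF o(2,3) m(3)] over_ne[OF o(1,2) t(4)] over_ne[OF o(1,3) t(5)] by auto
  have nK: "d ?a ?b ~= d ?a ?c"
  proof
   assume "d ?a ?b = d ?a ?c"
   then obtain l where l: "l:lines H" "?a:l" "?b:l" "?c:l" using d_eq[OF a(1) bc(1-4)] by blast
   have e: "d p ?a = A" "d p ?b = B" "d p ?c = C" "?b ~= p" using o(1-3) unfolding over_def by simp_all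
   show False using d_pencil[OF p op(1,2,3) e(4) bc(1) _ l] t(4) e t(10) m(1) Int_absorb2 by auto
  qed
  note dc = d_col[OF a(1)]
  have "d ?a x Int d ?a y ~= {0}"
  proof (rule transversals_meet[of "d ?a ?b" "d ?a ?c" "d ?a p"])
   show "gr 2 (d ?a ?b)" "gr 2 (d ?a ?c)" "subspace (d ?a p)" "subspace (d ?a x)" "subspace (d ?a y)"
    using d_gr[OF a(1)] grD(1) bc a o(4,7) by blast+
   show "d ?a ?b Int d ?a ?c ~= {0}" "d ?a p Int d ?a x = {0}" "d ?a p Int d ?a y = {0}"
    using dc[OF bc(1-4)] dc[OF a(2,3) o(4) a(4)] dc[OF a(2,3) o(7) a(5)] bc(5) x(3,4) by simp_all
   show "d ?a ?b Int d ?a p ~= {0}" "d ?a ?b Int d ?a x ~= {0}" "d ?a ?b Int d ?a y ~= {0}"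
    "d ?a ?c Int d ?a p ~= {0}" "d ?a ?c Int d ?a x ~= {0}" "d ?a ?c Int d ?a y ~= {0}"
    using dc[OF bc(1,2) a(2,3)] dc[OF bc(1,2) o(4) a(4)] dc[OF bc(1,2) o(7) a(5)] dc[OF bc(3,4) a(2,3)] dc[OF bc(3,4) o(4) a(4)] dc[OF bc(3,4) o(7) a(5)]
     col_sym[OF op(3)] col_sym[OF op(4)] o(5,6,8,9) by simp_all
  qed (rule nK)
  then show "col x y" using dc[OF o(4) a(4) o(7) a(5)] by simp
 qed
qed

end

section \<open>Collinearity and reconstruction from the forms\<close>

context scaled_spinor
begin

lemma form_dependent: "b:span {a} ==> form x b a = 0"
 by (simp add: form_def ind_Cons)

lemma rad_line:
 assumes "supp x Int supp y = A" "gr 1 A" shows "rad x y = A"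
proof -
 have "form z f e = 0" if "f:A" "e:A" for f e z
 proof (cases "e = 0")
  case True
  show ?thesis using ind_sub[of "[f, 0]" "[0]"] True by (auto simp: ind_def form_def)
 next
  case False
  have "A = span {e}" by (rule dim_le_1_span[OF that(2) False]) (use assms(2) in \<open>simp_all add: gr_def\<close>)
  then show ?thesis using form_dependent that(1) by blast
 qed
 then show ?thesis unfolding rad_def assms(1) by auto
qed

text \<open>Apart from the trivial cases with \<open>p\<close>, two near points are compared through
  their 2-spaces. For a near \<open>x\<close> and a far \<open>y\<close> the bound says that the
  radical is all of \<open>supp x\<close>, that is, that \<open>x\<close> is the neighbour of
  \<open>y\<close> over its direction.\<close>

lemma col_rad_near:
 assumes x: "x:points H" "y:points H" "col p x"
 shows "col x y <-> dim (supp x #+ supp y) <= dim (rad x y) + 2"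
proof -
 note S = supp_subspace[OF x(1)] supp_subspace[OF x(2)]
 note R = rad_subspace[OF x(1,2)]
 have z: "{0} #+ A = A" "A #+ {0} = A" if "subspace A" for A
  using that ssum_least[of "{0}" A A] ssum_least[of A A "{0}"] ssum_ub1[of A "{0}"] ssum_ub2[of A "{0}"] subspace_0[OF that] by auto
 have Rle: "dim (rad x y) <= dim (supp x Int supp y)" by (rule dim_subset) (auto simp: rad_def)
 show ?thesis
 proof (cases "x = p | y = p")
  case True
  then show ?thesis
  proof
   assume e: "x = p"
   then have "supp x = {0}" unfolding supp_def by simp
   moreover have "dim (rad x y) = 0"
   proof -
    have "dim (supp x Int supp y) <= dim {0}" by (rule dim_subset) (use calculation in blast)
    moreover have "dim {0 :: 'k^5} = 0" by simp
    ultimately show ?thesis using Rle by linarith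
   qed
   moreover have "dim (supp y) <= 2 <-> col p y" using supp_gr[OF x(2)] by (elim disjE conjE) (simp_all add: gr_def)
   ultimately show ?thesis using z(1)[OF S(2)] e by (simp only: add_0_left)
  next
   assume e: "y = p"
   then have "supp y = {0}" unfolding supp_def by simp
   moreover have "dim (supp x) <= 2" using supp_gr[OF x(1)] x(3) by (elim disjE conjE) (simp_all add: gr_def)
   ultimately show ?thesis using z(2)[OF S(1)] e col_sym[OF x(3)] by simp
  qed
 next
  case False
  let ?A = "supp x"
  have A: "gr 2 ?A" "?A = d p x" "x ~= p" using supp_gr[OF x(1)] False x(3) by auto
  have ox: "over ?A x" unfolding over_def using A x(3) by simp
  show ?thesis
  proof (cases "col p y")
   case True
   let ?B = "supp y"
   have B: "gr 2 ?B" "?B = d p y" "y ~= p" using supp_gr[OF x(2)] False True by auto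
   have c: "col x y <-> ?A Int ?B ~= {0}" using d_col[OF p x(3) A(3) True B(3)] A(2) B(2) by simp
   consider "?A = ?B" | "?A ~= ?B" "?A Int ?B ~= {0}" | "?A Int ?B = {0}" by blast
   then show ?thesis
   proof cases
    case 1
    show ?thesis using ssum_least[of ?A ?A ?A] ssum_ub1[of ?A ?A] c 1 A(1) gr2_nz[OF A(1)] by (auto simp: gr_def)
   next
    case 2
    note ab = gr2_adj[OF A(1) B(1) 2]
    show ?thesis using c 2 rad_line[OF refl ab(1)] ab by (simp add: gr_def)
   next
    case 3
    have "dim (?A #+ ?B) = 4" using dim_ssum_gr[OF A(1) B(1)] 3 by simp
    moreover have "dim (?A Int ?B) = 0" unfolding 3 by simp
    ultimately show ?thesis using c 3 Rle by linarith
   qed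
  next
   case far: False
   let ?Y = "supp y"
   note Y = far_supp(2)[OF x(2) far]
   show ?thesis
   proof (cases "?A <= ?Y")
    case True
    have s: "?A #+ ?Y = ?Y" using ssum_least[of ?A ?Y ?Y] ssum_ub2[of ?Y ?A] S True by blast
    obtain a b where ab: "?A = span {a, b}" "dim {a, b} = 2" using obtain_vectors2[OF A(1)] by blast

    have nbx: "nb x ?A = x" unfolding nb_def using x(3) by simp
    have RA: "rad x y <= ?A" unfolding rad_def by blast
    have i2: "?A Int ?Y = ?A" using True by blast
    have "2 <= dim (rad x y) <-> ?A <= rad x y"
     using gr_dim_ge[OF A(1), of "rad x y"] gr_eqI[OF _ A(1) RA] gr_dim_le[OF RA A(1)] R
     by (metis antisym gr_def order_refl)
    also have "... <-> nb y ?A = x"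
    proof -
     have "(ALL K. gr 2 K --> K <= ?A Int ?Y --> K Int ?A ~= {0} --> nb x K = nb y K) <-> nb x ?A = nb y ?A"
      unfolding i2 using gr_eqI[OF _ A(1)] A(1) gr2_nz[OF A(1)] by blast
     then show ?thesis using rad_nb[OF x(1,2) _ S(1)] i2 nbx by auto
    qed
    also have "... <-> col x y" using nb_eq[OF x(2) far ox] nb(2)[OF x(2) A(1) True] by auto
    finally show ?thesis using s Y by (simp add: gr_def)
   next
    case nA: False
    have n: "~ col x y" using nb_eq[OF x(2) far ox] nA by blast
    have "dim (?A Int ?Y) <= 2" by (rule gr_dim_le[OF Int_lower1 A(1)])
    then have le: "dim (?A Int ?Y) <= 1" using gr_eqI[OF gr_inter[OF A(1) Y] A(1)] nA by auto
    show ?thesis using dim_ssum_gr[OF A(1) Y] n le Rle by simp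
   qed
  qed
 qed
qed

text \<open>By \<open>mod_sp_dim\<close> with dimension 5, the inequality says that the subspaces
  attached to \<open>x\<close> and \<open>y\<close> meet in dimension at least 3, which is
  \<open>hcol\<close>.\<close>

theorem col_iff_rad:
 assumes x: "x:points H" "y:points H"
 shows "col x y <-> dim (supp x #+ supp y) <= dim (rad x y) + 2"
proof -
 consider "col p x" | "col p y" | "~ col p x" "~ col p y" by blast
 then show ?thesis
 proof cases
  case 1 then show ?thesis by (rule col_rad_near[OF x])
 next
  case 2
  show ?thesis using col_commute[of x y] ssum_commute[of "supp y"] rad_commute[of y] col_rad_near[OF x(2,1) 2] by simp
 next
  case 3
  note S = supp_subspace[OF x(1)] supp_subspace[OF x(2)]
  note g = far_supp(2)[OF x(1) 3(1)] far_supp(2)[OF x(2) 3(2)]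
  show ?thesis
  proof (cases "supp x = supp y")
   case True
   show ?thesis using ssum_least[of "supp x" "supp x" "supp x"] ssum_ub1[of "supp x" "supp x"] col_far_same[OF x 3 True] True g by (simp add: gr_def)
  next
   case False
   let ?W = "supp x Int supp y"
   have RW: "rad x y <= ?W" unfolding rad_def by blast
   have "dim ?W <= 4" by (rule gr_dim_le[OF Int_lower1 g(1)])
   moreover have "dim ?W ~= 4" using gr_inter[OF g] gr_eqI[OF _ g(1)] gr_eqI[OF _ g(2)] False by blast
   ultimately have W: "dim ?W = 3" using gr_inter_ge[OF g subset_UNIV subset_UNIV dim5(2)] by simp
   show ?thesis using dim_ssum_gr[OF g] col_far_diff[OF x 3 False] subspace_eqI[OF rad_subspace[OF x] subspace_inter[OF S] RW] dim_subset[of ?W "rad x y"] W by auto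
  qed
 qed
qed

text \<open>For far points choose disjoint 2-spaces \<open>F\<close> and \<open>K\<close> of the
  support. By \<open>far_dir_eq\<close> the points \<open>x\<close> and \<open>y\<close> lie on a
  line through a point \<open>r\<close> over \<open>F\<close>. If they were different, their common
  neighbour over \<open>K\<close> would be collinear with \<open>r\<close>, but \<open>K\<close> and
  \<open>F\<close> are disjoint.\<close>

theorem data_inj:
 assumes x: "x:points H" "y:points H" and s: "supp x = supp y" and f: "!!a b. a:supp x ==> b:supp x ==> form x a b = form y a b"
 shows "x = y"
proof -
 have dims: "dim (supp x) = dim (supp y)" using s by simp
 have R: "rad x y = supp x" unfolding rad_def using s f by auto
 have nbe: "nb x K = nb y K" if K: "gr 2 K" "K <= supp x" for K using rad_nb[OF x _ supp_subspace[OF x(1)]] R s gr2_nz[OF K(1)] Int_absorb2[OF K(2)] K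
  by auto
 have t: "(z = p <-> dim (supp z) = 0) & (col p z <-> dim (supp z) ~= 4)" if "z:points H" for z
  using supp_gr[OF that] by (elim disjE conjE) (simp_all add: gr_def del: dim_eq_0, metis col_refl)
 consider "x = p" "y = p" | "col p x" "col p y" "gr 2 (supp x)" | "~ col p x" "~ col p y"
  using t[OF x(1)] t[OF x(2)] dims supp_gr[OF x(1)] by metis
 then show ?thesis
 proof cases
  case 2
  then show ?thesis using nbe[OF 2(3)] unfolding nb_def by simp
 next
  case 3
  note g = far_supp(2)[OF x(1) 3(1)]
  obtain F where F: "gr 2 F" "F <= supp x" using gr_sub[OF g, of 2 "{0}"] subspace_0[OF grD(1)[OF g]] by auto
  obtain K where K: "gr 2 K" "K <= supp x" "K Int F = {0}" using disjoint_exists[OF F g] by blast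
  obtain r where r: "over F r" "col r x" "col r y" "d r x = d r y" using far_dir_eq[OF x 3 s F(1)] F(2) R by blast
  have rp: "r:points H" "x ~= r" "y ~= r" using r(1) 3 col_point[OF _ p] unfolding over_def by auto
  obtain l where l: "l:lines H" "r:l" "x:l" "y:l" using d_eq[OF rp(1) r(2) rp(2) r(3) rp(3) r(4)] by blast
  show ?thesis
  proof (rule ccontr)
   assume n: "x ~= y"
   let ?z = "nb x K"
   have z: "over K ?z" "col ?z x" "col ?z y" using nb[OF x(1) K(1,2)] nb(2)[OF x(2) K(1)] nbe[OF K(1,2)] K(2) s by simp_all
   show False using d_col[OF p, of ?z r] z(1) r(1) K(3) col_all[OF l(1,3,4) n z(2,3) l(2)] by (simp add: over_def)
  qed
 qed simp
qed

lemma form_swap: "x:points H ==> a:supp x ==> b:supp x ==> form x b a = - form x a b & form x a a = 0"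
 using form_alt unfolding alt_on_def by blast

text \<open>\<open>x\<close> is moved along its line through its neighbour over
  \<open>span {c, e}\<close>, to the point collinear with \<open>P t a b\<close>. All neighbours
  whose 2-spaces meet \<open>span {c, e}\<close> are kept, so only the value on
  \<open>(a, b)\<close> changes.\<close>

lemma form_move:
 assumes x: "x:points H" "~ col p x" and i: "ind [a, b, c, e]" and s: "span {a, b, c, e} = supp x"
 shows "EX x':points H. ~ col p x' & supp x' = supp x & form x' a b = t & (ALL u:{c, e}. ALL v:supp x. form x' u v = form x u v & form x' v u = form x v u)"
proof -
 have j: "ind [a, b]" "ind [c, e]" by (rule ind_sub[OF i], auto)+
 let ?F = "span {c, e}" and ?K = "span {a, b}"
 have FS: "?F <= supp x" "?K <= supp x" unfolding s[symmetric] by (rule span_mono, simp)+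
 have "span (set [c, e]) Int span (set [a, b]) = span (set [c, e] Int set [a, b])"
   by (rule span_inter_card[of "set [a, b, c, e]"]) (use i dim_dist[of "[a, b, c, e]"] in \<open>auto simp: ind_def distinct_card\<close>)
 then have FK: "?F Int ?K = {0}" using dim_dist[of "[a, b, c, e]"] i by (simp add: ind_def)
 note n = nb[OF x(1) ind2[OF j(2)] FS(1)] nb[OF x(1) ind2[OF j(1)] FS(2)]
 let ?r = "nb x ?F" and ?w = "nb x ?K" and ?z = "P t a b"
 note oz = P_over[OF j(1), of t]
 have rp: "col p ?r" "?r ~= p" "d p ?r = ?F" using n(1) unfolding over_def by simp_all
 have zp: "col p ?z" "?z ~= p" "d p ?z = ?K" "col p ?w" "?w ~= p" "d p ?w = ?K" using oz n(3) unfolding over_def by simp_all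
 have r: "?r:points H" "col ?r p" using col_point[OF rp(1) p] col_sym[OF rp(1)] by simp_all
 have nz: "~ col ?r ?z" "~ col ?r ?w" using d_col[OF p rp(1,2) zp(1,2)] d_col[OF p rp(1,2) zp(4,5)] rp(3) zp FK by simp_all
 obtain l where l: "l:lines H" "p:l" "?z:l" "?w:l" using d_eq[OF p zp(1,2,4,5)] zp(3,6) by auto
 have e: "fs ?r ?z = fs ?r ?w" by (rule fs_line[OF r(1) l(1,3,4,2) nz r(2)])
 have xr: "x ~= ?r" using rp x(2) by metis
 obtain x' where x': "col ?r x'" "x' ~= ?r" "d ?r x' = d ?r x" "col x' ?z"
  using fs(3)[OF r(1) col_point[OF zp(4) p] nz(2) n(2) col_sym[OF n(4)]] e fs(2)[OF r(1) col_point[OF zp(1) p] nz(1) d_gr[OF r(1) n(2) xr]] by auto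
 obtain k where k: "k:lines H" "?r:k" "x':k" "x:k" using d_eq[OF r(1) x'(1,2) n(2) xr x'(3)] by blast
 have px: "x':points H" by (rule col_point[OF x'(1) r(1)])
 have far: "~ col p x'" using col_all[OF k(1,2,3) x'(2)[symmetric] rp(1) _ k(4)] x(2) by blast
 have sx: "supp x' = supp x" using fs_line[OF p k(1,3,4,2) far x(2) rp(1)] far_supp(1)[OF px far] far_supp(1)[OF x] by simp
 have t: "form x' a b = t" using nb_eq[OF px far oz col_sym[OF x'(4)]] j(1) co_P[OF j(1)] by (simp add: form_def)
 have F: "?F <= rad x' x"
 proof (subst rad_nb[OF px x(1)])
  show "ALL A. gr 2 A --> A <= supp x' Int supp x --> A Int ?F ~= {0} --> nb x' A = nb x A"
  proof (intro allI impI)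
   fix A assume A: "gr 2 A" "A <= supp x' Int supp x" "A Int ?F ~= {0}"
   have w: "over A (nb x A)" "col (nb x A) x" using nb[OF x(1) A(1)] A(2) by simp_all
   show "nb x' A = nb x A" using nb_eq[OF px far w(1)] col_all[OF k(1,2,4) xr[symmetric] over_col[OF w(1) n(1) A(3)] w(2) k(3)] by simp
  qed
 qed (use FS sx in simp_all)
 have "form x' u v = form x u v & form x' v u = form x v u" if "u:{c, e}" "v:supp x" for u v
 proof -
  have u: "u:?F" using that(1) by (auto simp: span_base)
  then have 1: "form x' u v = form x u v" using F that(2) sx unfolding rad_def by blast
  have us: "u:supp x" using u FS by blast
  show ?thesis using form_swap[OF px, of u v] form_swap[OF x(1) us that(2)] us that(2) sx 1 by simp
 qed
 then show ?thesis using px far sx t by blast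
qed

lemma alt_span:
 assumes g: "alt_on Y g" "alt_on Y h" and S: "S <= Y" "subspace Y" and e: "!!u v. u:S ==> v:S ==> g u v = h u v"
  and uv: "u:span S" "v:span S"
 shows "g u v = h u v"
proof -
 have Y: "span S <= Y" using span_minimal[OF S] .
 have ext: "g u v = h u v" if u: "u:Y" "!!w. w:S ==> g u w = h u w" and v: "v:span S" for u v
 proof -
  have z: "g u 0 = 0" "h u 0 = 0" using g u(1) unfolding alt_on_def by (metis mult_zero_left vec.scale_zero_left)+
  have l: "f u (b + c) = f u b + f u c" "f u (t *s b) = t * f u b" if "alt_on Y f" "b:Y" "c:Y" for f b c t
   using that u(1) unfolding alt_on_def by blast+
  have "subspace {v:Y. g u v = h u v}"
     by (rule subspaceI) (use subspace_0[OF S(2)] subspace_add[OF S(2)] subspace_scale[OF S(2)] z in \<open>simp_all add: l[OF g(1)] l[OF g(2)]\<close>)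
  then show ?thesis using span_minimal[of S "{v:Y. g u v = h u v}"] v S u by auto
 qed
 have "g w v = h w v" if w: "w:S" for w using ext[of w v] e w S(1) uv(2) by blast
 then have "g v w = h v w" if w: "w:S" for w using g w S(1) Y uv(2) unfolding alt_on_def by (metis subsetD)
 then have "g v u = h v u" using ext[of v u] Y uv by blast
 moreover have "g u v = - g v u" "h u v = - h v u" using g Y uv unfolding alt_on_def by (meson subsetD)+
 ultimately show ?thesis by simp
qed

text \<open>In dimension 4 any far point with support \<open>Y\<close> serves as a start. Its form
  has six values on a basis, and \<open>form_move\<close> corrects them one at a time without
  disturbing the others.\<close>

theorem data_surj:
 assumes Y: "gr k Y" "k <= 4" "even k" and g: "alt_on Y g"
 shows "EX x:points H. supp x = Y & (ALL u:Y. ALL v:Y. form x u v = g u v)"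
proof -
 have sw: "form x v u = - form x u v" "form x u u = 0" if "x:points H" "u:supp x" "v:supp x" for x u v
  using form_swap[OF that] by simp_all
 have gw: "g v u = - g u v" "g u u = 0" if "u:Y" "v:Y" for u v using g that unfolding alt_on_def by blast+
 note S = grD(1)[OF Y(1)]
 have "k = 0 | k = 2 | k = 4" using Y(2,3) by presburger
 then show ?thesis
 proof (elim disjE)
  assume "k = 0"
  then have Y0: "Y = {0}" using Y(1) subspace_0[OF S] by (auto simp: gr_def)
  have "g 0 0 = 0" using gw Y0 by simp
  then show ?thesis using p Y0 by (intro bexI[of _ p]) (simp_all add: supp_def form_def ind_def)
 next
  assume "k = 2"
  then have Y2: "gr 2 Y" using Y by simp
  obtain a b where ab: "Y = span {a, b}" "dim {a, b} = 2" using obtain_vectors2[OF Y2] by blast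
  have i: "ind [a, b]" using ab(2) by (simp add: ind_def)
  let ?x = "P (g a b) a b"
  have x: "col p ?x" "?x ~= p" "d p ?x = Y" using P_over[OF i, of "g a b"] ab(1) unfolding over_def by simp_all
  have px: "?x:points H" and sx: "supp ?x = Y" using x col_point[OF x(1) p] unfolding supp_def by simp_all
  have m: "a:Y" "b:Y" unfolding ab(1) by (simp_all add: span_base)
  have f: "form ?x a b = g a b" unfolding form_def nb_def using i x(1) co_P[OF i] by simp
  have "form ?x u v = g u v" if "u:{a, b}" "v:{a, b}" for u v
   using that f sw[OF px, of a b] sw[OF px, of b b] gw[OF m] gw(2)[OF m(2,2)] m sx by auto
  then have "form ?x u v = g u v" if "u:Y" "v:Y" for u v
   using alt_span[OF form_alt[OF px, unfolded sx] g _ S, of "{a, b}"] m that ab(1) by simp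
  then show ?thesis using px sx by blast
 next
  assume "k = 4"
  then have Y4: "gr 4 Y" using Y by simp
  obtain Y3 where Y3: "gr 3 Y3" "Y3 <= Y" using gr_sub[OF Y4, of 3 "{0}"] subspace_0[OF S] by auto
  obtain b0 where "b0:Y3" "b0 ~= 0" using dim_pos[of Y3] Y3(1) by (auto simp: gr_def)
  then obtain b c e where bce: "Y3 = span {b, c, e}" "dim {b, c, e} = 3" using obtain_vectors3[OF Y3(1)] by metis
  obtain a where a: "a:Y" "a ~: Y3" using gr_ex[OF Y3(1) Y4] by auto
  have i: "ind [a, b, c, e]" using a(2) bce ind_Cons[of a "[b, c, e]"] by (simp add: ind_def)
  have m: "a:Y" "b:Y" "c:Y" "e:Y" using a Y3(2) bce(1) by (auto simp: span_base)
  have YS: "span {a, b, c, e} = Y"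
   by (rule gr_eqI[OF _ Y4 span_minimal]) (use ind_gr[OF i, of 4] m S in auto)
  obtain x0 where x0: "x0:points H" "~ col p x0" "supp x0 = Y" using r_far[OF Y4] far_supp(1) by metis
  have step: "EX x':points H. ~ col p x' & supp x' = Y & form x' a' b' = g a' b' & (ALL u:{c', e'}. ALL v:Y. form x' u v = form x u v & form x' v u = form x v u)"
   if "x:points H" "~ col p x" "supp x = Y" "distinct [a', b', c', e']" "{a', b', c', e'} = {a, b, c, e}" for x a' b' c' e'
   using form_move[OF that(1,2), of a' b' c' e' "g a' b'"] ind_sub[OF i, of "[a', b', c', e']"] that YS by simp
  have ds: "distinct [a, b, c, e]" by (rule dim_dist[OF i[unfolded ind_def]])
  obtain x1 where x1: "x1:points H" "~ col p x1" "supp x1 = Y" "form x1 a b = g a b"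
   using step[OF x0, of a b c e] ds by blast
  obtain x2 where x2: "x2:points H" "~ col p x2" "supp x2 = Y" "form x2 a c = g a c" "ALL u:{b, e}. ALL v:Y. form x2 u v = form x1 u v & form x2 v u = form x1 v u"
   using step[OF x1(1-3), of a c b e] ds by (auto simp: insert_commute)
  obtain x3 where x3: "x3:points H" "~ col p x3" "supp x3 = Y" "form x3 a e = g a e" "ALL u:{b, c}. ALL v:Y. form x3 u v = form x2 u v & form x3 v u = form x2 v u"
   using step[OF x2(1-3), of a e b c] ds by (auto simp: insert_commute)
  obtain x4 where x4: "x4:points H" "~ col p x4" "supp x4 = Y" "form x4 b c = g b c" "ALL u:{a, e}. ALL v:Y. form x4 u v = form x3 u v & form x4 v u = form x3 v u"
   using step[OF x3(1-3), of b c a e] ds by (auto simp: insert_commute)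
  obtain x5 where x5: "x5:points H" "~ col p x5" "supp x5 = Y" "form x5 b e = g b e" "ALL u:{a, c}. ALL v:Y. form x5 u v = form x4 u v & form x5 v u = form x4 v u"
   using step[OF x4(1-3), of b e a c] ds by (auto simp: insert_commute)
  obtain x6 where x6: "x6:points H" "~ col p x6" "supp x6 = Y" "form x6 c e = g c e" "ALL u:{a, b}. ALL v:Y. form x6 u v = form x5 u v & form x6 v u = form x5 v u"
   using step[OF x5(1-3), of c e a b] ds by (auto simp: insert_commute)
  have f: "form x6 a b = g a b" "form x6 a c = g a c" "form x6 a e = g a e" "form x6 b c = g b c" "form x6 b e = g b e" "form x6 c e = g c e"
   using x1(4) x2(4,5) x3(4,5) x4(4,5) x5(4,5) x6(4,5) m by simp_all
  have "form x6 u v = g u v" if uv: "u:{a, b, c, e}" "v:{a, b, c, e}" for u v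
  proof -
   have Yuv: "u:Y" "v:Y" using uv m by auto
   consider "u = v" | "form x6 u v = g u v" | "form x6 v u = g v u" using uv f by blast
   then show ?thesis
    by cases (use sw[OF x6(1), of u v] gw[OF Yuv] x6(3) Yuv in simp_all)
  qed
  then have "form x6 u v = g u v" if "u:Y" "v:Y" for u v
   using alt_span[OF form_alt[OF x6(1), unfolded x6(3)] g _ S, of "{a, b, c, e}"] m that YS by simp
  then show ?thesis using x6 by blast
 qed
qed

end

lemma mod_sp_eqD:
 assumes Y: "vec.subspace Y" "alt_on Y g" "vec.subspace Y'" "alt_on Y' g'" and e: "mod_sp Y g = mod_sp Y' g'"
 shows "Y = Y'" "f:Y ==> h:Y ==> g f h = g' f h"
proof -
 have ex: "EX v:mod_sp Y g. fv v = f" if h: "vec.subspace Y" "alt_on Y g" "f:Y" for Y f and g :: "'a^'b => 'a^'b => 'a"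
 proof -
  obtain w where "ALL e:Y. dotp e w = g f e" using mod_sp_lift[OF h(1,2,1,2,3,3)] by blast
  then show ?thesis using h(3) by (intro bexI[of _ "pr w f"]) (simp_all add: mod_sp_def)
 qed
 have im: "Y = fv ` mod_sp Y g" if "vec.subspace Y" "alt_on Y g" for Y and g :: "'a^'b => 'a^'b => 'a"
  using ex[OF that] by (force simp: mod_sp_def)
 show YY: "Y = Y'" using im[OF Y(1,2)] im[OF Y(3,4)] e by simp
 assume f: "f:Y" "h:Y"
 obtain v where v: "v:mod_sp Y g" "fv v = f" using ex[OF Y(1,2) f(1)] by blast
 show "g f h = g' f h" using v(1) e v f YY by (simp add: mod_sp_def)
qed

lemma mod_sp_cong: "(!!f h. f:Y ==> h:Y ==> g f h = g' f h) ==> mod_sp Y g = mod_sp Y g'"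
 by (auto simp: mod_sp_def)

context spinor_geometry
begin

text \<open>The counterpart of \<open>pts_line\<close>: by \<open>meets_determine\<close> the
  direction of the line at \<open>x\<close> is determined by the 2-spaces meeting it, that is, by
  the neighbours of \<open>x\<close> collinear with \<open>y\<close>.\<close>

lemma line_perp:
 assumes l: "l:lines H" "x:l" "y:l" "x ~= y" and z: "z:points H"
 shows "z:l <-> (ALL w:points H. col w x --> col w y --> col w z)"
proof
 show "z:l ==> ALL w:points H. col w x --> col w y --> col w z" using col_all[OF l] by blast
 assume h: "ALL w:points H. col w x --> col w y --> col w z"
 have x: "x:points H" "col x y" using line_points l col_line by blast+
 have cz: "col x z" using h x by simp
 show "z:l"
 proof (cases "z = x")
  case False
  note T = d_gr[OF x l(4)[symmetric]] d_gr[OF x(1) cz False]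
  have "d x y = d x z"
  proof (rule meets_determine[OF T])
   fix K assume K: "gr 2 K" "K Int d x y ~= {0}"
   obtain w where w: "col x w" "w ~= x" "d x w = K" using d_surj[OF x(1) K(1)] by blast
   show "K Int d x z ~= {0}" using d_col[OF x(1) w(1,2) x(2) l(4)[symmetric]] w(3) K(2) h col_point[OF w(1) x(1)] col_sym[OF w(1)] d_col[OF x(1) w(1,2) cz False] by simp
  qed (simp add: dim5)
  then obtain m where m: "m:lines H" "x:m" "y:m" "z:m" using d_eq[OF x l(4)[symmetric] cz False] by blast
  show ?thesis using m(4) line_eq[OF m(1) l(1) m(2) l(2) m(3) l(3,4)] by simp
 qed (use l in simp)
qed

end

section \<open>The isomorphism with the half-spin geometry\<close>

context scaled_spinor
begin

definition emb :: "'p => ('k^(5+5)) set" where "emb x = mod_sp (supp x) (form x)"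

lemma emb_points: "x:points H ==> emb x:half_spin_points"
proof -
 assume x: "x:points H"
 have "even (dim (supp x))" using supp_gr[OF x] by (elim disjE conjE) (simp_all add: gr_def dim_singleton)
 then show ?thesis unfolding emb_def using half_spin_iff[OF supp_subspace[OF x] form_alt[OF x]] by simp
qed

lemma emb_col:
 assumes x: "x:points H" "y:points H" shows "col x y <-> hcol (emb x) (emb y)"
  using mod_sp_dim[OF supp_subspace[OF x(1)] form_alt[OF x(1)] supp_subspace[OF x(2)] form_alt[OF x(2)]]
  by (auto simp: emb_def rad_def hcol_def col_iff_rad[OF x])

lemma emb_bij: "bij_betw emb (points H) half_spin_points"
 unfolding bij_betw_def
proof
 show "inj_on emb (points H)"
 proof (rule inj_onI)
  fix x y assume x: "x:points H" "y:points H" "emb x = emb y"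
  note D = mod_sp_eqD[OF supp_subspace[OF x(1)] form_alt[OF x(1)] supp_subspace[OF x(2)] form_alt[OF x(2)] x(3)[unfolded emb_def]]
  show "x = y" by (rule data_inj[OF x(1,2) D])
 qed
 show "emb ` points H = half_spin_points"
 proof
  show "emb ` points H <= half_spin_points" using emb_points by blast
  show "half_spin_points <= emb ` points H"
  proof
   fix M :: "('k^(5+5)) set" assume M: "M:half_spin_points"
   obtain Y g where Y: "subspace Y" "alt_on Y g" "M = mod_sp Y g" using maximal_mod_sp[OF ptsD(1)[OF M]] by (elim exE conjE)
   have ev: "even (dim Y)" using half_spin_iff[OF Y(1,2)] M Y(3) by simp
   have "dim Y <= 5" by (rule gr_dim_le[OF subset_UNIV dim5(2)])
   then have "dim Y <= 4" using ev by (cases "dim Y = 5") auto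
   then obtain x where x: "x:points H" "supp x = Y" "ALL u:Y. ALL v:Y. form x u v = g u v"
    using data_surj[of "dim Y" Y g] Y(1,2) ev by (auto simp: gr_def)
   have "emb x = M" unfolding emb_def x(2) Y(3) by (rule mod_sp_cong) (use x(3) in blast)
   then show "M:emb ` points H" using x(1) by blast
  qed
 qed
qed

text \<open>Both geometries recover a line from collinearity, by \<open>line_perp\<close> and
  \<open>pts_line\<close>, and \<open>emb\<close> is a bijection that respects collinearity.\<close>

lemma emb_line:
 assumes l: "l:lines H" "x:l" "y:l" "x ~= y"
 shows "vec.dim (emb x Int emb y) = 3" "emb ` l = {M:half_spin_points. emb x Int emb y <= M}"
proof -
 have x: "x:points H" "y:points H" using line_points l by blast+
 have ne: "emb x ~= emb y" using emb_bij x l(4) unfolding bij_betw_def inj_on_def by blast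
 have c: "hcol (emb x) (emb y)" using emb_col[OF x] col_line[OF l(1-3)] by simp
 note e = emb_points[OF x(1)] emb_points[OF x(2)] c ne
 show "vec.dim (emb x Int emb y) = 3" by (rule hcol_dim3[OF e])
 have im: "emb ` points H = half_spin_points" using emb_bij unfolding bij_betw_def by simp
 have *: "emb x Int emb y <= emb z <-> z:l" if z: "z:points H" for z
  unfolding pts_line[OF e emb_points[OF z]] line_perp[OF l z] im[symmetric] using emb_col x z by simp
 show "emb ` l = {M:half_spin_points. emb x Int emb y <= M}"
 proof
  show "emb ` l <= {M:half_spin_points. emb x Int emb y <= M}" using * emb_points line_points[OF l(1)] by blast
  show "{M:half_spin_points. emb x Int emb y <= M} <= emb ` l"
  proof
   fix M assume M: "M:{M:half_spin_points. emb x Int emb y <= M}"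
   then obtain z where z: "z:points H" "M = emb z" using im by blast
   then show "M:emb ` l" using * M by blast
  qed
 qed
qed

lemma emb_isomorphic: "isomorphic_geometry H (half_spin_geometry :: ('k^(5+5)) set geometry)"
 unfolding isomorphic_geometry_def
proof (rule exI[of _ emb], rule conjI)
 show "bij_betw emb (points H) (points half_spin_geometry)" using emb_bij by (simp add: half_spin_geometry_def)
 have L: "lines half_spin_geometry = {{M:half_spin_points. U <= M} |U. totally_singular U & vec.dim (U :: ('k^(5+5)) set) = 3}"
  by (simp add: half_spin_geometry_def)
 show "(%l. emb ` l) ` lines H = lines half_spin_geometry"
  unfolding L
 proof
  show "(%l. emb ` l) ` lines H <= {{M:half_spin_points. U <= M} |U. totally_singular U & vec.dim U = 3}"
  proof
   fix A assume "A:(%l. emb ` l) ` lines H"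
   then obtain l where l: "l:lines H" "A = emb ` l" by blast
   obtain x where x: "x:l" using line_other[OF l(1)] by blast
   obtain y where y: "y:l" "x ~= y" using line_other[OF l(1)] by metis
   note e = emb_line[OF l(1) x y]
   have "totally_singular (emb x Int emb y)"
    using ptsD(4)[OF emb_points[OF line_points[OF l(1) x]]] ptsD(3)[OF emb_points[OF line_points[OF l(1) y(1)]]]
    unfolding totally_singular_def by (simp add: vec.subspace_inter)
   then show "A:{{M:half_spin_points. U <= M} |U. totally_singular U & vec.dim U = 3}" using e l(2) by blast
  qed
  show "{{M:half_spin_points. U <= M} |U. totally_singular U & vec.dim U = 3} <= (%l. emb ` l) ` lines H"
  proof
   fix A :: "('k^(5+5)) set set" assume "A:{{M:half_spin_points. U <= M} |U. totally_singular U & vec.dim U = 3}"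
   then obtain U :: "('k^(5+5)) set" where U: "totally_singular U" "vec.dim U = 3" "A = {M:half_spin_points. U <= M}" by blast
   obtain M N where M: "M:half_spin_points" "N:half_spin_points" "M ~= N" "M Int N = U" using pts_meet[OF U(1,2)] by (elim exE conjE bexE)
   have im: "emb ` points H = half_spin_points" using emb_bij unfolding bij_betw_def by simp
   obtain x where x1: "x:points H" "M = emb x" using M(1) unfolding im[symmetric] by (elim imageE)
   obtain y where y1: "y:points H" "N = emb y" using M(2) unfolding im[symmetric] by (elim imageE)
   note x = x1(1) y1(1) x1(2) y1(2)
   have c: "col x y" using emb_col[OF x(1,2)] U(2) M(4) x unfolding hcol_def by simp
   have xy: "x ~= y" using M(3) x(3,4) by (elim contrapos_nn) simp
   obtain l where l: "l:lines H" "x:l" "y:l" using ex_line[OF c xy] by (elim exE conjE bexE)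
   show "A:(%l. emb ` l) ` lines H" using emb_line(2)[OF l xy] U(3) M(4) x l(1) by auto
  qed
 qed
qed

end

theorem (in spinor_geometry) spinor_isomorphic:
 assumes p: "p:points H"
 shows "isomorphic_geometry H (half_spin_geometry :: ('k^(5+5)) set geometry)"
proof -
 obtain r where r: "ALL F. gr 2 F --> col p (r F) & r F ~= p & d p (r F) = F"
  "ALL F1 F2 F3 k. gr 2 F1 --> gr 2 F2 --> gr 2 F3 --> F1 ~= F2 --> F1 Int F2 ~= {0} --> F1 Int F2 <= F3 --> F3 <= F1 #+ F2 -->
    k:lines H --> r F1:k --> r F2:k --> r F3:k"
  "ALL Y. gr 4 Y --> (EX n:points H. ~ col p n & fs p n = Y & (ALL F. gr 2 F --> F <= Y --> col n (r F)))"
  using section_exists[OF p] by (elim exE conjE)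
 interpret pointed_spinor H d p r
  apply unfold_locales
  subgoal using p .
  subgoal using r(1) by simp
  subgoal for F1 F2 F3 k using r(2)[rule_format, of F1 F2 F3 k] by simp
  subgoal using r(3) by simp
  done
 obtain P where P: "ALL a b. ind [a, b] --> (ALL s. over (span {a, b}) (P s a b)) & (ALL x. over (span {a, b}) x --> (EX! s. x = P s a b)) &
   (ALL s t. P s a (b + t *s a) = P s a b) & (ALL s. P s b (- a) = P s a b) & (ALL s m. m ~= 0 --> P (m * s) a (m *s b) = P s a b) &
   (ALL c s t. ind [a, b, c] --> lin (P s a b) (P t a c) (P (s + t) a (b + c)))"
  using param_exists by (elim exE)
 interpret scaled_spinor H d p r P
  by unfold_locales (rule P[rule_format])
 show ?thesis by (rule emb_isomorphic)
qed

section \<open>The spinor subspaces are half-spin geometries\<close>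

abbreviation vgr :: "nat => ('k::field^'n) set => bool" where "vgr == subspace_calculus.gr (*s)"
abbreviation vsum :: "('k::field^'n) set => ('k^'n) set => ('k^'n) set" where "vsum == subspace_calculus.ssum (*s)"

context subspace_calculus
begin

text \<open>An inclusion-reversing correspondence between the subspaces of \<open>W\<close> and
  those of the coordinate space. For a 5-space the directions become 2-spaces, which bivectors
  describe, and the 1-space of \<open>sigma\<close> becomes a 4-space.\<close>

definition duality :: "'b set => ('b set => ('a^'n) set) => bool" where
 "duality W de <-> (ALL k A. gr k A --> A <= W --> vgr (CARD('n) - k) (de A)) &
   (ALL k Y. vgr k Y --> (EX A. gr (CARD('n) - k) A & A <= W & de A = Y)) &
   (ALL A:{A. subspace A & A <= W}. ALL B:{A. subspace A & A <= W}. (de B <= de A <-> A <= B) &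
    de (A #+ B) = de A Int de B & de (A Int B) = vsum (de A) (de B))"

text \<open>Take annihilators after identifying \<open>W\<close> with the coordinate space by a
  linear isomorphism.\<close>

lemma duality_exists:
 assumes W: "gr CARD('n) W"
 shows "EX de :: 'b set => ('a^'n::finite) set. duality W de"
proof -
 interpret v: subspace_calculus "(*s) :: 'a => 'a^'n => 'a^'n" cart_basis by unfold_locales
 interpret vp: finite_dimensional_vector_space_pair "(*s) :: 'a => 'a^'n => 'a^'n" cart_basis scale Basis by unfold_locales
 obtain T where T: "Vector_Spaces.linear (*s) scale T" "T ` (UNIV :: ('a^'n) set) = W" "inj T"
  using W vp.subspace_isomorphism[OF vec.subspace_UNIV grD(1)[OF W]] by (auto simp: gr_def card_cart_basis)
 interpret T: Vector_Spaces.linear "(*s)" scale T by (rule T(1))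
 have im: "T ` (T -` A) = A" if "A <= W" for A using that T(2) by (simp add: Int_absorb2)
 have vi: "T -` T ` X = X" for X by (rule inj_vimage_image_eq[OF T(3)])
 have sub: "vec.subspace (T -` A)" if "subspace A" for A by (rule T.subspace_vimage[OF that])
 have di: "dim (T ` X) = vec.dim X" for X by (rule vp.dim_image_eq[OF T(1) inj_on_subset[OF T(3) subset_UNIV]])
 have g: "vgr k (T -` A)" if "gr k A" "A <= W" for k A
  unfolding v.gr_def using sub[OF grD(1)[OF that(1)]] di[of "T -` A"] im[OF that(2)] grD(2)[OF that(1)] by simp
 have g': "gr k (T ` X)" if "vgr k X" for k X
  unfolding gr_def using T.subspace_image[OF v.grD(1)[OF that]] di[of X] v.grD(2)[OF that] by simp
 have s: "T -` (A #+ B) = vsum (T -` A) (T -` B)" if "A <= W" "B <= W" for A B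
  using vi v.ssum_def T.span_image[symmetric] image_Un im[OF that(1)] im[OF that(2)] ssum_def by metis
 have "duality W (%A. ann (T -` A))"
  unfolding duality_def
 proof (intro conjI allI ballI impI)
  fix k A assume "gr k A" "A <= W" then show "vgr (CARD('n) - k) (ann (T -` A))" using ann_gr[OF g] by blast
 next
  fix k Y assume Y: "vgr k (Y :: ('a^'n) set)"
  show "EX A. gr (CARD('n) - k) A & A <= W & ann (T -` A) = Y"
   by (rule exI[of _ "T ` ann Y"]) (use g' ann_gr[OF Y] T(2) ann_ann[OF v.grD(1)[OF Y]] vi in auto)
 next
  fix A B assume "A:{A. subspace A & A <= W}" "B:{A. subspace A & A <= W}"
  then have A: "subspace A" "subspace B" "A <= W" "B <= W" by simp_all
  show "ann (T -` B) <= ann (T -` A) <-> A <= B"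
  proof
   assume "ann (T -` B) <= ann (T -` A)"
   from ann_mono[OF this] have "T -` A <= T -` B" unfolding ann_ann[OF sub[OF A(1)]] ann_ann[OF sub[OF A(2)]] .
   then show "A <= B" using im[OF A(3)] im[OF A(4)] by (metis image_mono)
  qed (intro ann_mono vimage_mono)
  show "ann (T -` (A #+ B)) = ann (T -` A) Int ann (T -` B)" unfolding s[OF A(3,4)] ann_ssum ..
  show "ann (T -` (A Int B)) = vsum (ann (T -` A)) (ann (T -` B))"
   unfolding vimage_Int by (rule ann_Int[OF sub[OF A(1)] sub[OF A(2)]])
 qed
 then show ?thesis by blast
qed

end

lemma (in gamma_geometry) subspace_gamma:
 assumes X: "is_subspace G X"
 shows "gamma_geometry (subgeometry G X)" "gamma_geometry.col (subgeometry G X) x y <-> x = y | x:X & y:X & col x y"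
proof -
 let ?H = "subgeometry G X"
 have L: "lines ?H = {l:lines G. l <= X}" "points ?H = X" by (simp_all add: subgeometry_def)
 have "partial_linear_space ?H" unfolding partial_linear_space_def L
 proof (intro conjI ballI impI)
  fix l assume "l:{l:lines G. l <= X}" then show "l <= X" "EX x:l. EX y:l. x ~= y" using line_other[of l]
   by (blast, metis (no_types, lifting) mem_Collect_eq)
 qed (use line_eq in blast)
 moreover have "gamma_space ?H"
  unfolding gamma_space_def L
 proof (intro ballI impI)
  fix x l assume x: "x:X" "l:{l:lines G. l <= X}" "x ~: l"
  have e: "perp ?H x Int l = perp G x Int l" unfolding perp_sub[OF X x(1)] perp_col using x(2) by blast
  show "perp ?H x Int l = {} | (EX y. perp ?H x Int l = {y}) | perp ?H x Int l = l" using X gam x by (auto simp: is_subspace_def e gamma_space_def)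
 qed
 ultimately show g: "gamma_geometry ?H" by unfold_locales
 show "gamma_geometry.col ?H x y <-> x = y | x:X & y:X & col x y" using adjacent_sub[OF X, of x y]
  by (auto simp: adjacent_def L gamma_geometry.col_def[OF g])
qed

context locally_grassmannian
begin

text \<open>By \<open>spinor_base\<close> every point \<open>x\<close> of the subspace has its own
  5-space \<open>W x\<close>, and dualities are chosen independently. The only axiom comparing two
  points through dimensions is \<open>d_type\<close>, and that is
  \<open>tetra_5_iff\<close>.\<close>

lemma spinor_set_geometry:
 assumes p0: "p0:points G" and W0: "gr 5 W0"
 shows "EX d :: 'p => 'p => ('k^5) set. spinor_geometry (subgeometry G (spinor_set p0 W0)) d"
proof -
 define D where "D = spinor_set p0 W0"
 let ?H = "subgeometry G D"
 have X: "is_subspace G D" using spinor_two_convex[OF p0 W0] unfolding D_def two_convex_subspace_def by simp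
 have P: "x:points G" if "x:D" for x using X that unfolding is_subspace_def by blast
 have H: "lines ?H = {l:lines G. l <= D}" "points ?H = D" by (simp_all add: subgeometry_def)
 interpret h: gamma_geometry ?H by (rule subspace_gamma(1)[OF X])
 interpret v: subspace_calculus "(*s) :: 'k => 'k^5 => 'k^5" cart_basis by unfold_locales
 have hc: "h.col x y <-> x = y | x:D & y:D & col x y" for x y by (rule subspace_gamma(2)[OF X])
 obtain W where W: "!!x. x:D ==> gr 5 (W x) & spinor_set x (W x) = D" unfolding D_def using spinor_base[OF p0 W0] by metis
 have "ALL x:D. EX de :: 'v set => ('k^5) set. duality (W x) de" using duality_exists[where 'n = 5] W by simp
 then obtain de :: "'p => 'v set => ('k^5) set" where du: "!!x. x:D ==> duality (W x) (de x)" by metis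
 define d where "d x y = de x (dir x y)" for x y
 define S where "S x = {A. subspace A & A <= W x}" for x
 have in_W: "gr 3 (dir x y)" "dir x y:S x" "y:D" if "x:D" "h.col x y" "y ~= x" for x y
  using that dir(1)[of x y] spinor_col[of y x "W x"] W[OF that(1)] grD(1) unfolding hc S_def by auto
 have gS: "gr (dim A) A" "A <= W x" if "A:S x" for A x using that unfolding S_def gr_def by auto
 have SI: "gr k A ==> A <= W x ==> A:S x" for A x k unfolding S_def gr_def by simp
 have gW: "gr 5 (W x)" if "x:D" for x using W that by simp
 have Sum: "A #+ B:S x" if "x:D" "A:S x" "B:S x" for A B x
  using ssum_le[OF _ _ gW[OF that(1)]] that(2,3) unfolding S_def by simp
 have Int: "A Int B:S x" if "A:S x" "B:S x" for A B x using that subspace_inter unfolding S_def by auto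
 have q: "(de x B <= de x A <-> A <= B) & de x (A #+ B) = de x A Int de x B & de x (A Int B) = vsum (de x A) (de x B)"
  if "x:D" "A:S x" "B:S x" for x A B
  using du[OF that(1), unfolded duality_def, THEN conjunct2, THEN conjunct2, THEN bspec, OF that(2)[unfolded S_def], THEN bspec, OF that(3)[unfolded S_def]] .
 note le = q[THEN conjunct1] and sm = q[THEN conjunct2, THEN conjunct1] and it = q[THEN conjunct2, THEN conjunct2]
 have dgr: "v.gr (5 - k) (de x A)" if "x:D" "gr k A" "A:S x" for x k A
  using du[OF that(1), unfolded duality_def, THEN conjunct1, rule_format, OF that(2) gS(2)[OF that(3)]] by simp
 have pre: "EX B. gr (5 - k) B & B:S x & de x B = Y" if "x:D" "v.gr k Y" for x k Y
  using du[OF that(1), unfolded duality_def, THEN conjunct2, THEN conjunct1, rule_format, OF that(2)] SI by auto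
 have zero: "de x A = {0} <-> dim A = 5" if A: "x:D" "A:S x" for x A
 proof -
  note g = dgr[OF A(1) gS(1)[OF A(2)] A(2)] and l = gr_le[OF gS(1)[OF A(2)] gW[OF A(1)] gS(2)[OF A(2)]]
  show ?thesis using l v.dim_pos_iff[OF v.grD(1)[OF g]] unfolding v.grD(2)[OF g] by (cases "de x A = {0}") simp_all
 qed
 have tr: "d x a Int d x b Int d x c = de x (tsum x a b c)" "tsum x a b c:S x"
  if x: "x:D" "h.col x a" "h.col x b" "h.col x c" "a ~= x" "b ~= x" "c ~= x" for x a b c
 proof -
  note A = in_W(2)[OF x(1,2,5)] and B = in_W(2)[OF x(1,3,6)] and C = in_W(2)[OF x(1,4,7)]
  note s = Sum[OF x(1) A B]
  show "d x a Int d x b Int d x c = de x (tsum x a b c)" unfolding tsum_def d_def sm[OF x(1) s C] sm[OF x(1) A B] ..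
  show "tsum x a b c:S x" unfolding tsum_def by (rule Sum[OF x(1) s C])
 qed
 have d_le: "d p a Int d p b <= de p A <-> A <= dir p a #+ dir p b" "de p A <= v.ssum (d p a) (d p b) <-> dir p a Int dir p b <= A"
  if x: "p:D" "h.col p a" "a ~= p" "h.col p b" "b ~= p" and A: "A:S p" for p a b A
 proof -
  note I = in_W(2)[OF x(1-3)] in_W(2)[OF x(1,4,5)]
  show "d p a Int d p b <= de p A <-> A <= dir p a #+ dir p b" "de p A <= v.ssum (d p a) (d p b) <-> dir p a Int dir p b <= A"
   unfolding d_def sm[OF x(1) I, symmetric] it[OF x(1) I, symmetric] using le[OF x(1) A Sum[OF x(1) I]] le[OF x(1) Int[OF I] A] by simp_all
 qed
 have "spinor_geometry ?H d"
 proof (unfold_locales; (unfold H(2))?)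
  fix x y assume xD: "x:D" and c: "h.col x y" "y ~= x"
  show "v.gr 2 (d x y)" unfolding d_def using dgr[OF xD in_W(1,2)[OF xD c]] by simp
 next
  fix x A assume xD: "x:D" and A: "v.gr 2 (A :: ('k^5) set)"
  obtain B where B: "gr (5 - 2) B" "B:S x" "de x B = A" using pre[OF xD A] by (elim exE conjE)
  have B3: "gr 3 B" using B(1) by simp
  obtain y where y: "y:ln x B" "y ~= x" using ln_other[OF P[OF xD] B3] by blast
  note e = dir_eqI[OF P[OF xD] B3 y]
  show "EX y. h.col x y & y ~= x & d x y = A" using spinor_colI[OF e(2) y(2), of "W x"] gS(2)[OF B(2)] W[OF xD] xD y e B(3) by (auto simp: hc d_def)
 next
  fix l x y z assume l: "l:lines ?H" "x:l" "y:l" "z:l" "y ~= x" "z ~= x"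
  then show "d x y = d x z" unfolding d_def using dir_phi[of l x y] dir_phi[of l x z] H by simp
 next
  fix x y z assume xD: "x:D" and c: "h.col x y" "y ~= x" "h.col x z" "z ~= x" and e: "d x y = d x z"
  note A = in_W[OF xD c(1,2)] and B = in_W[OF xD c(3,4)]
  have "dir x y = dir x z"
   using le[OF xD A(2) B(2)] le[OF xD B(2) A(2)] e unfolding d_def by blast
  moreover note L = dir(2-4)[of x y] and M = dir(2)[of x z]
  ultimately have l: "ln x (dir x y):lines G" "x:ln x (dir x y)" "y:ln x (dir x y)" "z:ln x (dir x y)" using c unfolding hc by auto
  show "EX l:lines ?H. x:l & y:l & z:l" using l subspace_line[OF X l(1,2,3) xD A(3) c(2)[symmetric]] by (auto simp: H)
 next
  fix x y z assume xD: "x:D" and c: "h.col x y" "y ~= x" "h.col x z" "z ~= x"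
  note A = in_W[OF xD c(1,2)] and B = in_W[OF xD c(3,4)]
  have cc: "col x y" "col x z" using c unfolding hc by auto
  have e1: "h.col y z <-> 2 <= dim (dir x y Int dir x z)"
   unfolding hc col_dir[OF P[OF xD] cc(1) c(2) cc(2) c(4), symmetric] using A(3) B(3) by auto
  have e2: "dim (dir x y #+ dir x z) + dim (dir x y Int dir x z) = 6" using dim_ssum_gr[OF A(1) B(1)] by simp
  have e4: "d x y Int d x z = {0} <-> dim (dir x y #+ dir x z) = 5"
   unfolding d_def sm[OF xD A(2) B(2), symmetric] by (rule zero[OF xD Sum[OF xD A(2) B(2)]])
  have "2 <= dim (dir x y Int dir x z) <-> dim (dir x y #+ dir x z) ~= 5" using e2 gr_dim_le[OF gS(2)[OF Sum[OF xD A(2) B(2)]] gW[OF xD]] by linarith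
  then show "h.col y z <-> d x y Int d x z ~= {0}" unfolding e1 e4 .
 next
  fix p a b k s assume pD: "p:D" and c: "h.col p a" "a ~= p" "h.col p b" "b ~= p" "h.col a b" "d p a ~= d p b"
   and k: "k:lines ?H" "a:k" "b:k" "s:k"
  have c': "col p a" "col p b" "col a b" "dir p a ~= dir p b" "k:lines G" "s:D" using c k unfolding hc H d_def by auto
  note E = dir_pencil(1)[OF P[OF pD] c'(1) c(2) c'(2) c(4) c'(3-5) k(2-4)]
  have hs: "h.col p s" "s ~= p" using E c'(6) pD unfolding hc by simp_all
  show "s ~= p & h.col p s & d p a Int d p b <= d p s & d p s <= v.ssum (d p a) (d p b)"
   using E hs d_le[OF pD c(1-4) in_W(2)[OF pD hs]] unfolding d_def[of p s] by simp
 next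
  fix p a b k and C :: "('k^5) set" assume pD: "p:D" and c: "h.col p a" "a ~= p" "h.col p b" "b ~= p" "h.col a b" "d p a ~= d p b"
   and k: "k:lines ?H" "a:k" "b:k" and C: "v.gr 2 C" "d p a Int d p b <= C" "C <= v.ssum (d p a) (d p b)"
  have c': "col p a" "col p b" "col a b" "dir p a ~= dir p b" "k:lines G" "k <= D" using c k unfolding hc H d_def by auto
  obtain E where E: "gr (5 - 2) E" "E:S p" "de p E = C" using pre[OF pD C(1)] by (elim exE conjE)
  have E3: "gr 3 E" using E(1) by simp
  have "dir p a Int dir p b <= E" "E <= dir p a #+ dir p b" using C(2,3) d_le[OF pD c(1-4) E(2)] unfolding E(3) by simp_all
  from dir_pencil(2)[OF P[OF pD] c'(1) c(2) c'(2) c(4) c'(3-5) k(2,3) E3 this]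
  obtain s where s: "s:k" "s ~= p" "col p s" "dir p s = E" by (elim bexE conjE)
  then show "EX s:k. s ~= p & h.col p s & d p s = C" unfolding hc d_def using E(3) c'(6) pD by blast
 next
  fix l m p x y k k' x' y'
  assume l: "l:lines ?H" "m:lines ?H" "p:l" "p:m" "l ~= m" "x:l" "x ~= p" "y:m" "y ~= p" "h.col x y"
   "k:lines ?H" "x:k" "y:k" "k':lines ?H" "x':k'" "y':k'" "x':l" "y':m" "x' ~= p" "y' ~= p"
  have L: "l:lines G" "m:lines G" "k:lines G" "k':lines G" "col x y" using l unfolding H hc by auto
  show "k Int k' ~= {}" by (rule pasch[OF L(1,2) l(3-9) L(5,3) l(12,13) L(4) l(15-20)])
 next
  fix x y assume x: "x:D" "y:D" and n: "~ h.col x y"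
  have xD: "x:D" "y:D" "~ col x y" using x n unfolding hc by auto
  obtain U where s: "sigma x y U (W x)" using spinor_far[of y x "W x"] W[OF xD(1)] xD by blast
  have U: "gr 1 U" "U:S x" using s SI[of 1 U x] unfolding sigma_def by blast+
  have "(EX s. h.col x s & d x s = A & h.col s y) <-> A <= de x U" if A: "v.gr 2 A" for A
    proof
     assume "EX s. h.col x s & d x s = A & h.col s y"
     then obtain z where z: "h.col x z" "d x z = A" "h.col z y" by blast
     have z': "col x z" "col y z" using z(1,3) col_sym[of z y] unfolding hc by auto
     note Z = sigma_dir[OF s z']
     show "A <= de x U" using z(2) le[OF xD(1) U(2) SI[OF Z(3,5)]] Z(4) unfolding d_def by simp
    next
     assume AU: "A <= de x U"
     obtain B where B: "gr (5 - 2) B" "B:S x" "de x B = A" using pre[OF xD(1) A] by (elim exE conjE)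
     have B3: "gr 3 B" using B(1) by simp
     have "U <= B" using le[OF xD(1) U(2) B(2)] AU B(3) by simp
     from sigma_near[OF s B3 this gS(2)[OF B(2)]] obtain z where z: "col x z" "z ~= x" "dir x z = B" "col y z" by (elim exE conjE)
     show "EX s. h.col x s & d x s = A & h.col s y" using spinor_colI[OF z(1,2), of "W x"] gS(2)[OF B(2)] W[OF xD(1)] z xD(1,2) B(3) col_sym[OF z(4)]
      by (auto simp: hc d_def)
    qed
  then show "EX Y. v.gr 4 Y & (ALL A. v.gr 2 A --> (EX s. h.col x s & d x s = A & h.col s y) <-> A <= Y)" using dgr[OF xD(1) U] by auto
 next
  fix p a b c assume p: "p:D" and c: "h.col p a" "h.col p b" "h.col p c" "h.col a b" "h.col a c" "h.col b c"
   and n: "p ~= a" "p ~= b" "p ~= c" "a ~= b" "a ~= c" "b ~= c" and z: "d p a Int d p b Int d p c = {0}"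
  have D: "p:D" "a:D" "b:D" "c:D" using c n unfolding hc by auto
  have c': "col p a" "col p b" "col p c" "col a b" "col a c" "col b c" "h.col a p" using c col_sym[of p a] unfolding hc by auto
  note t = tr[OF D(1) c(1-3) n(1-3)[symmetric]]
  \<comment> \<open>Trivial intersection of the dual 2-spaces means that the directions generate all
    of \<open>W p\<close>. In particular the four points are not coplanar, since coplanar directions
    lie in a 4-space.\<close>
  have 5: "dim (tsum p a b c) = 5" using z zero[OF D(1) t(2)] unfolding t(1) by simp
  have "~ coplanar {p,a,b,c}"
  proof
   assume "coplanar {p,a,b,c}"
   from coplanarD[OF this insertI1 P[OF D(1)]] obtain U V
    where U: "gr 4 V" "ALL x:{p,a,b,c}. x ~= p --> U <= dir p x & dir p x <= V" by (elim exE conjE)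
   have "dim (tsum p a b c) <= 4" using U(2) n(1-3) ssum_le[OF _ _ U(1)] gr_dim_le[OF _ U(1)] by (simp add: tsum_def)
   then show False using 5 by simp
  qed
  then have T: "tetra p a b c" unfolding tetra_def using P D c' n by simp
  have "gr 5 (tsum a p b c)" using tetra_5_iff[OF T] gS(1)[OF t(2)] 5 by simp
  moreover note t' = tr[OF D(2) c'(7) c(4,5) n(1) n(4,5)[symmetric]]
  ultimately show "d a p Int d a b Int d a c = {0}" using zero[OF D(2) t'(2)] by (simp add: gr_def)
 qed
 then show ?thesis unfolding D_def by blast
qed

lemma spinor_set_isomorphic:
 assumes "p:points G" "gr 5 W"
 shows "isomorphic_geometry (subgeometry G (spinor_set p W)) (half_spin_geometry :: ('k^(5+5)) set geometry)"
proof -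
 obtain d :: "'p => 'p => ('k^5) set" where d: "spinor_geometry (subgeometry G (spinor_set p W)) d"
  using spinor_set_geometry[OF assms] by (elim exE)
 show ?thesis by (rule spinor_geometry.spinor_isomorphic[OF d, of p]) (simp add: subgeometry_def spinor_set_def)
qed

end

theorem theorem1:
  fixes smul :: "'k::field \<Rightarrow> 'v::ab_group_add \<Rightarrow> 'v"
    and n :: nat
    and \<Gamma> :: "'p geometry"
  assumes "vector_space smul" and "vector_space.dim smul UNIV = n" and "n > 6"
    and "parapolar_space \<Gamma>"
    and "locally_grassmann \<Gamma> smul 3"
  shows "\<exists>\<D>. (\<forall>D\<in>\<D>. two_convex_subspace \<Gamma> D \<and>
             isomorphic_geometry (subgeometry \<Gamma> D)
               (half_spin_geometry :: ('k ^ (5 + 5)) set geometry)) \<and>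
           (\<forall>S\<in>symplecta \<Gamma>. \<exists>!D. D \<in> \<D> \<and> S \<subseteq> D)"
proof -
 interpret V: vector_space smul by (rule assms(1))
 obtain B where B: "V.independent B" "UNIV <= V.span B" "card B = V.dim UNIV"
  by (rule V.basis_exists[of UNIV]) blast
 \<comment> \<open>\<open>card\<close> is 0 on infinite sets, so a dimension above 6 already forces
   a finite basis.\<close>
 have "finite B" using B(3) assms(2,3) card_ge_0_finite[of B] by simp
 then interpret F: finite_dimensional_vector_space smul B
  by unfold_locales (use B in auto)
 have "7 <= F.dimension" unfolding F.dimension_def using B(3) assms(2,3) by simp
 then interpret locally_grassmannian \<Gamma> smul B
  using assms(4,5) by unfold_locales (simp_all add: parapolar_space_def)
 show ?thesis
 proof (intro exI[of _ spinor_sets] conjI ballI)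
  fix D assume "D:spinor_sets"
  then obtain p W where D: "D = spinor_set p W" "p:points \<Gamma>" "gr 5 W" unfolding spinor_sets_def by blast
  show "two_convex_subspace \<Gamma> D" unfolding D(1) by (rule spinor_two_convex[OF D(2,3)])
  show "isomorphic_geometry (subgeometry \<Gamma> D) (half_spin_geometry :: ('k ^ (5 + 5)) set geometry)"
   unfolding D(1) by (rule spinor_set_isomorphic[OF D(2,3)])
 qed (rule symplecton_unique)
qed

end
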